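(* For $t>30$, $$\left|\sum_{N=\lceil\sqrt{t/4\pi}\,\rceil}^{\lfloor\sqrt{t/2\pi}\rfloor}\frac{2\cos\left\{\frac t2\log\left(\frac t{2\pi}\right)-\frac t2-\frac\pi8-t\log N\right\}}{\sqrt N}-\left(T_{a+\varepsilon}+\sum_{\alpha}\frac{2\sqrt2\cos\left((t/2)\{\log pc(\alpha)+1/pc(\alpha)\}+t/2+\pi/8\right)}{(\alpha^2-a^2)^{1/4}}\right)\right|<6.15\,t^{-1/12},$$ where the second sum runs over odd integers $\alpha$ from $\alpha_{\min}$ to $INT_O(3\sqrt{t/\pi})$, and $a$, $pc$, $T_{a+\varepsilon}$, $\alpha_{\min}$ are as defined in the context.
   Context: $t$ is real and $a=\sqrt{8t/\pi}$. $INT_O(x)$ denotes the largest odd integer $\le x$ and $NINT_O(x)$ the odd integer nearest to $x$. For $\alpha>a$, $$pc(\alpha)=2(\alpha/a)^2\left\{1+\sqrt{1-(a/\alpha)^2}\right\}-1.$$ Put $\varepsilon=a-NINT_O(a)$. If $|\varepsilon|>t^{-1/6}$ then the transition term is negligible and is taken to be $T_{a+\varepsilon}=0$, and $\alpha_{\min}=INT_O(a)+2$. If $|\varepsilon|\le t^{-1/6}$ then, with $\alpha_0=NINT_O(a)$, one has $\alpha_{\min}=\alpha_0+2$ and the transition term represents the contribution of $\alpha_0$: $$T_{a+\varepsilon}=\left(1+\frac1{32t^2}\right)\frac{(\pi/2)^{1/4}\alpha_0}{2\,t^{1/4}}\,\operatorname{Re}\left[e^{-i\pi/8}\int_0^1\frac{\exp\left[i\pi\alpha_0^2x/4+i(t/2)\log\{(1-x)/x\}\right]}{[x(1-x)]^{1/4}}\,dx\right].$$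 *)

theory Defs
  imports "HOL-Analysis.Analysis"
begin

definition INT_O :: "real \<Rightarrow> int" where
  "INT_O x = (GREATEST n. odd n \<and> of_int n \<le> x)"

text \<open>When x is an even integer there are two nearest odd integers and the choice made by
  \<open>arg_min\<close> is unspecified. Below, such a tie gives |eps t| = 1 > t powr (-1/6) for every t > 1,
  so the choice affects neither \<open>alpha_min\<close> nor \<open>transition_term\<close>.\<close>

definition NINT_O :: "real \<Rightarrow> int" where
  "NINT_O x = arg_min (\<lambda>n. \<bar>x - of_int n\<bar>) odd"

definition a_param :: "real \<Rightarrow> real" where
  "a_param t = sqrt (8 * t / pi)"

definition pc :: "real \<Rightarrow> real \<Rightarrow> real" where
  "pc t \<alpha> = 2 * (\<alpha> / a_param t)\<^sup>2 * (1 + sqrt (1 - (a_param t / \<alpha>)\<^sup>2)) - 1"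

definition eps :: "real \<Rightarrow> real" where
  "eps t = a_param t - of_int (NINT_O (a_param t))"

definition alpha_min :: "real \<Rightarrow> int" where
  "alpha_min t =
     (if \<bar>eps t\<bar> > t powr (-1/6) then INT_O (a_param t) + 2 else NINT_O (a_param t) + 2)"

text \<open>The integrand is not defined mathematically at the endpoints 0 and 1; its values there
  (given by the totalised ln and division) do not affect the integral.\<close>

definition transition_integral :: "real \<Rightarrow> real \<Rightarrow> complex" where
  "transition_integral t \<alpha>\<^sub>0 =
     integral {0..1} (\<lambda>x::real.
       exp (\<i> * of_real (pi * \<alpha>\<^sub>0\<^sup>2 * x / 4) + \<i> * of_real (t / 2 * ln ((1 - x) / x)))
       / of_real ((x * (1 - x)) powr (1/4)))"

definition transition_term :: "real \<Rightarrow> real" where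
  "transition_term t =
     (if \<bar>eps t\<bar> > t powr (-1/6) then 0
      else (let \<alpha>\<^sub>0 = real_of_int (NINT_O (a_param t)) in
        (1 + 1 / (32 * t\<^sup>2)) * ((pi / 2) powr (1/4) * \<alpha>\<^sub>0 / (2 * t powr (1/4)))
        * Re (exp (- (\<i> * of_real (pi / 8))) * transition_integral t \<alpha>\<^sub>0)))"

text \<open>\<open>GREATEST\<close> and \<open>arg_min\<close> are attained in the two definitions above.\<close>

lemma INT_O_eq: "INT_O x = 2 * \<lfloor>(x - 1) / 2\<rfloor> + 1"
  unfolding INT_O_def
proof (rule Greatest_equality)
  show "odd (2 * \<lfloor>(x - 1) / 2\<rfloor> + 1) \<and> of_int (2 * \<lfloor>(x - 1) / 2\<rfloor> + 1) \<le> x"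
    using of_int_floor_le[of "(x - 1) / 2"] by simp
next
  fix n :: int
  assume n: "odd n \<and> of_int n \<le> x"
  then obtain k where k: "n = 2 * k + 1" by (auto elim: oddE)
  with n have "of_int k \<le> (x - 1) / 2" by simp
  then have "k \<le> \<lfloor>(x - 1) / 2\<rfloor>" by (simp add: le_floor_iff)
  with k show "n \<le> 2 * \<lfloor>(x - 1) / 2\<rfloor> + 1" by simp
qed

lemma NINT_O_nearest:
  shows "odd (NINT_O x)"
    and "odd m \<Longrightarrow> \<bar>x - of_int (NINT_O x)\<bar> \<le> \<bar>x - of_int m\<bar>"
proof -
  define n where "n = 2 * \<lfloor>x / 2\<rfloor> + 1"
  have fl: "of_int \<lfloor>x / 2\<rfloor> \<le> x / 2" "x / 2 < of_int \<lfloor>x / 2\<rfloor> + 1"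
    by linarith+
  have near: "\<bar>x - of_int n\<bar> \<le> \<bar>x - of_int m\<bar>" if "odd m" for m :: int
  proof (cases "m = n")
    case False
    have "odd n" by (simp add: n_def)
    with False that have "m \<le> n - 2 \<or> m \<ge> n + 2" by presburger
    then have "real_of_int m \<le> of_int n - 2 \<or> real_of_int m \<ge> of_int n + 2" by linarith
    moreover have "\<bar>x - of_int n\<bar> \<le> 1" using fl unfolding n_def by (simp only: of_int_add of_int_mult of_int_1 of_int_numeral)
    ultimately show ?thesis by linarith
  qed simp
  have "is_arg_min (\<lambda>n. \<bar>x - of_int n\<bar>) odd n"
    unfolding is_arg_min_linorder using near by (simp add: n_def)
  then have "is_arg_min (\<lambda>n. \<bar>x - of_int n\<bar>) odd (NINT_O x)"
    unfolding NINT_O_def arg_min_def by (rule someI)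
  then show "odd (NINT_O x)"
    and "odd m \<Longrightarrow> \<bar>x - of_int (NINT_O x)\<bar> \<le> \<bar>x - of_int m\<bar>"
    by (auto simp: is_arg_min_linorder)
qed

end

theory Submission
  imports Defs "HOL-Complex_Analysis.Complex_Analysis" "HOL-Real_Asymp.Real_Asymp" "HOL-Probability.Distributions"
begin

text \<open>
Put \<open>X = sqrt (t / (2 * pi))\<close>, so that \<open>a = 4 * X\<close>, the first sum runs over \<open>X / sqrt 2 \<le> N \<le> X\<close>, and
\<open>3 * sqrt (t / pi) = 3 * sqrt 2 * X\<close>. For odd \<open>\<alpha>\<close> the number \<open>N\<^sup>2 - \<alpha> * N\<close> is even, so
\<open>- pi * N\<^sup>2 + pi * \<alpha> * N\<close> may be added to the phase of every summand without changing it. The modified phase \<open>phase \<alpha>\<close> has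
derivative \<open>pi * (\<alpha> - vel x)\<close>, where \<open>vel x = 2 * (X\<^sup>2 / x + x)\<close> decreases from \<open>3 * sqrt 2 * X\<close> to \<open>4 * X\<close> on the
range of summation. Poisson summation replaces the sum by the integrals \<open>wave \<alpha>\<close> over odd \<open>\<alpha>\<close>, and those with a
stationary point are precisely the \<open>\<alpha>\<close> of the dual sum.

Four ingredients make this quantitative. The number of modes is truncated in \<open>poisson_truncated\<close>: the discarded modes
enter only through residuals of order \<open>1 / \<nu>\<^sup>2\<close>, bounded in \<open>residual_above\<close> and \<open>residual_below\<close>. A wave with a
stationary point is its Fresnel value up to endpoint errors (\<open>wave_saddle\<close>); this value is the summand of the dual sum
(\<open>target_pc\<close>). The stationary point of an \<open>\<alpha>\<close> within \<open>t powr (-1/6)\<close> of \<open>a\<close> merges with the endpoint \<open>X\<close>, where the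
phase has a cubic degeneracy; after the substitutions of \<open>transition_integral_cusp\<close> and \<open>wave_folded\<close> the transition
integral has the same cubic phase, and \<open>phase_gap\<close> and \<open>transition_core\<close> compare the two. Finally the endpoint errors
are summed.

All errors are measured in the unit \<open>2 / sqrt X\<close> and compared with \<open>M = t powr (1/6)\<close>. The endpoint errors are harmonic
sums over the modes, hence logarithmic in their number, while \<open>M\<close> is a cube root of it. The bound \<open>1.942 * M\<close> is proved for
few modes by \<open>cubic_budget\<close> and for many by induction with \<open>budget_step\<close>; since
\<open>2 / sqrt X * M \<le> 3.1665 * t powr (-1/12)\<close> and \<open>1.942 * 3.1665 < 6.15\<close>, this proves the theorem unless \<open>t\<close> is small
(\<open>transition_regime\<close>, \<open>turning_regime\<close>). For smaller \<open>t\<close> there are so few summands that they are bounded one by one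
(\<open>transition_small\<close>, \<open>turning_small\<close>).
\<close>

section \<open>Euler-Maclaurin summation with Fourier partial sums of the sawtooth\<close>

text \<open>An explicit primitive of the oscillating factor replaces its integral in the second mean value theorem, so
that bounds for oscillating integrals follow from bounds for a sine.\<close>
lemma second_mean_value_FTC:
  fixes g F f :: "real \<Rightarrow> real"
  assumes "a \<le> b" "\<And>x. x \<in> {a..b} \<Longrightarrow> (F has_real_derivative f x) (at x within {a..b})"
    and "\<And>x y. a \<le> x \<Longrightarrow> x \<le> y \<Longrightarrow> y \<le> b \<Longrightarrow> g x \<le> g y"
  obtains c where "c \<in> {a..b}"
    "((\<lambda>x. g x * f x) has_integral (g a * (F c - F a) + g b * (F b - F c))) {a..b}"
proof -
  have int: "(f has_integral (F d - F c)) {c..d}" if "a \<le> c" "c \<le> d" "d \<le> b" for c d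
  proof (rule fundamental_theorem_of_calculus[OF that(2)])
    fix x assume "x \<in> {c..d}"
    then have "(F has_real_derivative f x) (at x within {c..d})"
      using assms(2)[of x] that by (auto intro: DERIV_subset)
    then show "(F has_vector_derivative f x) (at x within {c..d})"
      by (simp add: has_real_derivative_iff_has_vector_derivative)
  qed
  have "f integrable_on {a..b}"
    using int[of a b] assms(1) by (auto simp: integrable_on_def)
  from second_mean_value_theorem_full[where g = g, OF this assms(1,3)]
  obtain c where c: "c \<in> {a..b}"
    "((\<lambda>x. g x * f x) has_integral (g a * integral {a..c} f + g b * integral {c..b} f)) {a..b}"
    by metis
  moreover have "integral {a..c} f = F c - F a" "integral {c..b} f = F b - F c"
    using int[of a c] int[of c b] c(1) by (auto intro!: integral_unique)
  ultimately show ?thesis using that by metis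
qed

lemma bonnet_increasing:
  fixes g F f :: "real \<Rightarrow> real"
  assumes "a \<le> b" "\<And>x. x \<in> {a..b} \<Longrightarrow> (F has_real_derivative f x) (at x within {a..b})"
    and "\<And>x y. a \<le> x \<Longrightarrow> x \<le> y \<Longrightarrow> y \<le> b \<Longrightarrow> g x \<le> g y" and "0 \<le> g a"
  obtains c where "c \<in> {a..b}" "((\<lambda>x. g x * f x) has_integral (g b * (F b - F c))) {a..b}"
proof (cases "a = b")
  case True
  then show ?thesis using that[of b] has_integral_refl(2)[of "\<lambda>x. g x * f x" b] by simp
next
  case False
  define g' where "g' = (\<lambda>x. if x = a then 0 else g x)"
  have "g' x \<le> g' y" if "a \<le> x" "x \<le> y" "y \<le> b" for x y
    using assms(3)[of x y] assms(3)[of a y] assms(4) that by (auto simp: g'_def)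
  from second_mean_value_FTC[where g = g', OF assms(1,2) this]
  obtain c where c: "c \<in> {a..b}"
    "((\<lambda>x. g' x * f x) has_integral (g' a * (F c - F a) + g' b * (F b - F c))) {a..b}" by metis
  have "((\<lambda>x. g x * f x) has_integral (g b * (F b - F c))) {a..b}"
    by (rule has_integral_spike_finite[of "{a}" _ _ "\<lambda>x. g' x * f x"]) (use c(2) False in \<open>auto simp: g'_def\<close>)
  with c(1) that show ?thesis by blast
qed

lemma bonnet_decreasing:
  fixes g F f :: "real \<Rightarrow> real"
  assumes "a \<le> b" "\<And>x. x \<in> {a..b} \<Longrightarrow> (F has_real_derivative f x) (at x within {a..b})"
    and "\<And>x y. a \<le> x \<Longrightarrow> x \<le> y \<Longrightarrow> y \<le> b \<Longrightarrow> g y \<le> g x" and "0 \<le> g b"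
  obtains c where "c \<in> {a..b}" "((\<lambda>x. g x * f x) has_integral (g a * (F c - F a))) {a..b}"
proof (cases "a = b")
  case True
  then show ?thesis using that[of b] has_integral_refl(2)[of "\<lambda>x. g x * f x" b] by simp
next
  case False
  define g' where "g' = (\<lambda>x. if x = b then 0 else - g x)"
  have "g' x \<le> g' y" if "a \<le> x" "x \<le> y" "y \<le> b" for x y
    using assms(3)[of x y] assms(3)[of x b] assms(4) that by (auto simp: g'_def)
  from second_mean_value_FTC[where g = g', OF assms(1,2) this]
  obtain c where c: "c \<in> {a..b}"
    "((\<lambda>x. g' x * f x) has_integral (g' a * (F c - F a) + g' b * (F b - F c))) {a..b}" by metis
  have "((\<lambda>x. - (g' x * f x)) has_integral - (g' a * (F c - F a) + g' b * (F b - F c))) {a..b}"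
    by (rule has_integral_neg[OF c(2)])
  then have 1: "((\<lambda>x. - (g' x * f x)) has_integral (g a * (F c - F a))) {a..b}"
    using False by (simp add: g'_def)
  have "((\<lambda>x. g x * f x) has_integral (g a * (F c - F a))) {a..b}"
    by (rule has_integral_spike_finite[OF _ _ 1, of "{b}"]) (auto simp: g'_def)
  with c(1) that show ?thesis by blast
qed

lemma bonnet_decreasing_integrable:
  fixes g f :: "real \<Rightarrow> real"
  assumes "a \<le> b" "f integrable_on {a..b}"
    and "\<And>x y. a \<le> x \<Longrightarrow> x \<le> y \<Longrightarrow> y \<le> b \<Longrightarrow> g y \<le> g x" and "0 \<le> g b"
  obtains c where "c \<in> {a..b}" "((\<lambda>x. g x * f x) has_integral (g a * integral {a..c} f)) {a..b}"
proof (cases "a = b")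
  case True
  then show ?thesis using that[of b] has_integral_refl(2)[of "\<lambda>x. g x * f x" b] by simp
next
  case False
  define g' where "g' = (\<lambda>x. if x = b then 0 else - g x)"
  have "g' x \<le> g' y" if "a \<le> x" "x \<le> y" "y \<le> b" for x y
    using assms(3)[of x y] assms(3)[of x b] assms(4) that by (auto simp: g'_def)
  from second_mean_value_theorem_full[where g = g', OF assms(2,1) this]
  obtain c where c: "c \<in> {a..b}"
    "((\<lambda>x. g' x * f x) has_integral (g' a * integral {a..c} f + g' b * integral {c..b} f)) {a..b}" by metis
  have 1: "((\<lambda>x. - (g' x * f x)) has_integral (g a * integral {a..c} f)) {a..b}"
    using has_integral_neg[OF c(2)] False by (simp add: g'_def)
  have "((\<lambda>x. g x * f x) has_integral (g a * integral {a..c} f)) {a..b}"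
    by (rule has_integral_spike_finite[OF _ _ 1, of "{b}"]) (auto simp: g'_def)
  with c(1) that show ?thesis by blast
qed

definition sawtooth_sum :: "nat \<Rightarrow> real \<Rightarrow> real" where
  "sawtooth_sum K x = (\<Sum>\<nu>=1..K. sin (2 * pi * real \<nu> * x) / (pi * real \<nu>))"

lemma sawtooth_sum_deriv:
  "(sawtooth_sum K has_real_derivative (\<Sum>\<nu>=1..K. 2 * cos (2 * pi * real \<nu> * x))) (at x within S)"
  unfolding sawtooth_sum_def
  by (auto intro!: derivative_eq_intros sum.cong simp: field_simps)

lemma euler_maclaurin_truncated:
  fixes h h' :: "real \<Rightarrow> real"
  assumes AB: "A \<le> B"
    and h: "\<And>x. x \<in> {A..B} \<Longrightarrow> (h has_real_derivative h' x) (at x within {A..B})"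
    and h': "continuous_on {A..B} h'"
  shows "((\<lambda>x. (x - of_int \<lfloor>x\<rfloor> - 1/2 + sawtooth_sum K x) * h' x) has_integral
     ((\<Sum>N = \<lceil>A\<rceil>..\<lfloor>B\<rfloor>. h (of_int N)) - integral {A..B} h
       - (\<Sum>\<nu>=1..K. 2 * integral {A..B} (\<lambda>x. h x * cos (2 * pi * real \<nu> * x)))
       + (B - of_int \<lfloor>B\<rfloor> - 1/2 + sawtooth_sum K B) * h B
       - (A - of_int \<lceil>A\<rceil> + 1/2 + sawtooth_sum K A) * h A)) {A..B}"
proof -
  let ?m = "of_int \<lceil>A\<rceil> :: real"
  define p where "p = (\<lambda>x. x - ?m + 1/2 + sawtooth_sum K x)"
  define p' where "p' = (\<lambda>x. 1 + (\<Sum>\<nu>=1..K. 2 * cos (2 * pi * real \<nu> * x)))"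
  have p: "(p has_real_derivative p' x) (at x within {A..B})" for x
    unfolding p_def p'_def by (auto intro!: derivative_eq_intros sawtooth_sum_deriv)
  have hc: "continuous_on {A..B} h"
    using h DERIV_continuous by (fastforce simp: continuous_on_eq_continuous_within)
  have single: "((\<lambda>x. if of_int N \<le> x then h' x else 0) has_integral (h B - h (of_int N))) {A..B}"
    if N: "N \<in> {\<lceil>A\<rceil>..\<lfloor>B\<rfloor>}" for N
  proof -
    have NB: "of_int N \<le> B" "A \<le> of_int N" using N by (auto simp: ceiling_le_iff le_floor_iff)
    have "(h' has_integral (h B - h (of_int N))) {of_int N..B}"
    proof (rule fundamental_theorem_of_calculus[OF NB(1)])
      fix x assume "x \<in> {of_int N..B}"
      then show "(h has_vector_derivative h' x) (at x within {of_int N..B})"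
        using DERIV_subset[OF h, of x "{of_int N..B}"] NB
        by (auto simp: has_real_derivative_iff_has_vector_derivative)
    qed
    then have "((\<lambda>x. if x \<in> {of_int N..B} then h' x else 0) has_integral (h B - h (of_int N))) {A..B}"
      using NB by (subst has_integral_restrict) auto
    then show ?thesis
      by (rule has_integral_eq[rotated]) auto
  qed
  have step: "((\<lambda>x. \<Sum>N = \<lceil>A\<rceil>..\<lfloor>B\<rfloor>. if of_int N \<le> x then h' x else 0) has_integral
      (\<Sum>N = \<lceil>A\<rceil>..\<lfloor>B\<rfloor>. h B - h (of_int N))) {A..B}"
    by (intro has_integral_sum single) auto
  have count: "(\<Sum>N = \<lceil>A\<rceil>..\<lfloor>B\<rfloor>. if of_int N \<le> x then h' x else 0) = (of_int \<lfloor>x\<rfloor> - ?m + 1) * h' x"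
    if x: "x \<in> {A..B}" for x
  proof -
    have fl: "\<lfloor>x\<rfloor> \<ge> \<lceil>A\<rceil> - 1" "\<lfloor>x\<rfloor> \<le> \<lfloor>B\<rfloor>" using x by (auto simp: floor_mono) linarith
    have "(\<Sum>N = \<lceil>A\<rceil>..\<lfloor>B\<rfloor>. if of_int N \<le> x then h' x else 0) = (\<Sum>N \<in> {\<lceil>A\<rceil>..\<lfloor>x\<rfloor>}. h' x)"
      by (rule sum.mono_neutral_cong_right) (use fl in \<open>auto simp: le_floor_iff\<close>)
    also have "\<dots> = real (nat (\<lfloor>x\<rfloor> - \<lceil>A\<rceil> + 1)) * h' x" by simp
    also have "real (nat (\<lfloor>x\<rfloor> - \<lceil>A\<rceil> + 1)) = of_int \<lfloor>x\<rfloor> - ?m + 1" using fl by simp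
    finally show ?thesis .
  qed
  have n: "((\<lambda>x. (of_int \<lfloor>x\<rfloor> - ?m + 1) * h' x) has_integral (\<Sum>N = \<lceil>A\<rceil>..\<lfloor>B\<rfloor>. h B - h (of_int N))) {A..B}"
    by (rule has_integral_eq[OF _ step]) (simp add: count)
  have sumn: "(\<Sum>N = \<lceil>A\<rceil>..\<lfloor>B\<rfloor>. h B - h (of_int N)) = (of_int \<lfloor>B\<rfloor> - ?m + 1) * h B - (\<Sum>N = \<lceil>A\<rceil>..\<lfloor>B\<rfloor>. h (of_int N))"
  proof -
    have "\<lfloor>B\<rfloor> \<ge> \<lceil>A\<rceil> - 1" using AB by linarith
    then show ?thesis by (simp add: sum_subtractf)
  qed
  have c2: "(\<lambda>x. h x * cos (2 * pi * real \<nu> * x)) integrable_on {A..B}" for \<nu>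
    by (intro integrable_continuous_real continuous_intros hc)
  have pd: "((\<lambda>x. h x * p' x) has_integral (integral {A..B} h
       + (\<Sum>\<nu>=1..K. 2 * integral {A..B} (\<lambda>x. h x * cos (2 * pi * real \<nu> * x))))) {A..B}"
  proof -
    have "((\<lambda>x. h x + (\<Sum>\<nu>=1..K. 2 * (h x * cos (2 * pi * real \<nu> * x)))) has_integral (integral {A..B} h
       + (\<Sum>\<nu>=1..K. 2 * integral {A..B} (\<lambda>x. h x * cos (2 * pi * real \<nu> * x))))) {A..B}"
      by (intro has_integral_add has_integral_sum has_integral_mult_right integrable_integral c2
          integrable_continuous_real hc) auto
    then show ?thesis
      by (rule has_integral_eq[rotated]) (simp add: p'_def algebra_simps sum_distrib_left)
  qed
  have full: "((\<lambda>x. p x * h' x + h x * p' x) has_integral (p B * h B - p A * h A)) {A..B}"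
  proof (rule fundamental_theorem_of_calculus[OF AB])
    fix x assume "x \<in> {A..B}"
    then show "((\<lambda>x. p x * h x) has_vector_derivative p x * h' x + h x * p' x) (at x within {A..B})"
      using DERIV_mult[OF p h, of x] by (auto simp: has_real_derivative_iff_has_vector_derivative[symmetric] algebra_simps)
  qed
  have "((\<lambda>x. (p x * h' x + h x * p' x) - h x * p' x - (of_int \<lfloor>x\<rfloor> - ?m + 1) * h' x) has_integral
     ((p B * h B - p A * h A) - (integral {A..B} h
       + (\<Sum>\<nu>=1..K. 2 * integral {A..B} (\<lambda>x. h x * cos (2 * pi * real \<nu> * x))))
       - ((of_int \<lfloor>B\<rfloor> - ?m + 1) * h B - (\<Sum>N = \<lceil>A\<rceil>..\<lfloor>B\<rfloor>. h (of_int N))))) {A..B}"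
    by (intro has_integral_diff full pd n[unfolded sumn])
  then show ?thesis
    by (simp add: p_def algebra_simps)
qed

lemma dirichlet_kernel_sin:
  "(1 + (\<Sum>\<nu>=1..K. 2 * cos (2 * pi * real \<nu> * x))) * sin (pi * x) = sin ((2 * real K + 1) * pi * x)"
proof (induction K)
  case (Suc K)
  have "2 * cos (2 * pi * real (Suc K) * x) * sin (pi * x)
      = sin ((2 * real (Suc K) + 1) * pi * x) - sin ((2 * real K + 1) * pi * x)"
  proof -
    have "(2 * real (Suc K) + 1) * pi * x = 2 * pi * real (Suc K) * x + pi * x"
         "(2 * real K + 1) * pi * x = 2 * pi * real (Suc K) * x - pi * x"
      by (simp_all add: algebra_simps)
    then show ?thesis by (simp add: sin_add sin_diff)
  qed
  then show ?case using Suc by (simp add: algebra_simps)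
qed (simp)

lemma sin_pi_ge: "sin (pi * x) \<ge> 2 * x" if "0 \<le> x" "x \<le> 1/2" for x :: real
proof -
  have "concave_on {0..pi} sin"
    by (rule f''_le0_imp_concave[where f' = cos and f'' = "\<lambda>x. - sin x"])
       (auto intro!: derivative_eq_intros sin_ge_zero)
  then have "sin ((1 - 2 * x) *\<^sub>R 0 + (2 * x) *\<^sub>R (pi/2)) \<ge> (1 - 2 * x) * sin 0 + (2 * x) * sin (pi/2)"
    using that by (intro concave_onD) auto
  then show ?thesis by (simp add: algebra_simps)
qed

text \<open>The second bound makes the Fourier remainder vanish away from the integers, the first keeps it bounded next
to them; together they give convergence of the remainder integrals.\<close>
lemma sawtooth_remainder_half:
  fixes x :: real
  assumes x: "0 < x" "x \<le> 1/2"
  shows "\<bar>x - 1/2 + sawtooth_sum K x\<bar> \<le> 1/2"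
    and "\<bar>x - 1/2 + sawtooth_sum K x\<bar> \<le> 2 / ((2 * real K + 1) * pi * sin (pi * x))"
proof -
  define M where "M = 2 * real K + 1"
  have M: "M \<ge> 1" by (simp add: M_def)
  define e where "e = (\<lambda>x. x - 1/2 + sawtooth_sum K x)"
  define C where "C = (\<lambda>x. (1 - cos (M * pi * x)) / (M * pi) / sin (pi * x))"
  define C2 where "C2 = (\<lambda>x. (1 + cos (M * pi * x)) / (M * pi) / sin (pi * x))"
  have sinpos: "sin (pi * y) > 0" if "0 < y" "y \<le> 1/2" for y
    using sin_pi_ge[of y] that by linarith
  have cospos: "cos (pi * y) \<ge> 0" if "0 < y" "y \<le> 1/2" for y
    using that mult_left_mono[OF that(2), of pi] by (intro cos_ge_zero) (auto intro: order_trans[of _ 0])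
  have ed: "(e has_real_derivative (sin (M * pi * y) / sin (pi * y))) (at y)" if "0 < y" "y \<le> 1/2" for y
  proof -
    have "(e has_real_derivative (1 + (\<Sum>\<nu>=1..K. 2 * cos (2 * pi * real \<nu> * y)))) (at y)"
      unfolding e_def by (auto intro!: derivative_eq_intros sawtooth_sum_deriv)
    moreover have "1 + (\<Sum>\<nu>=1..K. 2 * cos (2 * pi * real \<nu> * y)) = sin (M * pi * y) / sin (pi * y)"
      using dirichlet_kernel_sin[of y K] sinpos[OF that] by (simp add: M_def field_simps)
    ultimately show ?thesis by simp
  qed
  have Cd: "(C has_real_derivative (sin (M * pi * y) / sin (pi * y)
      - (1 - cos (M * pi * y)) / M * cos (pi * y) / (sin (pi * y))\<^sup>2)) (at y)" if "0 < y" "y \<le> 1/2" for y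
    unfolding C_def using sinpos[OF that] M
    by (auto intro!: derivative_eq_intros simp: field_simps power2_eq_square)
  have C2d: "(C2 has_real_derivative (- sin (M * pi * y) / sin (pi * y)
      - (1 + cos (M * pi * y)) / M * cos (pi * y) / (sin (pi * y))\<^sup>2)) (at y)" if "0 < y" "y \<le> 1/2" for y
    unfolding C2_def using sinpos[OF that] M
    by (auto intro!: derivative_eq_intros simp: field_simps power2_eq_square)
  have mono1: "e y - C y \<le> e z - C z" if "0 < y" "y \<le> z" "z \<le> 1/2" for y z
  proof (rule DERIV_nonneg_imp_nondecreasing[OF that(2)])
    fix w assume "y \<le> w" "w \<le> z"
    then have w: "0 < w" "w \<le> 1/2" using that by auto
    have 0: "0 \<le> (1 - cos (M * pi * w)) / M * cos (pi * w) / (sin (pi * w))\<^sup>2"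
      using cospos[OF w] M cos_le_one[of "M * pi * w"] by (intro mult_nonneg_nonneg divide_nonneg_nonneg) auto
    show "\<exists>d. ((\<lambda>a. e a - C a) has_real_derivative d) (at w) \<and> 0 \<le> d"
      using DERIV_diff[OF ed[OF w] Cd[OF w]] 0 by (intro exI[of _ "_ - (_ - _)"]) (rule conjI, assumption, simp)
  qed
  have mono2: "e y + C2 y \<ge> e z + C2 z" if "0 < y" "y \<le> z" "z \<le> 1/2" for y z
  proof (rule DERIV_nonpos_imp_nonincreasing[OF that(2)])
    fix w assume "y \<le> w" "w \<le> z"
    then have w: "0 < w" "w \<le> 1/2" using that by auto
    have "0 \<le> 1 + cos (M * pi * w)" using cos_ge_minus_one[of "M * pi * w"] by linarith
    then have "0 \<le> (1 + cos (M * pi * w)) / M * cos (pi * w) / (sin (pi * w))\<^sup>2"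
      using cospos[OF w] M by (intro mult_nonneg_nonneg divide_nonneg_nonneg) auto
    then show "\<exists>d. ((\<lambda>a. e a + C2 a) has_real_derivative d) (at w) \<and> d \<le> 0"
      using DERIV_add[OF ed[OF w] C2d[OF w]] by (intro exI[of _ "_ + (_ - _)"]) (rule conjI, assumption, simp)
  qed
  have Mh: "M * pi * (1/2) = real K * pi + pi / 2" by (simp add: M_def field_simps)
  have ch: "cos (M * pi * (1/2)) = 0" unfolding Mh by (simp add: cos_add)
  have eh: "e (1/2) = 0"
  proof -
    have "sin (2 * pi * real \<nu> * (1/2)) = 0" for \<nu> :: nat
      using sin_npi2[of \<nu>] by (simp add: mult_ac)
    then show ?thesis by (simp add: e_def sawtooth_sum_def)
  qed
  have nn: "0 \<le> C (1/2)" "0 \<le> C2 (1/2)"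
    using ch M by (simp_all add: C_def C2_def)
  have up: "e y \<le> C y" if "0 < y" "y \<le> 1/2" for y
    using mono1[of y "1/2"] that eh nn by linarith
  have lo2: "e y \<ge> - C2 y" if "0 < y" "y \<le> 1/2" for y
    using mono2[of y "1/2"] that eh nn by linarith
  have Cbound: "C y \<le> M * pi * y / 4" if y: "0 < y" "y \<le> 1/2" for y
  proof -
    have "cos (2 * (M * pi * y / 2)) = 1 - 2 * (sin (M * pi * y / 2))\<^sup>2"
      by (rule cos_double_sin)
    moreover have "(sin (M * pi * y / 2))\<^sup>2 \<le> (M * pi * y / 2)\<^sup>2"
      using abs_sin_x_le_abs_x[of "M * pi * y / 2"] by (simp only: abs_le_square_iff)
    ultimately have "1 - cos (M * pi * y) \<le> 2 * (M * pi * y / 2)\<^sup>2"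
      by simp
    then have "C y \<le> 2 * (M * pi * y / 2)\<^sup>2 / (M * pi) / sin (pi * y)"
      unfolding C_def using sinpos[OF y] M by (intro divide_right_mono) auto
    also have "\<dots> \<le> 2 * (M * pi * y / 2)\<^sup>2 / (M * pi) / (2 * y)"
      using sin_pi_ge[of y] y M by (intro divide_left_mono mult_pos_pos sinpos) auto
    also have "\<dots> = M * pi * y / 4"
      using M y by (simp add: field_simps power2_eq_square)
    finally show ?thesis .
  qed
  have C2nn: "0 \<le> C2 y" "C2 y \<le> 2 / (M * pi * sin (pi * y))" if y: "0 < y" "y \<le> 1/2" for y
  proof -
    have c: "0 \<le> 1 + cos (M * pi * y)" "1 + cos (M * pi * y) \<le> 2"
      using cos_ge_minus_one[of "M * pi * y"] cos_le_one[of "M * pi * y"] by linarith+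
    show "0 \<le> C2 y" unfolding C2_def using sinpos[OF y] M c by (intro divide_nonneg_nonneg) auto
    have "(1 + cos (M * pi * y)) / (M * pi * sin (pi * y)) \<le> 2 / (M * pi * sin (pi * y))"
      using sinpos[OF y] M c by (intro divide_right_mono) auto
    then show "C2 y \<le> 2 / (M * pi * sin (pi * y))" unfolding C2_def by simp
  qed
  have Cnn: "0 \<le> C y" "C y \<le> 2 / (M * pi * sin (pi * y))" if y: "0 < y" "y \<le> 1/2" for y
  proof -
    have c: "0 \<le> 1 - cos (M * pi * y)" "1 - cos (M * pi * y) \<le> 2"
      using cos_ge_minus_one[of "M * pi * y"] cos_le_one[of "M * pi * y"] by linarith+
    show "0 \<le> C y" unfolding C_def using sinpos[OF y] M c by (intro divide_nonneg_nonneg) auto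
    have "(1 - cos (M * pi * y)) / (M * pi * sin (pi * y)) \<le> 2 / (M * pi * sin (pi * y))"
      using sinpos[OF y] M c by (intro divide_right_mono) auto
    then show "C y \<le> 2 / (M * pi * sin (pi * y))" unfolding C_def by simp
  qed
  have "e x \<le> 1/2"
  proof (cases "M * x * pi \<le> 2")
    case True
    then show ?thesis using up[OF x] Cbound[OF x] by (simp add: algebra_simps)
  next
    case False
    have "C x \<le> 2 / (M * pi * sin (pi * x))" by (rule Cnn(2)[OF x])
    also have "\<dots> \<le> 2 / (M * pi * (2 * x))"
      using sin_pi_ge[of x] x M by (intro divide_left_mono mult_left_mono mult_pos_pos sinpos) auto
    also have "\<dots> \<le> 1/2" using False x M by (simp add: field_simps)
    finally show ?thesis using up[OF x] by simp
  qed
  moreover have "e x \<ge> - 1/2"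
  proof (rule tendsto_upperbound[of "\<lambda>y. e y - C y" "- 1/2" "at_right 0" "e x"])
    have "((\<lambda>y. M * pi * y / 4) \<longlongrightarrow> M * pi * 0 / 4) (at_right 0)"
      by (intro tendsto_intros) auto
    then have l: "((\<lambda>y. M * pi * y / 4) \<longlongrightarrow> 0) (at_right 0)" by simp
    have ev: "eventually (\<lambda>y. 0 < y \<and> y \<le> x) (at_right (0::real))"
      using x by (auto simp: eventually_at_right_field intro!: exI[of _ x])
    have C0: "(C \<longlongrightarrow> 0) (at_right 0)"
    proof (rule tendsto_sandwich[OF _ _ tendsto_const l])
      show "\<forall>\<^sub>F y in at_right 0. 0 \<le> C y" "\<forall>\<^sub>F y in at_right 0. C y \<le> M * pi * y / 4"
        by (rule eventually_mono[OF ev]; use x in \<open>blast intro: Cnn(1) Cbound order_trans\<close>)+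
    qed
    have "continuous (at_right 0) e"
      unfolding e_def sawtooth_sum_def by (intro continuous_intros) auto
    then have "(e \<longlongrightarrow> e 0) (at_right 0)" by (simp add: continuous_within)
    moreover have "e 0 = -1/2" by (simp add: e_def sawtooth_sum_def)
    ultimately show "((\<lambda>y. e y - C y) \<longlongrightarrow> - 1/2) (at_right 0)"
      using tendsto_diff[OF _ C0, of e "-1/2"] by simp
    show "eventually (\<lambda>y. e y - C y \<le> e x) (at_right 0)"
      using ev by eventually_elim (use mono1[of _ x] Cnn(1)[OF x] x in force)
    show "at_right (0::real) \<noteq> bot" by simp
  qed
  ultimately show "\<bar>x - 1/2 + sawtooth_sum K x\<bar> \<le> 1/2" unfolding e_def by linarith
  show "\<bar>x - 1/2 + sawtooth_sum K x\<bar> \<le> 2 / ((2 * real K + 1) * pi * sin (pi * x))"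
    using up[OF x] lo2[OF x] C2nn[OF x] Cnn[OF x] unfolding e_def M_def[symmetric] by linarith
qed


lemma sawtooth_sum_shift_int: "sawtooth_sum K (x - of_int n) = sawtooth_sum K x"
proof -
  have "sin (2 * pi * real \<nu> * (x - of_int n)) = sin (2 * pi * real \<nu> * x)" for \<nu> :: nat
  proof -
    have "2 * pi * real \<nu> * (x - of_int n) = 2 * pi * real \<nu> * x - 2 * pi * of_int (int \<nu> * n)"
      by (simp add: algebra_simps)
    moreover have "sin (2 * pi * of_int (int \<nu> * n)) = 0" "cos (2 * pi * of_int (int \<nu> * n)) = 1"
      using sin_int_2pin[of "int \<nu> * n"] cos_int_2pin[of "int \<nu> * n"] by simp_all
    ultimately show ?thesis by (simp add: sin_diff)
  qed
  then show ?thesis by (simp add: sawtooth_sum_def)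
qed

lemma sawtooth_sum_minus: "sawtooth_sum K (- x) = - sawtooth_sum K x"
  by (simp add: sawtooth_sum_def sum_negf)

lemma sawtooth_sum_int: "sawtooth_sum K (of_int n) = 0"
  using sawtooth_sum_shift_int[of K "of_int n" n] by (simp add: sawtooth_sum_def)

lemma sawtooth_remainder_nonint:
  fixes x :: real
  assumes "x \<notin> \<int>"
  obtains y where "0 < y" "y \<le> 1/2"
    "\<And>K. \<bar>x - of_int \<lfloor>x\<rfloor> - 1/2 + sawtooth_sum K x\<bar> = \<bar>y - 1/2 + sawtooth_sum K y\<bar>"
proof -
  let ?f = "x - of_int \<lfloor>x\<rfloor>"
  have "?f \<noteq> 0" using assms by (metis Ints_of_int eq_iff_diff_eq_0)
  then have f: "0 < ?f" "?f < 1" by linarith+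
  show ?thesis
  proof (cases "?f \<le> 1/2")
    case True
    show ?thesis
      by (rule that[of ?f]) (use f True in \<open>auto simp: sawtooth_sum_shift_int\<close>)
  next
    case False
    have "sawtooth_sum K (1 - ?f) = - sawtooth_sum K x" for K
    proof -
      have "sawtooth_sum K (1 - ?f) = sawtooth_sum K (- x - of_int (- \<lfloor>x\<rfloor> - 1))"
        by (simp add: algebra_simps)
      then show ?thesis by (simp only: sawtooth_sum_shift_int sawtooth_sum_minus)
    qed
    then show ?thesis
      by (intro that[of "1 - ?f"]) (use f False in \<open>auto simp: abs_if\<close>)
  qed
qed

lemma sawtooth_remainder_le_half:
  shows "\<bar>x - of_int \<lfloor>x\<rfloor> - 1/2 + sawtooth_sum K x\<bar> \<le> 1/2"
    and "\<bar>x - of_int \<lceil>x\<rceil> + 1/2 + sawtooth_sum K x\<bar> \<le> 1/2"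
proof -
  show 1: "\<bar>x - of_int \<lfloor>x\<rfloor> - 1/2 + sawtooth_sum K x\<bar> \<le> 1/2"
  proof (cases "x \<in> \<int>")
    case True
    then show ?thesis by (auto elim!: Ints_cases simp: sawtooth_sum_int)
  next
    case False
    then show ?thesis using sawtooth_remainder_nonint[OF False] sawtooth_remainder_half(1) by metis
  qed
  show "\<bar>x - of_int \<lceil>x\<rceil> + 1/2 + sawtooth_sum K x\<bar> \<le> 1/2"
  proof (cases "x \<in> \<int>")
    case True
    then show ?thesis by (auto elim!: Ints_cases simp: sawtooth_sum_int)
  next
    case False
    then have "\<lceil>x\<rceil> = \<lfloor>x\<rfloor> + 1" by (simp add: ceiling_altdef frac_eq_0_iff) (metis Ints_of_int)
    with 1 show ?thesis by simp
  qed
qed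

lemma sawtooth_remainder_tendsto:
  assumes "x \<notin> \<int>"
  shows "(\<lambda>K. x - of_int \<lfloor>x\<rfloor> - 1/2 + sawtooth_sum K x) \<longlonglongrightarrow> 0"
proof -
  obtain y where y: "0 < y" "y \<le> 1/2"
    and eq: "\<And>K. \<bar>x - of_int \<lfloor>x\<rfloor> - 1/2 + sawtooth_sum K x\<bar> = \<bar>y - 1/2 + sawtooth_sum K y\<bar>"
    using sawtooth_remainder_nonint[OF assms] by metis
  have pos: "sin (pi * y) > 0" using sin_pi_ge[of y] y by linarith
  show ?thesis
  proof (rule Lim_null_comparison)
    show "\<forall>\<^sub>F K in sequentially. norm (x - of_int \<lfloor>x\<rfloor> - 1/2 + sawtooth_sum K x) \<le> 2 / ((2 * real K + 1) * pi * sin (pi * y))"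
      using sawtooth_remainder_half(2)[OF y] by (simp add: eq)
    have "(\<lambda>K. 2 / (pi * sin (pi * y)) * (1 / (2 * real K + 1))) \<longlonglongrightarrow> 2 / (pi * sin (pi * y)) * 0"
      by (intro tendsto_intros) real_asymp
    then show "(\<lambda>K. 2 / ((2 * real K + 1) * pi * sin (pi * y))) \<longlonglongrightarrow> 0"
      by (simp add: field_simps)
  qed
qed

lemma sawtooth_integral_tendsto_0:
  fixes h' :: "real \<Rightarrow> real"
  assumes h': "continuous_on {A..B} h'"
  shows "(\<lambda>K. integral {A..B} (\<lambda>x. (x - of_int \<lfloor>x\<rfloor> - 1/2 + sawtooth_sum K x) * h' x)) \<longlonglongrightarrow> 0"
    and "(\<lambda>x. (x - of_int \<lfloor>x\<rfloor> - 1/2 + sawtooth_sum K x) * h' x) integrable_on {A..B}"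
proof -
  define s where "s = (\<lambda>K x. (x - of_int \<lfloor>x\<rfloor> - 1/2 + sawtooth_sum K x) * h' x)"
  have int: "s K integrable_on {A..B}" for K
  proof (cases "A \<le> B")
    case True
    define h where "h = (\<lambda>u. integral {A..u} h')"
    have "(h has_real_derivative h' x) (at x within {A..B})" if "x \<in> {A..B}" for x
      unfolding h_def has_real_derivative_iff_has_vector_derivative
      by (rule integral_has_vector_derivative[OF h' that])
    from euler_maclaurin_truncated[OF True this h'] show ?thesis
      by (auto simp: integrable_on_def s_def)
  qed (simp add: s_def integrable_on_empty)
  then show "(\<lambda>x. (x - of_int \<lfloor>x\<rfloor> - 1/2 + sawtooth_sum K x) * h' x) integrable_on {A..B}"
    by (simp add: s_def)
  have fin: "finite ({A..B} \<inter> \<int>)"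
  proof (rule finite_subset)
    show "{A..B} \<inter> \<int> \<subseteq> of_int ` {\<lfloor>A\<rfloor>..\<lceil>B\<rceil>}"
      by (auto elim!: Ints_cases) (metis atLeastAtMost_iff image_iff floor_le_iff le_ceiling_iff floor_less_cancel le_less_trans less_add_one not_le less_ceiling_iff linorder_not_less order_le_less of_int_less_iff)
  qed auto
  let ?z = "\<lambda>K x. if x \<in> \<int> then 0 else s K x"
  have eq: "integral {A..B} (?z K) = integral {A..B} (s K)" for K
    by (rule integral_spike[of "{A..B} \<inter> \<int>"]) (use fin in \<open>auto intro: negligible_finite\<close>)
  have intz: "?z K integrable_on {A..B}" for K
    by (rule integrable_spike[OF int negligible_finite[OF fin]]) auto
  have "(\<lambda>K. integral {A..B} (?z K)) \<longlonglongrightarrow> integral {A..B} (\<lambda>x. 0)"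
  proof (rule dominated_convergence(2)[OF intz])
    show "(\<lambda>x. \<bar>h' x\<bar>) integrable_on {A..B}"
      by (intro integrable_continuous_real continuous_intros h')
    show "norm (?z K x) \<le> \<bar>h' x\<bar>" if "x \<in> {A..B}" for K x
    proof -
      have "\<bar>x - of_int \<lfloor>x\<rfloor> - 1/2 + sawtooth_sum K x\<bar> * \<bar>h' x\<bar> \<le> 1 * \<bar>h' x\<bar>"
        using sawtooth_remainder_le_half(1)[of x K] by (intro mult_right_mono) auto
      then show ?thesis by (simp add: s_def abs_mult)
    qed
    show "(\<lambda>K. ?z K x) \<longlonglongrightarrow> 0" if "x \<in> {A..B}" for x
      using tendsto_mult_right[OF sawtooth_remainder_tendsto[of x], of "h' x"]
      by (cases "x \<in> \<int>") (auto simp: s_def mult.commute)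
  qed
  then show "(\<lambda>K. integral {A..B} (\<lambda>x. (x - of_int \<lfloor>x\<rfloor> - 1/2 + sawtooth_sum K x) * h' x)) \<longlonglongrightarrow> 0"
    by (simp add: eq s_def[abs_def])
qed

section \<open>Truncated Poisson summation\<close>

locale phase_sum =
  fixes g g' \<phi> \<phi>' :: "real \<Rightarrow> real" and A B :: real
  assumes AB: "A \<le> B"
    and g: "\<And>x. x \<in> {A..B} \<Longrightarrow> (g has_real_derivative g' x) (at x within {A..B})"
    and phi: "\<And>x. x \<in> {A..B} \<Longrightarrow> (\<phi> has_real_derivative \<phi>' x) (at x within {A..B})"
    and cont: "continuous_on {A..B} g'" "continuous_on {A..B} \<phi>'"
    and g_nonneg: "0 \<le> g A" "0 \<le> g B"
begin

definition mode :: "int \<Rightarrow> real" where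
  "mode \<nu> = integral {A..B} (\<lambda>x. g x * cos (\<phi> x + 2 * pi * of_int \<nu> * x))"

definition residual :: "int \<Rightarrow> real" where
  "residual \<nu> = integral {A..B} (\<lambda>x. g' x * sin (\<phi> x + 2 * pi * of_int \<nu> * x)
      + g x * (\<phi>' x * cos (\<phi> x + 2 * pi * of_int \<nu> * x))) / (2 * pi * of_int \<nu>)"

lemma continuous_g: "continuous_on {A..B} g" and continuous_phi: "continuous_on {A..B} \<phi>"
  using g phi DERIV_continuous by (fastforce simp: continuous_on_eq_continuous_within)+

lemmas conts = continuous_g continuous_phi cont

lemma residual_mode:
  assumes "\<nu> \<noteq> 0"
  shows "residual \<nu> = (g B * sin (\<phi> B + 2 * pi * of_int \<nu> * B) - g A * sin (\<phi> A + 2 * pi * of_int \<nu> * A))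
      / (2 * pi * of_int \<nu>) - mode \<nu>"
proof -
  let ?f = "\<lambda>x. \<phi> x + 2 * pi * of_int \<nu> * x"
  have "((\<lambda>x. g' x * sin (?f x) + g x * ((\<phi>' x + 2 * pi * of_int \<nu>) * cos (?f x)))
      has_integral (g B * sin (?f B) - g A * sin (?f A))) {A..B}"
  proof (rule fundamental_theorem_of_calculus[OF AB])
    fix x assume x: "x \<in> {A..B}"
    show "((\<lambda>x. g x * sin (?f x)) has_vector_derivative
        g' x * sin (?f x) + g x * ((\<phi>' x + 2 * pi * of_int \<nu>) * cos (?f x))) (at x within {A..B})"
      unfolding has_real_derivative_iff_has_vector_derivative[symmetric]
      by (auto intro!: derivative_eq_intros g[OF x] phi[OF x] simp: algebra_simps)
  qed
  moreover have "((\<lambda>x. 2 * pi * of_int \<nu> * (g x * cos (?f x))) has_integral 2 * pi * of_int \<nu> * mode \<nu>) {A..B}"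
    unfolding mode_def
    by (intro has_integral_mult_right integrable_integral integrable_continuous_real continuous_intros conts)
  ultimately have "((\<lambda>x. g' x * sin (?f x) + g x * ((\<phi>' x + 2 * pi * of_int \<nu>) * cos (?f x))
       - 2 * pi * of_int \<nu> * (g x * cos (?f x)))
      has_integral (g B * sin (?f B) - g A * sin (?f A) - 2 * pi * of_int \<nu> * mode \<nu>)) {A..B}"
    by (rule has_integral_diff)
  then have "((\<lambda>x. g' x * sin (?f x) + g x * (\<phi>' x * cos (?f x)))
      has_integral (g B * sin (?f B) - g A * sin (?f A) - 2 * pi * of_int \<nu> * mode \<nu>)) {A..B}"
    by (rule has_integral_eq[rotated]) (simp add: algebra_simps)
  then have "integral {A..B} (\<lambda>x. g' x * sin (?f x) + g x * (\<phi>' x * cos (?f x)))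
      = g B * sin (?f B) - g A * sin (?f A) - 2 * pi * of_int \<nu> * mode \<nu>" by (rule integral_unique)
  then show ?thesis using assms by (simp add: residual_def diff_divide_distrib)
qed

lemma mode_pair: "mode \<nu> + mode (- \<nu>) = 2 * integral {A..B} (\<lambda>x. g x * cos (\<phi> x) * cos (2 * pi * of_int \<nu> * x))"
proof -
  have "mode \<nu> + mode (- \<nu>) = integral {A..B} (\<lambda>x. g x * cos (\<phi> x + 2 * pi * of_int \<nu> * x) + g x * cos (\<phi> x + 2 * pi * of_int (- \<nu>) * x))"
    unfolding mode_def by (intro integral_add[symmetric] integrable_continuous_real continuous_intros conts)
  also have "\<dots> = integral {A..B} (\<lambda>x. 2 * (g x * cos (\<phi> x) * cos (2 * pi * of_int \<nu> * x)))"
    by (rule integral_cong) (simp add: cos_add cos_diff algebra_simps)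
  finally show ?thesis by simp
qed

lemma residual_pair:
  assumes "\<nu> \<noteq> 0"
  shows "residual \<nu> + residual (- \<nu>) = integral {A..B} (\<lambda>x. sin (2 * pi * of_int \<nu> * x) * (g' x * cos (\<phi> x) - g x * (\<phi>' x * sin (\<phi> x)))) / (pi * of_int \<nu>)"
proof -
  let ?i = "\<lambda>\<nu> x. g' x * sin (\<phi> x + 2 * pi * of_int \<nu> * x) + g x * (\<phi>' x * cos (\<phi> x + 2 * pi * of_int \<nu> * x))"
  have "integral {A..B} (?i \<nu>) - integral {A..B} (?i (- \<nu>)) = integral {A..B} (\<lambda>x. ?i \<nu> x - ?i (- \<nu>) x)"
    by (intro integral_diff[symmetric] integrable_continuous_real continuous_intros conts)
  also have "\<dots> = integral {A..B} (\<lambda>x. 2 * (sin (2 * pi * of_int \<nu> * x) * (g' x * cos (\<phi> x) - g x * (\<phi>' x * sin (\<phi> x)))))"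
    by (rule integral_cong) (simp add: sin_add cos_add sin_diff cos_diff algebra_simps)
  finally have "integral {A..B} (?i \<nu>) - integral {A..B} (?i (- \<nu>)) = 2 * integral {A..B} (\<lambda>x. sin (2 * pi * of_int \<nu> * x) * (g' x * cos (\<phi> x) - g x * (\<phi>' x * sin (\<phi> x))))"
    by simp
  moreover have "residual \<nu> + residual (- \<nu>) = (integral {A..B} (?i \<nu>) - integral {A..B} (?i (- \<nu>))) / (2 * pi * of_int \<nu>)"
    using assms by (simp add: residual_def diff_divide_distrib)
  ultimately show ?thesis by simp
qed

text \<open>A mode differs from its residual only by boundary values, and it is the residuals that are absolutely summable:
one integration by parts has been carried out in them. The modes in \<open>{K<..K'}\<close> have no partner
of opposite sign, so their boundary values do not cancel; they are paid for by \<open>(g A + g B) / (2 * pi * real \<nu>)\<close>.\<close>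
lemma poisson_truncated:
  assumes K: "K \<le> K'"
    and bound: "\<And>M. M > K' \<Longrightarrow> (\<Sum>\<nu>\<in>{K'<..M}. \<bar>residual (int \<nu>)\<bar>) + (\<Sum>\<nu>\<in>{K<..M}. \<bar>residual (- int \<nu>)\<bar>) \<le> D"
  shows "\<bar>(\<Sum>N = \<lceil>A\<rceil>..\<lfloor>B\<rfloor>. g (of_int N) * cos (\<phi> (of_int N))) - (\<Sum>\<nu> = - int K..int K'. mode \<nu>)\<bar>
     \<le> (g A + g B) / 2 + (\<Sum>\<nu>\<in>{K<..K'}. (g A + g B) / (2 * pi * real \<nu>)) + D"
proof -
  define h where "h = (\<lambda>x. g x * cos (\<phi> x))"
  define h' where "h' = (\<lambda>x. g' x * cos (\<phi> x) - g x * (\<phi>' x * sin (\<phi> x)))"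
  have hd: "(h has_real_derivative h' x) (at x within {A..B})" if "x \<in> {A..B}" for x
    unfolding h_def h'_def
    by (auto intro!: derivative_eq_intros g[OF that] phi[OF that] simp: algebra_simps)
  have hc: "continuous_on {A..B} h'" unfolding h'_def by (intro continuous_intros conts)
  define s where "s = (\<lambda>K. integral {A..B} (\<lambda>x. (x - of_int \<lfloor>x\<rfloor> - 1/2 + sawtooth_sum K x) * h' x))"
  define S where "S = (\<Sum>N = \<lceil>A\<rceil>..\<lfloor>B\<rfloor>. h (of_int N))"
  define eA where "eA = (A - of_int \<lceil>A\<rceil> + 1/2 + sawtooth_sum K A) * h A"
  define eB where "eB = (B - of_int \<lfloor>B\<rfloor> - 1/2 + sawtooth_sum K B) * h B"
  have em: "s K = S - integral {A..B} h - (\<Sum>\<nu>=1..K. 2 * integral {A..B} (\<lambda>x. h x * cos (2 * pi * real \<nu> * x)))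
       + eB - eA"
    unfolding s_def S_def eA_def eB_def by (rule integral_unique[OF euler_maclaurin_truncated[OF AB hd hc]])
  have m0: "mode 0 = integral {A..B} h" by (simp add: mode_def h_def)
  have sym: "(\<Sum>\<nu> = - int K..int K. mode \<nu>) = mode 0 + (\<Sum>\<nu>=1..K. mode (int \<nu>) + mode (- int \<nu>))" for K
  proof (induction K)
    case (Suc K)
    have "{- int (Suc K)..int (Suc K)} = insert (int (Suc K)) (insert (- int (Suc K)) {- int K..int K})" by auto
    then have "(\<Sum>\<nu> = - int (Suc K)..int (Suc K). mode \<nu>) = mode (int (Suc K)) + (mode (- int (Suc K)) + (\<Sum>\<nu> = - int K..int K. mode \<nu>))"
      by (simp del: of_nat_Suc)
    then show ?case using Suc by simp
  qed simp
  have em2: "S = (\<Sum>\<nu> = - int K..int K. mode \<nu>) + eA - eB + s K"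
  proof -
    have "mode (int \<nu>) + mode (- int \<nu>) = 2 * integral {A..B} (\<lambda>x. h x * cos (2 * pi * real \<nu> * x))" for \<nu>
      using mode_pair[of "int \<nu>"] by (simp add: h_def)
    then show ?thesis using em sym[of K] m0 by simp
  qed
  have step: "s M = s K + (\<Sum>\<nu>\<in>{K<..M}. residual (int \<nu>) + residual (- int \<nu>))" if "K \<le> M" for M
    using that
  proof (induction M rule: dec_induct)
    case (step M)
    have "s (Suc M) = integral {A..B} (\<lambda>x. (x - of_int \<lfloor>x\<rfloor> - 1/2 + sawtooth_sum M x) * h' x
        + (sin (2 * pi * real (Suc M) * x) * h' x) / (pi * real (Suc M)))"
      unfolding s_def by (rule integral_cong) (simp add: sawtooth_sum_def algebra_simps)
    also have "\<dots> = s M + integral {A..B} (\<lambda>x. (sin (2 * pi * real (Suc M) * x) * h' x) / (pi * real (Suc M)))"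
      unfolding s_def
      by (intro integral_add sawtooth_integral_tendsto_0(2) hc integrable_continuous_real continuous_intros) auto
    also have "integral {A..B} (\<lambda>x. (sin (2 * pi * real (Suc M) * x) * h' x) / (pi * real (Suc M)))
       = residual (int (Suc M)) + residual (- int (Suc M))"
      unfolding h'_def by (subst residual_pair) simp_all
    finally have "s (Suc M) = s M + (residual (int (Suc M)) + residual (- int (Suc M)))" .
    moreover have "{K<..Suc M} = insert (Suc M) {K<..M}" using step.hyps by auto
    ultimately show ?case using step.IH by (simp del: of_nat_Suc)
  qed simp
  define P where "P = (\<Sum>\<nu>\<in>{K<..K'}. mode (int \<nu>))"
  define R where "R = (\<Sum>\<nu>\<in>{K<..K'}. (g A + g B) / (2 * pi * real \<nu>))"
  have res: "\<bar>(\<Sum>\<nu>\<in>{K<..K'}. residual (int \<nu>)) + P\<bar> \<le> R"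
  proof -
    have "\<bar>residual (int \<nu>) + mode (int \<nu>)\<bar> \<le> (g A + g B) / (2 * pi * real \<nu>)" if "\<nu> \<in> {K<..K'}" for \<nu>
    proof -
      have nu: "\<nu> > 0" using that by auto
      let ?n = "g B * sin (\<phi> B + 2 * pi * of_int (int \<nu>) * B) - g A * sin (\<phi> A + 2 * pi * of_int (int \<nu>) * A)"
      have "\<bar>g B * sin z\<bar> \<le> g B" "\<bar>g A * sin z\<bar> \<le> g A" for z
        using g_nonneg abs_sin_le_one[of z] by (auto simp: abs_mult intro!: mult_left_le)
      then have "\<bar>?n\<bar> \<le> g A + g B" by (smt (verit, best))
      then have "\<bar>?n\<bar> / (2 * pi * real \<nu>) \<le> (g A + g B) / (2 * pi * real \<nu>)" using nu by (intro divide_right_mono) auto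
      then show ?thesis using nu by (subst residual_mode) (auto simp: abs_mult)
    qed
    then have "(\<Sum>\<nu>\<in>{K<..K'}. \<bar>residual (int \<nu>) + mode (int \<nu>)\<bar>) \<le> R" unfolding R_def by (rule sum_mono)
    then show ?thesis unfolding P_def sum.distrib[symmetric] by (rule order_trans[OF sum_abs])
  qed
  have "\<bar>s K - P\<bar> \<le> R + D"
  proof (rule field_le_epsilon)
    fix e :: real assume "e > 0"
    have "s \<longlonglongrightarrow> 0" unfolding s_def by (rule sawtooth_integral_tendsto_0(1)[OF hc])
    with \<open>e > 0\<close> obtain M0 where M0: "\<And>M. M \<ge> M0 \<Longrightarrow> \<bar>s M\<bar> < e" by (auto simp: LIMSEQ_iff)
    define M where "M = max M0 (Suc K')"
    have M: "M > K'" "\<bar>s M\<bar> < e" using M0 by (auto simp: M_def)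
    have split: "(\<Sum>\<nu>\<in>{K<..M}. residual (int \<nu>)) = (\<Sum>\<nu>\<in>{K<..K'}. residual (int \<nu>)) + (\<Sum>\<nu>\<in>{K'<..M}. residual (int \<nu>))"
      using K M by (subst sum.union_disjoint[symmetric]) (auto intro!: sum.cong)
    have "\<bar>\<Sum>\<nu>\<in>{K'<..M}. residual (int \<nu>)\<bar> + \<bar>\<Sum>\<nu>\<in>{K<..M}. residual (- int \<nu>)\<bar> \<le> D"
      by (rule order_trans[OF add_mono[OF sum_abs sum_abs] bound[OF M(1)]])
    moreover have "s K = s M - (\<Sum>\<nu>\<in>{K<..K'}. residual (int \<nu>)) - (\<Sum>\<nu>\<in>{K'<..M}. residual (int \<nu>)) - (\<Sum>\<nu>\<in>{K<..M}. residual (- int \<nu>))"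
      using step[of M] K M split by (simp add: sum.distrib)
    ultimately show "\<bar>s K - P\<bar> \<le> R + D + e" using res M(2) by linarith
  qed
  moreover have "\<bar>eA\<bar> \<le> g A / 2"
  proof -
    have "\<bar>eA\<bar> \<le> 1/2 * (g A * 1)" unfolding eA_def h_def abs_mult
      using sawtooth_remainder_le_half(2)[of A K] g_nonneg by (intro mult_mono) auto
    then show ?thesis by simp
  qed
  moreover have "\<bar>eB\<bar> \<le> g B / 2"
  proof -
    have "\<bar>eB\<bar> \<le> 1/2 * (g B * 1)" unfolding eB_def h_def abs_mult
      using sawtooth_remainder_le_half(1)[of B K] g_nonneg by (intro mult_mono) auto
    then show ?thesis by simp
  qed
  moreover have "(\<Sum>\<nu> = - int K..int K'. mode \<nu>) = (\<Sum>\<nu> = - int K..int K. mode \<nu>) + P"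
  proof -
    have "{- int K..int K'} = {- int K..int K} \<union> int ` {K<..K'}"
    proof -
      have "x \<in> int ` {K<..K'}" if "x \<le> int K'" "x > int K" for x
        using that by (intro image_eqI[of _ _ "nat x"]) auto
      then show ?thesis using K by force
    qed
    then show ?thesis unfolding P_def
      by (simp add: sum.union_disjoint[of _ "int ` {K<..K'}"] sum.reindex) (subst sum.union_disjoint; force simp: sum.reindex)
  qed
  ultimately have "\<bar>S - (\<Sum>\<nu> = - int K..int K'. mode \<nu>)\<bar> \<le> (g A + g B) / 2 + R + D"
    using em2 unfolding abs_le_iff by (simp add: field_simps)
  then show ?thesis by (simp add: S_def R_def h_def)
qed

end

section \<open>Fresnel integrals\<close>

definition fresnel_primitive :: "complex \<Rightarrow> complex" where
  "fresnel_primitive = (SOME F. (\<forall>z. (F has_field_derivative exp (\<i> * z\<^sup>2)) (at z)) \<and> F 0 = 0)"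

lemma fresnel_primitive_deriv: "(fresnel_primitive has_field_derivative exp (\<i> * z\<^sup>2)) (at z)"
  and fresnel_primitive_0 [simp]: "fresnel_primitive 0 = 0"
proof -
  have "(\<lambda>z. exp (\<i> * z\<^sup>2)) holomorphic_on UNIV" by (intro holomorphic_intros)
  then obtain F where F: "\<And>z. (F has_field_derivative exp (\<i> * z\<^sup>2)) (at z)"
    using holomorphic_convex_primitive'[of UNIV "\<lambda>z. exp (\<i> * z\<^sup>2)"] by auto
  have "\<exists>F. (\<forall>z. (F has_field_derivative exp (\<i> * z\<^sup>2)) (at z)) \<and> F 0 = 0"
    by (rule exI[of _ "\<lambda>z. F z - F 0"]) (auto intro!: derivative_eq_intros F)
  from someI_ex[OF this, folded fresnel_primitive_def]
  show "(fresnel_primitive has_field_derivative exp (\<i> * z\<^sup>2)) (at z)" "fresnel_primitive 0 = 0" by auto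
qed

lemma fresnel_primitive_minus: "fresnel_primitive (- z) = - fresnel_primitive z"
proof -
  have "((\<lambda>z. fresnel_primitive z + fresnel_primitive (- z)) has_field_derivative 0) (at z)" for z
    by (rule derivative_eq_intros DERIV_chain2[OF fresnel_primitive_deriv] fresnel_primitive_deriv refl | simp)+
  then obtain c where c: "\<And>z. fresnel_primitive z + fresnel_primitive (- z) = c"
    using has_field_derivative_zero_constant[of UNIV "\<lambda>z. fresnel_primitive z + fresnel_primitive (- z)"] by auto
  from c[of 0] c[of z] show ?thesis by (simp add: eq_neg_iff_add_eq_0 add.commute)
qed

lemma fresnel_primitive_segment:
  assumes "0 \<le> R"
  shows "((\<lambda>r. w * exp (\<i> * (u + of_real r * w)\<^sup>2)) has_integral (fresnel_primitive (u + of_real R * w) - fresnel_primitive u)) {0..R}"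
proof -
  have "((\<lambda>r. w * exp (\<i> * (u + of_real r * w)\<^sup>2)) has_integral
      ((fresnel_primitive \<circ> (\<lambda>r. u + of_real r * w)) R - (fresnel_primitive \<circ> (\<lambda>r. u + of_real r * w)) 0)) {0..R}"
  proof (rule fundamental_theorem_of_calculus[OF assms])
    fix x assume "x \<in> {0..R}"
    have "((\<lambda>r. u + of_real r * w) has_vector_derivative w) (at x)"
      by (auto intro!: derivative_eq_intros simp: has_vector_derivative_def scaleR_conv_of_real)
    from field_vector_diff_chain_at[OF this fresnel_primitive_deriv]
    show "((fresnel_primitive \<circ> (\<lambda>r. u + of_real r * w)) has_vector_derivative w * exp (\<i> * (u + of_real x * w)\<^sup>2)) (at x within {0..R})"
      by (rule has_vector_derivative_at_within)
  qed
  then show ?thesis by simp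
qed

lemma gaussian_integral_le:
  assumes "0 \<le> b"
  shows "integral {0..b} (\<lambda>x. exp (- x\<^sup>2)) \<le> sqrt pi / 2" (is ?A)
    and "((\<lambda>b. integral {0..b} (\<lambda>x. exp (- x\<^sup>2))) \<longlongrightarrow> sqrt pi / 2) at_top" (is ?B)
proof -
  let ?f = "\<lambda>x::real. indicator {0..} x *\<^sub>R exp (- x\<^sup>2) :: real"
  have int: "integrable lborel ?f" "integral\<^sup>L lborel ?f = sqrt pi / 2"
    using gaussian_moment_0 by (auto simp: has_bochner_integral_iff)
  have eq: "(\<integral>x. indicator {..b} x *\<^sub>R ?f x \<partial>lborel) = integral {0..b} (\<lambda>x. exp (- x\<^sup>2))" for b :: real
  proof -
    have "(\<integral>x. indicator {..b} x *\<^sub>R ?f x \<partial>lborel) = (LINT x:{0..b}|lborel. exp (- x\<^sup>2))"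
      unfolding set_lebesgue_integral_def by (intro Bochner_Integration.integral_cong) (auto split: split_indicator)
    also have "\<dots> = integral {0..b} (\<lambda>x. exp (- x\<^sup>2))"
      by (rule set_borel_integral_eq_integral(2)) (intro borel_integrable_atLeastAtMost' continuous_intros)
    finally show ?thesis .
  qed
  have "((\<lambda>b. \<integral>x. indicator {..b} x *\<^sub>R ?f x \<partial>lborel) \<longlongrightarrow> integral\<^sup>L lborel ?f) at_top"
    by (rule tendsto_integral_at_top) (use int in auto)
  then show B: ?B by (simp only: eq int(2))
  have "integral {0..b} (\<lambda>x. exp (- x\<^sup>2)) \<le> integral {0..c} (\<lambda>x. exp (- x\<^sup>2))" if "b \<le> c" for c
    using that assms by (intro integral_subset_le integrable_continuous_real continuous_intros) auto
  then show ?A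
    by (intro tendsto_lowerbound[OF B]) (auto simp: eventually_at_top_linorder intro!: exI[of _ b])
qed

abbreviation \<omega> :: complex where "\<omega> \<equiv> cis (pi / 4)"

lemma ray_norm:
  assumes "0 \<le> U"
  shows "norm (\<omega> * exp (\<i> * (of_real U + of_real r * \<omega>)\<^sup>2)) = exp (- r\<^sup>2 - sqrt 2 * U * r)"
proof -
  have w2: "\<omega>\<^sup>2 = \<i>" by (simp add: Complex.DeMoivre)
  have "\<i> * (of_real U + of_real r * \<omega>)\<^sup>2 = \<i> * of_real (U\<^sup>2) + \<i> * of_real (2 * U * r) * \<omega> + \<i> * of_real (r\<^sup>2) * \<omega>\<^sup>2"
    by (simp add: power2_eq_square algebra_simps)
  also have "Re \<dots> = - r\<^sup>2 - sqrt 2 * U * r"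
    unfolding w2 by (simp add: cis.ctr sin_45)
  finally have "Re (\<i> * (of_real U + of_real r * \<omega>)\<^sup>2) = - r\<^sup>2 - sqrt 2 * U * r" .
  then show ?thesis by (simp add: norm_mult)
qed

lemma fresnel_ray_bound:
  assumes U: "0 \<le> U" and R: "0 \<le> R"
  shows "norm (fresnel_primitive (of_real U + of_real R * \<omega>) - fresnel_primitive (of_real U)) \<le> sqrt pi / 2"
    and "0 < U \<Longrightarrow> norm (fresnel_primitive (of_real U + of_real R * \<omega>) - fresnel_primitive (of_real U)) \<le> 1 / (sqrt 2 * U)"
proof -
  let ?d = "fresnel_primitive (of_real U + of_real R * \<omega>) - fresnel_primitive (of_real U)"
  note hi = fresnel_primitive_segment[OF R, of \<omega> "of_real U"]
  have "norm ?d \<le> integral {0..R} (\<lambda>r. exp (- r\<^sup>2))"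
    unfolding integral_unique[OF hi, symmetric]
  proof (rule integral_norm_bound_integral)
    show "(\<lambda>r. \<omega> * exp (\<i> * (of_real U + of_real r * \<omega>)\<^sup>2)) integrable_on {0..R}" using hi by blast
    show "(\<lambda>r. exp (- r\<^sup>2) :: real) integrable_on {0..R}" by (intro integrable_continuous_real continuous_intros)
    show "norm (\<omega> * exp (\<i> * (of_real U + of_real r * \<omega>)\<^sup>2)) \<le> exp (- r\<^sup>2)" if "r \<in> {0..R}" for r
      unfolding ray_norm[OF U] using that U by simp
  qed
  also have "\<dots> \<le> sqrt pi / 2" by (rule gaussian_integral_le(1)[OF R])
  finally show "norm ?d \<le> sqrt pi / 2" .
  assume U': "0 < U"
  let ?k = "sqrt 2 * U"
  have k: "?k > 0" using U' by simp
  have ei: "((\<lambda>r. exp (- ?k * r)) has_integral ((- exp (- ?k * R) / ?k) - (- exp (- ?k * 0) / ?k))) {0..R}"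
    by (rule fundamental_theorem_of_calculus[OF R])
       (use k in \<open>auto simp: has_real_derivative_iff_has_vector_derivative[symmetric] intro!: derivative_eq_intros\<close>)
  have "norm ?d \<le> integral {0..R} (\<lambda>r. exp (- ?k * r))"
    unfolding integral_unique[OF hi, symmetric]
  proof (rule integral_norm_bound_integral)
    show "(\<lambda>r. \<omega> * exp (\<i> * (of_real U + of_real r * \<omega>)\<^sup>2)) integrable_on {0..R}" using hi by blast
    show "(\<lambda>r. exp (- ?k * r)) integrable_on {0..R}" using ei by blast
    show "norm (\<omega> * exp (\<i> * (of_real U + of_real r * \<omega>)\<^sup>2)) \<le> exp (- ?k * r)" if "r \<in> {0..R}" for r
      unfolding ray_norm[OF U] by simp
  qed
  also have "\<dots> = (1 - exp (- ?k * R)) / ?k" unfolding integral_unique[OF ei] by (simp add: diff_divide_distrib)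
  also have "\<dots> \<le> 1 / ?k" using k by (intro divide_right_mono) auto
  finally show "norm ?d \<le> 1 / (sqrt 2 * U)" .
qed

lemma fresnel_vertical_bound:
  assumes a: "0 < a" and b: "0 \<le> b"
  shows "norm (fresnel_primitive (of_real a + of_real b * \<i>) - fresnel_primitive (of_real a)) \<le> 1 / (2 * a)"
proof -
  let ?d = "fresnel_primitive (of_real a + of_real b * \<i>) - fresnel_primitive (of_real a)"
  note hi = fresnel_primitive_segment[OF b, of \<i> "of_real a"]
  let ?k = "2 * a"
  have ei: "((\<lambda>r. exp (- ?k * r)) has_integral ((- exp (- ?k * b) / ?k) - (- exp (- ?k * 0) / ?k))) {0..b}"
    by (rule fundamental_theorem_of_calculus[OF b])
       (use a in \<open>auto simp: has_real_derivative_iff_has_vector_derivative[symmetric] intro!: derivative_eq_intros\<close>)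
  have "norm ?d \<le> integral {0..b} (\<lambda>r. exp (- ?k * r))"
    unfolding integral_unique[OF hi, symmetric]
  proof (rule integral_norm_bound_integral)
    show "(\<lambda>r. \<i> * exp (\<i> * (of_real a + of_real r * \<i>)\<^sup>2)) integrable_on {0..b}" using hi by blast
    show "(\<lambda>r. exp (- ?k * r)) integrable_on {0..b}" using ei by blast
    show "norm (\<i> * exp (\<i> * (of_real a + of_real r * \<i>)\<^sup>2)) \<le> exp (- ?k * r)" if "r \<in> {0..b}" for r
      by (simp add: norm_mult power2_eq_square algebra_simps)
  qed
  also have "\<dots> = (1 - exp (- ?k * b)) / ?k" unfolding integral_unique[OF ei] by (simp add: diff_divide_distrib)
  also have "\<dots> \<le> 1 / ?k" using a by (intro divide_right_mono) auto
  finally show ?thesis .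
qed

lemma fresnel_corner: "of_real U + of_real (sqrt 2 * S) * \<omega> = of_real (U + S) + of_real S * \<i>"
  by (simp add: complex_eq_iff cis.ctr cos_45 sin_45)

lemma fresnel_limit: "((\<lambda>x. fresnel_primitive (of_real x)) \<longlongrightarrow> of_real (sqrt pi / 2) * \<omega>) at_top"
proof -
  have 1: "fresnel_primitive (of_real S + of_real S * \<i>) = of_real (integral {0..sqrt 2 * S} (\<lambda>x. exp (- x\<^sup>2))) * \<omega>" if "0 \<le> S" for S
  proof -
    have w2: "\<omega>\<^sup>2 = \<i>" by (simp add: Complex.DeMoivre)
    have "((\<lambda>r. \<omega> * exp (\<i> * (0 + of_real r * \<omega>)\<^sup>2)) has_integral fresnel_primitive (0 + of_real (sqrt 2 * S) * \<omega>)) {0..sqrt 2 * S}"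
      using fresnel_primitive_segment[of "sqrt 2 * S" \<omega> 0] that by simp
    moreover have "((\<lambda>r. of_real (exp (- r\<^sup>2)) * \<omega>) has_integral of_real (integral {0..sqrt 2 * S} (\<lambda>x. exp (- x\<^sup>2))) * \<omega>) {0..sqrt 2 * S}"
      by (intro has_integral_mult_left has_integral_of_real integrable_integral integrable_continuous_real continuous_intros)
    moreover have "\<omega> * exp (\<i> * (0 + of_real r * \<omega>)\<^sup>2) = of_real (exp (- r\<^sup>2)) * \<omega>" for r
    proof -
      have "\<i> * (0 + of_real r * \<omega>)\<^sup>2 = - of_real (r\<^sup>2)"
        by (simp add: power_mult_distrib w2 mult.left_commute[of \<i>])
      then show ?thesis by (simp add: exp_of_real[symmetric])
    qed
    ultimately have "fresnel_primitive (0 + of_real (sqrt 2 * S) * \<omega>) = of_real (integral {0..sqrt 2 * S} (\<lambda>x. exp (- x\<^sup>2))) * \<omega>"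
      using has_integral_unique by (metis (no_types, lifting) has_integral_cong)
    then show ?thesis using fresnel_corner[of 0 S] by simp
  qed
  have "((\<lambda>S. of_real (integral {0..sqrt 2 * S} (\<lambda>x. exp (- x\<^sup>2))) * \<omega>) \<longlongrightarrow> of_real (sqrt pi / 2) * \<omega>) at_top"
  proof (intro tendsto_intros)
    have "filterlim (\<lambda>S::real. sqrt 2 * S) at_top at_top" by real_asymp
    from filterlim_compose[OF gaussian_integral_le(2)[OF order_refl] this]
    show "((\<lambda>S. integral {0..sqrt 2 * S} (\<lambda>x. exp (- x\<^sup>2))) \<longlongrightarrow> sqrt pi / 2) at_top" by simp
  qed
  then have 2: "((\<lambda>S. fresnel_primitive (of_real S + of_real S * \<i>)) \<longlongrightarrow> of_real (sqrt pi / 2) * \<omega>) at_top"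
    by (rule Lim_transform_eventually) (use 1 in \<open>auto simp: eventually_at_top_linorder intro!: exI[of _ 0]\<close>)
  have "((\<lambda>S. fresnel_primitive (of_real S + of_real S * \<i>) - fresnel_primitive (of_real S)) \<longlongrightarrow> 0) at_top"
  proof (rule Lim_null_comparison)
    show "\<forall>\<^sub>F S in at_top. norm (fresnel_primitive (of_real S + of_real S * \<i>) - fresnel_primitive (of_real S)) \<le> 1 / (2 * S)"
      using eventually_gt_at_top[of 0] by eventually_elim (rule fresnel_vertical_bound, auto)
    show "((\<lambda>S. 1 / (2 * S) :: real) \<longlongrightarrow> 0) at_top" by real_asymp
  qed
  from tendsto_diff[OF 2 this] show ?thesis by simp
qed

text \<open>Turning the half line by \<open>pi / 4\<close> replaces the oscillating tail by a decaying Gaussian.\<close>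
lemma fresnel_tail:
  assumes U: "0 \<le> U"
  shows "norm (of_real (sqrt pi / 2) * \<omega> - fresnel_primitive (of_real U)) \<le> sqrt pi / 2"
    and "0 < U \<Longrightarrow> norm (of_real (sqrt pi / 2) * \<omega> - fresnel_primitive (of_real U)) \<le> 1 / (sqrt 2 * U)"
proof -
  have main: "norm (of_real (sqrt pi / 2) * \<omega> - fresnel_primitive (of_real U)) \<le> B"
    if B: "\<And>R. 0 \<le> R \<Longrightarrow> norm (fresnel_primitive (of_real U + of_real R * \<omega>) - fresnel_primitive (of_real U)) \<le> B" for B
  proof (rule tendsto_le[of at_top "\<lambda>S. B + 1 / (2 * (U + S))" _ "\<lambda>S. norm (fresnel_primitive (of_real (U + S)) - fresnel_primitive (of_real U))"])
    show "((\<lambda>S. B + 1 / (2 * (U + S))) \<longlongrightarrow> B) at_top" by real_asymp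
    have "filterlim (\<lambda>S::real. U + S) at_top at_top" by real_asymp
    from filterlim_compose[OF fresnel_limit this]
    show "((\<lambda>S. norm (fresnel_primitive (of_real (U + S)) - fresnel_primitive (of_real U))) \<longlongrightarrow> norm (of_real (sqrt pi / 2) * \<omega> - fresnel_primitive (of_real U))) at_top"
      by (intro tendsto_intros)
    show "\<forall>\<^sub>F S in at_top. norm (fresnel_primitive (of_real (U + S)) - fresnel_primitive (of_real U)) \<le> B + 1 / (2 * (U + S))"
      using eventually_gt_at_top[of 0]
    proof eventually_elim
      case (elim S)
      have "norm (fresnel_primitive (of_real (U + S) + of_real S * \<i>) - fresnel_primitive (of_real U)) \<le> B"
        using B[of "sqrt 2 * S"] elim by (simp only: fresnel_corner) simp
      moreover have "norm (fresnel_primitive (of_real (U + S) + of_real S * \<i>) - fresnel_primitive (of_real (U + S))) \<le> 1 / (2 * (U + S))"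
        using elim U by (intro fresnel_vertical_bound) auto
      ultimately show ?case
        using norm_triangle_sub[of "fresnel_primitive (of_real (U + S)) - fresnel_primitive (of_real U)" "fresnel_primitive (of_real (U + S) + of_real S * \<i>) - fresnel_primitive (of_real U)"]
        by (simp add: norm_minus_commute)
    qed
  qed simp
  show "norm (of_real (sqrt pi / 2) * \<omega> - fresnel_primitive (of_real U)) \<le> sqrt pi / 2"
    by (rule main) (rule fresnel_ray_bound(1)[OF U])
  show "norm (of_real (sqrt pi / 2) * \<omega> - fresnel_primitive (of_real U)) \<le> 1 / (sqrt 2 * U)" if "0 < U"
    by (rule main) (rule fresnel_ray_bound(2)[OF U _ that])
qed

definition fresnel_cos :: "real \<Rightarrow> real \<Rightarrow> real" where
  "fresnel_cos C x = Re (cis C * fresnel_primitive (of_real x))"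

lemma fresnel_cos_deriv: "(fresnel_cos C has_real_derivative cos (C + x\<^sup>2)) (at x within S)"
proof -
  have "((\<lambda>x. cis C * fresnel_primitive (of_real x)) has_vector_derivative (cis C * exp (\<i> * (of_real x)\<^sup>2))) (at x within S)"
    using has_vector_derivative_real_field[OF fresnel_primitive_deriv[of "of_real x"], of S]
    by (intro has_vector_derivative_mult_right) auto
  then have "((\<lambda>x. Re (cis C * fresnel_primitive (of_real x))) has_vector_derivative Re (cis C * exp (\<i> * (of_real x)\<^sup>2))) (at x within S)"
    by (rule bounded_linear.has_vector_derivative[OF bounded_linear_Re])
  moreover have "cis C * exp (\<i> * (of_real x)\<^sup>2) = cis (C + x\<^sup>2)"
    by (simp add: cis_conv_exp exp_add[symmetric] algebra_simps)
  ultimately show ?thesis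
    by (simp add: fresnel_cos_def[abs_def] has_real_derivative_iff_has_vector_derivative)
qed

lemma fresnel_cos_minus: "fresnel_cos C (- x) = - fresnel_cos C x"
  by (simp add: fresnel_cos_def fresnel_primitive_minus)

lemma fresnel_cos_limit_value: "Re (cis C * (of_real (sqrt pi / 2) * \<omega>)) = sqrt pi / 2 * cos (C + pi / 4)"
proof -
  have "cos (C + pi / 4) = cos C * (sqrt 2 / 2) - sin C * (sqrt 2 / 2)"
    by (simp only: cos_add cos_45 sin_45)
  then show ?thesis by (simp add: cis.ctr cos_45 sin_45 right_diff_distrib mult_ac)
qed

lemma fresnel_cos_tail:
  assumes U: "0 \<le> U"
  shows "\<bar>sqrt pi / 2 * cos (C + pi / 4) - fresnel_cos C U\<bar> \<le> sqrt pi / 2"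
    and "0 < U \<Longrightarrow> \<bar>sqrt pi / 2 * cos (C + pi / 4) - fresnel_cos C U\<bar> \<le> 1 / (sqrt 2 * U)"
    and "0 < U \<Longrightarrow> \<bar>sqrt pi / 2 * cos (C + pi / 4) - fresnel_cos C U\<bar> \<le> (1 + \<bar>sin (C + U\<^sup>2)\<bar>) / (2 * U)"
proof -
  let ?z = "of_real (sqrt pi / 2) * \<omega> - fresnel_primitive (of_real U)"
  have "sqrt pi / 2 * cos (C + pi / 4) - fresnel_cos C U = Re (cis C * ?z)"
    using fresnel_cos_limit_value[of C] by (simp add: fresnel_cos_def algebra_simps)
  then have le: "\<bar>sqrt pi / 2 * cos (C + pi / 4) - fresnel_cos C U\<bar> \<le> norm ?z"
    using abs_Re_le_cmod[of "cis C * ?z"] by (simp add: norm_mult)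
  show "\<bar>sqrt pi / 2 * cos (C + pi / 4) - fresnel_cos C U\<bar> \<le> sqrt pi / 2"
    using le fresnel_tail(1)[OF U] by simp
  show "\<bar>sqrt pi / 2 * cos (C + pi / 4) - fresnel_cos C U\<bar> \<le> 1 / (sqrt 2 * U)" if "0 < U"
    using le fresnel_tail(2)[OF U that] by simp
  assume U': "0 < U"
  have *: "\<bar>fresnel_cos C R - fresnel_cos C U\<bar> \<le> (1 + \<bar>sin (C + U\<^sup>2)\<bar>) / (2 * U)" if R: "U \<le> R" for R
  proof -
    obtain \<xi> where xi: "((\<lambda>x. (1 / (2 * x)) * (cos (C + x\<^sup>2) * (2 * x))) has_integral (1 / (2 * U) * (sin (C + \<xi>\<^sup>2) - sin (C + U\<^sup>2)))) {U..R}"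
    proof (rule bonnet_decreasing[OF R, of "\<lambda>x. sin (C + x\<^sup>2)" "\<lambda>x. cos (C + x\<^sup>2) * (2 * x)" "\<lambda>x. 1 / (2 * x)"])
      show "((\<lambda>x. sin (C + x\<^sup>2)) has_real_derivative cos (C + x\<^sup>2) * (2 * x)) (at x within {U..R})" for x
        by (auto intro!: derivative_eq_intros)
      show "1 / (2 * y) \<le> 1 / (2 * x)" if "U \<le> x" "x \<le> y" for x y
        using that U' by (intro divide_left_mono) auto
    qed (use U' R in auto)
    have "((\<lambda>x. cos (C + x\<^sup>2)) has_integral (1 / (2 * U) * (sin (C + \<xi>\<^sup>2) - sin (C + U\<^sup>2)))) {U..R}"
      by (rule has_integral_eq[OF _ xi]) (use U' in auto)
    moreover have "((\<lambda>x. cos (C + x\<^sup>2)) has_integral (fresnel_cos C R - fresnel_cos C U)) {U..R}"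
      by (rule fundamental_theorem_of_calculus[OF R])
         (simp add: has_real_derivative_iff_has_vector_derivative[symmetric] fresnel_cos_deriv)
    ultimately have "fresnel_cos C R - fresnel_cos C U = 1 / (2 * U) * (sin (C + \<xi>\<^sup>2) - sin (C + U\<^sup>2))"
      by (rule has_integral_unique[rotated])
    moreover have "\<bar>sin (C + \<xi>\<^sup>2) - sin (C + U\<^sup>2)\<bar> \<le> 1 + \<bar>sin (C + U\<^sup>2)\<bar>"
      using abs_sin_le_one[of "C + \<xi>\<^sup>2"] by linarith
    then have "1 / (2 * U) * \<bar>sin (C + \<xi>\<^sup>2) - sin (C + U\<^sup>2)\<bar> \<le> 1 / (2 * U) * (1 + \<bar>sin (C + U\<^sup>2)\<bar>)"
      using U' by (intro mult_left_mono) auto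
    ultimately show ?thesis using U' by (simp add: abs_mult)
  qed
  have "((\<lambda>R. fresnel_cos C R) \<longlongrightarrow> sqrt pi / 2 * cos (C + pi / 4)) at_top"
    unfolding fresnel_cos_def fresnel_cos_limit_value[symmetric] by (intro tendsto_intros fresnel_limit)
  then have "((\<lambda>R. \<bar>fresnel_cos C R - fresnel_cos C U\<bar>) \<longlongrightarrow> \<bar>sqrt pi / 2 * cos (C + pi / 4) - fresnel_cos C U\<bar>) at_top"
    by (intro tendsto_intros)
  then show "\<bar>sqrt pi / 2 * cos (C + pi / 4) - fresnel_cos C U\<bar> \<le> (1 + \<bar>sin (C + U\<^sup>2)\<bar>) / (2 * U)"
    by (rule tendsto_upperbound) (use * in \<open>auto simp: eventually_at_top_linorder\<close>)
qed

section \<open>A saddle point with a logarithmic phase\<close>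

text \<open>For \<open>x = stat \<alpha> * s\<close> the phase of a wave is its stationary value plus \<open>t * Q s\<close>, with
\<open>c = (stat \<alpha> / X)\<^sup>2\<close>; the endpoints of the interval are \<open>s1 < 1 < s2\<close>.\<close>
locale saddle =
  fixes c s1 s2 :: real
  assumes c: "c < 1" and s12: "7/10 \<le> s1" "s1 \<le> 1" "1 < s2"
    and range: "2/5 \<le> c * s1\<^sup>2" "c * s2\<^sup>2 \<le> 1"
begin

lemma c_ge: "2/5 \<le> c"
proof -
  have "c > 0"
  proof (rule ccontr)
    assume "\<not> c > 0"
    then have "c * s1\<^sup>2 \<le> 0" by (intro mult_nonpos_nonneg) auto
    then show False using range(1) by simp
  qed
  moreover have "s1\<^sup>2 \<le> 1" using s12 by (simp add: power_le_one)
  ultimately have "c * s1\<^sup>2 \<le> c * 1" by (intro mult_left_mono) auto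
  then show ?thesis using range by simp
qed

definition "Q s = s - 1 - ln s - c / 2 * (s - 1)\<^sup>2" for s :: real
definition "v s = 1 - c * s" for s :: real
definition "N s = 1 + s + c * s - 3 * c * s\<^sup>2" for s :: real
definition "N' s = 1 + c - 6 * c * s" for s :: real
definition "M s = N s * (6 * s * v s - 6 * c * s * (s - 1) - (s - 1) * v s) - 2 * N' s * s * (s - 1) * v s" for s :: real
definition "A s = sqrt s / ((s - 1) * v s)" for s :: real
definition "G0 = sqrt (2 / (1 - c))"

lemma s_range:
  assumes s: "s1 \<le> s" "s \<le> s2"
  shows "7/10 \<le> s \<and> s \<le> 2 \<and> 2/5 \<le> c * s\<^sup>2 \<and> c * s\<^sup>2 \<le> 1"
proof -
  have sq: "s1\<^sup>2 \<le> s\<^sup>2" "s\<^sup>2 \<le> s2\<^sup>2" using s s12 by (auto intro!: power_mono)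
  then have 1: "c * s1\<^sup>2 \<le> c * s\<^sup>2" "c * s\<^sup>2 \<le> c * s2\<^sup>2" using c_ge by (auto intro!: mult_left_mono)
  have "2/5 * s\<^sup>2 \<le> c * s\<^sup>2" using c_ge by (intro mult_right_mono) auto
  then have "s\<^sup>2 \<le> 2\<^sup>2" using 1 range by simp
  then have "s \<le> 2" by (rule power2_le_imp_le) auto
  then show ?thesis using 1 range s s12 by auto
qed

lemma v_pos: assumes "s1 \<le> s" "s \<le> s2" shows "0 < v s"
proof (cases "s \<le> 1")
  case True
  have "c * s \<le> c * 1" using c_ge True by (intro mult_left_mono) auto
  then show ?thesis using c unfolding v_def by linarith
next
  case False
  have "c * s * s \<le> 1" using s_range[OF assms] by (simp add: power2_eq_square)
  moreover have "c * s * 1 < c * s * s" using False c_ge by (intro mult_strict_left_mono) auto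
  ultimately have "c * s < 1" by simp
  then show ?thesis by (simp add: v_def)
qed

lemma N_eq: "s * N s = (s - 1)\<^sup>2 + (1 - c * s\<^sup>2) * (2 + 3 * (s - 1))"
  by (simp add: N_def power2_eq_square algebra_simps)

lemma N_pos: assumes "s1 \<le> s" "s \<le> s2" shows "0 < N s"
proof -
  note r = s_range[OF assms]
  have "(1 - c * s\<^sup>2) * (2 + 3 * (s - 1)) \<ge> 0" using r by (intro mult_nonneg_nonneg) auto
  moreover have "(s - 1)\<^sup>2 > 0 \<or> (1 - c * s\<^sup>2) * (2 + 3 * (s - 1)) > 0" using c by (cases "s = 1") auto
  ultimately have "s * N s > 0" unfolding N_eq using zero_le_power2[of "s - 1"] by linarith
  then show ?thesis using r by (simp add: zero_less_mult_iff)
qed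

lemma M_eq: "s\<^sup>2 * M s = (let x = s - 1; T = 1 - c * s\<^sup>2 in
   T\<^sup>2 * (12 + 30 * x + 21 * x\<^sup>2) + T * x * (8 + 14 * x + 12 * x\<^sup>2) + x\<^sup>2 * (8 + 8 * x + 3 * x\<^sup>2))"
  unfolding M_def N_def N'_def v_def Let_def by algebra

lemma M_pos: assumes "s1 \<le> s" "s \<le> s2" shows "0 < M s"
proof -
  note r = s_range[OF assms]
  define x where "x = s - 1"
  define T where "T = 1 - c * s\<^sup>2"
  have T: "0 \<le> T" "T \<le> 3/5" using r by (auto simp: T_def)
  have x: "- (3/10) \<le> x" "x \<le> 1" using r by (auto simp: x_def)
  have nz: "x \<noteq> 0 \<or> T > 0" using c by (auto simp: x_def T_def)
  have e: "s\<^sup>2 * M s = T\<^sup>2 * (12 + 30 * x + 21 * x\<^sup>2) + T * x * (8 + 14 * x + 12 * x\<^sup>2) + x\<^sup>2 * (8 + 8 * x + 3 * x\<^sup>2)"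
    unfolding M_eq x_def T_def Let_def ..
  have "s\<^sup>2 * M s > 0"
  proof (cases "x \<ge> 0")
    case True
    have "T\<^sup>2 * (12 + 30 * x + 21 * x\<^sup>2) \<ge> T\<^sup>2 * 12" "x\<^sup>2 * (8 + 8 * x + 3 * x\<^sup>2) \<ge> x\<^sup>2 * 8"
      using True by (intro mult_left_mono; simp)+
    moreover have "T * x * (8 + 14 * x + 12 * x\<^sup>2) \<ge> 0" using True T by simp
    moreover have "T\<^sup>2 * 12 + x\<^sup>2 * 8 > 0"
      using nz by (auto intro: add_pos_nonneg add_nonneg_pos)
    ultimately show ?thesis unfolding e by linarith
  next
    case False
    have 1: "12 + 30 * x + 21 * x\<^sup>2 \<ge> 4"
    proof -
      have "12 + 30 * x + 21 * x\<^sup>2 - 4 = (x + 3/10) * (21 * x + 237/10) + 89/100" by (simp add: power2_eq_square field_simps)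
      moreover have "(x + 3/10) * (21 * x + 237/10) \<ge> 0" using x by (intro mult_nonneg_nonneg) auto
      ultimately show ?thesis by linarith
    qed
    have 2: "8 + 8 * x + 3 * x\<^sup>2 \<ge> 5" using x zero_le_power2[of x] by linarith
    have 3: "8 + 14 * x + 12 * x\<^sup>2 \<le> 8"
    proof -
      have "x * (14 + 12 * x) \<le> 0" using False x by (intro mult_nonpos_nonneg) auto
      then show ?thesis by (simp add: power2_eq_square algebra_simps)
    qed
    have "T\<^sup>2 * (12 + 30 * x + 21 * x\<^sup>2) \<ge> T\<^sup>2 * 4" "x\<^sup>2 * (8 + 8 * x + 3 * x\<^sup>2) \<ge> x\<^sup>2 * 5"
      using 1 2 by (intro mult_left_mono; simp)+
    moreover have "T * x * (8 + 14 * x + 12 * x\<^sup>2) \<ge> T * x * 8"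
      using 3 False T by (intro mult_left_mono_neg) (auto simp: mult_nonneg_nonpos)
    moreover have "T\<^sup>2 * 4 + T * x * 8 + x\<^sup>2 * 5 = (2 * T + 2 * x)\<^sup>2 + x\<^sup>2" by (simp add: power2_eq_square algebra_simps)
    moreover have "x\<^sup>2 > 0" using False by simp
    ultimately show ?thesis unfolding e using zero_le_power2[of "2 * T + 2 * x"] by linarith
  qed
  then show ?thesis by (simp add: zero_less_mult_iff)
qed

lemma Q_1 [simp]: "Q 1 = 0" by (simp add: Q_def)

lemma Q_deriv: "0 < s \<Longrightarrow> (Q has_real_derivative ((s - 1) * v s / s)) (at s within S)"
  unfolding Q_def v_def by (auto intro!: derivative_eq_intros simp: field_simps power2_eq_square)

lemma N_deriv: "(N has_real_derivative N' s) (at s within S)"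
  unfolding N_def N'_def by (auto intro!: derivative_eq_intros)

lemma v_deriv: "(v has_real_derivative - c) (at s within S)"
  unfolding v_def by (auto intro!: derivative_eq_intros)

definition "M' s = N' s * (6 * s * v s - 6 * c * s * (s - 1) - (s - 1) * v s)
   + N s * (6 * v s - 6 * c * s - 6 * c * (s - 1) - 6 * c * s - v s + c * (s - 1))
   + 12 * c * s * (s - 1) * v s - 2 * N' s * ((s - 1) * v s + s * v s - c * s * (s - 1))" for s :: real

lemma M_deriv: "(M has_real_derivative M' s) (at s within S)"
proof -
  have "(N' has_real_derivative (- 6 * c)) (at s within S)" for s S
    unfolding N'_def by (auto intro!: derivative_eq_intros)
  then show ?thesis unfolding M_def M'_def
    by (auto intro!: derivative_eq_intros N_deriv v_deriv simp: algebra_simps)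
qed

definition "R s = 3 * (s - 1)\<^sup>2 * (v s)\<^sup>2 * N s / M s" for s :: real

definition "C8 s = (M s)\<^sup>2 - 3 * s * ((2 * v s - 2 * c * (s - 1)) * N s * M s
     + (s - 1) * v s * (N' s * M s - N s * M' s))" for s :: real

lemma C8_eq: "s ^ 3 * C8 s = (let x = s - 1; T = 1 - c * s\<^sup>2 in
   x\<^sup>2 * (x + T)\<^sup>2 * (160 - 240 * T + 72 * T\<^sup>2 + x * (160 - 240 * T + 63 * T\<^sup>2) - 9 * x\<^sup>2 * T))"
  unfolding C8_def M_def M'_def N_def N'_def v_def Let_def by algebra

lemma C8_nonneg: assumes "s1 \<le> s" "s \<le> s2" shows "0 \<le> C8 s"
proof -
  note r = s_range[OF assms]
  define x where "x = s - 1"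
  define T where "T = 1 - c * s\<^sup>2"
  have T: "0 \<le> T" "T \<le> 3/5" using r by (auto simp: T_def)
  have x: "- (3/10) \<le> x" "x \<le> 1" using r by (auto simp: x_def)
  have x2: "x\<^sup>2 \<le> 1" using x by (simp add: abs_square_le_1)
  define E1 where "E1 = 160 - 240 * T + 72 * T\<^sup>2"
  define E2 where "E2 = 160 - 240 * T + 63 * T\<^sup>2"
  have "(T - 3/5) * (72 * T - 1968/10) \<ge> 0" using T by (intro mult_nonpos_nonpos) auto
  moreover have "(T - 3/5) * (72 * T - 1968/10) = E1 - 160 + 11808/100" by (simp add: E1_def power2_eq_square field_simps)
  ultimately have B1: "E1 \<ge> 41" by linarith
  have "(T - 3/5) * (63 * T - 2022/10) \<ge> 0" using T by (intro mult_nonpos_nonpos) auto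
  moreover have "(T - 3/5) * (63 * T - 2022/10) = E2 - 160 + 12132/100" by (simp add: E2_def power2_eq_square field_simps)
  ultimately have B2: "E2 \<ge> 38" by linarith
  have B21: "E2 \<le> E1" by (simp add: E1_def E2_def)
  have B3: "x * E2 \<ge> - (3/10) * E1"
  proof (cases "x \<ge> 0")
    case True
    then have "x * E2 \<ge> 0" using B2 by simp
    then show ?thesis using B1 by linarith
  next
    case False
    have "x * E2 \<ge> (- (3/10)) * E2" using x B2 by (intro mult_right_mono) auto
    then show ?thesis using B21 by linarith
  qed
  have "9 * x\<^sup>2 * T \<le> 9 * 1 * (3/5)" using x2 T by (intro mult_mono) auto
  then have "E1 + x * E2 - 9 * x\<^sup>2 * T \<ge> 0"
    using B1 B3 by linarith
  then have "s ^ 3 * C8 s \<ge> 0" unfolding C8_eq Let_def x_def[symmetric] T_def[symmetric] E1_def[symmetric] E2_def[symmetric] by (intro mult_nonneg_nonneg) auto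
  then show ?thesis using r by (simp add: zero_le_mult_iff)
qed

lemma R_deriv: assumes "s1 \<le> s" "s \<le> s2"
  shows "((\<lambda>s. Q s - R s) has_real_derivative ((s - 1) * (v s * C8 s / (s * (M s)\<^sup>2)))) (at s)"
proof -
  note M = M_pos[OF assms] and r = s_range[OF assms]
  have "(R has_real_derivative ((3 * (2 * (s - 1)) * (v s)\<^sup>2 * N s + 3 * (s - 1)\<^sup>2 * (2 * v s * (- c)) * N s + 3 * (s - 1)\<^sup>2 * (v s)\<^sup>2 * N' s) * M s
       - 3 * (s - 1)\<^sup>2 * (v s)\<^sup>2 * N s * M' s) / (M s * M s)) (at s)"
    unfolding R_def using M
    by (auto intro!: derivative_eq_intros N_deriv v_deriv M_deriv simp: algebra_simps)
  from DERIV_diff[OF Q_deriv this] r have "((\<lambda>s. Q s - R s) has_real_derivative ((s - 1) * v s / s -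
      ((3 * (2 * (s - 1)) * (v s)\<^sup>2 * N s + 3 * (s - 1)\<^sup>2 * (2 * v s * (- c)) * N s + 3 * (s - 1)\<^sup>2 * (v s)\<^sup>2 * N' s) * M s
       - 3 * (s - 1)\<^sup>2 * (v s)\<^sup>2 * N s * M' s) / (M s * M s))) (at s)" by simp
  moreover have "(s - 1) * v s / s -
      ((3 * (2 * (s - 1)) * (v s)\<^sup>2 * N s + 3 * (s - 1)\<^sup>2 * (2 * v s * (- c)) * N s + 3 * (s - 1)\<^sup>2 * (v s)\<^sup>2 * N' s) * M s
       - 3 * (s - 1)\<^sup>2 * (v s)\<^sup>2 * N s * M' s) / (M s * M s) = (s - 1) * (v s * C8 s / (s * (M s)\<^sup>2))"
    using M r unfolding C8_def by (simp add: field_simps power2_eq_square)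
  ultimately show ?thesis by simp
qed

lemma R_1: "R 1 = 0" by (simp add: R_def)

lemma DERIV_shift_sign_right:
  fixes f :: "real \<Rightarrow> real"
  assumes "1 \<le> w" "w \<le> s" and "\<And>z. w \<le> z \<Longrightarrow> z \<le> s \<Longrightarrow> \<exists>d. (f has_real_derivative (z - 1) * d) (at z) \<and> 0 \<le> d"
  shows "f w \<le> f s"
proof (rule DERIV_nonneg_imp_nondecreasing[OF assms(2)])
  fix z assume z: "w \<le> z" "z \<le> s"
  from assms(3)[OF z] obtain d where "(f has_real_derivative (z - 1) * d) (at z)" "0 \<le> d" by blast
  then show "\<exists>d. (f has_real_derivative d) (at z) \<and> 0 \<le> d" using z assms(1) by (intro exI[of _ "(z - 1) * d"]) auto
qed

lemma DERIV_shift_sign_left: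
  fixes f :: "real \<Rightarrow> real"
  assumes "w \<le> 1" "s \<le> w" and "\<And>z. s \<le> z \<Longrightarrow> z \<le> w \<Longrightarrow> \<exists>d. (f has_real_derivative (z - 1) * d) (at z) \<and> 0 \<le> d"
  shows "f w \<le> f s"
proof (rule DERIV_nonpos_imp_nonincreasing[OF assms(2)])
  fix z assume z: "s \<le> z" "z \<le> w"
  from assms(3)[OF z] obtain d where "(f has_real_derivative (z - 1) * d) (at z)" "0 \<le> d" by blast
  then show "\<exists>d. (f has_real_derivative d) (at z) \<and> d \<le> 0" using z assms(1)
    by (intro exI[of _ "(z - 1) * d"]) (auto intro: mult_nonpos_nonneg)
qed


lemma Q_ge_R: assumes "s1 \<le> s" "s \<le> s2" shows "R s \<le> Q s"
proof -
  have d: "\<exists>d. ((\<lambda>s. Q s - R s) has_real_derivative (z - 1) * d) (at z) \<and> 0 \<le> d" if "s1 \<le> z" "z \<le> s2" for z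
    using R_deriv[OF that] C8_nonneg[OF that] v_pos[OF that] s_range[OF that] by (intro exI conjI) (assumption, simp)
  have "Q 1 - R 1 \<le> Q s - R s"
  proof (cases "1 \<le> s")
    case True
    show ?thesis by (rule DERIV_shift_sign_right[of 1 s "\<lambda>s. Q s - R s"]) (use True assms s12 d in auto)
  next
    case False
    show ?thesis by (rule DERIV_shift_sign_left[of 1 s "\<lambda>s. Q s - R s"]) (use False assms s12 d in auto)
  qed
  then show ?thesis by (simp add: R_1)
qed

lemma Q_pos: assumes "s1 \<le> s" "s \<le> s2" "s \<noteq> 1" shows "0 < Q s"
proof -
  have "0 < R s" unfolding R_def using N_pos[OF assms(1,2)] M_pos[OF assms(1,2)] v_pos[OF assms(1,2)] assms(3) by simp
  then show ?thesis using Q_ge_R[OF assms(1,2)] by simp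
qed

lemma quotient_limits:
  "((\<lambda>s. Q s / (s - 1)\<^sup>2) \<longlongrightarrow> (1 - c) / 2) (at 1)"
  "((\<lambda>s. (Q s / (s - 1)\<^sup>2 - (1 - c) / 2) / (s - 1)) \<longlongrightarrow> - 1/3) (at 1)"
proof -
  have "((\<lambda>s::real. (s - 1 - ln s) / (s - 1)\<^sup>2) \<longlongrightarrow> 1/2) (at 1)" by real_asymp
  then have "((\<lambda>s. (s - 1 - ln s) / (s - 1)\<^sup>2 - c / 2) \<longlongrightarrow> 1/2 - c/2) (at 1)" by (rule tendsto_diff[OF _ tendsto_const])
  then show "((\<lambda>s. Q s / (s - 1)\<^sup>2) \<longlongrightarrow> (1 - c) / 2) (at 1)"
    unfolding diff_divide_distrib
    by (rule Lim_transform_eventually) (auto simp: eventually_at_filter Q_def field_simps)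
  have "((\<lambda>s::real. ((s - 1 - ln s) / (s - 1)\<^sup>2 - 1/2) / (s - 1)) \<longlongrightarrow> - 1/3) (at 1)" by real_asymp
  then show "((\<lambda>s. (Q s / (s - 1)\<^sup>2 - (1 - c) / 2) / (s - 1)) \<longlongrightarrow> - 1/3) (at 1)"
    by (rule Lim_transform_eventually) (auto simp: eventually_at_filter Q_def field_simps)
qed

definition "Lr s = - (ln s + 2 * ln (N s) + 3 * ln (Q s) - 3 * ln ((s - 1)\<^sup>2) - 6 * ln (v s))" for s :: real

lemma Lr_deriv: assumes "s1 \<le> s" "s \<le> s2" "s \<noteq> 1"
  shows "\<exists>d. (Lr has_real_derivative (s - 1) * d) (at s) \<and> 0 \<le> d"
proof -
  note r = s_range[OF assms(1,2)] and v = v_pos[OF assms(1,2)] and N = N_pos[OF assms(1,2)] and M = M_pos[OF assms(1,2)]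
    and Q = Q_pos[OF assms] and QR = Q_ge_R[OF assms(1,2)]
  have x: "s - 1 \<noteq> 0" using assms by simp
  have 1: "(Lr has_real_derivative - (1 / s + 2 * (N' s / N s) + 3 * ((s - 1) * v s / s / Q s) - 3 * (2 * (s - 1) / (s - 1)\<^sup>2) - 6 * (- c / v s))) (at s)"
    unfolding Lr_def using r v N Q x
    by (auto intro!: derivative_eq_intros N_deriv v_deriv Q_deriv simp: mult_ac)
  have "1 / s + 2 * (N' s / N s) - 3 * (2 * (s - 1) / (s - 1)\<^sup>2) - 6 * (- c / v s) = - M s / (s * (s - 1) * v s * N s)"
  proof -
    define y where "y = s - 1"
    show ?thesis using r v N x unfolding M_def y_def[symmetric] by (simp add: field_simps power2_eq_square)
  qed
  then have "- (1 / s + 2 * (N' s / N s) + 3 * ((s - 1) * v s / s / Q s) - 3 * (2 * (s - 1) / (s - 1)\<^sup>2) - 6 * (- c / v s))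
     = M s / (s * (s - 1) * v s * N s) - 3 * ((s - 1) * v s / s / Q s)" by linarith
  also have "\<dots> = (s - 1) * (M s * (Q s - R s) / (s * (s - 1)\<^sup>2 * v s * N s * Q s))"
  proof -
    define y where "y = s - 1"
    show ?thesis using r v N Q M x unfolding R_def y_def[symmetric] by (simp add: field_simps power2_eq_square)
  qed
  finally have "(Lr has_real_derivative (s - 1) * (M s * (Q s - R s) / (s * (s - 1)\<^sup>2 * v s * N s * Q s))) (at s)"
    using 1 by simp
  moreover have "0 \<le> M s * (Q s - R s) / (s * (s - 1)\<^sup>2 * v s * N s * Q s)" using r v N Q M QR by simp
  ultimately show ?thesis by blast
qed

lemma Lr_limit: "(Lr \<longlongrightarrow> ln (2 * (1 - c))) (at 1)"
proof -
  have N1: "(N \<longlongrightarrow> 2 * (1 - c)) (at 1)"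
    using DERIV_isCont[OF N_deriv, of 1] by (simp add: isCont_def N_def algebra_simps)
  have v1: "(v \<longlongrightarrow> 1 - c) (at 1)"
    using DERIV_isCont[OF v_deriv, of 1] by (simp add: isCont_def v_def)
  have L1: "((\<lambda>s. - (ln s + 2 * ln (N s) + 3 * ln (Q s / (s - 1)\<^sup>2) - 6 * ln (v s)))
      \<longlongrightarrow> - (ln 1 + 2 * ln (2 * (1 - c)) + 3 * ln ((1 - c) / 2) - 6 * ln (1 - c))) (at 1)"
    using c by (intro tendsto_intros quotient_limits N1 v1) auto
  have L2: "- (ln 1 + 2 * ln (2 * (1 - c)) + 3 * ln ((1 - c) / 2) - 6 * ln (1 - c)) = ln (2 * (1 - c))"
  proof -
    have "ln (2 * (1 - c)) = ln 2 + ln (1 - c)" using c by (subst ln_mult) auto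
    moreover have "ln ((1 - c) / 2) = ln (1 - c) - ln 2" using c by (subst ln_div) auto
    moreover have "- (0 + 2 * (p + r) + 3 * (r - p) - 6 * r) = p + r" for p r :: real by (simp add: algebra_simps)
    ultimately show ?thesis by (simp only: ln_one)
  qed
  have L3: "\<forall>\<^sub>F s in at 1. - (ln s + 2 * ln (N s) + 3 * ln (Q s / (s - 1)\<^sup>2) - 6 * ln (v s)) = Lr s"
  proof -
    have "\<forall>\<^sub>F s in at 1. 0 < Q s / (s - 1)\<^sup>2"
      using order_tendstoD(1)[OF quotient_limits(1), of 0] c by simp
    moreover have "\<forall>\<^sub>F s in at (1::real). s \<noteq> 1" by (simp add: eventually_at_filter)
    ultimately show ?thesis
    proof eventually_elim
      case (elim s)
      then have "0 < Q s" by (simp add: zero_less_divide_iff)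
      then show ?case using elim by (simp add: Lr_def ln_div)
    qed
  qed
  show ?thesis by (rule Lim_transform_eventually[OF L1[unfolded L2] L3])
qed

lemma rho_le: assumes "s1 \<le> s" "s \<le> s2" "s \<noteq> 1"
  shows "2 * (1 - c) * s * (N s)\<^sup>2 * (Q s) ^ 3 \<le> (s - 1) ^ 6 * (v s) ^ 6"
proof -
  note r = s_range[OF assms(1,2)] and v = v_pos[OF assms(1,2)] and N = N_pos[OF assms(1,2)]
    and Q = Q_pos[OF assms]
  have L: "ln (2 * (1 - c)) \<le> Lr s"
  proof (cases "1 < s")
    case True
    have "\<forall>\<^sub>F w in at_right 1. Lr w \<le> Lr s"
    proof (rule eventually_at_rightI[OF _ True])
      fix w assume w: "w \<in> {1<..<s}"
      show "Lr w \<le> Lr s" by (rule DERIV_shift_sign_right) (use w assms s12 in \<open>auto intro!: Lr_deriv\<close>)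
    qed
    moreover have "(Lr \<longlongrightarrow> ln (2 * (1 - c))) (at_right 1)" using Lr_limit by (simp add: filterlim_at_split)
    ultimately show ?thesis by (intro tendsto_upperbound[of Lr _ "at_right 1"]) auto
  next
    case False
    then have s: "s < 1" using assms by simp
    have "\<forall>\<^sub>F w in at_left 1. Lr w \<le> Lr s"
    proof (rule eventually_at_leftI[OF _ s])
      fix w assume w: "w \<in> {s<..<1}"
      show "Lr w \<le> Lr s" by (rule DERIV_shift_sign_left) (use w assms s12 in \<open>auto intro!: Lr_deriv\<close>)
    qed
    moreover have "(Lr \<longlongrightarrow> ln (2 * (1 - c))) (at_left 1)" using Lr_limit by (simp add: filterlim_at_split)
    ultimately show ?thesis by (intro tendsto_upperbound[of Lr _ "at_left 1"]) auto
  qed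
  define a where "a = \<bar>s - 1\<bar>"
  have a: "a > 0" "(s - 1)\<^sup>2 = a\<^sup>2" "(s - 1) ^ 6 = a ^ 6" using assms by (auto simp: a_def)
  have "ln (2 * (1 - c) * s * (N s)\<^sup>2 * (Q s) ^ 3) \<le> ln (a ^ 6 * (v s) ^ 6)"
    using L c r v N Q a unfolding Lr_def by (simp add: ln_mult ln_realpow)
  then show ?thesis using c r v N Q a by (subst (asm) ln_le_cancel_iff) auto
qed

definition "H s = 2 * A s - sgn (s - 1) * G0 / sqrt (Q s)" for s :: real

lemma A_deriv: assumes "s1 \<le> s" "s \<le> s2" "s \<noteq> 1"
  shows "(A has_real_derivative - N s / (2 * sqrt s * (s - 1)\<^sup>2 * (v s)\<^sup>2)) (at s)"
proof -
  note r = s_range[OF assms(1,2)] and v = v_pos[OF assms(1,2)]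
  have x: "s - 1 \<noteq> 0" using assms by simp
  have "(A has_real_derivative ((inverse (sqrt s) / 2) * ((s - 1) * v s) - sqrt s * (1 * v s + (- c) * (s - 1))) / (((s - 1) * v s) * ((s - 1) * v s))) (at s)"
    unfolding A_def using r v x by (auto intro!: derivative_eq_intros v_deriv)
  moreover have "((inverse (sqrt s) / 2) * ((s - 1) * v s) - sqrt s * (1 * v s + (- c) * (s - 1))) / (((s - 1) * v s) * ((s - 1) * v s))
     = - N s / (2 * sqrt s * (s - 1)\<^sup>2 * (v s)\<^sup>2)"
  proof -
    define k where "k = sqrt s"
    have k: "k > 0" "s = k * k" using r by (auto simp: k_def)
    have "(inverse k / 2) * ((s - 1) * v s) - k * (1 * v s + (- c) * (s - 1)) = - N s / (2 * k)"
      using k(1) unfolding N_def v_def k(2) by (simp add: field_simps power2_eq_square)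
    then show ?thesis using v x k unfolding k_def by (simp add: power2_eq_square)
  qed
  ultimately show ?thesis by simp
qed

lemma H_mono_side:
  assumes "s1 \<le> a" "a \<le> b" "b \<le> s2" and side: "1 < a \<or> b < 1"
  shows "H a \<le> H b"
proof -
  define \<sigma> :: real where "\<sigma> = (if 1 < a then 1 else - 1)"
  have sg: "sgn (z - 1) = \<sigma>" "\<bar>z - 1\<bar> = \<sigma> * (z - 1)" "z \<noteq> 1" if "a \<le> z" "z \<le> b" for z
    using that side by (auto simp: \<sigma>_def)
  define f where "f = (\<lambda>s. 2 * A s - \<sigma> * G0 / sqrt (Q s))"
  have "f a \<le> f b"
  proof (rule DERIV_nonneg_imp_nondecreasing[OF assms(2)])
    fix z assume z: "a \<le> z" "z \<le> b"
    then have z': "s1 \<le> z" "z \<le> s2" "z \<noteq> 1" using assms sg(3)[OF z] by auto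
    note r = s_range[OF z'(1,2)] and v = v_pos[OF z'(1,2)] and N = N_pos[OF z'(1,2)] and Q = Q_pos[OF z']
    have x: "\<bar>z - 1\<bar> > 0" using z' by simp
    have d: "(f has_real_derivative 2 * (- N z / (2 * sqrt z * (z - 1)\<^sup>2 * (v z)\<^sup>2))
        + \<sigma> * G0 * ((z - 1) * v z / z) / (2 * Q z * sqrt (Q z))) (at z)"
      unfolding f_def using Q r
      by (auto intro!: derivative_eq_intros A_deriv[OF z'] Q_deriv simp: field_simps)
    define b1 where "b1 = N z / (sqrt z * (z - 1)\<^sup>2 * (v z)\<^sup>2)"
    define a1 where "a1 = G0 * (\<bar>z - 1\<bar> * v z / z) / (2 * Q z * sqrt (Q z))"
    have G0: "G0 > 0" "G0\<^sup>2 = 2 / (1 - c)" using c by (auto simp: G0_def)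
    have b2: "b1\<^sup>2 = (N z)\<^sup>2 / (z * (z - 1) ^ 4 * (v z) ^ 4)"
      using r by (simp add: b1_def power_divide power_mult_distrib)
    have a2: "a1\<^sup>2 = (z - 1)\<^sup>2 * (v z)\<^sup>2 / (2 * (1 - c) * z\<^sup>2 * (Q z) ^ 3)"
      using Q G0(2) by (simp add: a1_def power_divide power_mult_distrib) (simp add: field_simps power2_eq_square power3_eq_cube)
    have "b1\<^sup>2 \<le> a1\<^sup>2"
    proof -
      have p: "0 < (z - 1) ^ 4" "0 < (v z) ^ 4" "0 < (Q z) ^ 3" "0 < z" "0 < 1 - c" using x v Q r c by auto
      have e: "(z - 1) ^ 6 = (z - 1)\<^sup>2 * (z - 1) ^ 4" "(v z) ^ 6 = (v z)\<^sup>2 * (v z) ^ 4" by (simp_all flip: power_add)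
      have "(N z)\<^sup>2 * (2 * (1 - c) * z\<^sup>2 * (Q z) ^ 3) = z * (2 * (1 - c) * z * (N z)\<^sup>2 * (Q z) ^ 3)"
        by (simp add: power2_eq_square)
      also have "\<dots> \<le> z * ((z - 1) ^ 6 * (v z) ^ 6)" using rho_le[OF z'] p by (intro mult_left_mono) auto
      also have "\<dots> = ((z - 1)\<^sup>2 * (v z)\<^sup>2) * (z * (z - 1) ^ 4 * (v z) ^ 4)" unfolding e by (simp add: mult_ac)
      finally show ?thesis unfolding a2 b2 using p by (subst frac_le_eq) (auto simp: divide_nonpos_pos field_simps)
    qed
    then have "b1 \<le> a1" by (rule power2_le_imp_le) (use G0 Q v r in \<open>auto simp: a1_def\<close>)
    then have "0 \<le> 2 * (- N z / (2 * sqrt z * (z - 1)\<^sup>2 * (v z)\<^sup>2))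
        + \<sigma> * G0 * ((z - 1) * v z / z) / (2 * Q z * sqrt (Q z))"
      using sg(2)[OF z] by (simp add: a1_def b1_def mult_ac)
    with d show "\<exists>y. (f has_real_derivative y) (at z) \<and> 0 \<le> y" by blast
  qed
  moreover have "f a = H a" "f b = H b" using sg(1)[of a] sg(1)[of b] assms(2) by (auto simp: f_def H_def)
  ultimately show ?thesis by simp
qed

text \<open>\<open>2 * A\<close> is the density of the integral in the variable \<open>Q\<close>, and \<open>G0 / sqrt Q\<close> is the
density of a pure Fresnel integral with the same singularity at the saddle. Their difference is nonnegative and monotone
across the saddle, hence the second mean value theorem controls it without further information on its size inside.\<close>
lemma H_nonneg: assumes "s1 \<le> s" "s \<le> s2" "s \<noteq> 1" shows "0 \<le> H s"
proof -
  note r = s_range[OF assms(1,2)] and v = v_pos[OF assms(1,2)] and Q = Q_pos[OF assms]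
  define R2 where "R2 = (\<lambda>s. (s - 1)\<^sup>2 * (v s)\<^sup>2 / (2 * (1 - c) * s))"
  have d: "\<exists>d. ((\<lambda>s. Q s - R2 s) has_real_derivative d) (at z) \<and> 0 \<le> d" if z: "s1 \<le> z" "z \<le> s2" for z
  proof -
    note rz = s_range[OF z] and vz = v_pos[OF z]
    have e: "1 - c = v z + c * (z - 1)" by (simp add: v_def algebra_simps)
    have cc: "1 - c \<noteq> 0" using c by simp
    have "((\<lambda>s. Q s - R2 s) has_real_derivative ((z - 1) * v z / z -
       ((2 * (z - 1) * (v z)\<^sup>2 + (z - 1)\<^sup>2 * (2 * v z * (- c))) * (2 * (1 - c) * z) - (z - 1)\<^sup>2 * (v z)\<^sup>2 * (2 * (1 - c)))
         / ((2 * (1 - c) * z) * (2 * (1 - c) * z)))) (at z)"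
      unfolding R2_def using rz cc
      by (auto intro!: derivative_eq_intros Q_deriv v_deriv simp: algebra_simps)
    moreover have "(z - 1) * v z / z -
       ((2 * (z - 1) * (v z)\<^sup>2 + (z - 1)\<^sup>2 * (2 * v z * (- c))) * (2 * (1 - c) * z) - (z - 1)\<^sup>2 * (v z)\<^sup>2 * (2 * (1 - c)))
         / ((2 * (1 - c) * z) * (2 * (1 - c) * z))
       = ((z - 1)\<^sup>2 * v z * (4 * c * z + v z)) / (2 * (1 - c) * z\<^sup>2)"
    proof -
      have num: "(z - 1) * v z * (2 * (1 - c)) * z - ((2 * (z - 1) * (v z)\<^sup>2 + (z - 1)\<^sup>2 * (2 * v z * (- c))) * z - (z - 1)\<^sup>2 * (v z)\<^sup>2)
        = (z - 1)\<^sup>2 * v z * (4 * c * z + v z)"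
        unfolding e by (simp add: power2_eq_square algebra_simps)
      have z0: "z \<noteq> 0" using rz by auto
      have "X / z - (Y * (D * z) - W * D) / ((D * z) * (D * z)) = (X * D * z - (Y * z - W)) / (D * z\<^sup>2)"
        if "D \<noteq> 0" for X Y W D
        using that z0 by (simp add: field_simps power2_eq_square)
      note gen = this
      show ?thesis by (subst gen) (use cc in simp, simp only: num)
    qed
    moreover have "0 \<le> ((z - 1)\<^sup>2 * v z * (4 * c * z + v z)) / (2 * (1 - c) * z\<^sup>2)" using vz rz c c_ge by simp
    ultimately show ?thesis by metis
  qed
  have R21: "R2 1 = 0" by (simp add: R2_def)
  have G0: "G0 > 0" "G0\<^sup>2 = 2 / (1 - c)" using c by (auto simp: G0_def)
  have A2: "(2 * A s)\<^sup>2 * R2 s = G0\<^sup>2"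
    using v r assms c unfolding G0(2) R2_def A_def by (simp add: power_divide power_mult_distrib) (simp add: field_simps)
  have g2: "(G0 / sqrt (Q s))\<^sup>2 = G0\<^sup>2 / Q s" using Q by (simp add: power_divide)
  have R2pos: "R2 s > 0" using v r assms c by (simp add: R2_def)
  have A2': "(2 * A s)\<^sup>2 = G0\<^sup>2 / R2 s" using A2 R2pos by (simp add: field_simps)
  show ?thesis
  proof (cases "1 < s")
    case True
    have "Q 1 - R2 1 \<le> Q s - R2 s"
      by (rule DERIV_nonneg_imp_nondecreasing) (use True assms s12 d in auto)
    then have "R2 s \<le> Q s" using R21 by simp
    then have "(G0 / sqrt (Q s))\<^sup>2 \<le> (2 * A s)\<^sup>2" unfolding g2 A2' using R2pos by (intro divide_left_mono) auto
    then have "G0 / sqrt (Q s) \<le> 2 * A s"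
      by (rule power2_le_imp_le) (use True v r in \<open>auto simp: A_def\<close>)
    then show ?thesis using True by (simp add: H_def)
  next
    case False
    then have s: "s < 1" using assms by simp
    have "Q s - R2 s \<le> Q 1 - R2 1"
      by (rule DERIV_nonneg_imp_nondecreasing) (use s assms s12 d in auto)
    then have "Q s \<le> R2 s" using R21 by simp
    then have "(- 2 * A s)\<^sup>2 \<le> (G0 / sqrt (Q s))\<^sup>2" using g2 A2' Q by (simp add: divide_left_mono)
    then have "- 2 * A s \<le> G0 / sqrt (Q s)"
      by (rule power2_le_imp_le) (use G0 Q in auto)
    then show ?thesis using s by (simp add: H_def)
  qed
qed

lemma H_limit: "\<exists>h0. (H \<longlongrightarrow> h0) (at 1)"
proof -
  define q where "q = (\<lambda>s. Q s / (s - 1)\<^sup>2)"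
  define q0 where "q0 = (1 - c) / 2"
  have q0: "q0 > 0" using c by (simp add: q0_def)
  have G0q: "G0 / sqrt q0 = 2 / (1 - c)"
  proof -
    have "(G0 / sqrt q0)\<^sup>2 = (2 / (1 - c))\<^sup>2"
      using c by (simp add: G0_def q0_def power_divide) (simp add: power2_eq_square)
    moreover have "0 \<le> G0 / sqrt q0" "0 \<le> 2 / (1 - c)" using c q0 by (auto simp: G0_def)
    ultimately show ?thesis by (rule power2_eq_imp_eq)
  qed
  have ql: "(q \<longlongrightarrow> q0) (at 1)" "((\<lambda>s. (q s - q0) / (s - 1)) \<longlongrightarrow> - 1/3) (at 1)"
    using quotient_limits by (simp_all add: q_def q0_def)
  have "((\<lambda>s. 2 * sqrt s / v s) has_real_derivative (2 * (inverse (sqrt 1) / 2) * v 1 - 2 * sqrt 1 * (- c)) / (v 1 * v 1)) (at 1)"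
    using c by (auto intro!: derivative_eq_intros v_deriv simp: v_def)
  then obtain d1 where d1: "((\<lambda>s. 2 * sqrt s / v s) has_real_derivative d1) (at 1)" by blast
  then have l1: "((\<lambda>s. (2 * sqrt s / v s - 2 / (1 - c)) / (s - 1)) \<longlongrightarrow> d1) (at 1)"
    by (simp add: has_field_derivative_iff v_def)
  have l2: "((\<lambda>s. G0 * ((q s - q0) / (s - 1)) / (sqrt (q s) * sqrt q0 * (sqrt q0 + sqrt (q s))))
      \<longlongrightarrow> G0 * (- 1/3) / (sqrt q0 * sqrt q0 * (sqrt q0 + sqrt q0))) (at 1)"
    using q0 by (intro tendsto_intros ql) auto
  have "((\<lambda>s. (2 * sqrt s / v s - 2 / (1 - c)) / (s - 1) + G0 * ((q s - q0) / (s - 1)) / (sqrt (q s) * sqrt q0 * (sqrt q0 + sqrt (q s))))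
      \<longlongrightarrow> d1 + G0 * (- 1/3) / (sqrt q0 * sqrt q0 * (sqrt q0 + sqrt q0))) (at 1)"
    by (rule tendsto_add[OF l1 l2])
  moreover have "\<forall>\<^sub>F s in at 1. (2 * sqrt s / v s - 2 / (1 - c)) / (s - 1) + G0 * ((q s - q0) / (s - 1)) / (sqrt (q s) * sqrt q0 * (sqrt q0 + sqrt (q s))) = H s"
  proof -
    have "\<forall>\<^sub>F s in at 1. 0 < q s" using order_tendstoD(1)[OF ql(1), of 0] q0 by simp
    moreover have "\<forall>\<^sub>F s in at (1::real). s \<noteq> 1" by (simp add: eventually_at_filter)
    ultimately show ?thesis
    proof eventually_elim
      case (elim s)
      define k k0 where "k = sqrt (q s)" and "k0 = sqrt q0"
      have k: "k > 0" "k0 > 0" "q s = k\<^sup>2" "q0 = k0\<^sup>2" using elim q0 by (auto simp: k_def k0_def)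
      have "sqrt (Q s) = \<bar>s - 1\<bar> * k"
        using elim by (simp add: k_def q_def real_sqrt_divide)
      then have "sgn (s - 1) * G0 / sqrt (Q s) = G0 / k / (s - 1)"
        using elim k(1) by (auto simp: sgn_if abs_if divide_simps)
      moreover have "G0 / k = 2 / (1 - c) - G0 * (q s - q0) / (k * k0 * (k0 + k))"
      proof -
        have "G0 / k = G0 / k0 - G0 * (k\<^sup>2 - k0\<^sup>2) / (k * k0 * (k0 + k))"
        proof -
          have "k\<^sup>2 - k0\<^sup>2 = (k - k0) * (k0 + k)" by (simp add: power2_eq_square algebra_simps)
          then have "G0 * (k\<^sup>2 - k0\<^sup>2) / (k * k0 * (k0 + k)) = G0 * (k - k0) / (k * k0)" using k(1,2) by simp
          also have "\<dots> = G0 / k0 - G0 / k" using k(1,2) by (simp add: field_simps)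
          finally show ?thesis by simp
        qed
        moreover have "G0 / k0 = 2 / (1 - c)" using G0q by (simp only: k0_def)
        ultimately show ?thesis by (simp only: k(3,4))
      qed
      ultimately have "H s = (2 * sqrt s / v s - (2 / (1 - c) - G0 * (q s - q0) / (k * k0 * (k0 + k)))) / (s - 1)"
        unfolding H_def A_def by (simp add: diff_divide_distrib mult.commute)
      moreover have "(A1 - e) / x + g * (p / x) / D = (A1 - (e - g * p / D)) / x" for A1 e x g p D :: real
        by (simp add: diff_divide_distrib add_divide_distrib)
      ultimately show ?case unfolding k_def[symmetric] k0_def[symmetric] by (simp add: mult.commute)
    qed
  qed
  ultimately show ?thesis by (blast intro: Lim_transform_eventually)
qed

definition "h0 = Lim (at 1) H"

lemma H_tendsto: "(H \<longlongrightarrow> h0) (at 1)"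
  using H_limit tendsto_Lim[of "at (1::real)" H] by (auto simp: h0_def)

definition "Hc s = (if s = 1 then h0 else H s)" for s :: real

lemma h0_bounds:
  shows "s1 \<le> s \<Longrightarrow> s < 1 \<Longrightarrow> H s \<le> h0" and "1 < s \<Longrightarrow> s \<le> s2 \<Longrightarrow> h0 \<le> H s"
proof -
  show "H s \<le> h0" if s: "s1 \<le> s" "s < 1"
  proof (rule tendsto_lowerbound)
    show "(H \<longlongrightarrow> h0) (at_left 1)" using H_tendsto by (simp add: filterlim_at_split)
    show "\<forall>\<^sub>F w in at_left 1. H s \<le> H w"
      by (rule eventually_at_leftI[OF _ s(2)]) (use s s12 in \<open>auto intro!: H_mono_side\<close>)
  qed simp
  show "h0 \<le> H s" if s: "1 < s" "s \<le> s2"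
  proof (rule tendsto_upperbound)
    show "(H \<longlongrightarrow> h0) (at_right 1)" using H_tendsto by (simp add: filterlim_at_split)
    show "\<forall>\<^sub>F w in at_right 1. H w \<le> H s"
      by (rule eventually_at_rightI[OF _ s(1)]) (use s s12 in \<open>auto intro!: H_mono_side\<close>)
  qed simp
qed

lemma Hc_mono: assumes "s1 \<le> a" "a \<le> b" "b \<le> s2" shows "Hc a \<le> Hc b"
proof -
  consider "b < 1" | "1 < a" | "a = 1" "b = 1" | "a < 1" "b = 1" | "a = 1" "1 < b" | "a < 1" "1 < b"
    using assms by linarith
  then show ?thesis
    by cases (use assms H_mono_side[OF assms] h0_bounds[of a] h0_bounds[of b] in \<open>auto simp: Hc_def\<close>)
qed

lemma Hc_nonneg: assumes "s1 \<le> s" "s \<le> s2" shows "0 \<le> Hc s"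
proof (cases "s = 1")
  case True
  have "\<forall>\<^sub>F w in at_right 1. 0 \<le> H w"
    by (rule eventually_at_rightI[OF _ s12(3)]) (use s12 in \<open>auto intro!: H_nonneg\<close>)
  moreover have "(H \<longlongrightarrow> h0) (at_right 1)" using H_tendsto by (simp add: filterlim_at_split)
  ultimately have "0 \<le> h0" by (intro tendsto_lowerbound[of H]) auto
  then show ?thesis using True by (simp add: Hc_def)
qed (use H_nonneg assms in \<open>auto simp: Hc_def\<close>)

definition "U s = sgn (s - 1) * sqrt (Q s)" for s :: real

lemma Q_nonneg: assumes "s1 \<le> s" "s \<le> s2" shows "0 \<le> Q s"
  using Q_pos[OF assms] by (cases "s = 1") auto

lemma U_sq: assumes "s1 \<le> s" "s \<le> s2" shows "(U s)\<^sup>2 = Q s"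
  using Q_nonneg[OF assms] by (cases "s = 1") (auto simp: U_def power_mult_distrib sgn_if)

lemma U_continuous: "continuous_on {s1..s2} U"
proof -
  have Qc: "continuous_on {s1..s2} Q"
    unfolding Q_def using s12 by (intro continuous_intros) auto
  have "U = (\<lambda>s. if s \<le> 1 then - sqrt (Q s) else sqrt (Q s))"
    by (auto simp: U_def fun_eq_iff sgn_if)
  moreover have "continuous_on {s1..s2} (\<lambda>s. if s \<le> 1 then - sqrt (Q s) else sqrt (Q s))"
  proof (rule continuous_on_subset)
    show "{s1..s2} \<subseteq> {s1..1} \<union> {1..s2}" by auto
    show "continuous_on ({s1..1} \<union> {1..s2}) (\<lambda>s. if s \<le> 1 then - sqrt (Q s) else sqrt (Q s))"
      by (rule continuous_on_If) (use s12 in \<open>auto intro!: continuous_intros continuous_on_subset[OF Qc]\<close>)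
  qed
  ultimately show ?thesis by simp
qed

lemma U_deriv: assumes "s1 \<le> s" "s \<le> s2" "s \<noteq> 1"
  shows "(U has_real_derivative ((s - 1) * v s / s) / (2 * U s)) (at s)"
proof -
  note Q = Q_pos[OF assms] and r = s_range[OF assms(1,2)]
  define \<sigma> :: real where "\<sigma> = sgn (s - 1)"
  have sg: "\<sigma> * \<sigma> = 1" "\<sigma> \<noteq> 0" using assms by (auto simp: \<sigma>_def sgn_if)
  have "((\<lambda>s. \<sigma> * sqrt (Q s)) has_real_derivative \<sigma> * (((s - 1) * v s / s) * (inverse (sqrt (Q s)) / 2))) (at s)"
    using Q r by (auto intro!: derivative_eq_intros Q_deriv simp: mult_ac)
  moreover have "\<sigma> * (((s - 1) * v s / s) * (inverse (sqrt (Q s)) / 2)) = ((s - 1) * v s / s) / (2 * U s)"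
  proof -
    have "w / (2 * (\<sigma> * z)) = \<sigma> * (w * (inverse z / 2))" for w z
    proof -
      have "\<sigma> = 1 \<or> \<sigma> = - 1" using assms by (auto simp: \<sigma>_def sgn_if)
      then show ?thesis by (elim disjE) (simp_all add: inverse_eq_divide)
    qed
    then show ?thesis unfolding U_def \<sigma>_def[symmetric] by (rule sym)
  qed
  moreover have "\<forall>\<^sub>F w in nhds s. \<sigma> * sqrt (Q w) = U w"
  proof (cases "1 < s")
    case True
    then have "\<forall>\<^sub>F w in nhds s. w \<in> {1<..}" by (intro eventually_nhds_in_open) auto
    then show ?thesis by eventually_elim (use True in \<open>auto simp: U_def \<sigma>_def\<close>)
  next
    case False
    then have "\<forall>\<^sub>F w in nhds s. w \<in> {..<1}" using assms by (intro eventually_nhds_in_open) auto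
    then show ?thesis by eventually_elim (use False assms in \<open>auto simp: U_def \<sigma>_def\<close>)
  qed
  ultimately show ?thesis by (subst DERIV_cong_ev[OF refl _ refl, symmetric]) auto
qed

lemma saddle_integral:
  assumes ab: "s1 \<le> a" "a < s2" and t: "0 < t"
  shows "((\<lambda>s. cos (C + t * Q s) / sqrt s) integrable_on {a..s2})"
    and "\<bar>integral {a..s2} (\<lambda>s. cos (C + t * Q s) / sqrt s)
       - G0 / sqrt t * (fresnel_cos C (sqrt t * U s2) - fresnel_cos C (sqrt t * U a))\<bar>
     \<le> H s2 * (1 + \<bar>sin (C + t * Q s2)\<bar>) / (2 * t)"
proof -
  define Q' where "Q' = (\<lambda>s. (s - 1) * v s / s)"
  have 1: "((\<lambda>s. cos (C + t * Q s) * (sqrt t * (Q' s / (2 * U s)))) has_integral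
      (fresnel_cos C (sqrt t * U s2) - fresnel_cos C (sqrt t * U a))) {a..s2}"
  proof (rule fundamental_theorem_of_calculus_interior_strong[of "{1}"])
    show "continuous_on {a..s2} (\<lambda>s. fresnel_cos C (sqrt t * U s))"
    proof (rule continuous_on_compose2[of UNIV "fresnel_cos C"])
      show "continuous_on UNIV (fresnel_cos C)" using fresnel_cos_deriv DERIV_isCont continuous_at_imp_continuous_on by blast
      show "continuous_on {a..s2} (\<lambda>s. sqrt t * U s)"
        by (intro continuous_intros continuous_on_subset[OF U_continuous]) (use ab in auto)
    qed auto
    fix s assume "s \<in> {a<..<s2} - {1}"
    then have s: "s1 \<le> s" "s \<le> s2" "s \<noteq> 1" using ab by auto
    have "((\<lambda>s. fresnel_cos C (sqrt t * U s)) has_real_derivative cos (C + (sqrt t * U s)\<^sup>2) * (sqrt t * (((s - 1) * v s / s) / (2 * U s)))) (at s)"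
      by (rule DERIV_chain2[OF fresnel_cos_deriv]) (intro derivative_intros DERIV_cmult U_deriv[OF s])
    moreover have "(sqrt t * U s)\<^sup>2 = t * Q s" using U_sq[OF s(1,2)] t by (simp add: power_mult_distrib)
    ultimately show "((\<lambda>s. fresnel_cos C (sqrt t * U s)) has_vector_derivative cos (C + t * Q s) * (sqrt t * (Q' s / (2 * U s)))) (at s)"
      by (simp add: has_real_derivative_iff_has_vector_derivative Q'_def)
  qed (use ab in auto)
  obtain \<xi> where xi: "((\<lambda>s. Hc s * (cos (C + t * Q s) * Q' s)) has_integral (Hc s2 * (sin (C + t * Q s2) / t - sin (C + t * Q \<xi>) / t))) {a..s2}"
  proof (rule bonnet_increasing[of a s2 "\<lambda>s. sin (C + t * Q s) / t" "\<lambda>s. cos (C + t * Q s) * Q' s" Hc])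
    show "((\<lambda>s. sin (C + t * Q s) / t) has_real_derivative cos (C + t * Q s) * Q' s) (at s within {a..s2})" if "s \<in> {a..s2}" for s
    proof -
      have "0 < s" using that ab s12 by auto
      then show ?thesis unfolding Q'_def using t by (auto intro!: derivative_eq_intros Q_deriv)
    qed
  qed (use ab Hc_mono Hc_nonneg in auto)
  have e: "cos (C + t * Q s) / sqrt s = G0 / sqrt t * (cos (C + t * Q s) * (sqrt t * (Q' s / (2 * U s)))) + 1/2 * (Hc s * (cos (C + t * Q s) * Q' s))"
    if s: "s \<in> {a..s2} - {1}" for s
  proof -
    have s': "s1 \<le> s" "s \<le> s2" "s \<noteq> 1" using s ab by auto
    note Q = Q_pos[OF s'] and r = s_range[OF s'(1,2)] and v = v_pos[OF s'(1,2)]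
    have x: "s - 1 \<noteq> 0" using s' by simp
    have H: "H s = 2 * A s - G0 / U s" using x by (simp add: H_def U_def sgn_if)
    have AQ: "A s * Q' s = 1 / sqrt s"
    proof -
      have "A s * Q' s = sqrt s / s" using x v r unfolding A_def Q'_def by simp
      also have "\<dots> = 1 / sqrt s" using r by (subst frac_eq_eq) auto
      finally show ?thesis .
    qed
    have "G0 / sqrt t * (sqrt t * (Q' s / (2 * U s))) + 1/2 * (Hc s * Q' s) = A s * Q' s"
      using t s' unfolding Hc_def H by (simp add: field_simps)
    then have "cos (C + t * Q s) * (A s * Q' s) = G0 / sqrt t * (cos (C + t * Q s) * (sqrt t * (Q' s / (2 * U s)))) + 1/2 * (Hc s * (cos (C + t * Q s) * Q' s))"
    proof -
      have gen: "K * Z = g * (K * p) + 1/2 * (h * (K * q'))" if "g * p + 1/2 * (h * q') = Z" for K Z g p h q' :: real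
        unfolding that[symmetric] by (simp add: algebra_simps)
      assume "G0 / sqrt t * (sqrt t * (Q' s / (2 * U s))) + 1/2 * (Hc s * Q' s) = A s * Q' s"
      then show ?thesis by (rule gen)
    qed
    then show ?thesis by (simp add: AQ)
  qed
  have sum: "((\<lambda>s. G0 / sqrt t * (cos (C + t * Q s) * (sqrt t * (Q' s / (2 * U s)))) + 1/2 * (Hc s * (cos (C + t * Q s) * Q' s)))
     has_integral (G0 / sqrt t * (fresnel_cos C (sqrt t * U s2) - fresnel_cos C (sqrt t * U a))
       + 1/2 * (Hc s2 * (sin (C + t * Q s2) / t - sin (C + t * Q \<xi>) / t)))) {a..s2}"
    by (intro has_integral_add has_integral_mult_right 1 xi)
  have fin: "((\<lambda>s. cos (C + t * Q s) / sqrt s)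
     has_integral (G0 / sqrt t * (fresnel_cos C (sqrt t * U s2) - fresnel_cos C (sqrt t * U a))
       + 1/2 * (Hc s2 * (sin (C + t * Q s2) / t - sin (C + t * Q \<xi>) / t)))) {a..s2}"
    by (rule has_integral_spike_finite[OF _ _ sum, of "{1}"]) (use e in auto)
  then show "(\<lambda>s. cos (C + t * Q s) / sqrt s) integrable_on {a..s2}" by blast
  have H2: "Hc s2 = H s2" "0 \<le> H s2" using s12 H_nonneg[of s2] by (auto simp: Hc_def)
  have "\<bar>sin (C + t * Q s2) - sin (C + t * Q \<xi>)\<bar> \<le> 1 + \<bar>sin (C + t * Q s2)\<bar>"
    using abs_sin_le_one[of "C + t * Q \<xi>"] by linarith
  then have "H s2 * \<bar>sin (C + t * Q s2) - sin (C + t * Q \<xi>)\<bar> / (2 * t) \<le> H s2 * (1 + \<bar>sin (C + t * Q s2)\<bar>) / (2 * t)"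
    using H2 t by (intro divide_right_mono mult_left_mono) auto
  moreover have "\<bar>1/2 * (Hc s2 * (sin (C + t * Q s2) / t - sin (C + t * Q \<xi>) / t))\<bar> = H s2 * \<bar>sin (C + t * Q s2) - sin (C + t * Q \<xi>)\<bar> / (2 * t)"
    using H2 t by (simp add: abs_mult diff_divide_distrib[symmetric])
  ultimately show "\<bar>integral {a..s2} (\<lambda>s. cos (C + t * Q s) / sqrt s)
       - G0 / sqrt t * (fresnel_cos C (sqrt t * U s2) - fresnel_cos C (sqrt t * U a))\<bar>
     \<le> H s2 * (1 + \<bar>sin (C + t * Q s2)\<bar>) / (2 * t)"
    using integral_unique[OF fin] by simp
qed

end

section \<open>The waves of the theta phase\<close>

locale hardy =
  fixes X :: real
  assumes X_pos: "0 < X"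
begin

definition "t = 2 * pi * X\<^sup>2"
definition "Xb = X / sqrt 2"
definition "phase \<alpha> x = t * ln X - t / 2 - pi / 8 - t * ln x - pi * x\<^sup>2 + pi * \<alpha> * x" for \<alpha> x :: real
definition "vel x = 2 * (X\<^sup>2 / x + x)" for x :: real
definition "wave \<alpha> = integral {Xb..X} (\<lambda>x. 2 / sqrt x * cos (phase \<alpha> x))" for \<alpha> :: real

lemma t_pos: "0 < t" using X_pos by (simp add: t_def)

lemma Xb: "0 < Xb" "Xb < X" "Xb\<^sup>2 = X\<^sup>2 / 2"
proof -
  have "1 < sqrt 2" by simp
  then show "0 < Xb" "Xb < X" "Xb\<^sup>2 = X\<^sup>2 / 2" using X_pos by (auto simp: Xb_def field_simps power_divide)
qed

lemma vel_X [simp]: "vel X = 4 * X"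
  using X_pos by (simp add: vel_def power2_eq_square)

lemma vel_Xb: "vel Xb = 3 * sqrt 2 * X"
proof -
  have "vel Xb = 2 * (X * sqrt 2 + X / sqrt 2)" using X_pos by (simp add: vel_def Xb_def power2_eq_square)
  also have "X / sqrt 2 = X * sqrt 2 / 2" by (simp add: field_simps real_div_sqrt)
  finally show ?thesis by (simp add: algebra_simps)
qed

lemma phase_deriv: "0 < x \<Longrightarrow> (phase \<alpha> has_real_derivative pi * (\<alpha> - vel x)) (at x within S)"
  unfolding phase_def vel_def t_def
  by (auto intro!: derivative_eq_intros simp: field_simps power2_eq_square)

lemma vel_deriv: "0 < x \<Longrightarrow> (vel has_real_derivative 2 * (1 - X\<^sup>2 / x\<^sup>2)) (at x within S)"
  unfolding vel_def by (auto intro!: derivative_eq_intros simp: field_simps power2_eq_square)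

lemma vel_antimono: assumes "0 < x" "x \<le> y" "y \<le> X" shows "vel y \<le> vel x"
proof (rule DERIV_nonpos_imp_nonincreasing[OF assms(2)])
  fix z assume z: "x \<le> z" "z \<le> y"
  then have "z\<^sup>2 \<le> X\<^sup>2" using assms by (intro power_mono) auto
  then have "1 - X\<^sup>2 / z\<^sup>2 \<le> 0" using z assms by (simp add: field_simps)
  then have "2 * (1 - X\<^sup>2 / z\<^sup>2) \<le> 0" by (intro mult_nonneg_nonpos) auto
  then show "\<exists>d. (vel has_real_derivative d) (at z) \<and> d \<le> 0"
    using z assms by (intro exI[of _ "2 * (1 - X\<^sup>2 / z\<^sup>2)"] conjI vel_deriv) linarith+
qed

lemma vel_range: assumes "Xb \<le> x" "x \<le> X" shows "4 * X \<le> vel x" "vel x \<le> 3 * sqrt 2 * X"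
  using vel_antimono[of x X] vel_antimono[of Xb x] assms Xb by (auto simp: vel_Xb)

lemma phase_continuous: "0 < u \<Longrightarrow> continuous_on {u..w} (phase \<alpha>)"
  unfolding phase_def by (intro continuous_intros) auto

lemma cos_phase_integrable: "0 < u \<Longrightarrow> (\<lambda>x. cos (phase \<alpha> x)) integrable_on {u..w}"
  by (intro integrable_continuous_real continuous_intros phase_continuous)

lemma weight_antimono: "0 < x \<Longrightarrow> x \<le> y \<Longrightarrow> 2 / sqrt y \<le> 2 / sqrt x"
  by (intro divide_left_mono) auto

text \<open>The reciprocal of the phase derivative is monotone because \<open>vel\<close> is, so Bonnet's theorem applies to it.\<close>
lemma oscillatory_below:
  assumes al: "\<alpha> < 4 * X" and u: "Xb \<le> u" "u \<le> w" "w \<le> X"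
  shows "\<bar>integral {u..w} (\<lambda>x. cos (phase \<alpha> x))\<bar> \<le> (1 + \<bar>sin (phase \<alpha> w)\<bar>) / (pi * (4 * X - \<alpha>))"
proof -
  define g where "g = (\<lambda>x. 1 / (pi * (vel x - \<alpha>)))"
  have vx: "vel x - \<alpha> \<ge> 4 * X - \<alpha>" "0 < vel x - \<alpha>" if "x \<in> {u..w}" for x
    using vel_range(1)[of x] that u al by auto
  obtain \<xi> where xi: "((\<lambda>x. g x * (cos (phase \<alpha> x) * (pi * (vel x - \<alpha>)))) has_integral (g w * (- sin (phase \<alpha> w) - (- sin (phase \<alpha> \<xi>))))) {u..w}"
  proof (rule bonnet_increasing[OF u(2), of "\<lambda>x. - sin (phase \<alpha> x)" "\<lambda>x. cos (phase \<alpha> x) * (pi * (vel x - \<alpha>))" g])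
    show "((\<lambda>x. - sin (phase \<alpha> x)) has_real_derivative cos (phase \<alpha> x) * (pi * (vel x - \<alpha>))) (at x within {u..w})" if "x \<in> {u..w}" for x
      using that u Xb by (auto intro!: derivative_eq_intros phase_deriv simp: algebra_simps)
    show "g x \<le> g y" if "u \<le> x" "x \<le> y" "y \<le> w" for x y
      unfolding g_def using that vel_antimono[of x y] u Xb vx[of x] vx[of y]
      by (intro divide_left_mono mult_pos_pos mult_left_mono) auto
    show "0 \<le> g u" using vx[of u] u by (simp add: g_def)
  qed
  have "((\<lambda>x. cos (phase \<alpha> x)) has_integral (g w * (- sin (phase \<alpha> w) - (- sin (phase \<alpha> \<xi>))))) {u..w}"
    by (rule has_integral_eq[OF _ xi]) (use vx in \<open>force simp: g_def\<close>)
  then have "integral {u..w} (\<lambda>x. cos (phase \<alpha> x)) = g w * (sin (phase \<alpha> \<xi>) - sin (phase \<alpha> w))" by (simp add: integral_unique)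
  moreover have "\<bar>sin (phase \<alpha> \<xi>) - sin (phase \<alpha> w)\<bar> \<le> 1 + \<bar>sin (phase \<alpha> w)\<bar>" using abs_sin_le_one[of "phase \<alpha> \<xi>"] by linarith
  moreover have "0 \<le> g w" "g w \<le> 1 / (pi * (4 * X - \<alpha>))"
    unfolding g_def using vx[of w] u al by (auto intro!: divide_left_mono mult_left_mono)
  ultimately have "\<bar>integral {u..w} (\<lambda>x. cos (phase \<alpha> x))\<bar> \<le> 1 / (pi * (4 * X - \<alpha>)) * (1 + \<bar>sin (phase \<alpha> w)\<bar>)"
    using al by (simp only: abs_mult) (intro mult_mono, auto)
  then show ?thesis by simp
qed

lemma oscillatory_above:
  assumes al: "3 * sqrt 2 * X < \<alpha>" and u: "Xb \<le> u" "u \<le> w" "w \<le> X"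
  shows "\<bar>integral {u..w} (\<lambda>x. sin (phase \<alpha> x))\<bar> \<le> 2 / (pi * (\<alpha> - 3 * sqrt 2 * X))"
proof -
  define g where "g = (\<lambda>x. 1 / (pi * (\<alpha> - vel x)))"
  have vx: "\<alpha> - vel x \<ge> \<alpha> - 3 * sqrt 2 * X" "0 < \<alpha> - vel x" if "x \<in> {u..w}" for x
    using vel_range(2)[of x] that u al by auto
  obtain \<xi> where xi: "((\<lambda>x. g x * (sin (phase \<alpha> x) * (pi * (\<alpha> - vel x)))) has_integral (g u * (- cos (phase \<alpha> \<xi>) - (- cos (phase \<alpha> u))))) {u..w}"
  proof (rule bonnet_decreasing[OF u(2), of "\<lambda>x. - cos (phase \<alpha> x)" "\<lambda>x. sin (phase \<alpha> x) * (pi * (\<alpha> - vel x))" g])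
    show "((\<lambda>x. - cos (phase \<alpha> x)) has_real_derivative sin (phase \<alpha> x) * (pi * (\<alpha> - vel x))) (at x within {u..w})" if "x \<in> {u..w}" for x
      using that u Xb by (auto intro!: derivative_eq_intros phase_deriv simp: algebra_simps)
    show "g y \<le> g x" if "u \<le> x" "x \<le> y" "y \<le> w" for x y
      unfolding g_def using that vel_antimono[of x y] u Xb vx[of x] vx[of y]
      by (intro divide_left_mono mult_pos_pos mult_left_mono) auto
    show "0 \<le> g w" using vx[of w] u by (simp add: g_def)
  qed
  have "((\<lambda>x. sin (phase \<alpha> x)) has_integral (g u * (- cos (phase \<alpha> \<xi>) - (- cos (phase \<alpha> u))))) {u..w}"
    by (rule has_integral_eq[OF _ xi]) (use vx in \<open>force simp: g_def\<close>)
  then have "integral {u..w} (\<lambda>x. sin (phase \<alpha> x)) = g u * (cos (phase \<alpha> u) - cos (phase \<alpha> \<xi>))" by (simp add: integral_unique)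
  moreover have "\<bar>cos (phase \<alpha> u) - cos (phase \<alpha> \<xi>)\<bar> \<le> 2" using abs_cos_le_one[of "phase \<alpha> \<xi>"] abs_cos_le_one[of "phase \<alpha> u"] by linarith
  moreover have "0 \<le> g u" "g u \<le> 1 / (pi * (\<alpha> - 3 * sqrt 2 * X))"
    unfolding g_def using vx[of u] u al by (auto intro!: divide_left_mono mult_left_mono)
  ultimately have "\<bar>integral {u..w} (\<lambda>x. sin (phase \<alpha> x))\<bar> \<le> 1 / (pi * (\<alpha> - 3 * sqrt 2 * X)) * 2"
    using al by (simp only: abs_mult) (intro mult_mono, auto)
  then show ?thesis by simp
qed

lemma oscillatory_below_sin:
  assumes al: "\<alpha> < 4 * X" and u: "Xb \<le> u" "u \<le> w" "w \<le> X"
  shows "\<bar>integral {u..w} (\<lambda>x. sin (phase \<alpha> x))\<bar> \<le> 2 / (pi * (4 * X - \<alpha>))"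
proof -
  define g where "g = (\<lambda>x. 1 / (pi * (vel x - \<alpha>)))"
  have vx: "vel x - \<alpha> \<ge> 4 * X - \<alpha>" "0 < vel x - \<alpha>" if "x \<in> {u..w}" for x
    using vel_range(1)[of x] that u al by auto
  obtain \<xi> where xi: "((\<lambda>x. g x * (sin (phase \<alpha> x) * (pi * (vel x - \<alpha>)))) has_integral (g w * (cos (phase \<alpha> w) - cos (phase \<alpha> \<xi>)))) {u..w}"
  proof (rule bonnet_increasing[OF u(2), of "\<lambda>x. cos (phase \<alpha> x)" "\<lambda>x. sin (phase \<alpha> x) * (pi * (vel x - \<alpha>))" g])
    show "((\<lambda>x. cos (phase \<alpha> x)) has_real_derivative sin (phase \<alpha> x) * (pi * (vel x - \<alpha>))) (at x within {u..w})" if "x \<in> {u..w}" for x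
      using that u Xb by (auto intro!: derivative_eq_intros phase_deriv simp: algebra_simps)
    show "g x \<le> g y" if "u \<le> x" "x \<le> y" "y \<le> w" for x y
      unfolding g_def using that vel_antimono[of x y] u Xb vx[of x] vx[of y]
      by (intro divide_left_mono mult_pos_pos mult_left_mono) auto
    show "0 \<le> g u" using vx[of u] u by (simp add: g_def)
  qed
  have "((\<lambda>x. sin (phase \<alpha> x)) has_integral (g w * (cos (phase \<alpha> w) - cos (phase \<alpha> \<xi>)))) {u..w}"
    by (rule has_integral_eq[OF _ xi]) (use vx in \<open>force simp: g_def\<close>)
  then have "integral {u..w} (\<lambda>x. sin (phase \<alpha> x)) = g w * (cos (phase \<alpha> w) - cos (phase \<alpha> \<xi>))" by (simp add: integral_unique)
  moreover have "\<bar>cos (phase \<alpha> w) - cos (phase \<alpha> \<xi>)\<bar> \<le> 2" using abs_cos_le_one[of "phase \<alpha> \<xi>"] abs_cos_le_one[of "phase \<alpha> w"] by linarith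
  moreover have "0 \<le> g w" "g w \<le> 1 / (pi * (4 * X - \<alpha>))"
    unfolding g_def using vx[of w] u al by (auto intro!: divide_left_mono mult_left_mono)
  ultimately have "\<bar>integral {u..w} (\<lambda>x. sin (phase \<alpha> x))\<bar> \<le> 1 / (pi * (4 * X - \<alpha>)) * 2"
    using al by (simp only: abs_mult) (intro mult_mono, auto)
  then show ?thesis by simp
qed

lemma sqrt_Xb: "1 / sqrt Xb = sqrt (sqrt 2) / sqrt X"
  by (simp add: Xb_def real_sqrt_divide)

lemma sqrt_sqrt2: "sqrt (sqrt 2) \<le> 1.1893" "1 \<le> sqrt (sqrt 2)"
proof -
  have "sqrt 2 \<le> 1.1893\<^sup>2" by (rule real_le_lsqrt) (auto simp: power2_eq_square)
  then show "sqrt (sqrt 2) \<le> 1.1893" using real_sqrt_le_mono[of "sqrt 2" "1.1893\<^sup>2"] by simp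
  show "1 \<le> sqrt (sqrt 2)" by simp
qed

text \<open>The constant is \<open>2 * 1.1893 - 1\<close>, where \<open>1.1893\<close> bounds the ratio \<open>sqrt (sqrt 2)\<close> of the weights
at the two ends.\<close>
lemma wave_below:
  assumes al: "\<alpha> < 4 * X"
  shows "\<bar>wave \<alpha>\<bar> \<le> 2 / sqrt X * (1.3786 + \<bar>sin (phase \<alpha> X)\<bar>) / (pi * (4 * X - \<alpha>))"
proof -
  note Xb0 = Xb(1,2)
  define w where "w = (\<lambda>x. 2 / sqrt x - 2 / sqrt X)"
  let ?P = "1 / (pi * (4 * X - \<alpha>))"
  have P: "?P > 0" using al by simp
  obtain \<xi> where xi: "\<xi> \<in> {Xb..X}" "((\<lambda>x. w x * cos (phase \<alpha> x)) has_integral (w Xb * integral {Xb..\<xi>} (\<lambda>x. cos (phase \<alpha> x)))) {Xb..X}"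
    by (rule bonnet_decreasing_integrable[of Xb X "\<lambda>x. cos (phase \<alpha> x)" w])
       (use Xb0 cos_phase_integrable weight_antimono in \<open>auto simp: w_def\<close>)
  have "((\<lambda>x. 2 / sqrt X * cos (phase \<alpha> x)) has_integral (2 / sqrt X * integral {Xb..X} (\<lambda>x. cos (phase \<alpha> x)))) {Xb..X}"
    by (intro has_integral_mult_right integrable_integral cos_phase_integrable Xb0)
  from has_integral_add[OF this xi(2)]
  have "((\<lambda>x. 2 / sqrt x * cos (phase \<alpha> x)) has_integral (2 / sqrt X * integral {Xb..X} (\<lambda>x. cos (phase \<alpha> x)) + w Xb * integral {Xb..\<xi>} (\<lambda>x. cos (phase \<alpha> x)))) {Xb..X}"
    by (rule has_integral_eq[rotated]) (simp add: w_def algebra_simps)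
  then have eq: "wave \<alpha> = 2 / sqrt X * integral {Xb..X} (\<lambda>x. cos (phase \<alpha> x)) + w Xb * integral {Xb..\<xi>} (\<lambda>x. cos (phase \<alpha> x))"
    unfolding wave_def by (rule integral_unique)
  have "\<bar>integral {Xb..X} (\<lambda>x. cos (phase \<alpha> x))\<bar> \<le> (1 + \<bar>sin (phase \<alpha> X)\<bar>) * ?P"
    using oscillatory_below[OF al, of Xb X] Xb0 by simp
  then have 1: "\<bar>2 / sqrt X * integral {Xb..X} (\<lambda>x. cos (phase \<alpha> x))\<bar> \<le> 2 / sqrt X * ((1 + \<bar>sin (phase \<alpha> X)\<bar>) * ?P)"
    using X_pos unfolding abs_mult by (intro mult_mono) auto
  have "\<bar>integral {Xb..\<xi>} (\<lambda>x. cos (phase \<alpha> x))\<bar> \<le> (1 + \<bar>sin (phase \<alpha> \<xi>)\<bar>) * ?P"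
    using oscillatory_below[OF al, of Xb \<xi>] xi(1) by simp
  also have "\<dots> \<le> (1 + 1) * ?P" using P by (intro mult_right_mono add_left_mono abs_sin_le_one) auto
  finally have i2: "\<bar>integral {Xb..\<xi>} (\<lambda>x. cos (phase \<alpha> x))\<bar> \<le> 2 * ?P" by simp
  have wXb: "w Xb = 2 / sqrt X * (sqrt (sqrt 2) - 1)"
    using sqrt_Xb by (simp add: w_def divide_inverse algebra_simps)
  have "0 \<le> w Xb" unfolding wXb using sqrt_sqrt2 X_pos by (intro mult_nonneg_nonneg) auto
  moreover have "w Xb \<le> 2 / sqrt X * 0.1893"
    unfolding wXb using sqrt_sqrt2 X_pos by (intro mult_left_mono) auto
  ultimately have 2: "\<bar>w Xb * integral {Xb..\<xi>} (\<lambda>x. cos (phase \<alpha> x))\<bar> \<le> (2 / sqrt X * 0.1893) * (2 * ?P)"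
    unfolding abs_mult using i2 X_pos by (intro mult_mono) auto
  have "2 / sqrt X * ((1 + \<bar>sin (phase \<alpha> X)\<bar>) * ?P) + (2 / sqrt X * 0.1893) * (2 * ?P)
     = 2 / sqrt X * (1.3786 + \<bar>sin (phase \<alpha> X)\<bar>) * ?P"
  proof -
    have "g * ((1 + s) * p) + (g * 0.1893) * (2 * p) = g * (1.3786 + s) * p" for g s p :: real by (simp add: algebra_simps)
    then show ?thesis .
  qed
  then have "\<bar>wave \<alpha>\<bar> \<le> 2 / sqrt X * (1.3786 + \<bar>sin (phase \<alpha> X)\<bar>) * ?P"
    unfolding eq using 1 2
      abs_triangle_ineq[of "2 / sqrt X * integral {Xb..X} (\<lambda>x. cos (phase \<alpha> x))" "w Xb * integral {Xb..\<xi>} (\<lambda>x. cos (phase \<alpha> x))"]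
    by linarith
  then show ?thesis by simp
qed

definition "amplitude \<alpha> = 2 * sqrt 2 / (\<alpha>\<^sup>2 - (4 * X)\<^sup>2) powr (1/4)" for \<alpha> :: real
definition "stat \<alpha> = X * (\<alpha> / (4 * X) - sqrt ((\<alpha> / (4 * X))\<^sup>2 - 1))" for \<alpha> :: real

end

context saddle
begin

lemma Q_lower:
  assumes s: "s1 \<le> s" "s \<le> 1" and half: "1/2 \<le> c * s1\<^sup>2"
  shows "((s - 1) * v s / s)\<^sup>2 / (2 * c) \<le> Q s"
proof -
  define P where "P = (\<lambda>s. (s - 1) * v s / s)"
  define j where "j = (\<lambda>s. Q s - (P s)\<^sup>2 / (2 * c))"
  have "j 1 \<le> j s"
  proof (rule DERIV_shift_sign_left[OF _ s(2)])
    fix z assume z: "s \<le> z" "z \<le> 1"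
    then have z': "s1 \<le> z" "z \<le> s2" using s s12 by auto
    note r = s_range[OF z'] and vz = v_pos[OF z']
    have "s1\<^sup>2 \<le> z\<^sup>2" using z' s12 by (intro power_mono) auto
    then have cz: "1/2 \<le> c * z\<^sup>2" using half c_ge mult_left_mono[of "s1\<^sup>2" "z\<^sup>2" c] by linarith
    have P: "(P has_real_derivative (1 / z\<^sup>2 - c)) (at z)"
    proof -
      have "(P has_real_derivative ((1 * v z + (- c) * (z - 1)) * z - (z - 1) * v z * 1) / (z * z)) (at z)"
        unfolding P_def using r by (auto intro!: derivative_eq_intros v_deriv)
      moreover have "((1 * v z + (- c) * (z - 1)) * z - (z - 1) * v z * 1) / (z * z) = 1 / z\<^sup>2 - c"
        using r by (simp add: v_def field_simps power2_eq_square)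
      ultimately show ?thesis by simp
    qed
    have "(j has_real_derivative (P z - (2 * P z * (1 / z\<^sup>2 - c)) / (2 * c))) (at z)"
    proof -
      have "(Q has_real_derivative P z) (at z)" unfolding P_def by (rule Q_deriv) (use r in auto)
      then show ?thesis unfolding j_def using c_ge by (auto intro!: derivative_eq_intros P)
    qed
    then have "(j has_real_derivative ((z - 1) * v z / z - (2 * ((z - 1) * v z / z) * (1 / z\<^sup>2 - c)) / (2 * c))) (at z)"
      unfolding P_def .
    moreover have "(z - 1) * v z / z - (2 * ((z - 1) * v z / z) * (1 / z\<^sup>2 - c)) / (2 * c) = (z - 1) * (v z / z * (2 - 1 / (c * z\<^sup>2)))"
      using r c_ge by (simp add: field_simps power2_eq_square)
    moreover have "0 \<le> v z / z * (2 - 1 / (c * z\<^sup>2))"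
      using r vz cz by (intro mult_nonneg_nonneg) (auto simp: field_simps)
    ultimately show "\<exists>d. (j has_real_derivative (z - 1) * d) (at z) \<and> 0 \<le> d" by metis
  qed simp
  then show ?thesis by (simp add: j_def P_def)
qed

end

context hardy
begin

text \<open>Rescaling by the stationary point turns the wave into the integral of \<open>saddle\<close>, with
\<open>c = (stat \<alpha> / X)\<^sup>2\<close>. The complete Fresnel integral is \<open>D\<close>; cutting at the end \<open>X\<close>, where the phase has
derivative \<open>pi * (\<alpha> - 4 * X)\<close>, costs \<open>main\<close>, and the cut at the other end costs the term with
\<open>amplitude \<alpha>\<close>.\<close>
lemma wave_saddle:
  assumes al: "4 * X < \<alpha>" "\<alpha> \<le> 4.4 * X"
  defines "main \<equiv> 2 / sqrt X * (1 + \<bar>sin (phase \<alpha> X)\<bar>) / (pi * (\<alpha> - 4 * X))"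
    and "D \<equiv> amplitude \<alpha> * cos (phase \<alpha> (stat \<alpha>) + pi / 4)"
  shows "\<alpha> \<le> 3 * sqrt 2 * X \<Longrightarrow> \<bar>wave \<alpha> - D\<bar> \<le> main + amplitude \<alpha> / 2"
    and "\<alpha> < 3 * sqrt 2 * X \<Longrightarrow> \<bar>wave \<alpha> - D\<bar> \<le> main + amplitude \<alpha> * (sqrt 2 / (pi * (3 * sqrt 2 * X - \<alpha>)))"
    and "3 * sqrt 2 * X < \<alpha> \<Longrightarrow> \<bar>wave \<alpha>\<bar> \<le> main + amplitude \<alpha> / 2"
proof -
  define k where "k = \<alpha> / (4 * X)"
  have k: "1 < k" "k \<le> 11/10" using al X_pos by (auto simp: k_def field_simps)
  have ak: "\<alpha> = 4 * X * k" using X_pos by (simp add: k_def)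
  define r where "r = k - sqrt (k\<^sup>2 - 1)"
  have k1: "0 < k\<^sup>2 - 1" using k by (simp add: power2_eq_square) (smt (verit) mult_less_cancel_left2)
  have sq: "(sqrt (k\<^sup>2 - 1))\<^sup>2 = k\<^sup>2 - 1" using k1 by simp
  have r_ge: "\<rho> \<le> r" if "2 * \<rho> * k \<le> 1 + \<rho>\<^sup>2" "\<rho> \<le> k" for \<rho>
  proof -
    have "k\<^sup>2 - 1 \<le> (k - \<rho>)\<^sup>2" using that by (simp add: power2_eq_square algebra_simps)
    then have "sqrt (k\<^sup>2 - 1) \<le> k - \<rho>" using that by (intro real_le_lsqrt) auto
    then show ?thesis by (simp add: r_def)
  qed
  have r64: "64/100 \<le> r" using k by (intro r_ge) (auto simp: power2_eq_square)
  have r1: "r < 1"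
  proof -
    have "(k - 1)\<^sup>2 < (sqrt (k\<^sup>2 - 1))\<^sup>2" unfolding sq using k by (simp add: power2_eq_square algebra_simps)
    then have "k - 1 < sqrt (k\<^sup>2 - 1)" by (rule power2_less_imp_less) (use k1 in auto)
    then show ?thesis by (simp add: r_def)
  qed
  have rk: "2 * k * r = 1 + r\<^sup>2"
    using sq by (simp add: r_def power2_eq_square algebra_simps)
  define \<kappa> where "\<kappa> = X * r"
  have kap: "0 < \<kappa>" using X_pos r64 by (simp add: \<kappa>_def)
  have stat: "stat \<alpha> = \<kappa>" by (simp add: stat_def \<kappa>_def r_def k_def)
  define s2 where "s2 = 1 / r"
  define a where "a = 1 / (sqrt 2 * r)"
  define s1 where "s1 = min 1 a"
  have a_ge: "7/10 \<le> a"
  proof -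
    have "sqrt 2 * r \<le> sqrt 2 * 1" using r1 by (intro mult_left_mono) auto
    also have "\<dots> \<le> 10/7" by (intro order_trans[OF eq_refl[OF mult_1_right]] real_le_lsqrt) (auto simp: power_divide)
    finally have "1 / (10/7) \<le> a" unfolding a_def using r64 by (intro divide_left_mono) auto
    then show ?thesis by simp
  qed
  have a2: "r\<^sup>2 * a\<^sup>2 = 1/2" using r64 by (simp add: a_def power_divide power_mult_distrib)
  have r2: "2/5 \<le> r\<^sup>2" using power_mono[OF r64, of 2] by (simp add: power_divide)
  have as2: "a < s2"
  proof -
    have "1 * r < sqrt 2 * r" using r64 by (intro mult_strict_right_mono) auto
    then show ?thesis unfolding a_def s2_def using r64 by (intro divide_strict_left_mono) auto
  qed
  interpret saddle "r\<^sup>2" s1 s2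
  proof
    show "r\<^sup>2 < 1" using r1 r64 by (simp add: power_less_one_iff abs_square_less_1)
    show "7/10 \<le> s1" using a_ge by (simp add: s1_def)
    show "s1 \<le> 1" by (simp add: s1_def)
    show "1 < s2" using r1 r64 by (simp add: s2_def)
    show "2/5 \<le> r\<^sup>2 * s1\<^sup>2" using a2 r2 by (auto simp: s1_def min_def)
    show "r\<^sup>2 * s2\<^sup>2 \<le> 1" using r64 by (simp add: s2_def power_divide)
  qed
  define C where "C = phase \<alpha> \<kappa>"
  have ph: "phase \<alpha> (\<kappa> * s) = C + t * Q s" if "0 < s" for s
  proof -
    have e1: "pi * \<kappa>\<^sup>2 = t * r\<^sup>2 / 2" by (simp add: t_def \<kappa>_def power_mult_distrib)
    have "pi * \<alpha> * \<kappa> = t * (2 * k * r)" unfolding ak \<kappa>_def t_def by (simp add: power2_eq_square)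
    then have e2: "pi * \<alpha> * \<kappa> = t * (1 + r\<^sup>2)" unfolding rk .
    have "phase \<alpha> (\<kappa> * s) = t * ln X - t / 2 - pi / 8 - t * (ln \<kappa> + ln s) - (pi * \<kappa>\<^sup>2) * s\<^sup>2 + (pi * \<alpha> * \<kappa>) * s"
      using kap that by (simp add: phase_def ln_mult power_mult_distrib mult_ac)
    moreover have "C = t * ln X - t / 2 - pi / 8 - t * ln \<kappa> - pi * \<kappa>\<^sup>2 + pi * \<alpha> * \<kappa>" by (simp add: C_def phase_def)
    ultimately show ?thesis unfolding e1 e2 Q_def by (simp add: power2_eq_square field_simps)
  qed
  have ks: "\<kappa> * s2 = X" "\<kappa> * a = Xb" using r64 by (simp_all add: \<kappa>_def s2_def a_def Xb_def)
  have s1a: "s1 \<le> a" by (simp add: s1_def)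
  define J where "J = integral {a..s2} (\<lambda>s. cos (C + t * Q s) / sqrt s)"
  have wave: "wave \<alpha> = 2 * sqrt \<kappa> * J"
  proof -
    define f where "f = (\<lambda>x. 2 / sqrt x * cos (phase \<alpha> x))"
    have "f integrable_on {Xb..X}" unfolding f_def
      using Xb by (intro integrable_continuous_real continuous_intros phase_continuous) auto
    then have "(f has_integral wave \<alpha>) {Xb..X}" unfolding wave_def f_def by (rule integrable_integral)
    from has_integral_stretch_real[OF this, of \<kappa>] kap
    have "((\<lambda>s. f (\<kappa> * s)) has_integral (1 / \<kappa> * wave \<alpha>)) ((\<lambda>x. x / \<kappa>) ` {Xb..X})" by simp
    moreover have "(\<lambda>x. x / \<kappa>) ` {Xb..X} = {a..s2}"
      using kap ks by (simp add: image_divide_atLeastAtMost) (simp add: field_simps)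
    ultimately have 1: "((\<lambda>s. f (\<kappa> * s)) has_integral (1 / \<kappa> * wave \<alpha>)) {a..s2}" by simp
    have "((\<lambda>s. 2 / sqrt \<kappa> * (cos (C + t * Q s) / sqrt s)) has_integral 2 / sqrt \<kappa> * J) {a..s2}"
      unfolding J_def by (intro has_integral_mult_right integrable_integral saddle_integral(1) s1a as2 t_pos)
    then have "((\<lambda>s. f (\<kappa> * s)) has_integral 2 / sqrt \<kappa> * J) {a..s2}"
      by (rule has_integral_eq[rotated]) (use a_ge ph in \<open>auto simp: f_def real_sqrt_mult\<close>)
    from has_integral_unique[OF 1 this] have "wave \<alpha> = \<kappa> * (2 / sqrt \<kappa> * J)" using kap by (simp add: field_simps)
    also have "\<dots> = 2 * (\<kappa> / sqrt \<kappa>) * J" by simp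
    also have "\<kappa> / sqrt \<kappa> = sqrt \<kappa>" using kap by (simp add: real_div_sqrt)
    finally show ?thesis .
  qed
  have U2: "0 < U s2" using Q_pos[of s2] s12 by (simp add: U_def)
  have H2: "H s2 + G0 / U s2 = 2 * A s2" using s12 by (simp add: H_def U_def)
  define sn where "sn = \<bar>sin (phase \<alpha> X)\<bar>"
  have sn: "\<bar>sin (C + t * Q s2)\<bar> = sn" using ph[of s2] s12 ks by (simp add: sn_def)
  have mainA: "2 * sqrt \<kappa> * (2 * A s2 * (1 + sn) / (2 * t)) = main"
  proof -
    have v2: "v s2 = 1 - r" unfolding v_def s2_def using r64 by (simp add: power2_eq_square)
    have "2 * r * (k - 1) = (1 - r)\<^sup>2" using rk by (simp add: power2_eq_square algebra_simps)
    then have "k - 1 = (1 - r)\<^sup>2 / (2 * r)" using r64 by (simp add: eq_divide_eq mult_ac)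
    moreover have "\<alpha> - 4 * X = 4 * X * (k - 1)" unfolding ak by (simp add: algebra_simps)
    ultimately have e: "\<alpha> - 4 * X = 2 * X * ((1 - r)\<^sup>2 / r)" by simp
    have "A s2 = sqrt (1 / r) * (r / (1 - r)\<^sup>2)"
      using r64 r1 unfolding A_def v2 by (simp add: s2_def power2_eq_square field_simps)
    then have "sqrt \<kappa> * A s2 = sqrt X * (sqrt r * sqrt (1 / r)) * (r / (1 - r)\<^sup>2)"
      by (simp add: \<kappa>_def real_sqrt_mult)
    also have "sqrt r * sqrt (1 / r) = 1" using r64 by (simp add: real_sqrt_mult[symmetric])
    finally have kA: "sqrt \<kappa> * A s2 = sqrt X * (r / (1 - r)\<^sup>2)" by simp
    have "2 * sqrt \<kappa> * (2 * A s2 * (1 + sn) / (2 * t)) = (sqrt \<kappa> * A s2) * (2 * (1 + sn) / t)" by simp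
    also have "\<dots> = main"
    proof -
      define q where "q = sqrt X"
      have q: "q > 0" "X = q\<^sup>2" using X_pos by (auto simp: q_def)
      define d where "d = 1 - r"
      have d: "d > 0" using r1 by (simp add: d_def)
      show ?thesis unfolding kA main_def e sn_def[symmetric] t_def q_def[symmetric] d_def[symmetric] unfolding q(2)
        using q(1) r64 d by (simp add: field_simps power2_eq_square)
    qed
    finally show ?thesis .
  qed
  have amp: "amplitude \<alpha> = 2 * sqrt \<kappa> * (G0 / sqrt t) * sqrt pi"
  proof -
    have p: "0 < \<alpha>\<^sup>2 - (4 * X)\<^sup>2" using k1 X_pos unfolding ak by (simp add: power_mult_distrib algebra_simps)
    have kk: "k\<^sup>2 - 1 = (1 - r\<^sup>2)\<^sup>2 / (4 * r\<^sup>2)"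
    proof -
      have kf: "k = (1 + r\<^sup>2) / (2 * r)" using rk r64 by (simp add: field_simps)
      show ?thesis unfolding kf using r64 by (simp add: field_simps power2_eq_square)
    qed
    have "(amplitude \<alpha>) ^ 4 = (2 * sqrt 2) ^ 4 / (\<alpha>\<^sup>2 - (4 * X)\<^sup>2)"
      unfolding amplitude_def power_divide using p by (simp add: powr_power)
    also have "\<dots> = 16 * r\<^sup>2 / (X\<^sup>2 * (1 - r\<^sup>2)\<^sup>2)"
    proof -
      have q1: "\<alpha>\<^sup>2 - (4 * X)\<^sup>2 = 16 * X\<^sup>2 * (k\<^sup>2 - 1)" unfolding ak by (simp add: power2_eq_square algebra_simps)
      have q2: "(2 * sqrt 2) ^ 4 = (64::real)" by (simp add: power_mult_distrib power4_eq_xxxx)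
      define d where "d = 1 - r\<^sup>2"
      have "d > 0" using c by (simp add: d_def)
      then show ?thesis unfolding q1 q2 kk d_def[symmetric] using r64 X_pos by (simp add: field_simps)
    qed
    also have "\<dots> = (2 * sqrt \<kappa> * (G0 / sqrt t) * sqrt pi) ^ 4"
    proof -
      have s4: "(sqrt z) ^ 4 = z\<^sup>2" if "0 \<le> z" for z
        using that by (simp add: power4_eq_xxxx power2_eq_square)
      have c1: "0 < 1 - r\<^sup>2" using c by simp
      have E: "(2 * sqrt \<kappa> * (G0 / sqrt t) * sqrt pi) ^ 4 = 16 * \<kappa>\<^sup>2 * ((2 / (1 - r\<^sup>2))\<^sup>2 / t\<^sup>2) * pi\<^sup>2"
        using kap t_pos c1 unfolding G0_def by (simp add: power_mult_distrib power_divide s4)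
      define d where "d = 1 - r\<^sup>2"
      have "d > 0" using c1 by (simp add: d_def)
      then show ?thesis unfolding E unfolding \<kappa>_def t_def d_def[symmetric]
        using X_pos by (simp add: field_simps power2_eq_square)
    qed
    finally have "(amplitude \<alpha>) ^ 4 = (2 * sqrt \<kappa> * (G0 / sqrt t) * sqrt pi) ^ 4" .
    then show ?thesis
      by (rule power_eq_imp_eq_base) (use p kap t_pos c in \<open>auto simp: amplitude_def G0_def\<close>)
  qed
  define L where "L = sqrt pi / 2 * cos (C + pi / 4)"
  define w where "w = 2 * sqrt \<kappa> * (G0 / sqrt t)"
  have G0p: "0 < G0" using c by (simp add: G0_def)
  have wp: "0 < w" using kap t_pos G0p by (simp add: w_def)
  have D: "D = w * (2 * L)" unfolding D_def amp stat w_def L_def C_def by simp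
  have J1: "\<bar>wave \<alpha> - w * (fresnel_cos C (sqrt t * U s2) - fresnel_cos C (sqrt t * U a))\<bar> \<le> 2 * sqrt \<kappa> * (H s2 * (1 + sn) / (2 * t))"
  proof -
    have "\<bar>J - G0 / sqrt t * (fresnel_cos C (sqrt t * U s2) - fresnel_cos C (sqrt t * U a))\<bar> \<le> H s2 * (1 + sn) / (2 * t)"
      using saddle_integral(2)[OF s1a as2 t_pos, of C] unfolding J_def sn .
    then have "2 * sqrt \<kappa> * \<bar>J - G0 / sqrt t * (fresnel_cos C (sqrt t * U s2) - fresnel_cos C (sqrt t * U a))\<bar> \<le> 2 * sqrt \<kappa> * (H s2 * (1 + sn) / (2 * t))"
      using kap by (intro mult_left_mono) auto
    moreover have "wave \<alpha> - w * (fresnel_cos C (sqrt t * U s2) - fresnel_cos C (sqrt t * U a)) = 2 * sqrt \<kappa> * (J - G0 / sqrt t * (fresnel_cos C (sqrt t * U s2) - fresnel_cos C (sqrt t * U a)))"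
      unfolding wave w_def by (simp add: algebra_simps)
    ultimately show ?thesis using kap by (simp add: abs_mult)
  qed
  have T2: "w * \<bar>L - fresnel_cos C (sqrt t * U s2)\<bar> \<le> 2 * sqrt \<kappa> * (G0 / U s2 * (1 + sn) / (2 * t))"
  proof -
    have "(sqrt t * U s2)\<^sup>2 = t * Q s2" using t_pos U_sq[of s2] s12 by (simp add: power_mult_distrib)
    then have "\<bar>L - fresnel_cos C (sqrt t * U s2)\<bar> \<le> (1 + sn) / (2 * (sqrt t * U s2))"
      using fresnel_cos_tail(3)[of "sqrt t * U s2" C] U2 t_pos sn by (simp add: L_def)
    then have "w * \<bar>L - fresnel_cos C (sqrt t * U s2)\<bar> \<le> w * ((1 + sn) / (2 * (sqrt t * U s2)))"
      by (rule mult_left_mono) (use wp in simp)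
    also have "\<dots> = 2 * sqrt \<kappa> * (G0 / U s2 * (1 + sn) / (2 * (sqrt t * sqrt t)))" by (simp add: w_def)
    finally show ?thesis using t_pos by simp
  qed
  have JT: "2 * sqrt \<kappa> * (H s2 * (1 + sn) / (2 * t)) + 2 * sqrt \<kappa> * (G0 / U s2 * (1 + sn) / (2 * t)) = main"
    unfolding mainA[symmetric] H2[symmetric] by (simp add: algebra_simps add_divide_distrib)
  have below: "\<bar>wave \<alpha> - D\<bar> \<le> main + w * \<bar>L - fresnel_cos C (sqrt t * \<bar>U a\<bar>)\<bar>" if "\<alpha> \<le> 3 * sqrt 2 * X"
  proof -
    have "2 * (1 / sqrt 2) * k \<le> 3 / 2"
    proof -
      have "k \<le> 3 * sqrt 2 / 4" using that X_pos by (simp add: k_def field_simps)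
      then have "sqrt 2 * k \<le> sqrt 2 * (3 * sqrt 2 / 4)" by (intro mult_left_mono) auto
      also have "\<dots> = 3 / 2" by simp
      finally have "sqrt 2 * k \<le> 3 / 2" .
      moreover have "2 * (1 / sqrt 2) = sqrt 2" by (simp add: real_div_sqrt)
      ultimately show ?thesis by simp
    qed
    then have "1 / sqrt 2 \<le> r" using k by (intro r_ge) (auto simp: power_divide intro: order_trans[of _ 1])
    then have "a \<le> 1" unfolding a_def using r64 by (simp add: field_simps)
    then have Ua: "U a = - \<bar>U a\<bar>" using Q_nonneg[of a] s1a as2 by (cases "a = 1") (auto simp: U_def sgn_if)
    then have "fresnel_cos C (sqrt t * U a) = - fresnel_cos C (sqrt t * \<bar>U a\<bar>)"
      by (metis fresnel_cos_minus mult_minus_right)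
    then have "wave \<alpha> - D = (wave \<alpha> - w * (fresnel_cos C (sqrt t * U s2) - fresnel_cos C (sqrt t * U a)))
       - w * (L - fresnel_cos C (sqrt t * U s2)) - w * (L - fresnel_cos C (sqrt t * \<bar>U a\<bar>))"
      unfolding D by (simp add: algebra_simps)
    moreover have "\<bar>w * (L - z)\<bar> = w * \<bar>L - z\<bar>" for z using wp by (simp add: abs_mult)
    ultimately show ?thesis using J1 T2 JT by (smt (verit, ccfv_threshold))
  qed
  have half: "w * \<bar>L - fresnel_cos C (sqrt t * \<bar>U a\<bar>)\<bar> \<le> amplitude \<alpha> / 2"
  proof -
    have "w * \<bar>L - fresnel_cos C (sqrt t * \<bar>U a\<bar>)\<bar> \<le> w * (sqrt pi / 2)"
      using fresnel_cos_tail(1)[of "sqrt t * \<bar>U a\<bar>" C] wp t_pos by (intro mult_left_mono) (auto simp: L_def)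
    then show ?thesis unfolding amp w_def by simp
  qed
  show "\<bar>wave \<alpha> - D\<bar> \<le> main + amplitude \<alpha> / 2" if "\<alpha> \<le> 3 * sqrt 2 * X"
    using below[OF that] half by linarith
  show "\<bar>wave \<alpha> - D\<bar> \<le> main + amplitude \<alpha> * (sqrt 2 / (pi * (3 * sqrt 2 * X - \<alpha>)))" if b: "\<alpha> < 3 * sqrt 2 * X"
  proof -
    define \<delta> where "\<delta> = (3 * sqrt 2 * X - \<alpha>) / (4 * X)"
    have dp: "0 < \<delta>" using b X_pos by (simp add: \<delta>_def)
    have kd: "k = 3 * sqrt 2 / 4 - \<delta>" using X_pos by (simp add: \<delta>_def k_def field_simps)
    have "2 * (1 / sqrt 2) * k \<le> 3 / 2"
    proof -
      have "k \<le> 3 * sqrt 2 / 4" using kd dp by simp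
      then have "sqrt 2 * k \<le> sqrt 2 * (3 * sqrt 2 / 4)" by (intro mult_left_mono) auto
      also have "\<dots> = 3 / 2" by simp
      finally have "sqrt 2 * k \<le> 3 / 2" .
      moreover have "2 * (1 / sqrt 2) = sqrt 2" by (simp add: real_div_sqrt)
      ultimately show ?thesis by simp
    qed
    then have "1 / sqrt 2 \<le> r" using k by (intro r_ge) (auto simp: power_divide intro: order_trans[of _ 1])
    then have a1: "a \<le> 1" unfolding a_def using r64 by (simp add: field_simps)
    then have sa: "s1 = a" by (simp add: s1_def)
    have e: "(a - 1) * v a / a = r * (2 * k - 3 * sqrt 2 / 2)"
    proof -
      define q where "q = sqrt 2"
      have q: "q > 0" "q * q = 2" by (auto simp: q_def)
      have ia: "1 / a = q * r" by (simp add: a_def q_def)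
      have va: "v a = 1 - r / q" unfolding v_def a_def q_def using r64 by (simp add: power2_eq_square)
      have "(a - 1) * v a / a = (1 - 1 / a) * v a" using a_ge by (simp add: field_simps)
      also have "\<dots> = (1 - q * r) * (1 - r / q)" unfolding ia va ..
      also have "\<dots> = 1 + r\<^sup>2 - r * (q + 1 / q)" using q by (simp add: field_simps power2_eq_square)
      also have "1 / q = q / 2" using q by (simp add: field_simps)
      also have "1 + r\<^sup>2 = 2 * k * r" using rk by simp
      finally show ?thesis by (simp add: q_def algebra_simps)
    qed
    have "((a - 1) * v a / a)\<^sup>2 / (2 * r\<^sup>2) = 2 * \<delta>\<^sup>2"
      unfolding e kd using r64 by (simp add: power_mult_distrib power2_eq_square algebra_simps)
    then have Qa: "2 * \<delta>\<^sup>2 \<le> Q a" using Q_lower[of a] a1 sa a2 by simp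
    have "sqrt 2 * \<delta> = sqrt (2 * \<delta>\<^sup>2)" using dp by (simp add: real_sqrt_mult)
    also have "\<dots> \<le> sqrt (Q a)" using Qa by simp
    also have "\<dots> = \<bar>U a\<bar>"
    proof -
      have "a \<noteq> 1" using Qa dp by (metis Q_1 mult_pos_pos not_le zero_less_numeral zero_less_power)
      then show ?thesis using Q_nonneg[of a] s1a as2 by (simp add: U_def abs_mult sgn_if)
    qed
    finally have Ua: "sqrt 2 * \<delta> \<le> \<bar>U a\<bar>" .
    then have Uap: "0 < \<bar>U a\<bar>" using dp by (smt (verit) mult_pos_pos real_sqrt_gt_zero)
    have "\<bar>L - fresnel_cos C (sqrt t * \<bar>U a\<bar>)\<bar> \<le> 1 / (sqrt 2 * (sqrt t * \<bar>U a\<bar>))"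
      using fresnel_cos_tail(2)[of "sqrt t * \<bar>U a\<bar>" C] t_pos Uap unfolding L_def by simp
    also have "\<dots> \<le> 1 / (sqrt 2 * (sqrt t * (sqrt 2 * \<delta>)))"
      using Ua t_pos dp Uap by (intro divide_left_mono mult_left_mono mult_pos_pos) auto
    also have "\<dots> = 1 / (2 * sqrt t * \<delta>)" by simp
    finally have "w * \<bar>L - fresnel_cos C (sqrt t * \<bar>U a\<bar>)\<bar> \<le> w * (1 / (2 * sqrt t * \<delta>))"
      using wp by (intro mult_left_mono) auto
    also have "\<dots> = amplitude \<alpha> * (sqrt 2 / (pi * (3 * sqrt 2 * X - \<alpha>)))"
    proof -
      have st: "sqrt t = sqrt 2 * sqrt pi * X" using X_pos by (simp add: t_def real_sqrt_mult)
      have "amplitude \<alpha> = w * sqrt pi" unfolding amp w_def by simp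
      moreover have "3 * sqrt 2 * X - \<alpha> = 4 * X * \<delta>" using X_pos by (simp add: \<delta>_def)
      moreover have "1 / (2 * sqrt t * \<delta>) = (sqrt pi * sqrt 2) / (pi * (4 * X * \<delta>))"
      proof (subst frac_eq_eq)
        have "sqrt pi * sqrt 2 * (2 * sqrt t * \<delta>) = (sqrt pi * sqrt pi) * (sqrt 2 * sqrt 2) * (2 * X * \<delta>)"
          unfolding st by (simp only: mult_ac)
        then have "sqrt pi * sqrt 2 * (2 * sqrt t * \<delta>) = 1 * (pi * (4 * X * \<delta>))" by simp
        then show "1 * (pi * (4 * X * \<delta>)) = sqrt pi * sqrt 2 * (2 * sqrt t * \<delta>)" by (rule sym)
      qed (use X_pos dp t_pos in auto)
      ultimately show ?thesis by simp
    qed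
    finally show ?thesis using below b by linarith
  qed
  show "\<bar>wave \<alpha>\<bar> \<le> main + amplitude \<alpha> / 2" if b: "3 * sqrt 2 * X < \<alpha>"
  proof -
    have "3 * sqrt 2 / 4 < k" using b X_pos by (simp add: k_def field_simps)
    then have "sqrt 2 * (3 * sqrt 2 / 4) < sqrt 2 * k" by (intro mult_strict_left_mono) auto
    then have "(k - 1 / sqrt 2)\<^sup>2 < (sqrt (k\<^sup>2 - 1))\<^sup>2"
      unfolding sq by (simp add: power2_eq_square field_simps)
    then have "k - 1 / sqrt 2 < sqrt (k\<^sup>2 - 1)" by (rule power2_less_imp_less) (use k1 in auto)
    then have "r < 1 / sqrt 2" by (simp add: r_def)
    then have "1 < a" unfolding a_def using r64 by (simp add: field_simps)
    then have Ua: "U a = \<bar>U a\<bar>" using Q_nonneg[of a] s1a as2 by (simp add: U_def)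
    have "wave \<alpha> = (wave \<alpha> - w * (fresnel_cos C (sqrt t * U s2) - fresnel_cos C (sqrt t * U a)))
       - w * (L - fresnel_cos C (sqrt t * U s2)) + w * (L - fresnel_cos C (sqrt t * U a))"
      by (simp add: algebra_simps)
    moreover have "\<bar>w * (L - z)\<bar> = w * \<bar>L - z\<bar>" for z using wp by (simp add: abs_mult)
    ultimately show ?thesis using J1 T2 JT half Ua by (smt (verit, ccfv_threshold))
  qed
qed

end

section \<open>Poisson residuals of the excluded modes\<close>

lemma oscillatory_sign_change:
  fixes m \<Psi> \<psi> :: "real \<Rightarrow> real"
  assumes ab: "a \<le> \<xi>" "\<xi> \<le> b"
    and d: "\<And>x. x \<in> {a..b} \<Longrightarrow> (\<Psi> has_real_derivative \<psi> x) (at x within {a..b})"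
    and mono: "\<And>x y. a \<le> x \<Longrightarrow> x \<le> y \<Longrightarrow> y \<le> b \<Longrightarrow> m x \<le> m y" and neg: "m a \<le> 0"
  shows "\<bar>integral {a..\<xi>} (\<lambda>x. m x * (\<psi> x * cos (\<Psi> x)))\<bar> \<le> 2 * (- m a) + 2 * max (m b) 0"
proof -
  obtain c where c: "c \<in> {a..\<xi>}" "((\<lambda>x. m x * (\<psi> x * cos (\<Psi> x))) has_integral (m a * (sin (\<Psi> c) - sin (\<Psi> a)) + m \<xi> * (sin (\<Psi> \<xi>) - sin (\<Psi> c)))) {a..\<xi>}"
  proof (rule second_mean_value_FTC[OF ab(1), of "\<lambda>x. sin (\<Psi> x)" "\<lambda>x. \<psi> x * cos (\<Psi> x)" m])
    fix x assume "x \<in> {a..\<xi>}"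
    then have "(\<Psi> has_real_derivative \<psi> x) (at x within {a..\<xi>})"
      using ab by (intro DERIV_subset[OF d]) auto
    then show "((\<lambda>x. sin (\<Psi> x)) has_real_derivative \<psi> x * cos (\<Psi> x)) (at x within {a..\<xi>})"
      by (auto intro!: derivative_eq_intros)
  qed (use ab mono in auto)
  have osc: "\<bar>sin u - sin w\<bar> \<le> 2" for u w :: real
    using abs_sin_le_one[of u] abs_sin_le_one[of w] by linarith
  have prod: "\<bar>k * (sin u - sin w)\<bar> \<le> 2 * \<bar>k\<bar>" for k u w :: real
    using mult_left_mono[OF osc[of u w], of "\<bar>k\<bar>"] by (simp add: abs_mult)
  have m: "m a \<le> m \<xi>" "m \<xi> \<le> m b" using mono ab by auto
  have "\<bar>m a * (sin (\<Psi> c) - sin (\<Psi> a)) + m \<xi> * (sin (\<Psi> \<xi>) - sin (\<Psi> c))\<bar> \<le> 2 * (- m a) + 2 * max (m b) 0"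
  proof (cases "0 \<le> m \<xi>")
    case True
    then show ?thesis using prod[of "m a" "\<Psi> c" "\<Psi> a"] prod[of "m \<xi>" "\<Psi> \<xi>" "\<Psi> c"] m neg by linarith
  next
    case False
    have "m a * (sin (\<Psi> c) - sin (\<Psi> a)) + m \<xi> * (sin (\<Psi> \<xi>) - sin (\<Psi> c))
       = (m a - m \<xi>) * (sin (\<Psi> c) - sin (\<Psi> a)) + m \<xi> * (sin (\<Psi> \<xi>) - sin (\<Psi> a))" by (simp add: algebra_simps)
    also have "\<bar>\<dots>\<bar> \<le> 2 * \<bar>m a - m \<xi>\<bar> + 2 * \<bar>m \<xi>\<bar>"
      by (rule order_trans[OF abs_triangle_ineq add_mono[OF prod prod]])
    also have "\<dots> \<le> 2 * (- m a) + 2 * max (m b) 0" using m False by simp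
    finally show ?thesis .
  qed
  then show ?thesis using integral_unique[OF c(2)] by simp
qed

lemma residual_constants:
  fixes P Q R g g' nn :: real
  assumes "nn > 0"
  shows "(g * (2 * (- (- P)) + 2 * Q) + g' * (2 / pi * R)) / (2 * pi * nn)
     = g / pi * (P / nn + Q / nn) + g' / pi\<^sup>2 * (R / nn)"
proof -
  have "g' * (2 / pi * R) / (2 * pi * nn) = g' / pi\<^sup>2 * (R / nn)"
    "g * (2 * (- (- P)) + 2 * Q) / (2 * pi * nn) = g / pi * (P / nn + Q / nn)"
    using assms by (simp_all add: power2_eq_square field_simps)
  then show ?thesis by (simp only: add_divide_distrib)
qed

context hardy
begin

lemma phase_shift: "phase \<kappa> x + 2 * pi * \<nu> * x = phase (\<kappa> + 2 * \<nu>) x"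
  by (simp add: phase_def algebra_simps)

lemma vel_continuous: "continuous_on {Xb..X} vel"
  unfolding vel_def using Xb by (intro continuous_intros) auto

lemma phase_sum_wave: "phase_sum (\<lambda>x. 2 / sqrt x) (\<lambda>x. - (1 / (x * sqrt x))) (phase \<kappa>) (\<lambda>x. pi * (\<kappa> - vel x)) Xb X"
proof
  show "Xb \<le> X" using Xb by simp
  fix x assume "x \<in> {Xb..X}"
  then have x: "0 < x" using Xb by auto
  show "((\<lambda>x. 2 / sqrt x) has_real_derivative - (1 / (x * sqrt x))) (at x within {Xb..X})"
    using x by (auto intro!: derivative_eq_intros simp: field_simps)
  show "(phase \<kappa> has_real_derivative pi * (\<kappa> - vel x)) (at x within {Xb..X})" by (rule phase_deriv[OF x])
next
  show "continuous_on {Xb..X} (\<lambda>x. - (1 / (x * sqrt x)))" using Xb by (intro continuous_intros) auto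
  show "continuous_on {Xb..X} (\<lambda>x. pi * (\<kappa> - vel x))" by (intro continuous_intros vel_continuous)
qed (use Xb in auto)

lemma residual_split:
  fixes \<kappa> :: real and \<nu> :: int
  assumes nu: "\<nu> \<noteq> 0"
    and W: "\<And>\<xi>. \<xi> \<in> {Xb..X} \<Longrightarrow> \<bar>integral {Xb..\<xi>} (\<lambda>x. pi * (\<kappa> - vel x) * cos (phase (\<kappa> + 2 * real_of_int \<nu>) x))\<bar> \<le> V"
    and Z: "\<And>\<xi>. \<xi> \<in> {Xb..X} \<Longrightarrow> \<bar>integral {Xb..\<xi>} (\<lambda>x. sin (phase (\<kappa> + 2 * real_of_int \<nu>) x))\<bar> \<le> S"
  shows "\<bar>phase_sum.residual (\<lambda>x. 2 / sqrt x) (\<lambda>x. - (1 / (x * sqrt x))) (phase \<kappa>) (\<lambda>x. pi * (\<kappa> - vel x)) Xb X \<nu>\<bar>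
     \<le> (2 / sqrt Xb * V + 1 / (Xb * sqrt Xb) * S) / (2 * pi * \<bar>\<nu>\<bar>)"
proof -
  interpret phase_sum "\<lambda>x. 2 / sqrt x" "\<lambda>x. - (1 / (x * sqrt x))" "phase \<kappa>" "\<lambda>x. pi * (\<kappa> - vel x)" Xb X by (rule phase_sum_wave)
  let ?\<alpha> = "\<kappa> + 2 * real_of_int \<nu>"
  have pc: "continuous_on {Xb..X} (phase ?\<alpha>)" by (rule phase_continuous) (rule Xb)
  obtain \<xi>1 where x1: "\<xi>1 \<in> {Xb..X}" "((\<lambda>x. 2 / sqrt x * (pi * (\<kappa> - vel x) * cos (phase ?\<alpha> x))) has_integral (2 / sqrt Xb * integral {Xb..\<xi>1} (\<lambda>x. pi * (\<kappa> - vel x) * cos (phase ?\<alpha> x)))) {Xb..X}"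
    by (rule bonnet_decreasing_integrable[OF AB, of "\<lambda>x. pi * (\<kappa> - vel x) * cos (phase ?\<alpha> x)" "\<lambda>x. 2 / sqrt x"])
       (use Xb weight_antimono in \<open>auto intro!: integrable_continuous_real continuous_intros pc vel_continuous\<close>)
  obtain \<xi>2 where x2: "\<xi>2 \<in> {Xb..X}" "((\<lambda>x. 1 / (x * sqrt x) * sin (phase ?\<alpha> x)) has_integral (1 / (Xb * sqrt Xb) * integral {Xb..\<xi>2} (\<lambda>x. sin (phase ?\<alpha> x)))) {Xb..X}"
    by (rule bonnet_decreasing_integrable[OF AB, of "\<lambda>x. sin (phase ?\<alpha> x)" "\<lambda>x. 1 / (x * sqrt x)"])
       (use Xb in \<open>auto intro!: integrable_continuous_real continuous_intros pc divide_left_mono mult_mono mult_pos_pos\<close>)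
  have "integral {Xb..X} (\<lambda>x. - (1 / (x * sqrt x)) * sin (phase \<kappa> x + 2 * pi * real_of_int \<nu> * x)
      + 2 / sqrt x * (pi * (\<kappa> - vel x) * cos (phase \<kappa> x + 2 * pi * real_of_int \<nu> * x)))
     = 2 / sqrt Xb * integral {Xb..\<xi>1} (\<lambda>x. pi * (\<kappa> - vel x) * cos (phase ?\<alpha> x)) - 1 / (Xb * sqrt Xb) * integral {Xb..\<xi>2} (\<lambda>x. sin (phase ?\<alpha> x))"
    unfolding phase_shift
    by (rule integral_unique, rule has_integral_eq[OF _ has_integral_diff[OF x1(2) x2(2)]]) simp
  moreover have "\<bar>2 / sqrt Xb * integral {Xb..\<xi>1} (\<lambda>x. pi * (\<kappa> - vel x) * cos (phase ?\<alpha> x))\<bar> \<le> 2 / sqrt Xb * V"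
    using W[OF x1(1)] Xb by (simp only: abs_mult) (intro mult_mono, auto)
  moreover have "\<bar>1 / (Xb * sqrt Xb) * integral {Xb..\<xi>2} (\<lambda>x. sin (phase ?\<alpha> x))\<bar> \<le> 1 / (Xb * sqrt Xb) * S"
    using Z[OF x2(1)] Xb by (simp only: abs_mult) (intro mult_mono, auto)
  ultimately have "\<bar>integral {Xb..X} (\<lambda>x. - (1 / (x * sqrt x)) * sin (phase \<kappa> x + 2 * pi * real_of_int \<nu> * x)
      + 2 / sqrt x * (pi * (\<kappa> - vel x) * cos (phase \<kappa> x + 2 * pi * real_of_int \<nu> * x)))\<bar> \<le> 2 / sqrt Xb * V + 1 / (Xb * sqrt Xb) * S"
    by linarith
  then show ?thesis unfolding residual_def using nu by (simp add: abs_mult divide_right_mono)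
qed

abbreviation (input) res where "res \<kappa> \<equiv> phase_sum.residual (\<lambda>x. 2 / sqrt x) (\<lambda>x. - (1 / (x * sqrt x))) (phase \<kappa>) (\<lambda>x. pi * (\<kappa> - vel x)) Xb X"

text \<open>In the residual of the mode \<open>\<kappa> + 2 * n\<close> the factor of the phase derivative is the quotient of
\<open>\<kappa> - vel x\<close> by \<open>\<kappa> + 2 * n - vel x\<close>, which is monotone in \<open>x\<close> but may change sign; this is what makes
\<open>oscillatory_sign_change\<close> applicable and the bound of order \<open>1 / n\<^sup>2\<close>.\<close>
lemma residual_above:
  fixes \<kappa> p q :: real and n :: nat
  assumes p: "p = 3 * sqrt 2 * X - \<kappa>" "0 \<le> p" and q: "q = \<kappa> - 4 * X" and n: "p < 2 * real n" "- q < 2 * real n"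
  shows "\<bar>res \<kappa> (int n)\<bar> \<le> 2 / sqrt Xb / pi * (p / (real n * (2 * real n - p)) + max q 0 / (real n * (2 * real n + q)))
     + 1 / (Xb * sqrt Xb) / pi\<^sup>2 / (real n * (2 * real n - p))"
proof -
  let ?\<alpha> = "\<kappa> + 2 * real n"
  have n0: "0 < real n" using p n by linarith
  have ab: "4 * X \<le> 3 * sqrt 2 * X" using vel_range[of X] Xb by simp
  have al: "3 * sqrt 2 * X < ?\<alpha>" using p n by simp
  define m where "m = (\<lambda>x. (\<kappa> - vel x) / (?\<alpha> - vel x))"
  have vx: "vel x < ?\<alpha>" if "x \<in> {Xb..X}" for x using vel_range(2)[of x] that al by auto
  have mf: "m x = 1 - 2 * real n / (?\<alpha> - vel x)" if "x \<in> {Xb..X}" for x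
    using vx[OF that] by (simp add: m_def field_simps)
  have mono: "m x \<le> m y" if "Xb \<le> x" "x \<le> y" "y \<le> X" for x y
  proof -
    have "2 * real n / (?\<alpha> - vel y) \<le> 2 * real n / (?\<alpha> - vel x)"
      using vel_antimono[of x y] that Xb vx[of x] vx[of y] by (intro divide_left_mono) auto
    then show ?thesis using mf[of x] mf[of y] that by auto
  qed
  have mA: "m Xb = - (p / (2 * real n - p))" and mB: "m X = q / (2 * real n + q)"
  proof -
    have e: "\<kappa> - 3 * sqrt 2 * X = - p" "\<kappa> + 2 * real n - 3 * sqrt 2 * X = 2 * real n - p"
      "\<kappa> - 4 * X = q" "\<kappa> + 2 * real n - 4 * X = 2 * real n + q" using p q by auto
    show "m Xb = - (p / (2 * real n - p))" "m X = q / (2 * real n + q)"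
      unfolding m_def vel_Xb vel_X e by simp_all
  qed
  have "\<bar>res \<kappa> (int n)\<bar> \<le> (2 / sqrt Xb * (2 * (- m Xb) + 2 * max (m X) 0) + 1 / (Xb * sqrt Xb) * (2 / (pi * (?\<alpha> - 3 * sqrt 2 * X)))) / (2 * pi * \<bar>int n\<bar>)"
  proof (rule residual_split)
    show "int n \<noteq> 0" using n0 by simp
    fix \<xi> assume xi: "\<xi> \<in> {Xb..X}"
    have eq: "pi * (\<kappa> - vel x) * cos (phase (\<kappa> + 2 * real_of_int (int n)) x) = m x * (pi * (?\<alpha> - vel x) * cos (phase ?\<alpha> x))" if "x \<in> {Xb..\<xi>}" for x
      using vx[of x] that xi by (simp add: m_def)
    have "\<bar>integral {Xb..\<xi>} (\<lambda>x. m x * (pi * (?\<alpha> - vel x) * cos (phase ?\<alpha> x)))\<bar> \<le> 2 * (- m Xb) + 2 * max (m X) 0"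
    proof (rule oscillatory_sign_change)
      show "(phase ?\<alpha> has_real_derivative pi * (?\<alpha> - vel x)) (at x within {Xb..X})" if "x \<in> {Xb..X}" for x
        using that Xb by (intro phase_deriv) auto
      show "m Xb \<le> 0" unfolding mA using p n by simp
    qed (use xi mono in auto)
    then show "\<bar>integral {Xb..\<xi>} (\<lambda>x. pi * (\<kappa> - vel x) * cos (phase (\<kappa> + 2 * real_of_int (int n)) x))\<bar> \<le> 2 * (- m Xb) + 2 * max (m X) 0"
      using integral_cong[of "{Xb..\<xi>}", OF eq] by simp
    show "\<bar>integral {Xb..\<xi>} (\<lambda>x. sin (phase (\<kappa> + 2 * real_of_int (int n)) x))\<bar> \<le> 2 / (pi * (?\<alpha> - 3 * sqrt 2 * X))"
      using oscillatory_above[OF al, of Xb \<xi>] xi by simp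
  qed
  also have "max (m X) 0 = max q 0 / (2 * real n + q)"
    unfolding mB using n by (simp add: max_divide_distrib_right)
  also have "?\<alpha> - 3 * sqrt 2 * X = 2 * real n - p" using p by simp
  also have "(2 / sqrt Xb * (2 * (- m Xb) + 2 * (max q 0 / (2 * real n + q))) + 1 / (Xb * sqrt Xb) * (2 / (pi * (2 * real n - p)))) / (2 * pi * \<bar>int n\<bar>)
     = 2 / sqrt Xb / pi * (p / (real n * (2 * real n - p)) + max q 0 / (real n * (2 * real n + q)))
     + 1 / (Xb * sqrt Xb) / pi\<^sup>2 / (real n * (2 * real n - p))"
    using residual_constants[OF n0, of "2 / sqrt Xb" "p / (2 * real n - p)" "max q 0 / (2 * real n + q)" "1 / (Xb * sqrt Xb)" "1 / (2 * real n - p)"]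
    by (simp only: mA divide_divide_eq_left mult.commute[of _ "real n"] times_divide_times_eq mult_1_right of_int_of_nat_eq abs_of_nat mult.right_neutral abs_minus)
  finally show ?thesis .
qed

lemma residual_below:
  fixes \<kappa> p q :: real and n :: nat
  assumes p: "p = 3 * sqrt 2 * X - \<kappa>" "0 \<le> p" and q: "q = \<kappa> - 4 * X" and n: "q < 2 * real n" "0 < n"
  shows "\<bar>res \<kappa> (- int n)\<bar> \<le> 2 / sqrt Xb / pi * (p / (real n * (2 * real n + p)) + max q 0 / (real n * (2 * real n - q)))
     + 1 / (Xb * sqrt Xb) / pi\<^sup>2 / (real n * (2 * real n - q))"
proof -
  let ?\<alpha> = "\<kappa> - 2 * real n"
  have n0: "0 < real n" using n by simp
  have al: "?\<alpha> < 4 * X" using q n by simp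
  define m where "m = (\<lambda>x. - ((\<kappa> - vel x) / (?\<alpha> - vel x)))"
  have vx: "?\<alpha> < vel x" if "x \<in> {Xb..X}" for x using vel_range(1)[of x] that al by auto
  have mf: "m x = 2 * real n / (vel x - ?\<alpha>) - 1" if "x \<in> {Xb..X}" for x
    using vx[OF that] by (simp add: m_def field_simps)
  have mono: "m x \<le> m y" if "Xb \<le> x" "x \<le> y" "y \<le> X" for x y
  proof -
    have "2 * real n / (vel x - ?\<alpha>) \<le> 2 * real n / (vel y - ?\<alpha>)"
      using vel_antimono[of x y] that Xb vx[of x] vx[of y] by (intro divide_left_mono) auto
    then show ?thesis using mf[of x] mf[of y] that by auto
  qed
  have mA: "m Xb = - (p / (2 * real n + p))" and mB: "m X = q / (2 * real n - q)"
  proof -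
    have e: "\<kappa> - 3 * sqrt 2 * X = - p" "\<kappa> - 2 * real n - 3 * sqrt 2 * X = - (2 * real n + p)"
      "\<kappa> - 4 * X = q" "\<kappa> - 2 * real n - 4 * X = - (2 * real n - q)" using p q by auto
    show "m Xb = - (p / (2 * real n + p))" "m X = q / (2 * real n - q)"
      unfolding m_def vel_Xb vel_X e by (simp_all only: minus_divide_divide minus_divide_right [symmetric] minus_minus)
  qed
  have "\<bar>res \<kappa> (- int n)\<bar> \<le> (2 / sqrt Xb * (2 * (- m Xb) + 2 * max (m X) 0) + 1 / (Xb * sqrt Xb) * (2 / (pi * (4 * X - ?\<alpha>)))) / (2 * pi * \<bar>- int n\<bar>)"
  proof (rule residual_split)
    show "- int n \<noteq> 0" using n0 by simp
    fix \<xi> assume xi: "\<xi> \<in> {Xb..X}"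
    have eq: "pi * (\<kappa> - vel x) * cos (phase (\<kappa> + 2 * real_of_int (- int n)) x) = - (m x * (pi * (?\<alpha> - vel x) * cos (phase ?\<alpha> x)))" if "x \<in> {Xb..\<xi>}" for x
      using vx[of x] that xi by (simp add: m_def)
    have "\<bar>integral {Xb..\<xi>} (\<lambda>x. m x * (pi * (?\<alpha> - vel x) * cos (phase ?\<alpha> x)))\<bar> \<le> 2 * (- m Xb) + 2 * max (m X) 0"
    proof (rule oscillatory_sign_change)
      show "(phase ?\<alpha> has_real_derivative pi * (?\<alpha> - vel x)) (at x within {Xb..X})" if "x \<in> {Xb..X}" for x
        using that Xb by (intro phase_deriv) auto
      show "m Xb \<le> 0" unfolding mA using p n by simp
    qed (use xi mono in auto)
    then have "\<bar>integral {Xb..\<xi>} (\<lambda>x. - (m x * (pi * (?\<alpha> - vel x) * cos (phase ?\<alpha> x))))\<bar> \<le> 2 * (- m Xb) + 2 * max (m X) 0"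
      by simp
    then show "\<bar>integral {Xb..\<xi>} (\<lambda>x. pi * (\<kappa> - vel x) * cos (phase (\<kappa> + 2 * real_of_int (- int n)) x))\<bar> \<le> 2 * (- m Xb) + 2 * max (m X) 0"
      using integral_cong[of "{Xb..\<xi>}", OF eq] by simp
    show "\<bar>integral {Xb..\<xi>} (\<lambda>x. sin (phase (\<kappa> + 2 * real_of_int (- int n)) x))\<bar> \<le> 2 / (pi * (4 * X - ?\<alpha>))"
      using oscillatory_below_sin[OF al, of Xb \<xi>] xi by simp
  qed
  also have "max (m X) 0 = max q 0 / (2 * real n - q)"
    unfolding mB using n by (simp add: max_divide_distrib_right)
  also have "4 * X - ?\<alpha> = 2 * real n - q" using q by simp
  also have "(2 / sqrt Xb * (2 * (- m Xb) + 2 * (max q 0 / (2 * real n - q))) + 1 / (Xb * sqrt Xb) * (2 / (pi * (2 * real n - q)))) / (2 * pi * \<bar>- int n\<bar>)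
     = 2 / sqrt Xb / pi * (p / (real n * (2 * real n + p)) + max q 0 / (real n * (2 * real n - q)))
     + 1 / (Xb * sqrt Xb) / pi\<^sup>2 / (real n * (2 * real n - q))"
    using residual_constants[OF n0, of "2 / sqrt Xb" "p / (2 * real n + p)" "max q 0 / (2 * real n - q)" "1 / (Xb * sqrt Xb)" "1 / (2 * real n - q)"]
    by (simp only: mA divide_divide_eq_left mult.commute[of _ "real n"] times_divide_times_eq mult_1_right of_int_of_nat_eq abs_of_nat mult.right_neutral abs_minus)
  finally show ?thesis .
qed

end

section \<open>The transition integral as an integral of an odd phase\<close>

definition cusp_phase :: "real \<Rightarrow> real \<Rightarrow> real" where
  "cusp_phase k z = (ln (1 + z) - ln (1 - z)) / 2 - k\<^sup>2 * z"

definition cusp_integrand :: "real \<Rightarrow> real \<Rightarrow> real \<Rightarrow> real" where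
  "cusp_integrand t k z = (1 - z\<^sup>2) powr (-1/4) * cos (t * cusp_phase k z)"

lemma cusp_phase_deriv:
  assumes "\<bar>z\<bar> < 1"
  shows "(cusp_phase k has_real_derivative 1 / (1 - z\<^sup>2) - k\<^sup>2) (at z within S)"
proof -
  have z: "0 < 1 + z" "0 < 1 - z" using assms by auto
  have "(cusp_phase k has_real_derivative (1 / (1 + z) + 1 / (1 - z)) / 2 - k\<^sup>2) (at z within S)"
    unfolding cusp_phase_def using z by (auto intro!: derivative_eq_intros)
  moreover have "(1 / (1 + z) + 1 / (1 - z)) / 2 = 1 / (1 - z\<^sup>2)"
  proof -
    have "1 - z\<^sup>2 = (1 + z) * (1 - z)" by (simp add: algebra_simps power2_eq_square)
    then show ?thesis using z by (simp add: divide_simps)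
  qed
  ultimately show ?thesis by simp
qed

lemma cusp_phase_0 [simp]: "cusp_phase k 0 = 0" by (simp add: cusp_phase_def)

lemma cusp_phase_minus: "cusp_phase k (- z) = - cusp_phase k z"
  by (simp add: cusp_phase_def diff_divide_distrib)

lemma cusp_integrand_even: "cusp_integrand t k (- z) = cusp_integrand t k z"
proof -
  have "t * cusp_phase k (- z) = - (t * cusp_phase k z)" by (simp add: cusp_phase_minus)
  then show ?thesis by (simp add: cusp_integrand_def)
qed

lemma cusp_integrand_continuous: "S \<subseteq> {-1<..<1} \<Longrightarrow> continuous_on S (cusp_integrand t k)"
proof -
  have "1 - x\<^sup>2 \<noteq> 0" if "x \<in> {-1<..<1}" for x :: real
    using that abs_square_less_1[of x] by auto
  then have "continuous_on {-1<..<1} (cusp_integrand t k)"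
    unfolding cusp_integrand_def cusp_phase_def by (intro continuous_intros) auto
  then show "S \<subseteq> {-1<..<1} \<Longrightarrow> continuous_on S (cusp_integrand t k)" by (rule continuous_on_subset)
qed

lemma powr_quarter_integrable:
  "(\<lambda>z::real. z powr (-1/4)) integrable_on {0..1}" "(\<lambda>z::real. (1 - z) powr (-1/4)) integrable_on {0..1}"
proof -
  show *: "(\<lambda>z::real. z powr (-1/4)) integrable_on {0..1}"
    using has_integral_powr_from_0[of "-1/4" 1] by (auto simp: integrable_on_def)
  show "(\<lambda>z::real. (1 - z) powr (-1/4)) integrable_on {0..1}"
    using integrable_affinity[of "\<lambda>z::real. z powr (-1/4)" 0 1 "-1" 1] *
    by (simp add: image_diff_atLeastAtMost[of 1 0 "1::real"])
qed

lemma powr_quarter_antimono: "0 < x \<Longrightarrow> x \<le> y \<Longrightarrow> (y::real) powr (-1/4) \<le> x powr (-1/4)"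
  by (intro powr_mono2') auto

lemma cusp_integrand_bound: "\<bar>cusp_integrand t k z\<bar> \<le> (1 - z\<^sup>2) powr (-1/4)"
  unfolding cusp_integrand_def abs_mult using abs_cos_le_one[of "t * cusp_phase k z"]
  by (simp add: mult_left_le)

lemma cusp_integrand_integrable: "cusp_integrand t k integrable_on {0..1}"
proof -
  have "cusp_integrand t k integrable_on {0<..<1}"
  proof (rule measurable_bounded_by_integrable_imp_integrable)
    show "cusp_integrand t k \<in> borel_measurable (lebesgue_on {0<..<1})"
      by (intro continuous_imp_measurable_on_sets_lebesgue cusp_integrand_continuous) auto
    show "(\<lambda>z::real. (1 - z) powr (-1/4)) integrable_on {0<..<1}"
      using powr_quarter_integrable(2) by (simp add: integrable_on_open_interval_real)
    show "norm (cusp_integrand t k z) \<le> (1 - z) powr (-1/4)" if "z \<in> {0<..<1}" for z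
    proof -
      have "(1 - z\<^sup>2) powr (-1/4) \<le> (1 - z) powr (-1/4)"
        using that by (intro powr_quarter_antimono) (auto simp: power2_eq_square mult_le_cancel_left1)
      then show ?thesis using cusp_integrand_bound[of t k z] by simp
    qed
  qed auto
  then show ?thesis by (simp add: integrable_on_open_interval_real)
qed

lemma cusp_tail:
  assumes t: "0 < t" and z0: "0 < z0" "z0 < 1" and D: "k\<^sup>2 * (1 - z0\<^sup>2) < 1"
  shows "\<bar>integral {z0..1} (cusp_integrand t k)\<bar> \<le> 2 * ((1 - z0\<^sup>2) powr (3/4) / (t * (1 - k\<^sup>2 * (1 - z0\<^sup>2))))" (is "_ \<le> ?B")
proof -
  define m where "m = (\<lambda>z. (1 - z\<^sup>2) powr (3/4) / (t * (1 - k\<^sup>2 * (1 - z\<^sup>2))))"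
  have sq: "z0\<^sup>2 \<le> x\<^sup>2" "x\<^sup>2 \<le> y\<^sup>2" "y\<^sup>2 \<le> 1" if "z0 \<le> x" "x \<le> y" "y \<le> 1" for x y
    using that z0 by (auto intro!: power_mono power_le_one)
  have pos: "0 < 1 - k\<^sup>2 * (1 - x\<^sup>2)" if "z0 \<le> x" "x \<le> 1" for x
  proof -
    have "k\<^sup>2 * (1 - x\<^sup>2) \<le> k\<^sup>2 * (1 - z0\<^sup>2)" using sq[of x x] that by (intro mult_left_mono) auto
    then show ?thesis using D by linarith
  qed
  have fin: "\<bar>integral {z0..z1} (cusp_integrand t k)\<bar> \<le> ?B" if z1: "z0 \<le> z1" "z1 < 1" for z1
  proof -
    obtain c where c: "((\<lambda>z. m z * (cos (t * cusp_phase k z) * (t * (1 / (1 - z\<^sup>2) - k\<^sup>2)))) has_integral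
        m z0 * (sin (t * cusp_phase k c) - sin (t * cusp_phase k z0))) {z0..z1}"
    proof (rule bonnet_decreasing[OF z1(1), of "\<lambda>z. sin (t * cusp_phase k z)" "\<lambda>z. cos (t * cusp_phase k z) * (t * (1 / (1 - z\<^sup>2) - k\<^sup>2))" m])
      show "((\<lambda>z. sin (t * cusp_phase k z)) has_real_derivative cos (t * cusp_phase k z) * (t * (1 / (1 - z\<^sup>2) - k\<^sup>2))) (at z within {z0..z1})"
        if "z \<in> {z0..z1}" for z
        using that z0 z1 by (auto intro!: derivative_eq_intros cusp_phase_deriv)
      show "m y \<le> m x" if "z0 \<le> x" "x \<le> y" "y \<le> z1" for x y
        unfolding m_def
      proof (rule frac_le)
        show "(1 - y\<^sup>2) powr (3/4) \<le> (1 - x\<^sup>2) powr (3/4)" using sq[of x y] that z1 by (intro powr_mono2) auto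
        show "0 < t * (1 - k\<^sup>2 * (1 - x\<^sup>2))" using pos[of x] that z1 t by simp
        have "k\<^sup>2 * (1 - y\<^sup>2) \<le> k\<^sup>2 * (1 - x\<^sup>2)" using sq[of x y] that z1 by (intro mult_left_mono) auto
        then show "t * (1 - k\<^sup>2 * (1 - x\<^sup>2)) \<le> t * (1 - k\<^sup>2 * (1 - y\<^sup>2))" using t by (intro mult_left_mono) auto
      qed auto
      show "0 \<le> m z1" unfolding m_def using pos[of z1] z1 t by simp
    qed
    have "(cusp_integrand t k has_integral m z0 * (sin (t * cusp_phase k c) - sin (t * cusp_phase k z0))) {z0..z1}"
    proof (rule has_integral_eq[OF _ c])
      fix z assume z: "z \<in> {z0..z1}"
      have p: "0 < 1 - k\<^sup>2 * (1 - z\<^sup>2)" using pos[of z] z z1 by auto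
      have q: "0 < 1 - z\<^sup>2" using z z0 z1 abs_square_less_1[of z] by auto
      have "(1 - z\<^sup>2) powr (3/4) = (1 - z\<^sup>2) powr (-1/4) * (1 - z\<^sup>2)"
        using q powr_add[of "1 - z\<^sup>2" "-1/4" 1] by simp
      moreover have "1 / (1 - z\<^sup>2) - k\<^sup>2 = (1 - k\<^sup>2 * (1 - z\<^sup>2)) / (1 - z\<^sup>2)" using q by (simp add: diff_divide_distrib)
      ultimately show "m z * (cos (t * cusp_phase k z) * (t * (1 / (1 - z\<^sup>2) - k\<^sup>2))) = cusp_integrand t k z"
        using t p q unfolding m_def cusp_integrand_def
        by (simp only: times_divide_eq_left times_divide_eq_right) (simp add: nonzero_divide_eq_eq)
    qed
    then have "\<bar>integral {z0..z1} (cusp_integrand t k)\<bar> = \<bar>m z0\<bar> * \<bar>sin (t * cusp_phase k c) - sin (t * cusp_phase k z0)\<bar>"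
      by (simp add: integral_unique abs_mult)
    also have "\<dots> \<le> m z0 * 2"
    proof (rule mult_mono)
      show "\<bar>m z0\<bar> \<le> m z0" unfolding m_def using pos[of z0] z0 t by simp
      show "\<bar>sin (t * cusp_phase k c) - sin (t * cusp_phase k z0)\<bar> \<le> 2"
        using abs_sin_le_one[of "t * cusp_phase k c"] abs_sin_le_one[of "t * cusp_phase k z0"] by linarith
    qed (use \<open>0 < t\<close> pos[of z0] z0 in \<open>auto simp: m_def\<close>)
    finally show ?thesis by (simp add: m_def mult.commute)
  qed
  have "continuous_on {z0..1} (\<lambda>z1. integral {z0..z1} (cusp_integrand t k))"
    using integrable_on_subinterval[OF cusp_integrand_integrable, of z0 1] z0 by (intro indefinite_integral_continuous_1) auto
  then have "((\<lambda>z1. integral {z0..z1} (cusp_integrand t k)) \<longlongrightarrow> integral {z0..1} (cusp_integrand t k)) (at 1 within {z0..1})"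
    using z0 by (auto simp: continuous_on_def)
  then have lim: "((\<lambda>z1. \<bar>integral {z0..z1} (cusp_integrand t k)\<bar>) \<longlongrightarrow> \<bar>integral {z0..1} (cusp_integrand t k)\<bar>) (at_left 1)"
    using z0 by (intro tendsto_rabs) (simp add: at_within_Icc_at_left)
  show ?thesis
  proof (rule tendsto_upperbound[OF lim])
    show "\<forall>\<^sub>F z1 in at_left 1. \<bar>integral {z0..z1} (cusp_integrand t k)\<bar> \<le> ?B"
      unfolding eventually_at_left_field using z0 fin by (intro exI[of _ z0]) auto
  qed simp
qed

text \<open>The substitution \<open>z = 1 - 2 * x\<close> makes the phase an odd function of \<open>z\<close> up to the constant
\<open>pi * (\<alpha>\<^sup>2 - 1) / 8\<close>. The odd part of the integrand cancels, and a real integral over half of the interval remains.\<close>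
lemma transition_integral_cusp:
  assumes t: "0 < t" and k: "t * k\<^sup>2 = pi * \<alpha>\<^sup>2 / 8" and c: "sin (pi * (\<alpha>\<^sup>2 - 1) / 8) = 0"
  shows "Re (exp (- (\<i> * of_real (pi / 8))) * transition_integral t \<alpha>)
     = cos (pi * (\<alpha>\<^sup>2 - 1) / 8) * sqrt 2 * integral {0..1} (cusp_integrand t k)"
proof -
  define F where "F = (\<lambda>x::real. exp (\<i> * of_real (pi * \<alpha>\<^sup>2 * x / 4) + \<i> * of_real (t / 2 * ln ((1 - x) / x)))
       / of_real ((x * (1 - x)) powr (1/4)) :: complex)"
  let ?e = "exp (- (\<i> * of_real (pi / 8))) :: complex"
  let ?s = "cos (pi * (\<alpha>\<^sup>2 - 1) / 8)"
  have ReF: "Re (?e * F x) = ?s * sqrt 2 * cusp_integrand t k (2 * x - 1)" if x: "x \<in> {0<..<1}" for x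
  proof -
    have "?e * F x = cis (- (pi / 8) + (pi * \<alpha>\<^sup>2 * x / 4 + t / 2 * ln ((1 - x) / x))) / of_real ((x * (1 - x)) powr (1/4))"
      unfolding F_def cis_conv_exp by (simp add: exp_add [symmetric] algebra_simps)
    then have re: "Re (?e * F x) = cos (- (pi / 8) + (pi * \<alpha>\<^sup>2 * x / 4 + t / 2 * ln ((1 - x) / x))) / (x * (1 - x)) powr (1/4)"
      by simp
    have ph: "- (pi / 8) + (pi * \<alpha>\<^sup>2 * x / 4 + t / 2 * ln ((1 - x) / x)) = pi * (\<alpha>\<^sup>2 - 1) / 8 - t * cusp_phase k (2 * x - 1)"
    proof -
      define L where "L = ln ((1 - x) / x)"
      define P where "P = cusp_phase k (2 * x - 1)"
      have "L = ln (2 * (1 - x)) - ln (2 * x)" unfolding L_def using x ln_mult[of 2 "1 - x"] ln_mult[of 2 x] ln_div[of "1 - x" x] by simp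
      then have "P = - (L / 2) - k\<^sup>2 * (2 * x - 1)" by (simp add: P_def cusp_phase_def algebra_simps diff_divide_distrib)
      then have "t * P = - (t * L / 2) - t * k\<^sup>2 * (2 * x - 1)" by (simp add: right_diff_distrib)
      then have "t * P = - (t * L / 2) - pi * \<alpha>\<^sup>2 / 8 * (2 * x - 1)" unfolding k .
      then show ?thesis unfolding L_def[symmetric] P_def[symmetric] by (simp add: field_simps)
    qed
    have co: "cos (pi * (\<alpha>\<^sup>2 - 1) / 8 - t * cusp_phase k (2 * x - 1)) = ?s * cos (t * cusp_phase k (2 * x - 1))" using c by (simp add: cos_diff)
    have we: "1 / (x * (1 - x)) powr (1/4) = sqrt 2 * (1 - (2 * x - 1)\<^sup>2) powr (-1/4)"
    proof -
      have "1 - (2 * x - 1)\<^sup>2 = 4 * (x * (1 - x))" by (simp add: power2_eq_square algebra_simps)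
      moreover have "(4::real) powr (-1/4) * sqrt 2 = 1"
      proof -
        have "(4::real) powr (-1/4) = (2 powr 2) powr (-1/4)" by simp
        also have "\<dots> = 2 powr (-1/2)" unfolding powr_powr by simp
        also have "\<dots> = 1 / sqrt 2" by (simp add: powr_minus_divide powr_half_sqrt)
        finally show ?thesis by simp
      qed
      ultimately show ?thesis using x by (simp add: powr_mult powr_minus_divide)
    qed
    have "Re (?e * F x) = ?s * cos (t * cusp_phase k (2 * x - 1)) * (1 / (x * (1 - x)) powr (1/4))"
      unfolding re ph co by simp
    then show ?thesis unfolding we cusp_integrand_def by (simp only: mult.assoc mult.commute mult.left_commute)
  qed
  have "F integrable_on {0<..<1}"
  proof (rule measurable_bounded_by_integrable_imp_integrable)
    have "(x * (1 - x)) powr (1/4) \<noteq> 0" if "x \<in> {0<..<1}" for x :: real using that by auto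
    then have "continuous_on {0<..<1} F" unfolding F_def by (intro continuous_intros) auto
    then show "F \<in> borel_measurable (lebesgue_on {0<..<1})"
      by (intro continuous_imp_measurable_on_sets_lebesgue) auto
    show "(\<lambda>x::real. 2 powr (1/4) * (x powr (-1/4) + (1 - x) powr (-1/4))) integrable_on {0<..<1}"
      unfolding integrable_on_open_interval_real
      by (intro integrable_on_mult_right integrable_add powr_quarter_integrable)
    fix x :: real assume x: "x \<in> {0<..<1}"
    have "norm (F x) = (x * (1 - x)) powr (-1/4)"
      unfolding F_def using x by (simp add: norm_divide powr_minus_divide exp_add norm_mult)
    also have "\<dots> \<le> 2 powr (1/4) * (x powr (-1/4) + (1 - x) powr (-1/4))"
    proof -
      have half: "(y / 2) powr (-1/4) = 2 powr (1/4) * y powr (-1/4)" if "0 < y" for y :: real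
        using that by (simp add: powr_divide powr_minus_divide)
      show ?thesis
      proof (cases "x \<le> 1/2")
        case True
        then have "x / 2 \<le> x * (1 - x)" using x by (auto simp: field_simps)
        then have "(x * (1 - x)) powr (-1/4) \<le> (x / 2) powr (-1/4)" using x by (intro powr_quarter_antimono) auto
        then show ?thesis using x half[of x] by (auto simp: distrib_left intro: add_increasing2)
      next
        case False
        then have "(1 - x) / 2 \<le> x * (1 - x)" using x mult_right_mono[of "1/2" x "1 - x"] by auto
        then have "(x * (1 - x)) powr (-1/4) \<le> ((1 - x) / 2) powr (-1/4)" using x by (intro powr_quarter_antimono) auto
        then show ?thesis using x half[of "1 - x"] by (auto simp: distrib_left intro: add_increasing)
      qed
    qed
    finally show "norm (F x) \<le> 2 powr (1/4) * (x powr (-1/4) + (1 - x) powr (-1/4))" .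
  qed auto
  then have "(F has_integral integral {0..1} F) {0<..<1}"
    by (metis integral_open_interval_real integrable_integral)
  from has_integral_linear[OF has_integral_mult_right[OF this, of ?e] bounded_linear_Re]
  have 1: "((\<lambda>x. Re (?e * F x)) has_integral Re (?e * integral {0..1} F)) {0<..<1}" by (simp add: o_def)
  define I where "I = integral {0..1} (cusp_integrand t k)"
  have r: "(cusp_integrand t k has_integral I) {0..1}" unfolding I_def by (rule integrable_integral[OF cusp_integrand_integrable])
  have l: "(cusp_integrand t k has_integral I) {-1..0}"
    using has_integral_reflect_real[of "cusp_integrand t k" I 1 0] r by (simp add: cusp_integrand_even)
  have "(cusp_integrand t k has_integral (I + I)) {-1..1}"
    by (rule has_integral_combine[OF _ _ l r]) auto
  then have "(cusp_integrand t k has_integral (I + I)) (cbox (-1) 1)" by simp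
  from has_integral_affinity'[OF this, of 2 "-1"]
  have "((\<lambda>x. cusp_integrand t k (2 * x - 1)) has_integral I) {0..1}" by simp
  from has_integral_mult_right[OF this, of "?s * sqrt 2"]
  have "((\<lambda>x. ?s * sqrt 2 * cusp_integrand t k (2 * x - 1)) has_integral ?s * sqrt 2 * I) {0<..<1}"
    by (simp add: has_integral_Icc_iff_Ioo mult.assoc)
  from has_integral_eq[OF _ this, of "\<lambda>x. Re (?e * F x)"] ReF
  have "((\<lambda>x. Re (?e * F x)) has_integral ?s * sqrt 2 * I) {0<..<1}" by auto
  from has_integral_unique[OF 1 this] show ?thesis by (simp add: transition_integral_def F_def I_def)
qed

section \<open>The wave of the turning point, unfolded\<close>

lemma arctan_taylor_bounds:
  fixes x :: real assumes "0 \<le> x"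
  shows "x - x^3/3 + x^5/5 - x^7/7 \<le> arctan x" "arctan x \<le> x - x^3/3 + x^5/5 - x^7/7 + x^9/9"
proof -
  have pos: "1 + y\<^sup>2 > 0" for y :: real by (simp add: add_pos_nonneg)
  have "\<exists>d. ((\<lambda>x. arctan x - (x - x^3/3 + x^5/5 - x^7/7)) has_real_derivative d) (at y) \<and> 0 \<le> d" for y :: real
  proof (intro exI conjI)
    show "((\<lambda>x. arctan x - (x - x^3/3 + x^5/5 - x^7/7)) has_real_derivative inverse (1 + y\<^sup>2) - (1 - y^2 + y^4 - y^6)) (at y)"
      by (auto intro!: derivative_eq_intros)
    have "inverse (1 + y\<^sup>2) - (1 - y^2 + y^4 - y^6) = y^8 / (1 + y\<^sup>2)"
      using pos[of y] by (simp add: divide_simps) (simp add: algebra_simps power_add [symmetric])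
    then show "0 \<le> inverse (1 + y\<^sup>2) - (1 - y^2 + y^4 - y^6)" using pos[of y] by simp
  qed
  from DERIV_nonneg_imp_nondecreasing[OF assms this]
  show "x - x^3/3 + x^5/5 - x^7/7 \<le> arctan x" by simp
  have "\<exists>d. ((\<lambda>x. x - x^3/3 + x^5/5 - x^7/7 + x^9/9 - arctan x) has_real_derivative d) (at y) \<and> 0 \<le> d" for y :: real
  proof (intro exI conjI)
    show "((\<lambda>x. x - x^3/3 + x^5/5 - x^7/7 + x^9/9 - arctan x) has_real_derivative (1 - y^2 + y^4 - y^6 + y^8) - inverse (1 + y\<^sup>2)) (at y)"
      by (auto intro!: derivative_eq_intros)
    have "(1 - y^2 + y^4 - y^6 + y^8) - inverse (1 + y\<^sup>2) = y^10 / (1 + y\<^sup>2)"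
      using pos[of y] by (simp add: divide_simps) (simp add: algebra_simps power_add [symmetric])
    then show "0 \<le> (1 - y^2 + y^4 - y^6 + y^8) - inverse (1 + y\<^sup>2)" using pos[of y] by simp
  qed
  from DERIV_nonneg_imp_nondecreasing[OF assms this]
  show "arctan x \<le> x - x^3/3 + x^5/5 - x^7/7 + x^9/9" by simp
qed

lemma pi_bounds: "3.14159 < pi" "pi < 3.1416"
proof -
  have "pi = 16 * arctan (1/5) - 4 * arctan (1/239)" using machin by simp
  then show "3.14159 < pi" "pi < 3.1416"
    using arctan_taylor_bounds[of "1/5"] arctan_taylor_bounds[of "1/239"] by (simp_all add: power_divide)
qed

context hardy
begin

definition "folded \<alpha> w = phase \<alpha> (X * (1 - w / 2)\<^sup>2) - pi * (\<alpha>\<^sup>2 - 1) / 8" for \<alpha> w :: real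

definition "fold_end = 2 * (1 - 1 / sqrt (sqrt 2))"

lemma fold_end: "0.3181 \<le> fold_end" "fold_end \<le> 0.3183" "(1 - fold_end / 2)\<^sup>2 = 1 / sqrt 2"
proof -
  have s2: "1.414213 \<le> sqrt 2" "sqrt 2 \<le> 1.414214" by (intro real_le_rsqrt real_le_lsqrt; simp add: power2_eq_square)+
  have "1.18920 \<le> sqrt (sqrt 2)" "sqrt (sqrt 2) \<le> 1.18921"
    by (intro real_le_rsqrt real_le_lsqrt; use s2 in \<open>simp add: power2_eq_square\<close>)+
  then have "1 / 1.18921 \<le> 1 / sqrt (sqrt 2)" "1 / sqrt (sqrt 2) \<le> 1 / 1.18920"
    by (auto simp: field_simps)
  then show "0.3181 \<le> fold_end" "fold_end \<le> 0.3183" unfolding fold_end_def by auto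
  show "(1 - fold_end / 2)\<^sup>2 = 1 / sqrt 2"
  proof -
    have "1 - 2 * (1 - u) / 2 = u" for u :: real by (simp add: field_simps)
    then show ?thesis by (simp only: fold_end_def power_divide) simp
  qed
qed

definition "fold_speed k w = 1 / (1 - w / 2) + (1 - w / 2) ^ 3 - 2 * k * (1 - w / 2)" for k w :: real

lemma folded_deriv:
  assumes "w < 2"
  shows "(folded \<alpha> has_real_derivative t * fold_speed (\<alpha> / (4 * X)) w) (at w within S)"
proof -
  have s: "0 < 1 - w / 2" using assms by simp
  have g: "((\<lambda>w. X * (1 - w / 2)\<^sup>2) has_real_derivative - (X * (1 - w / 2))) (at w within S)"
    by (auto intro!: derivative_eq_intros)
  have "((\<lambda>w. phase \<alpha> (X * (1 - w / 2)\<^sup>2)) has_real_derivative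
      pi * (\<alpha> - vel (X * (1 - w / 2)\<^sup>2)) * - (X * (1 - w / 2))) (at w within S)"
    by (rule DERIV_chain2[OF phase_deriv g]) (use s X_pos in simp)
  then have 1: "(folded \<alpha> has_real_derivative pi * (\<alpha> - vel (X * (1 - w / 2)\<^sup>2)) * - (X * (1 - w / 2))) (at w within S)"
    unfolding folded_def by (auto intro!: derivative_eq_intros)
  have "pi * (\<alpha> - vel (X * s\<^sup>2)) * - (X * s) = t * (1 / s + s ^ 3 - 2 * (\<alpha> / (4 * X)) * s)" if "0 < s" for s
    using that X_pos by (simp add: vel_def t_def field_simps power2_eq_square power3_eq_cube)
  from this[OF s] 1 show ?thesis by (simp only: fold_speed_def)
qed

lemma folded_0: "folded \<alpha> 0 = - (pi * (4 * X - \<alpha>)\<^sup>2 / 8)"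
  by (simp add: folded_def phase_def t_def power2_eq_square field_simps)

lemma folded_continuous: "S \<subseteq> {..<2} \<Longrightarrow> continuous_on S (folded \<alpha>)"
  using folded_deriv by (intro DERIV_continuous_on) blast

text \<open>The substitution \<open>x = X * (1 - w / 2)\<^sup>2\<close> absorbs the weight \<open>1 / sqrt x\<close>; in the variable \<open>w\<close> the
phase has the same cubic behaviour as \<open>cusp_phase\<close>.\<close>
lemma wave_folded:
  assumes "sin (pi * (\<alpha>\<^sup>2 - 1) / 8) = 0"
  shows "wave \<alpha> = cos (pi * (\<alpha>\<^sup>2 - 1) / 8) * (2 * sqrt X * integral {0..fold_end} (\<lambda>w. cos (folded \<alpha> w)))"
proof -
  define G where "G = (\<lambda>w. X * (1 - w / 2)\<^sup>2)"
  let ?f = "\<lambda>x. 2 / sqrt x * cos (phase \<alpha> x)"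
  have G: "G 0 = X" "G fold_end = Xb" using fold_end by (simp_all add: G_def Xb_def)
  have "((\<lambda>w. - (X * (1 - w / 2)) *\<^sub>R ?f (G w)) has_integral (integral {G 0..G fold_end} ?f - integral {G fold_end..G 0} ?f)) {0..fold_end}"
  proof (rule has_integral_substitution_general[where s = "{}"])
    show "G ` {0..fold_end} \<subseteq> {Xb..X}"
    proof (intro image_subsetI)
      fix w assume w: "w \<in> {0..fold_end}"
      have "(1 - fold_end / 2)\<^sup>2 \<le> (1 - w / 2)\<^sup>2" "(1 - w / 2)\<^sup>2 \<le> 1"
        using w fold_end(1,2) by (auto intro!: power_mono power_le_one)
      then have "X * (1 - fold_end / 2)\<^sup>2 \<le> X * (1 - w / 2)\<^sup>2" "X * (1 - w / 2)\<^sup>2 \<le> X * 1"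
        using X_pos by (auto intro!: mult_left_mono)
      then show "G w \<in> {Xb..X}" unfolding G(2)[symmetric] by (simp add: G_def)
    qed
    show "continuous_on {Xb..X} ?f" using Xb by (intro continuous_intros phase_continuous) auto
    show "continuous_on {0..fold_end} G" unfolding G_def by (intro continuous_intros) auto
    show "(G has_real_derivative - (X * (1 - w / 2))) (at w within {0..fold_end})" for w
      unfolding G_def by (auto intro!: derivative_eq_intros)
  qed (use fold_end in auto)
  moreover have "integral {X..Xb} ?f = 0" using Xb by simp
  ultimately have "((\<lambda>w. - (X * (1 - w / 2)) * ?f (G w)) has_integral - wave \<alpha>) {0..fold_end}"
    unfolding G wave_def by simp
  from has_integral_neg[OF this]
  have 1: "((\<lambda>w. X * (1 - w / 2) * ?f (G w)) has_integral wave \<alpha>) {0..fold_end}" by simp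
  have "((\<lambda>w. cos (pi * (\<alpha>\<^sup>2 - 1) / 8) * (2 * sqrt X * cos (folded \<alpha> w))) has_integral wave \<alpha>) {0..fold_end}"
  proof (rule has_integral_eq[OF _ 1])
    fix w assume w: "w \<in> {0..fold_end}"
    then have s: "0 < 1 - w / 2" using fold_end by auto
    have "X * (1 - w / 2) * (2 / sqrt (G w)) = 2 * sqrt X"
    proof -
      have "sqrt (G w) = sqrt X * (1 - w / 2)" unfolding G_def using s X_pos by (simp add: real_sqrt_mult)
      moreover have "X * v * (2 / (sqrt X * v)) = 2 * sqrt X" if "0 < v" for v
      proof -
        have "X = sqrt X * sqrt X" "sqrt X \<noteq> 0" using X_pos by auto
        then show ?thesis using that by (simp add: field_simps)
      qed
      ultimately show ?thesis using s by (simp only:)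
    qed
    moreover have "cos (phase \<alpha> (G w)) = cos (pi * (\<alpha>\<^sup>2 - 1) / 8 + folded \<alpha> w)" by (simp add: folded_def G_def)
    moreover have "\<dots> = cos (pi * (\<alpha>\<^sup>2 - 1) / 8) * cos (folded \<alpha> w)" using assms by (simp add: cos_add)
    ultimately show "X * (1 - w / 2) * ?f (G w) = cos (pi * (\<alpha>\<^sup>2 - 1) / 8) * (2 * sqrt X * cos (folded \<alpha> w))"
      by (metis (no_types, lifting) mult.assoc mult.left_commute)
  qed
  from integral_unique[OF this] show ?thesis by simp
qed

lemma folded_tail:
  fixes \<alpha> w0 :: real
  defines "k \<equiv> \<alpha> / (4 * X)"
  assumes w0: "0 \<le> w0" "w0 \<le> 1" "w0 \<le> w1" "w1 < 2" and k: "2 * (1 - k) \<le> 2 * w0"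
    and pos: "0 < fold_speed k w0"
  shows "\<bar>integral {w0..w1} (\<lambda>w. cos (folded \<alpha> w))\<bar> \<le> 2 / (t * fold_speed k w0)"
proof -
  define g where "g = (\<lambda>w. 1 / (t * fold_speed k w))"
  have mono: "fold_speed k x \<le> fold_speed k y" if "w0 \<le> x" "x \<le> y" "y < 2" for x y
  proof -
    define p where "p = 1 - x / 2"
    define q where "q = 1 - y / 2"
    define S where "S = 1 - w0 / 2"
    have pq: "0 < q" "q \<le> p" "p \<le> S" "S \<le> 1" "1/2 \<le> S" using that w0 by (auto simp: p_def q_def S_def)
    have "p * q \<le> 1" using pq by (intro mult_le_one) auto
    then have a: "1 \<le> 1 / (p * q)" using pq by simp
    have b: "p\<^sup>2 + p * q + q\<^sup>2 \<le> 3 * S\<^sup>2"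
    proof -
      have "p\<^sup>2 \<le> S\<^sup>2" "q\<^sup>2 \<le> S\<^sup>2" "p * q \<le> S * S" using pq by (auto intro!: power_mono mult_mono)
      then show ?thesis by (simp add: power2_eq_square)
    qed
    have c: "3 * S\<^sup>2 \<le> 1 + 2 * k"
    proof -
      have "3 * S\<^sup>2 = 3 - 3 * w0 + 3 / 4 * w0\<^sup>2" by (simp add: S_def power2_eq_square algebra_simps)
      moreover have "w0\<^sup>2 \<le> w0" using w0 by (simp add: power2_eq_square mult_left_le)
      moreover have "2 - 2 * k \<le> 2 * w0" using k by simp
      ultimately show ?thesis using w0(1) by argo
    qed
    have "fold_speed k y - fold_speed k x = (p - q) * (1 / (p * q) - (p\<^sup>2 + p * q + q\<^sup>2) + 2 * k)"
      using pq by (simp add: fold_speed_def p_def[symmetric] q_def[symmetric] field_simps power2_eq_square power3_eq_cube)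
    moreover have "0 \<le> (p - q) * (1 / (p * q) - (p\<^sup>2 + p * q + q\<^sup>2) + 2 * k)"
      using pq a b c by (intro mult_nonneg_nonneg) linarith+
    ultimately show ?thesis by simp
  qed
  have fp: "0 < fold_speed k x" if "w0 \<le> x" "x < 2" for x using mono[of w0 x] pos that by linarith
  obtain c where c: "((\<lambda>w. g w * (cos (folded \<alpha> w) * (t * fold_speed k w))) has_integral g w0 * (sin (folded \<alpha> c) - sin (folded \<alpha> w0))) {w0..w1}"
  proof (rule bonnet_decreasing[OF w0(3), of "\<lambda>w. sin (folded \<alpha> w)" "\<lambda>w. cos (folded \<alpha> w) * (t * fold_speed k w)" g])
    show "((\<lambda>w. sin (folded \<alpha> w)) has_real_derivative cos (folded \<alpha> w) * (t * fold_speed k w)) (at w within {w0..w1})" if "w \<in> {w0..w1}" for w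
      using that w0 unfolding k_def by (auto intro!: derivative_eq_intros folded_deriv)
    show "g y \<le> g x" if "w0 \<le> x" "x \<le> y" "y \<le> w1" for x y
      unfolding g_def using that mono[of x y] fp[of x] fp[of y] t_pos w0 by (intro divide_left_mono mult_left_mono) auto
    show "0 \<le> g w1" using fp[of w1] t_pos w0 by (simp add: g_def)
  qed
  have "((\<lambda>w. cos (folded \<alpha> w)) has_integral g w0 * (sin (folded \<alpha> c) - sin (folded \<alpha> w0))) {w0..w1}"
  proof (rule has_integral_eq[OF _ c])
    fix w assume "w \<in> {w0..w1}"
    then have "0 < fold_speed k w" using fp w0 by auto
    then show "g w * (cos (folded \<alpha> w) * (t * fold_speed k w)) = cos (folded \<alpha> w)" using t_pos by (simp add: g_def)
  qed
  then have "\<bar>integral {w0..w1} (\<lambda>w. cos (folded \<alpha> w))\<bar> = g w0 * \<bar>sin (folded \<alpha> c) - sin (folded \<alpha> w0)\<bar>"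
    using fp[of w0] t_pos w0 by (simp add: integral_unique abs_mult g_def)
  also have "\<dots> \<le> g w0 * 2"
  proof (rule mult_left_mono)
    show "\<bar>sin (folded \<alpha> c) - sin (folded \<alpha> w0)\<bar> \<le> 2"
      using abs_sin_le_one[of "folded \<alpha> c"] abs_sin_le_one[of "folded \<alpha> w0"] by linarith
  qed (use fp[of w0] t_pos w0 in \<open>simp add: g_def\<close>)
  finally show ?thesis by (simp add: g_def)
qed

lemma sqrt_X_powr: "sqrt 2 * (pi / 2) powr (1/4) * sqrt X = t powr (1/4)"
proof -
  have "t = pi / 2 * (2 * X)\<^sup>2" by (simp add: t_def power2_eq_square)
  then have "t powr (1/4) = (pi / 2) powr (1/4) * ((2 * X)\<^sup>2) powr (1/4)" using powr_mult[of "pi / 2" "(2 * X)\<^sup>2" "1/4"] by simp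
  also have "((2 * X)\<^sup>2) powr (1/4) = sqrt (2 * X)"
  proof -
    have "((2 * X)\<^sup>2) powr (1/4) = ((2 * X) powr 2) powr (1/4)" using X_pos by simp
    also have "\<dots> = (2 * X) powr (1/2)" unfolding powr_powr by simp
    finally show ?thesis using X_pos by (simp add: powr_half_sqrt)
  qed
  finally show ?thesis by (simp add: real_sqrt_mult)
qed

lemma transition_term_cusp:
  fixes \<alpha> :: real
  defines "k \<equiv> \<alpha> / (4 * X)"
  assumes c: "sin (pi * (\<alpha>\<^sup>2 - 1) / 8) = 0"
  shows "(1 + 1 / (32 * t\<^sup>2)) * ((pi / 2) powr (1/4) * \<alpha> / (2 * t powr (1/4)))
        * Re (exp (- (\<i> * of_real (pi / 8))) * transition_integral t \<alpha>)
     = cos (pi * (\<alpha>\<^sup>2 - 1) / 8) * (2 * sqrt X * (k * (1 + 1 / (32 * t\<^sup>2)) * integral {0..1} (cusp_integrand t k)))"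
proof -
  have k: "t * k\<^sup>2 = pi * \<alpha>\<^sup>2 / 8" using X_pos by (simp add: k_def t_def power_divide power_mult_distrib)
  have P: "0 < (pi / 2) powr (1/4)" by simp
  have XX: "X = sqrt X * sqrt X" using X_pos by simp
  have pre: "(pi / 2) powr (1/4) * \<alpha> / (2 * t powr (1/4)) * sqrt 2 = k * (2 * sqrt X)"
  proof -
    have "\<alpha> = 4 * k * (sqrt X * sqrt X)" using X_pos by (simp add: k_def)
    then show ?thesis unfolding sqrt_X_powr[symmetric] using P X_pos by (simp add: field_simps)
  qed
  have "(1 + 1 / (32 * t\<^sup>2)) * ((pi / 2) powr (1/4) * \<alpha> / (2 * t powr (1/4)))
        * Re (exp (- (\<i> * of_real (pi / 8))) * transition_integral t \<alpha>)
    = (1 + 1 / (32 * t\<^sup>2)) * ((pi / 2) powr (1/4) * \<alpha> / (2 * t powr (1/4)) * sqrt 2)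
       * (cos (pi * (\<alpha>\<^sup>2 - 1) / 8) * integral {0..1} (cusp_integrand t k))"
    unfolding transition_integral_cusp[OF t_pos k c] by (simp only: mult_ac)
  also have "\<dots> = cos (pi * (\<alpha>\<^sup>2 - 1) / 8) * (2 * sqrt X * (k * (1 + 1 / (32 * t\<^sup>2)) * integral {0..1} (cusp_integrand t k)))"
    unfolding pre by (simp only: mult_ac)
  finally show ?thesis .
qed

end

section \<open>Comparison of the two cubic phases\<close>

lemma inverse_fourth_root_le:
  fixes x c :: real assumes "0 < x" "0 < c" "1 \<le> c ^ 4 * x"
  shows "x powr (-1/4) \<le> c"
proof -
  have "1 / x \<le> c ^ 4" using assms by (simp add: field_simps)
  then have "(1 / x) powr (1/4) \<le> (c ^ 4) powr (1/4)" using assms by (intro powr_mono2) auto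
  also have "(c ^ 4) powr (1/4) = c"
  proof -
    have "(c ^ 4) powr (1/4) = (c powr 4) powr (1/4)" using assms by (simp add: powr_numeral)
    then show ?thesis unfolding powr_powr using assms by simp
  qed
  finally show ?thesis using assms by (simp add: powr_divide powr_minus_divide)
qed

lemma inverse_fourth_root_bound:
  fixes y :: real assumes "0 \<le> y" "y \<le> (507/5000)"
  shows "1 \<le> (1 - y) powr (-1/4)" "(1 - y) powr (-1/4) \<le> 1 + (7/25) * y"
proof -
  have "(1 - y) powr (-1/4) = 1 / (1 - y) powr (1/4)" by (simp add: powr_minus_divide)
  moreover have "(1 - y) powr (1/4) \<le> 1" using assms by (intro powr_le1) auto
  ultimately show "1 \<le> (1 - y) powr (-1/4)" using assms by simp
  have "1 * (1 + (28/25) * y) \<le> (1 + (7/25) * y) ^ 4"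
    using Bernoulli_inequality[of "(7/25) * y" 4] assms by simp
  moreover have "1 \<le> (1 + (28/25) * y) * (1 - y)"
  proof -
    have "y * y \<le> (507/5000) * y" using assms by (intro mult_right_mono) auto
    then show ?thesis using assms by (simp add: algebra_simps)
  qed
  moreover have "(1 + (28/25) * y) * (1 - y) \<le> (1 + (7/25) * y) ^ 4 * (1 - y)"
    using calculation(1) assms by (intro mult_right_mono) auto
  ultimately have "1 \<le> (1 + (7/25) * y) ^ 4 * (1 - y)" by linarith
  then show "(1 - y) powr (-1/4) \<le> 1 + (7/25) * y" using assms by (intro inverse_fourth_root_le) auto
qed

lemma abs_le_by_deriv:
  fixes f B :: "real \<Rightarrow> real"
  assumes "a \<le> b" and "\<And>x. a \<le> x \<Longrightarrow> x \<le> b \<Longrightarrow> (f has_real_derivative f' x) (at x)"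
    and "\<And>x. a \<le> x \<Longrightarrow> x \<le> b \<Longrightarrow> (B has_real_derivative B' x) (at x)"
    and "\<And>x. a \<le> x \<Longrightarrow> x \<le> b \<Longrightarrow> \<bar>f' x\<bar> \<le> B' x"
  shows "\<bar>f b - f a\<bar> \<le> B b - B a"
proof -
  have "B a - f a \<le> B b - f b"
  proof (rule DERIV_nonneg_imp_nondecreasing[OF assms(1)])
    fix x assume x: "a \<le> x" "x \<le> b"
    show "\<exists>d. ((\<lambda>x. B x - f x) has_real_derivative d) (at x) \<and> 0 \<le> d"
      using DERIV_diff[OF assms(3)[OF x] assms(2)[OF x]] assms(4)[OF x] by (intro exI[of _ "B' x - f' x"]) auto
  qed
  moreover have "B a + f a \<le> B b + f b"
  proof (rule DERIV_nonneg_imp_nondecreasing[OF assms(1)])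
    fix x assume x: "a \<le> x" "x \<le> b"
    show "\<exists>d. ((\<lambda>x. B x + f x) has_real_derivative d) (at x) \<and> 0 \<le> d"
      using DERIV_add[OF assms(3)[OF x] assms(2)[OF x]] assms(4)[OF x] by (intro exI[of _ "B' x + f' x"]) auto
  qed
  ultimately show ?thesis by linarith
qed

context hardy
begin

lemma fold_speed_eq:
  assumes "x < 2"
  shows "fold_speed k x = x\<^sup>2 + x ^ 4 / (16 * (1 - x / 2)) + 2 * (1 - k) * (1 - x / 2)"
proof -
  define s where "s = 1 - x / 2"
  have s: "0 < s" using assms by (simp add: s_def)
  have xs: "x = 2 * (1 - s)" by (simp add: s_def)
  have e1: "1 / s + s ^ 3 - 2 * s = x\<^sup>2 + x ^ 4 / (16 * s)"
  proof -
    have "16 * (1 + s ^ 4 - 2 * s\<^sup>2) = 16 * s * x\<^sup>2 + x ^ 4" unfolding xs by algebra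
    then have "1 + s ^ 4 - 2 * s\<^sup>2 = s * x\<^sup>2 + x ^ 4 / 16" by simp
    moreover have "s * (1 / s + s ^ 3 - 2 * s) = 1 + s ^ 4 - 2 * s\<^sup>2"
      using s by (simp add: distrib_left right_diff_distrib power2_eq_square power3_eq_cube power4_eq_xxxx)
    moreover have "s * (x\<^sup>2 + x ^ 4 / (16 * s)) = s * x\<^sup>2 + x ^ 4 / 16" using s by (simp add: distrib_left)
    ultimately have "s * (1 / s + s ^ 3 - 2 * s) = s * (x\<^sup>2 + x ^ 4 / (16 * s))" by (simp only:)
    then show ?thesis using s by simp
  qed
  then show ?thesis unfolding fold_speed_def s_def[symmetric] by (simp add: algebra_simps)
qed

text \<open>Both derivatives begin with \<open>t * z\<^sup>2\<close>, hence for \<open>\<alpha> = 4 * X\<close> the phases differ only at fifth order; the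
other terms measure the distance of \<open>\<alpha>\<close> from the turning point.\<close>
lemma phase_gap:
  fixes \<alpha> z :: real
  defines "h \<equiv> 1 - \<alpha> / (4 * X)"
  assumes z: "0 \<le> z" "z \<le> (3183/10000)"
  shows "\<bar>t * cusp_phase (\<alpha> / (4 * X)) z - folded \<alpha> z\<bar>
     \<le> pi * (4 * X - \<alpha>)\<^sup>2 / 8 + t * ((2101/10000) * z ^ 5 + \<bar>h\<bar> * z\<^sup>2 / 2 + h\<^sup>2 * z)"
proof -
  let ?k = "\<alpha> / (4 * X)"
  let ?f = "\<lambda>z. t * cusp_phase ?k z - folded \<alpha> z"
  let ?B = "\<lambda>z. t * ((2101/10000) * z ^ 5 + \<bar>h\<bar> * z\<^sup>2 / 2 + h\<^sup>2 * z)"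
  have "\<bar>?f z - ?f 0\<bar> \<le> ?B z - ?B 0"
  proof (rule abs_le_by_deriv[OF z(1)])
    fix x assume x: "0 \<le> x" "x \<le> z"
    then have x1: "\<bar>x\<bar> < 1" "x < 2" using z by auto
    show "(?f has_real_derivative t * (1 / (1 - x\<^sup>2) - ?k\<^sup>2) - t * fold_speed ?k x) (at x)"
      using x1 by (intro derivative_intros DERIV_cmult cusp_phase_deriv folded_deriv) auto
    show "(?B has_real_derivative t * ((2101/2000) * x ^ 4 + \<bar>h\<bar> * x + h\<^sup>2)) (at x)"
      by (auto intro!: derivative_eq_intros)
    have x2: "x\<^sup>2 \<le> (507/5000)"
    proof -
      have "x\<^sup>2 \<le> (3183/10000)\<^sup>2" using x z by (intro power_mono) auto
      then show ?thesis by (simp add: power2_eq_square)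
    qed
    define s where "s = 1 - x / 2"
    have s: "(21/25) \<le> s" "s \<le> 1" using x z by (auto simp: s_def)
    have xs: "x = 2 * (1 - s)" by (simp add: s_def)
    have e1: "fold_speed ?k x = x\<^sup>2 + x ^ 4 / (16 * s) + 2 * (1 - ?k) * s"
      using fold_speed_eq[OF x1(2)] by (simp only: s_def)
    have e2: "1 / (1 - x\<^sup>2) = 1 + x\<^sup>2 + x ^ 4 / (1 - x\<^sup>2)"
    proof -
      have "(1 + x\<^sup>2) * (1 - x\<^sup>2) = 1 - x ^ 4" by (simp add: algebra_simps power2_eq_square power4_eq_xxxx)
      moreover have "0 < 1 - x\<^sup>2" using x2 by simp
      ultimately show ?thesis by (simp add: field_simps)
    qed
    have e3: "1 - ?k\<^sup>2 - 2 * (1 - ?k) * s = h * x - h\<^sup>2"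
    proof -
      have "1 - k\<^sup>2 - 2 * (1 - k) * (1 - x / 2) = (1 - k) * x - (1 - k)\<^sup>2" for k :: real
        by (simp add: field_simps power2_eq_square)
      then show ?thesis unfolding h_def s_def .
    qed
    have "t * (1 / (1 - x\<^sup>2) - ?k\<^sup>2) - t * fold_speed ?k x = t * (x ^ 4 * (1 / (1 - x\<^sup>2) - 1 / (16 * s)) + h * x - h\<^sup>2)"
    proof -
      have "1 / (1 - x\<^sup>2) - ?k\<^sup>2 - fold_speed ?k x = x ^ 4 * (1 / (1 - x\<^sup>2) - 1 / (16 * s)) + h * x - h\<^sup>2"
      proof -
        have "x ^ 4 * (1 / (1 - x\<^sup>2) - 1 / (16 * s)) = x ^ 4 / (1 - x\<^sup>2) - x ^ 4 / (16 * s)" by (simp add: right_diff_distrib)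
        then show ?thesis using e1 e2 e3 by linarith
      qed
      then show ?thesis by (simp only: right_diff_distrib [symmetric])
    qed
    also have "\<bar>\<dots>\<bar> \<le> t * ((2101/2000) * x ^ 4 + \<bar>h\<bar> * x + h\<^sup>2)"
    proof -
      have a: "1 / (1 - x\<^sup>2) \<le> (1113/1000)" "1 \<le> 1 / (1 - x\<^sup>2)" using x2 by (auto simp: field_simps)
      have b: "1 / 16 \<le> 1 / (16 * s)" "1 / (16 * s) \<le> 1" using s by (auto simp: field_simps)
      have "\<bar>x ^ 4 * (1 / (1 - x\<^sup>2) - 1 / (16 * s))\<bar> \<le> x ^ 4 * (2101/2000)"
        unfolding abs_mult using a b by (intro mult_mono) auto
      moreover have "\<bar>h * x\<bar> = \<bar>h\<bar> * x" using x by (simp add: abs_mult)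
      moreover have "0 \<le> h\<^sup>2" by simp
      ultimately have "\<bar>x ^ 4 * (1 / (1 - x\<^sup>2) - 1 / (16 * s)) + h * x - h\<^sup>2\<bar> \<le> x ^ 4 * (2101/2000) + \<bar>h\<bar> * x + h\<^sup>2"
        using abs_triangle_ineq4[of "x ^ 4 * (1 / (1 - x\<^sup>2) - 1 / (16 * s)) + h * x" "h\<^sup>2"]
          abs_triangle_ineq[of "x ^ 4 * (1 / (1 - x\<^sup>2) - 1 / (16 * s))" "h * x"]
        by (simp only: abs_power2)
      then show ?thesis using t_pos by (simp add: abs_mult mult.commute)
    qed
    finally show "\<bar>t * (1 / (1 - x\<^sup>2) - ?k\<^sup>2) - t * fold_speed ?k x\<bar> \<le> t * ((2101/2000) * x ^ 4 + \<bar>h\<bar> * x + h\<^sup>2)" .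
  qed
  moreover have "?f 0 = pi * (4 * X - \<alpha>)\<^sup>2 / 8" by (simp add: folded_0)
  moreover have "0 \<le> pi * (4 * X - \<alpha>)\<^sup>2 / 8" by simp
  moreover have "?B 0 = 0" by simp
  ultimately show ?thesis by linarith
qed

lemma near_cusp_bounds:
  fixes \<alpha> r v :: real
  defines "k \<equiv> \<alpha> / (4 * X)" and "k' \<equiv> \<alpha> / (4 * X) * (1 + 1 / (32 * t\<^sup>2))"
  assumes r: "t = r ^ 3" "r * v = 1" "0 < v" "v \<le> (1613/5000)" and e: "(4 * X - \<alpha>)\<^sup>2 \<le> v"
  shows "\<bar>1 - k\<bar> \<le> (627/1000) * v\<^sup>2" "(1 - k)\<^sup>2 \<le> (983/2500) * v ^ 4" "\<bar>k' - 1\<bar> \<le> (157/250) * v\<^sup>2"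
    "\<bar>1 - k\<^sup>2\<bar> \<le> (627/500) * v\<^sup>2 + (983/2500) * v ^ 4" "0 < k'"
proof -
  have rv: "r = 1 / v" using r by (simp add: field_simps)
  have "(1 - k)\<^sup>2 = (4 * X - \<alpha>)\<^sup>2 / (16 * X\<^sup>2)"
  proof -
    have "1 - k = (4 * X - \<alpha>) / (4 * X)" using X_pos by (simp add: k_def diff_divide_distrib)
    then show ?thesis by (simp only: power_divide power_mult_distrib) simp
  qed
  also have "16 * X\<^sup>2 = 8 * t / pi" by (simp add: t_def)
  also have "\<dots> = 8 / (pi * v ^ 3)" unfolding r(1) rv by (simp add: power_divide)
  also have "(4 * X - \<alpha>)\<^sup>2 / (8 / (pi * v ^ 3)) \<le> v / (8 / (pi * v ^ 3))"
    using e r by (intro divide_right_mono) auto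
  also have "\<dots> = pi / 8 * v ^ 4" by (simp add: eval_nat_numeral)
  also have "\<dots> \<le> (627/1000)\<^sup>2 * v ^ 4"
    using pi_bounds by (intro mult_right_mono) (auto simp: power2_eq_square)
  also have "\<dots> = ((627/1000) * v\<^sup>2)\<^sup>2" by (simp add: power_mult_distrib eval_nat_numeral)
  finally have sq: "(1 - k)\<^sup>2 \<le> ((627/1000) * v\<^sup>2)\<^sup>2" .
  then have "\<bar>1 - k\<bar> \<le> \<bar>(627/1000) * v\<^sup>2\<bar>" by (simp only: abs_le_square_iff)
  then show h: "\<bar>1 - k\<bar> \<le> (627/1000) * v\<^sup>2" by simp
  have "((627/1000) * v\<^sup>2)\<^sup>2 = (393129/1000000) * v ^ 4" by (simp add: power_mult_distrib power2_eq_square eval_nat_numeral)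
  then show h2: "(1 - k)\<^sup>2 \<le> (983/2500) * v ^ 4" using sq zero_less_power[OF r(3), of 4] by linarith
  have k2: "1 - k\<^sup>2 = 2 * (1 - k) - (1 - k)\<^sup>2" by (simp add: power2_eq_square algebra_simps)
  have "\<bar>2 * x - q\<bar> \<le> 2 * (627/1000) * p + b" if "\<bar>x\<bar> \<le> 627/1000 * p" "0 \<le> q" "q \<le> b" for x q p b :: real
    using that by linarith
  from this[OF h _ h2] show "\<bar>1 - k\<^sup>2\<bar> \<le> (627/500) * v\<^sup>2 + (983/2500) * v ^ 4" unfolding k2 by simp
  have vv: "v\<^sup>2 \<le> (1041/10000)" "v ^ 4 \<le> (109/10000)"
    using power_mono[of v "(1613/5000)" 2] power_mono[of v "(1613/5000)" 4] r by (auto simp: power2_eq_square power4_eq_xxxx)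
  then have k: "(93/100) \<le> k" "k \<le> (107/100)" using h by linarith+
  have "1 / (32 * t\<^sup>2) = 1 / 32 * v ^ 4 * v\<^sup>2" unfolding r(1) rv by (simp add: power_divide eval_nat_numeral)
  also have "\<dots> \<le> (1/2000) * v\<^sup>2"
    by (rule mult_right_mono) (use vv in auto)
  finally have p: "1 / (32 * t\<^sup>2) \<le> (1/2000) * v\<^sup>2" "0 \<le> 1 / (32 * t\<^sup>2)" by auto
  have "k * (1 / (32 * t\<^sup>2)) \<le> (107/100) * ((1/2000) * v\<^sup>2)" using k p by (intro mult_mono) auto
  moreover define b where "b = k * (1 / (32 * t\<^sup>2))"
  moreover have b0: "0 \<le> b" unfolding b_def using k p by simp
  moreover have k': "k' = k + b" by (simp add: k'_def k_def b_def distrib_left)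
  ultimately show "\<bar>k' - 1\<bar> \<le> (157/250) * v\<^sup>2" using h zero_less_power[OF r(3), of 2] by linarith
  show "0 < k'" using k b0 unfolding k' by linarith
qed

lemma cos_lipschitz: "\<bar>cos x - cos y\<bar> \<le> \<bar>x - y\<bar>" for x y :: real
proof -
  have "\<bar>cos x - cos y\<bar> = 2 * (\<bar>sin ((x + y) / 2)\<bar> * \<bar>sin ((y - x) / 2)\<bar>)" by (simp add: cos_diff_cos abs_mult)
  also have "\<dots> \<le> 2 * (1 * \<bar>(y - x) / 2\<bar>)" by (intro mult_left_mono mult_mono abs_sin_x_le_abs_x abs_sin_le_one) auto
  finally show ?thesis by (simp add: abs_minus_commute)
qed

text \<open>The cubic phases are of order one for \<open>z\<close> of size \<open>v = 1 / r\<close>, the inverse cube root of \<open>t\<close>. On a few multiples of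
that length both integrands are compared pointwise; beyond it each of them is integrated by parts.\<close>
lemma transition_core:
  fixes \<alpha> r v w :: real
  defines "k \<equiv> \<alpha> / (4 * X)" and "k' \<equiv> \<alpha> / (4 * X) * (1 + 1 / (32 * t\<^sup>2))"
  assumes r: "t = r ^ 3" "r * v = 1" "0 < v" "v \<le> (1613/5000)" and e: "(4 * X - \<alpha>)\<^sup>2 \<le> v"
    and w: "0 \<le> w" "w \<le> (1201/500) * v" "w \<le> (3183/10000)"
  shows "\<bar>k' * integral {0..w} (cusp_integrand t k) - integral {0..w} (\<lambda>w. cos (folded \<alpha> w))\<bar> \<le> (299/125) * v\<^sup>2 + (268/25) * v ^ 3"
proof -
  note nb = near_cusp_bounds[OF r e, folded k_def k'_def]
  have r0: "0 < r" using r(2,3) by (metis zero_less_mult_pos2 zero_less_one)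
  define a0 where "a0 = (3927/10000) * v + (81/125) * v\<^sup>2"
  define a1 where "a1 = (983/2500) * v"
  define a2 where "a2 = (627/2000) * r + (7/25)"
  define a5 where "a5 = (2101/10000) * r ^ 3"
  have a: "0 \<le> a0" "0 \<le> a1" "0 \<le> a2" "0 \<le> a5" using r r0 by (auto simp: a0_def a1_def a2_def a5_def)
  define P where "P = (\<lambda>z. a0 + a1 * z + a2 * z\<^sup>2 + a5 * z ^ 5)"
  have bound: "\<bar>k' * cusp_integrand t k z - cos (folded \<alpha> z)\<bar> \<le> P z" if z: "z \<in> {0..w}" for z
  proof -
    have z': "0 \<le> z" "z \<le> (3183/10000)" using z w by auto
    have z2: "z\<^sup>2 \<le> (507/5000)" using power_mono[OF z'(2,1), of 2] by (simp add: power2_eq_square)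
    define W where "W = (1 - z\<^sup>2) powr (-1/4)"
    have W: "1 \<le> W" "W \<le> 1 + (7/25) * z\<^sup>2" unfolding W_def using inverse_fourth_root_bound[OF _ z2] by auto
    define A where "A = cos (t * cusp_phase k z)"
    define B where "B = cos (folded \<alpha> z)"
    have eq: "k' * cusp_integrand t k z - B = (k' - 1) * W * A + (W - 1) * A + (A - B)"
      by (simp add: cusp_integrand_def W_def A_def algebra_simps)
    have 1: "\<bar>(k' - 1) * W * A\<bar> \<le> (157/250) * v\<^sup>2 * (2571/2500) * 1"
      unfolding abs_mult using nb(3) W z2 by (intro mult_mono) (auto simp: A_def)
    have 2: "\<bar>(W - 1) * A\<bar> \<le> (7/25) * z\<^sup>2 * 1"
      unfolding abs_mult using W by (intro mult_mono) (auto simp: A_def)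
    have 3: "\<bar>A - B\<bar> \<le> (3927/10000) * v + ((2101/10000) * r ^ 3 * z ^ 5 + (627/2000) * r * z\<^sup>2 + (983/2500) * v * z)"
    proof -
      have "\<bar>A - B\<bar> \<le> \<bar>t * cusp_phase k z - folded \<alpha> z\<bar>" unfolding A_def B_def by (rule cos_lipschitz)
      also have "\<dots> \<le> pi * (4 * X - \<alpha>)\<^sup>2 / 8 + t * ((2101/10000) * z ^ 5 + \<bar>1 - k\<bar> * z\<^sup>2 / 2 + (1 - k)\<^sup>2 * z)"
        unfolding k_def by (rule phase_gap[OF z'])
      also have "\<dots> \<le> (3927/1250) * v / 8 + r ^ 3 * ((2101/10000) * z ^ 5 + (627/1000) * v\<^sup>2 * z\<^sup>2 / 2 + (983/2500) * v ^ 4 * z)"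
        unfolding r(1) using pi_bounds e nb(1,2) z' r0
        by (intro add_mono mult_mono divide_right_mono mult_left_mono mult_right_mono) auto
      also have "r ^ 3 * ((2101/10000) * z ^ 5 + (627/1000) * v\<^sup>2 * z\<^sup>2 / 2 + (983/2500) * v ^ 4 * z)
        = (2101/10000) * r ^ 3 * z ^ 5 + (627/2000) * r * (r * v)\<^sup>2 * z\<^sup>2 + (983/2500) * v * (r * v) ^ 3 * z"
        by (simp add: algebra_simps eval_nat_numeral)
      also have "\<dots> = (2101/10000) * r ^ 3 * z ^ 5 + (627/2000) * r * z\<^sup>2 + (983/2500) * v * z" unfolding r(2) by simp
      finally show ?thesis by simp
    qed
    have 4: "(157/250) * v\<^sup>2 * (2571/2500) * 1 \<le> (81/125) * v\<^sup>2" by simp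
    have "\<bar>k' * cusp_integrand t k z - B\<bar> \<le> \<bar>(k' - 1) * W * A\<bar> + \<bar>(W - 1) * A\<bar> + \<bar>A - B\<bar>"
      unfolding eq by (intro order_trans[OF abs_triangle_ineq] add_right_mono abs_triangle_ineq)
    also have "\<dots> \<le> (81/125) * v\<^sup>2 + (7/25) * z\<^sup>2 + ((3927/10000) * v + ((2101/10000) * r ^ 3 * z ^ 5 + (627/2000) * r * z\<^sup>2 + (983/2500) * v * z))"
      using 1 2 3 4 by (intro add_mono) auto
    also have "\<dots> = P z" by (simp add: P_def a0_def a1_def a2_def a5_def algebra_simps)
    finally show ?thesis unfolding B_def .
  qed
  define Q where "Q = (\<lambda>z::real. a0 * z + a1 * z\<^sup>2 / 2 + a2 * z ^ 3 / 3 + a5 * z ^ 6 / 6)"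
  have Q: "(P has_integral Q w - Q 0) {0..w}"
  proof (rule fundamental_theorem_of_calculus[OF w(1)])
    show "(Q has_vector_derivative P z) (at z within {0..w})" for z
      unfolding has_real_derivative_iff_has_vector_derivative[symmetric] Q_def P_def
      by (auto intro!: derivative_eq_intros)
  qed
  have ci: "cusp_integrand t k integrable_on {0..w}"
    using integrable_on_subinterval[OF cusp_integrand_integrable, of 0 w] w by auto
  have fi: "(\<lambda>w. cos (folded \<alpha> w)) integrable_on {0..w}"
    using w by (intro integrable_continuous_real continuous_intros folded_continuous) auto
  have di: "(\<lambda>z. k' * cusp_integrand t k z - cos (folded \<alpha> z)) integrable_on {0..w}"
    by (intro integrable_diff integrable_on_mult_right ci fi)
  have "k' * integral {0..w} (cusp_integrand t k) - integral {0..w} (\<lambda>w. cos (folded \<alpha> w))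
     = integral {0..w} (\<lambda>z. k' * cusp_integrand t k z - cos (folded \<alpha> z))"
    using ci fi by (subst integral_diff) (auto intro: integrable_on_mult_right)
  also have "\<bar>\<dots>\<bar> \<le> integral {0..w} P"
    using integral_norm_bound_integral[OF di has_integral_integrable[OF Q]] bound by simp
  also have "\<dots> = Q w" using integral_unique[OF Q] by (simp add: Q_def)
  also have "\<dots> \<le> Q ((1201/500) * v)"
    unfolding Q_def using w r a by (intro add_mono divide_right_mono mult_left_mono power_mono) auto
  also have "\<dots> \<le> (299/125) * v\<^sup>2 + (268/25) * v ^ 3"
  proof -
    have gen: "(3927/10000) * (1201/500) * V + (81/125) * (1201/500) * W + (983/2500) * (1201/500)\<^sup>2 / 2 * W + (627/2000) * (1201/500) ^ 3 / 3 * V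
       + (7/25) * (1201/500) ^ 3 / 3 * W + (2101/10000) * (1201/500) ^ 6 / 6 * W \<le> (299/125) * V + (268/25) * W" if "0 \<le> V" "0 \<le> W" for V W :: real
      using that by (simp add: power_divide)
    have "Q (b * v) = (3927/10000) * b * v\<^sup>2 + (81/125) * b * v ^ 3 + (983/2500) * b\<^sup>2 / 2 * v ^ 3 + (627/2000) * b ^ 3 / 3 * ((r * v) * v\<^sup>2)
       + (7/25) * b ^ 3 / 3 * v ^ 3 + (2101/10000) * b ^ 6 / 6 * ((r * v) ^ 3 * v ^ 3)" for b
      unfolding Q_def a0_def a1_def a2_def a5_def by (simp add: field_simps eval_nat_numeral)
    from this[of "(1201/500)"] have "Q ((1201/500) * v) = (3927/10000) * (1201/500) * v\<^sup>2 + (81/125) * (1201/500) * v ^ 3 + (983/2500) * (1201/500)\<^sup>2 / 2 * v ^ 3 + (627/2000) * (1201/500) ^ 3 / 3 * v\<^sup>2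
       + (7/25) * (1201/500) ^ 3 / 3 * v ^ 3 + (2101/10000) * (1201/500) ^ 6 / 6 * v ^ 3"
      unfolding r(2) power_one mult_1_left .
    also have "\<dots> \<le> (299/125) * v\<^sup>2 + (268/25) * v ^ 3" by (rule gen) (use r in auto)
    finally show ?thesis .
  qed
  finally show ?thesis .
qed

lemma cusp_tail_near:
  fixes \<alpha> r v w c :: real
  defines "k \<equiv> \<alpha> / (4 * X)"
  assumes r: "t = r ^ 3" "r * v = 1" "0 < v" "v \<le> (1613/5000)" and e: "(4 * X - \<alpha>)\<^sup>2 \<le> v"
    and w: "0 < w" "w < 1" "(c + (627/500)) * v\<^sup>2 + (983/2500) * v ^ 4 \<le> w\<^sup>2" and c: "0 < c"
  shows "\<bar>integral {w..1} (cusp_integrand t k)\<bar> \<le> 2 / c * v"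
    "w \<le> (8/25) \<Longrightarrow> 0 < fold_speed k w \<and> 2 / (t * fold_speed k w) \<le> 2 / c * v"
proof -
  note nb = near_cusp_bounds[OF r e, folded k_def]
  have r0: "0 < r" using r(2,3) by (metis zero_less_mult_pos2 zero_less_one)
  have v2: "0 < c * v\<^sup>2" using c r by simp
  have fin: "x / (t * D) \<le> x / c * v" if D: "c * v\<^sup>2 \<le> D" "0 \<le> x" for D x
  proof -
    have "c * r \<le> t * D"
    proof -
      have "c * r = r ^ 3 * (c * v\<^sup>2)"
      proof -
        have "r ^ 3 * (c * v\<^sup>2) = c * r * (r * v)\<^sup>2" by (simp add: eval_nat_numeral)
        then show ?thesis unfolding r(2) by (simp only: power_one mult_1_right)
      qed
      also have "\<dots> \<le> r ^ 3 * D" using r0 D by (intro mult_left_mono) auto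
      finally show ?thesis unfolding r(1) .
    qed
    moreover have "0 < c * r" using c r0 by simp
    ultimately have "x / (t * D) \<le> x / (c * r)" using D by (intro frac_le) auto
    also have "\<dots> = x / c * v" using c r0 r(2) by (simp add: field_simps)
    finally show ?thesis .
  qed
  have w1: "0 \<le> 1 - w\<^sup>2" "1 - w\<^sup>2 \<le> 1" "w\<^sup>2 < 1" using w abs_square_less_1[of w] by auto
  have D: "1 - k\<^sup>2 * (1 - w\<^sup>2) = w\<^sup>2 + (1 - k\<^sup>2) * (1 - w\<^sup>2)" by (simp add: algebra_simps)
  have "\<bar>(1 - k\<^sup>2) * (1 - w\<^sup>2)\<bar> \<le> ((627/500) * v\<^sup>2 + (983/2500) * v ^ 4) * 1"
    unfolding abs_mult using nb(4) w1 by (intro mult_mono) auto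
  from abs_le_D2[OF this] have D1: "c * v\<^sup>2 \<le> 1 - k\<^sup>2 * (1 - w\<^sup>2)" unfolding D using w(3) by (simp add: distrib_right)
  have "(1 - w\<^sup>2) powr (3/4) \<le> 1" using w1 by (intro powr_le1) auto
  then have "(1 - w\<^sup>2) powr (3/4) / (t * (1 - k\<^sup>2 * (1 - w\<^sup>2))) \<le> 1 / (t * (1 - k\<^sup>2 * (1 - w\<^sup>2)))"
    using t_pos D1 v2 by (intro divide_right_mono) auto
  also have "\<dots> \<le> 1 / c * v" by (rule fin[OF D1]) simp
  finally show "\<bar>integral {w..1} (cusp_integrand t k)\<bar> \<le> 2 / c * v"
    using cusp_tail[OF t_pos w(1,2), of k] D1 v2 by simp
  assume ww: "w \<le> (8/25)"
  have s: "(21/25) \<le> 1 - w / 2" "1 - w / 2 \<le> 1" using ww w by auto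
  have "\<bar>2 * (1 - k) * (1 - w / 2)\<bar> \<le> (2 * ((627/1000) * v\<^sup>2)) * 1"
    unfolding abs_mult using nb(1) s by (intro mult_mono) auto
  from abs_le_D2[OF this] have "- (2 * ((627/1000) * v\<^sup>2)) \<le> 2 * (1 - k) * (1 - w / 2)" by simp
  moreover have "0 \<le> w ^ 4 / (16 * (1 - w / 2))" using s w by simp
  moreover have "0 \<le> v ^ 4" using r by simp
  moreover have "(c + (627/500)) * v\<^sup>2 = c * v\<^sup>2 + 2 * ((627/1000) * v\<^sup>2)" by (simp add: distrib_right)
  ultimately have D3: "c * v\<^sup>2 \<le> fold_speed k w" using w fold_speed_eq[of w k] by linarith
  then show "0 < fold_speed k w \<and> 2 / (t * fold_speed k w) \<le> 2 / c * v" using fin[OF D3, of 2] v2 by auto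
qed


lemma transition_wave_core:
  fixes \<alpha> r v :: real
  defines "k \<equiv> \<alpha> / (4 * X)" and "k' \<equiv> \<alpha> / (4 * X) * (1 + 1 / (32 * t\<^sup>2))"
  assumes r: "t = r ^ 3" "r * v = 1" "0 < v" "v \<le> (63/400)" and e: "(4 * X - \<alpha>)\<^sup>2 \<le> v"
  shows "\<bar>k' * integral {0..1} (cusp_integrand t k) - integral {0..fold_end} (\<lambda>w. cos (folded \<alpha> w))\<bar> \<le> (141/100) * v"
proof -
  have r': "v \<le> (1613/5000)" using r(4) by simp
  note nb = near_cusp_bounds[OF r(1-3) r' e, folded k_def k'_def]
  have v2: "v\<^sup>2 \<le> (63/400) * v" using r by (simp add: power2_eq_square mult_right_mono)
  have v3: "v ^ 3 \<le> (63/400) * v\<^sup>2" "v ^ 4 \<le> (249/10000) * v\<^sup>2"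
  proof -
    have "v * v\<^sup>2 \<le> (63/400) * v\<^sup>2" using r by (intro mult_right_mono) auto
    then show "v ^ 3 \<le> (63/400) * v\<^sup>2" by (simp add: eval_nat_numeral)
    have "v\<^sup>2 \<le> (249/10000)" using power_mono[OF r(4), of 2] r by (simp add: power2_eq_square)
    then have "v\<^sup>2 * v\<^sup>2 \<le> (249/10000) * v\<^sup>2" by (intro mult_right_mono) auto
    then show "v ^ 4 \<le> (249/10000) * v\<^sup>2" by (simp add: eval_nat_numeral)
  qed
  have "(157/250) * v\<^sup>2 \<le> (157/10000)" using power_mono[OF r(4), of 2] r by (simp add: power2_eq_square)
  then have k': "0 \<le> k'" "k' \<le> (10157/10000)" using nb(3,5) by linarith+
  have split: "\<bar>k' * integral {0..1} (cusp_integrand t k) - integral {0..fold_end} (\<lambda>w. cos (folded \<alpha> w))\<bar>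
    \<le> ((299/125) * v\<^sup>2 + (268/25) * v ^ 3) + (10157/10000) * \<bar>integral {w..1} (cusp_integrand t k)\<bar> + \<bar>integral {w..fold_end} (\<lambda>w. cos (folded \<alpha> w))\<bar>"
    if w: "0 \<le> w" "w \<le> (1201/500) * v" "w \<le> fold_end" for w
  proof -
    have w1: "w \<le> (3183/10000)" "w \<le> 1" "fold_end \<le> 1" using w fold_end by auto
    have "integral {0..1} (cusp_integrand t k) = integral {0..w} (cusp_integrand t k) + integral {w..1} (cusp_integrand t k)"
      using Henstock_Kurzweil_Integration.integral_combine[OF w(1) w1(2) cusp_integrand_integrable] by simp
    moreover have "(\<lambda>w. cos (folded \<alpha> w)) integrable_on {0..fold_end}"
      using w1 by (intro integrable_continuous_real continuous_intros folded_continuous) auto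
    then have "integral {0..fold_end} (\<lambda>w. cos (folded \<alpha> w)) = integral {0..w} (\<lambda>w. cos (folded \<alpha> w)) + integral {w..fold_end} (\<lambda>w. cos (folded \<alpha> w))"
      using Henstock_Kurzweil_Integration.integral_combine[OF w(1,3)] by metis
    ultimately have eq: "k' * integral {0..1} (cusp_integrand t k) - integral {0..fold_end} (\<lambda>w. cos (folded \<alpha> w))
      = (k' * integral {0..w} (cusp_integrand t k) - integral {0..w} (\<lambda>w. cos (folded \<alpha> w)))
        + k' * integral {w..1} (cusp_integrand t k) - integral {w..fold_end} (\<lambda>w. cos (folded \<alpha> w))"
      by (simp only: distrib_left)
    have "\<bar>k' * integral {w..1} (cusp_integrand t k)\<bar> \<le> (10157/10000) * \<bar>integral {w..1} (cusp_integrand t k)\<bar>"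
      unfolding abs_mult using k' by (intro mult_right_mono) auto
    then show ?thesis unfolding eq
      using transition_core[OF r(1-3) r' e w(1,2) w1(1), folded k_def k'_def] by linarith
  qed
  show ?thesis
  proof (cases "v \<le> 1 / (1509/200)")
    case True
    define w where "w = (12/5) * v"
    have w: "0 < w" "w < 1" "w \<le> (8/25)" "w \<le> (1201/500) * v" "w \<le> fold_end" using True r fold_end by (auto simp: w_def)
    have tail: "((449/100) + (627/500)) * v\<^sup>2 + (983/2500) * v ^ 4 \<le> w\<^sup>2"
    proof -
      have "w\<^sup>2 = 144/25 * v\<^sup>2" by (simp add: w_def power_mult_distrib power2_eq_square)
      then show ?thesis using v3(2) zero_le_power2[of v] by argo
    qed
    have h: "2 * (1 - k) \<le> 2 * w"
    proof -
      have "(627/1000) * v\<^sup>2 \<le> (12/5) * v" using v2 r by linarith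
      then show ?thesis using nb(1) unfolding w_def by argo
    qed
    have c: "0 < ((449/100)::real)" by simp
    have 1: "\<bar>integral {w..1} (cusp_integrand t k)\<bar> \<le> 891/2000 * v"
      unfolding k_def by (rule order_trans[OF cusp_tail_near(1)[OF r(1-3) r' e w(1,2) tail c]]) (use r in simp)
    have 2: "0 < fold_speed k w" "2 / (t * fold_speed k w) \<le> 891/2000 * v"
    proof -
      have "2 / (449/100) * v \<le> 891/2000 * v" using r by simp
      then show "0 < fold_speed k w" "2 / (t * fold_speed k w) \<le> 891/2000 * v"
        using cusp_tail_near(2)[OF r(1-3) r' e w(1,2) tail c w(3)] unfolding k_def by auto
    qed
    have "\<bar>integral {w..fold_end} (\<lambda>w. cos (folded \<alpha> w))\<bar> \<le> 2 / (t * fold_speed k w)"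
      using folded_tail[of w fold_end \<alpha>] w fold_end h 2(1) unfolding k_def by simp
    moreover have "v\<^sup>2 \<le> 6627/50000 * v" using r True by (simp only: power2_eq_square) (intro mult_right_mono, auto)
    moreover have "v ^ 3 \<le> 1757/100000 * v"
    proof -
    have "v ^ 3 \<le> (1 / (1509/200))\<^sup>2 * v"
      using mult_right_mono[OF power_mono[OF True, of 2], of v] r by (simp add: eval_nat_numeral)
    also have "(1 / (1509/200) :: real)\<^sup>2 * v \<le> 1757/100000 * v" using r by (intro mult_right_mono) (auto simp: power2_eq_square)
    finally show ?thesis .
    qed
    ultimately show ?thesis using split[OF less_imp_le[OF w(1)] w(4,5)] 1 2(2) r(3) by linarith
  next
    case False
    define w where "w = fold_end"
    have w: "0 < w" "w < 1" "w \<le> (8/25)" "w \<le> (1201/500) * v" "w \<le> fold_end" using False r fold_end by (auto simp: w_def)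
    have tail: "((281/100) + (627/500)) * v\<^sup>2 + (983/2500) * v ^ 4 \<le> w\<^sup>2"
    proof -
      have "v\<^sup>2 \<le> (63/400)\<^sup>2" using r by (intro power_mono) auto
      then have "(20369/5000) * v\<^sup>2 \<le> (3181/10000)\<^sup>2" by (simp add: power2_eq_square)
      also have "(3181/10000)\<^sup>2 \<le> w\<^sup>2" unfolding w_def using fold_end by (intro power_mono) auto
      finally show ?thesis using v3(2) zero_le_power2[of v] by argo
    qed
    have c: "0 < ((281/100)::real)" by simp
    have 1: "\<bar>integral {w..1} (cusp_integrand t k)\<bar> \<le> 3559/5000 * v"
      unfolding k_def by (rule order_trans[OF cusp_tail_near(1)[OF r(1-3) r' e w(1,2) tail c]]) (use r in simp)
    have "\<bar>integral {w..fold_end} (\<lambda>w. cos (folded \<alpha> w))\<bar> = 0" by (simp add: w_def)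
    then show ?thesis using split[OF less_imp_le[OF w(1)] w(4,5)] 1 v2 v3(1) r(3) by linarith
  qed
qed

lemma transition_size_core:
  fixes \<alpha> r v :: real
  defines "k \<equiv> \<alpha> / (4 * X)" and "k' \<equiv> \<alpha> / (4 * X) * (1 + 1 / (32 * t\<^sup>2))"
  assumes r: "t = r ^ 3" "r * v = 1" "0 < v" "v \<le> (161/500)" and e: "(4 * X - \<alpha>)\<^sup>2 \<le> v"
  shows "\<bar>k' * integral {0..1} (cusp_integrand t k)\<bar> \<le> (81/25) * v"
    "v \<le> (431/2000) \<Longrightarrow> - ((53/25) * v) \<le> k' * integral {0..1} (cusp_integrand t k)"
proof -
  have r': "v \<le> (1613/5000)" using r(4) by simp
  note nb = near_cusp_bounds[OF r(1-3) r' e, folded k_def k'_def]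
  define w where "w = 2 * v"
  have w: "0 < w" "w < 1" using r by (auto simp: w_def)
  have v2: "v\<^sup>2 \<le> (25921/250000)" using power_mono[OF r(4), of 2] r by (simp add: power2_eq_square)
  have v4: "v ^ 4 \<le> (25921/250000) * v\<^sup>2" using mult_right_mono[OF v2, of "v\<^sup>2"] by (simp add: eval_nat_numeral)
  have tail: "((541/200) + (627/500)) * v\<^sup>2 + (983/2500) * v ^ 4 \<le> w\<^sup>2"
  proof -
    have "w\<^sup>2 = 4 * v\<^sup>2" by (simp add: w_def power_mult_distrib)
    then show ?thesis using v4 zero_le_power2[of v] by argo
  qed
  have c: "0 < ((541/200)::real)" by simp
  have T: "\<bar>integral {w..1} (cusp_integrand t k)\<bar> \<le> 3697/5000 * v"
    unfolding k_def by (rule order_trans[OF cusp_tail_near(1)[OF r(1-3) r' e w tail c]]) (use r in simp)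
  have int: "cusp_integrand t k integrable_on {a..b}" if "0 \<le> a" "b \<le> 1" for a b
    using integrable_on_subinterval[OF cusp_integrand_integrable, of a b] that by auto
  have part: "\<bar>integral {a..w} (cusp_integrand t k)\<bar> \<le> C * (w - a)"
    if a: "0 \<le> a" "a \<le> w" and C: "0 < C" "1 \<le> C ^ 4 * (1 - w\<^sup>2)" for a C
  proof -
    have w2: "0 < 1 - w\<^sup>2" using w abs_square_less_1[of w] by auto
    have "norm (integral {a..w} (cusp_integrand t k)) \<le> integral {a..w} (\<lambda>_. C)"
    proof (rule integral_norm_bound_integral[OF int])
      fix z assume z: "z \<in> {a..w}"
      have "z\<^sup>2 \<le> w\<^sup>2" using z a by (intro power_mono) auto
      then have "(1 - z\<^sup>2) powr (-1/4) \<le> (1 - w\<^sup>2) powr (-1/4)" using w2 by (intro powr_quarter_antimono) auto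
      also have "\<dots> \<le> C" by (rule inverse_fourth_root_le[OF w2 C])
      finally show "norm (cusp_integrand t k z) \<le> C" using cusp_integrand_bound[of t k z] by simp
    qed (use a w in auto)
    then show ?thesis using a by (simp add: mult.commute)
  qed
  have comb: "integral {0..1} (cusp_integrand t k) = integral {0..w} (cusp_integrand t k) + integral {w..1} (cusp_integrand t k)"
    using Henstock_Kurzweil_Integration.integral_combine[OF _ _ cusp_integrand_integrable, of w] w by simp
  have w2: "w\<^sup>2 \<le> (20737/50000)" using v2 by (simp add: w_def power_mult_distrib)
  have "1 \<le> (143/125) ^ 4 * (1 - (20737/50000) :: real)" by (simp add: eval_nat_numeral)
  also have "\<dots> \<le> (143/125) ^ 4 * (1 - w\<^sup>2)" using w2 by (intro mult_left_mono) auto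
  finally have "\<bar>integral {0..w} (cusp_integrand t k)\<bar> \<le> (143/125) * (w - 0)" using w by (intro part) auto
  then have I: "\<bar>integral {0..1} (cusp_integrand t k)\<bar> \<le> (1211/400) * v"
  proof -
    show ?thesis using \<open>\<bar>integral {0..w} (cusp_integrand t k)\<bar> \<le> _\<close> T r(3) w_def unfolding comb by argo
  qed
  have k': "0 \<le> k'" "k' \<le> (2663/2500)" using nb(3,5) v2 by linarith+
  have "\<bar>k' * integral {0..1} (cusp_integrand t k)\<bar> \<le> (2663/2500) * ((1211/400) * v)"
    unfolding abs_mult using k' I by (intro mult_mono) auto
  also have "\<dots> \<le> (81/25) * v" using r(3) by simp
  finally show "\<bar>k' * integral {0..1} (cusp_integrand t k)\<bar> \<le> (81/25) * v" .
  assume v: "v \<le> (431/2000)"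
  have v2: "v\<^sup>2 \<le> (929/20000)" using power_mono[OF v, of 2] r by (simp add: power2_eq_square)
  have v4: "v ^ 4 \<le> (929/20000) * v\<^sup>2" using mult_right_mono[OF v2, of "v\<^sup>2"] by (simp add: eval_nat_numeral)
  have tail: "((2727/1000) + (627/500)) * v\<^sup>2 + (983/2500) * v ^ 4 \<le> w\<^sup>2"
  proof -
    have "w\<^sup>2 = 4 * v\<^sup>2" by (simp add: w_def power_mult_distrib)
    then show ?thesis using v4 zero_le_power2[of v] by argo
  qed
  have c: "0 < ((2727/1000)::real)" by simp
  have T: "\<bar>integral {w..1} (cusp_integrand t k)\<bar> \<le> 1467/2000 * v"
    unfolding k_def by (rule order_trans[OF cusp_tail_near(1)[OF r(1-3) r' e w tail c]]) (use r in simp)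
  define a where "a = (3/4) * v"
  have a: "0 \<le> a" "a \<le> w" "a \<le> (17/100)" using r v by (auto simp: a_def w_def)
  have w2: "w\<^sup>2 \<le> (929/5000)" using v2 by (simp add: w_def power_mult_distrib)
  have "1 \<le> (10529/10000) ^ 4 * (1 - (929/5000) :: real)" by (simp add: eval_nat_numeral)
  also have "\<dots> \<le> (10529/10000) ^ 4 * (1 - w\<^sup>2)" using w2 by (intro mult_left_mono) auto
  finally have M: "\<bar>integral {a..w} (cusp_integrand t k)\<bar> \<le> (10529/10000) * (w - a)" using a by (intro part) auto
  have "0 \<le> integral {0..a} (cusp_integrand t k)"
  proof (rule integral_nonneg[OF int])
    fix z assume "z \<in> {0..a}"
    then have z: "0 \<le> z" "z \<le> a" by auto
    have "\<bar>cusp_phase k z - cusp_phase k 0\<bar> \<le> (93/50) * v\<^sup>2 * z - (93/50) * v\<^sup>2 * 0"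
    proof (rule abs_le_by_deriv[OF z(1), where f' = "\<lambda>x. 1 / (1 - x\<^sup>2) - k\<^sup>2" and B' = "\<lambda>_. (93/50) * v\<^sup>2"])
      fix x assume x: "0 \<le> x" "x \<le> z"
      then show "(cusp_phase k has_real_derivative 1 / (1 - x\<^sup>2) - k\<^sup>2) (at x)" using z a by (intro cusp_phase_deriv) auto
      show "((\<lambda>x. (93/50) * v\<^sup>2 * x) has_real_derivative (93/50) * v\<^sup>2) (at x)" by (auto intro!: derivative_eq_intros)
      have "x\<^sup>2 \<le> a\<^sup>2" using x z by (intro power_mono) auto
      then have x2: "x\<^sup>2 \<le> (9/16) * v\<^sup>2" by (simp add: a_def power_mult_distrib power2_eq_square)
      then have x3: "x\<^sup>2 \<le> (131/5000)" using v2 by linarith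
      have "x\<^sup>2 * (131/5000) \<ge> x\<^sup>2 * x\<^sup>2" using x3 by (intro mult_left_mono) auto
      moreover have "(1 + 1027/1000 * x\<^sup>2) * (1 - x\<^sup>2) = 1 + 27/1000 * x\<^sup>2 - 1027/1000 * (x\<^sup>2 * x\<^sup>2)" by (simp add: field_simps)
      ultimately have "1 \<le> (1 + (1027/1000) * x\<^sup>2) * (1 - x\<^sup>2)" using zero_le_power2[of x] by argo
      then have "1 / (1 - x\<^sup>2) \<le> 1 + (1027/1000) * x\<^sup>2" "1 \<le> 1 / (1 - x\<^sup>2)" using x3 by (auto simp: pos_divide_le_eq)
      then show "\<bar>1 / (1 - x\<^sup>2) - k\<^sup>2\<bar> \<le> (93/50) * v\<^sup>2" using nb(4) x2 v4 by linarith
    qed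
    then have "\<bar>cusp_phase k z\<bar> \<le> (93/50) * v\<^sup>2 * z" by simp
    also have "\<dots> \<le> (93/50) * v\<^sup>2 * a" using z by (intro mult_left_mono) auto
    finally have "t * \<bar>cusp_phase k z\<bar> \<le> t * ((93/50) * v\<^sup>2 * a)" using t_pos by (intro mult_left_mono) auto
    also have "\<dots> = (279/200) * (r * v) ^ 3" unfolding r(1) a_def by (simp add: eval_nat_numeral)
    also have "\<dots> \<le> pi / 2" using pi_bounds unfolding r(2) by simp
    finally have "\<bar>t * cusp_phase k z\<bar> \<le> pi / 2" using t_pos by (simp add: abs_mult)
    then have "0 \<le> cos (t * cusp_phase k z)" by (intro cos_ge_zero) auto
    then show "0 \<le> cusp_integrand t k z" by (simp add: cusp_integrand_def)
  qed (use a in auto)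
  moreover have "integral {0..w} (cusp_integrand t k) = integral {0..a} (cusp_integrand t k) + integral {a..w} (cusp_integrand t k)"
    using Henstock_Kurzweil_Integration.integral_combine[OF a(1,2) int] w by simp
  ultimately have I: "- ((41/20) * v) \<le> integral {0..1} (cusp_integrand t k)"
    unfolding comb using T M r(3) w_def a_def by argo
  have k': "0 \<le> k'" "k' \<le> (2573/2500)" using nb(3,5) v2 by linarith+
  have "- ((53/25) * v) \<le> - ((2573/2500) * ((41/20) * v))" using r(3) by simp
  also have "\<dots> \<le> - (k' * ((41/20) * v))" using k' r(3) by (intro le_imp_neg_le mult_right_mono) auto
  also have "\<dots> \<le> k' * integral {0..1} (cusp_integrand t k)" using mult_left_mono[OF I k'(1)] by simp
  finally show "- ((53/25) * v) \<le> k' * integral {0..1} (cusp_integrand t k)" .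
qed

end

section \<open>Numerical budgets for harmonic sums\<close>

definition odd_harmonic :: "nat \<Rightarrow> real" where
  "odd_harmonic P = (\<Sum>i<P. 1 / (2 * real i + 1))"

lemma odd_harmonic_Suc: "odd_harmonic (Suc P) = odd_harmonic P + 1 / (2 * real P + 1)"
  by (simp add: odd_harmonic_def)

lemma odd_harmonic_nonneg: "0 \<le> odd_harmonic P"
  unfolding odd_harmonic_def by (intro sum_nonneg) auto

lemma odd_harmonic_le_quarter: "9 \<le> P \<Longrightarrow> odd_harmonic P \<le> real P / 4"
proof (induction P rule: dec_induct)
  case base
  show ?case by (simp add: odd_harmonic_def eval_nat_numeral)
next
  case (step P)
  have "1 / (2 * real P + 1) \<le> 1 / 4" using step(1) by (intro divide_left_mono) auto
  with step.IH show ?case unfolding odd_harmonic_Suc of_nat_Suc by argo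
qed

lemma odd_harmonic_average_antimono: "P \<le> Q \<Longrightarrow> 0 < P \<Longrightarrow> odd_harmonic Q / real Q \<le> odd_harmonic P / real P"
proof (induction Q rule: dec_induct)
  case (step Q)
  have "real Q * (1 / (2 * real Q + 1)) \<le> odd_harmonic Q"
  proof -
    have "(\<Sum>i<Q. 1 / (2 * real Q + 1)) \<le> odd_harmonic Q"
      unfolding odd_harmonic_def by (intro sum_mono divide_left_mono) auto
    then show ?thesis by simp
  qed
  then have "odd_harmonic (Suc Q) * real Q \<le> odd_harmonic Q * real (Suc Q)" unfolding odd_harmonic_Suc by (simp add: algebra_simps)
  then have "odd_harmonic (Suc Q) / real (Suc Q) \<le> odd_harmonic Q / real Q" using step by (simp add: field_simps)
  then show ?case using step by simp
qed simp

lemma le_of_cube_le: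
  fixes a b :: real assumes "c * a ^ 3 \<le> l" "l \<le> c * b ^ 3" "0 < c" "0 \<le> b"
  shows "a \<le> b"
proof (rule ccontr)
  assume "\<not> a \<le> b"
  then have "b ^ 3 < a ^ 3" using assms by (intro power_strict_mono) auto
  then have "c * b ^ 3 < c * a ^ 3" using assms by simp
  then show False using assms by linarith
qed

text \<open>An upper bound for \<open>(3 * sqrt 2 - 4) * X / M ^ 3\<close>, half of which is the number of modes per unit of \<open>M ^ 3\<close>.\<close>
abbreviation "\<rho> \<equiv> (9681/100000) :: real"

text \<open>A convex cubic lies below a line on an interval as soon as it does so at both ends.\<close>
lemma cubic_budget:
  fixes A C M L ml mh \<gamma> :: real
  assumes L: "0 \<le> L" "L \<le> hi" "L \<le> \<rho> * M ^ 3" and m: "0 < ml" "ml \<le> M" "ml \<le> mh" "hi \<le> \<rho> * mh ^ 3" and A: "0 \<le> A" "0 \<le> \<gamma>"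
    and e0: "A * (\<rho> * ml ^ 3) + C \<le> \<gamma> * ml" and e1: "A * (\<rho> * mh ^ 3) + C \<le> \<gamma> * mh"
  shows "A * L + C \<le> \<gamma> * M"
proof (cases "M \<le> mh")
  case False
  have "A * L \<le> A * (\<rho> * mh ^ 3)" using L m A by (intro mult_left_mono) auto
  moreover have "\<gamma> * mh \<le> \<gamma> * M" using False A by (intro mult_left_mono) auto
  ultimately show ?thesis using e1 by linarith
next
  case True
  show ?thesis
  proof (cases "ml = mh")
    case True
    then have "M = ml" using \<open>M \<le> mh\<close> m by simp
    then have "A * L \<le> A * (\<rho> * ml ^ 3)" using L A by (intro mult_left_mono) auto
    then show ?thesis using e0 \<open>M = ml\<close> by simp
  next
    case False
    define u where "u = (M - ml) / (mh - ml)"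
    have u: "0 \<le> u" "u \<le> 1" using True False m by (auto simp: u_def)
    have M: "M = (1 - u) * ml + u * mh"
    proof -
      have "u * (mh - ml) = M - ml" using False by (simp add: u_def)
      then show ?thesis by (simp add: algebra_simps)
    qed
    have "M ^ 3 \<le> (1 - u) * ml ^ 3 + u * mh ^ 3"
    proof -
      have "(1 - u) * ml ^ 3 + u * mh ^ 3 - M ^ 3 = u * (1 - u) * (mh - ml)\<^sup>2 * ((1 + u) * mh + (2 - u) * ml)"
        unfolding M by algebra
      moreover have "0 \<le> u * (1 - u) * (mh - ml)\<^sup>2 * ((1 + u) * mh + (2 - u) * ml)"
        using u m by (intro mult_nonneg_nonneg add_nonneg_nonneg) auto
      ultimately show ?thesis by linarith
    qed
    then have "\<rho> * M ^ 3 \<le> \<rho> * ((1 - u) * ml ^ 3 + u * mh ^ 3)" by (intro mult_left_mono) auto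
    then have "A * L \<le> A * (\<rho> * ((1 - u) * ml ^ 3 + u * mh ^ 3))" using L(3) A by (intro mult_left_mono) linarith+
    also have "\<dots> = (1 - u) * (A * (\<rho> * ml ^ 3)) + u * (A * (\<rho> * mh ^ 3))"
    proof -
      have "A * (c * ((1 - u) * x + u * y)) = (1 - u) * (A * (c * x)) + u * (A * (c * y))" for c x y :: real by (simp add: algebra_simps)
      then show ?thesis .
    qed
    finally have "A * L + C \<le> (1 - u) * (A * (\<rho> * ml ^ 3) + C) + u * (A * (\<rho> * mh ^ 3) + C)" by (simp add: algebra_simps)
    also have "\<dots> \<le> (1 - u) * (\<gamma> * ml) + u * (\<gamma> * mh)" using u e0 e1 by (intro add_mono mult_left_mono) auto
    also have "\<dots> = \<gamma> * M" unfolding M by (simp add: algebra_simps)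
    finally show ?thesis .
  qed
qed

lemma cube_root_gap:
  fixes m M :: real
  assumes "0 \<le> m" "m \<le> M" "0 < M" and L: "\<rho> * M ^ 3 = L" "\<rho> * m ^ 3 = L - 2"
  shows "2 * M \<le> 3 * L * (M - m)"
proof -
  have "M ^ 3 - m ^ 3 = (M - m) * (M\<^sup>2 + M * m + m\<^sup>2)" by algebra
  also have "\<dots> \<le> (M - m) * (3 * M\<^sup>2)"
  proof (rule mult_left_mono)
    have "M * m \<le> M * M" "m\<^sup>2 \<le> M\<^sup>2" using assms by (auto intro!: mult_left_mono power_mono)
    then show "M\<^sup>2 + M * m + m\<^sup>2 \<le> 3 * M\<^sup>2" by (simp add: power2_eq_square)
  qed (use assms in simp)
  finally have "\<rho> * (M ^ 3 - m ^ 3) \<le> \<rho> * ((M - m) * (3 * M\<^sup>2))" by (intro mult_left_mono) auto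
  moreover have "\<rho> * (M ^ 3 - m ^ 3) = 2" unfolding right_diff_distrib L by simp
  ultimately have "2 * M \<le> \<rho> * ((M - m) * (3 * M\<^sup>2)) * M" using assms by (intro mult_right_mono) auto
  also have "\<dots> = 3 * (\<rho> * M ^ 3) * (M - m)" by (simp add: algebra_simps power2_eq_square power3_eq_cube)
  finally show ?thesis unfolding L .
qed

text \<open>One more mode lengthens \<open>L\<close> by 2, and then \<open>M\<close>, which grows like a cube root, has to grow by at least
\<open>2 * M / (3 * L)\<close> (\<open>cube_root_gap\<close>). This exceeds the increment of the harmonic sums, of order \<open>1 / L\<close>, so a bound
linear in \<open>M\<close> is inherited from \<open>L - 2\<close>.\<close>
lemma budget_step:
  fixes A A' C C' \<gamma> L M ml \<kappa> :: real and P :: nat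
  assumes P: "9 \<le> P" "2 < L" "L \<le> 2 * (real P + 1)"
    and IH: "\<And>m. 0 < m \<Longrightarrow> L - 2 \<le> \<rho> * m ^ 3 \<Longrightarrow> A * (L - 2) + C \<le> \<gamma> * m"
    and inc: "A' * L - A * (L - 2) + (C' - C) \<le> \<kappa> / (real P + 1)"
    and num: "0 \<le> \<kappa>" "3 * \<kappa> \<le> \<gamma> * ml" "\<rho> * ml ^ 3 \<le> L" "0 < \<gamma>"
    and M: "0 < M" "L \<le> \<rho> * M ^ 3"
  shows "A' * L + C' \<le> \<gamma> * M"
proof -
  define M0 where "M0 = root 3 (L / \<rho>)"
  define m where "m = root 3 ((L - 2) / \<rho>)"
  have M0: "0 < M0" "\<rho> * M0 ^ 3 = L" using P by (simp_all add: M0_def)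
  have m: "0 < m" "\<rho> * m ^ 3 = L - 2" using P by (simp_all add: m_def)
  have "m \<le> M0" by (rule le_of_cube_le[of "\<rho>" _ "L - 2"]) (use m M0 in auto)
  from cube_root_gap[OF less_imp_le[OF m(1)] this M0 m(2)] have "2 * M0 \<le> 3 * L * (M0 - m)" .
  also have "\<dots> \<le> 3 * (2 * (real P + 1)) * (M0 - m)" using P \<open>m \<le> M0\<close> by (intro mult_right_mono) auto
  finally have "M0 / (3 * (real P + 1)) \<le> M0 - m" by (simp add: field_simps)
  then have "\<gamma> * (M0 / (3 * (real P + 1))) \<le> \<gamma> * (M0 - m)" using num by (intro mult_left_mono) auto
  moreover have "\<kappa> / (real P + 1) \<le> \<gamma> * (M0 / (3 * (real P + 1)))"
  proof -
    have "ml \<le> M0" by (rule le_of_cube_le[of "\<rho>" _ L]) (use num M0 in auto)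
    then have "\<gamma> * ml \<le> \<gamma> * M0" using num by (intro mult_left_mono) auto
    then have "3 * \<kappa> \<le> \<gamma> * M0" using num by linarith
    then have "\<kappa> / (real P + 1) \<le> (\<gamma> * M0 / 3) / (real P + 1)" by (intro divide_right_mono) auto
    then show ?thesis by simp
  qed
  moreover have "A * (L - 2) + C \<le> \<gamma> * m" using IH[OF m(1)] m(2) by simp
  moreover have "\<gamma> * (M0 - m) = \<gamma> * M0 - \<gamma> * m" by (simp add: right_diff_distrib)
  ultimately have "A' * L + C' \<le> \<gamma> * M0" using inc by linarith
  also have "M0 \<le> M" by (rule le_of_cube_le[of "\<rho>" _ L]) (use M M0 in auto)
  then have "\<gamma> * M0 \<le> \<gamma> * M" using num by (intro mult_left_mono) auto
  finally show ?thesis .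
qed

lemma average_step:
  assumes "9 \<le> P" "0 \<le> L" "2 * real P + 2 - L \<le> s" "0 \<le> s"
  shows "odd_harmonic (Suc P) / real (Suc P) * L - odd_harmonic P / real P * (L - 2) \<le> (s / 4 + L / (2 * real P + 1)) / (real P + 1)"
proof -
  define x where "x = real P"
  have x: "9 \<le> x" using assms by (simp add: x_def)
  define w where "w = odd_harmonic P / x"
  have w: "0 \<le> w" "w \<le> 1/4" using odd_harmonic_le_quarter[OF assms(1)] odd_harmonic_nonneg[of P] x by (auto simp: w_def x_def field_simps)
  have O: "odd_harmonic P = w * x" using x by (simp add: w_def)
  have "odd_harmonic (Suc P) / real (Suc P) * L = (w * x + 1 / (2 * x + 1)) / (x + 1) * L"
    unfolding odd_harmonic_Suc O x_def by (simp add: add.commute)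
  also have "\<dots> = w * x * L / (x + 1) + L / (2 * x + 1) / (x + 1)" by (simp add: add_divide_distrib distrib_right)
  also have "w * x * L / (x + 1) = w * (L - 2) + w * (2 * x + 2 - L) / (x + 1)" using x by (simp add: field_simps)
  finally have "odd_harmonic (Suc P) / real (Suc P) * L - odd_harmonic P / real P * (L - 2)
     = w * (2 * x + 2 - L) / (x + 1) + L / (2 * x + 1) / (x + 1)" unfolding w_def x_def by simp
  also have "w * (2 * x + 2 - L) \<le> 1/4 * s"
  proof -
    have "w * (2 * x + 2 - L) \<le> w * s" using w assms by (intro mult_left_mono) (auto simp: x_def)
    also have "\<dots> \<le> 1/4 * s" using w assms by (intro mult_right_mono) auto
    finally show ?thesis .
  qed
  then have "w * (2 * x + 2 - L) / (x + 1) + L / (2 * x + 1) / (x + 1) \<le> 1/4 * s / (x + 1) + L / (2 * x + 1) / (x + 1)"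
    using x by (intro add_right_mono divide_right_mono) auto
  also have "\<dots> = (s / 4 + L / (2 * real P + 1)) / (real P + 1)" by (simp add: x_def add_divide_distrib)
  finally show ?thesis .
qed

definition stat_sum :: "real \<Rightarrow> nat \<Rightarrow> real" where
  "stat_sum \<tau> n = (\<Sum>j<n. (7717/10000) / (2 * real j + 2 - \<tau>))"

definition end_sum :: "nat \<Rightarrow> real" where
  "end_sum n = (3/5) + (\<Sum>j<n. (27/50) / (2 * real j + 1))"

lemma stat_sum_mono: "\<tau> \<le> \<tau>' \<Longrightarrow> \<tau>' < 2 \<Longrightarrow> stat_sum \<tau> n \<le> stat_sum \<tau>' n"
  unfolding stat_sum_def by (intro sum_mono divide_left_mono mult_pos_pos) auto

lemma transition_budget_large:
  assumes "8 \<le> n" "2 * real n - (297/250) \<le> L" "L \<le> 2 * real n + (297/250)" "L \<le> \<rho> * M ^ 3" "0 < M"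
  shows "(7571/10000) * (odd_harmonic (Suc n) / real (Suc n)) * L + ((10947/10000) + (3/1000) + (4179/10000) + stat_sum (47/250) n + end_sum (n - 1)) \<le> (6897/5000) * M"
  using assms
proof (induction n arbitrary: L M rule: dec_induct)
  case base
  have "(1337/250) \<le> M" by (rule le_of_cube_le[of \<rho> _ L]) (use base in \<open>auto simp: power3_eq_cube\<close>)
  have o: "odd_harmonic 9 \<le> (208063/100000)" by (simp add: odd_harmonic_def eval_nat_numeral)
  have s: "stat_sum (47/250) 8 \<le> (22171/20000)" by (simp add: stat_sum_def eval_nat_numeral)
  have e: "end_sum 7 \<le> (82789/50000)" by (simp add: end_sum_def eval_nat_numeral)
  have "(7571/10000) * ((208063/100000) / 9) * L + ((10947/10000) + (3/1000) + (4179/10000) + (22171/20000) + (82789/50000)) \<le> (6897/5000) * M"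
    by (rule cubic_budget[where ml = "(1337/250)" and mh = "(3513/625)" and hi = "(4297/250)"])
       (use base \<open>(1337/250) \<le> M\<close> in \<open>simp_all add: power3_eq_cube\<close>)
  moreover have "(7571/10000) * (odd_harmonic 9 / 9) * L \<le> (7571/10000) * ((208063/100000) / 9) * L"
    using o base by (intro mult_right_mono mult_left_mono divide_right_mono) auto
  moreover have "Suc 8 = 9" "8 - 1 = (7::nat)" "real 9 = 9" by simp_all
  ultimately show ?case using s e by (simp only: of_nat_numeral)
next
  case (step n)
  define x where "x = real (Suc n)"
  have x: "9 \<le> x" using step by (simp add: x_def)
  have L: "2 * x - (297/250) \<le> L" "L \<le> 2 * x + (297/250)" using step.prems by (auto simp: x_def)
  let ?a = "\<lambda>k. odd_harmonic (Suc k) / real (Suc k)"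
  let ?C = "\<lambda>n. (10947/10000) + (3/1000) + (4179/10000) + stat_sum (47/250) n + end_sum (n - 1)"
  show ?case
  proof (rule budget_step[where P = "Suc n" and L = L and A = "(7571/10000) * ?a n" and C = "?C n" and ml = "(11/2)" and \<kappa> = "(23/10)"])
    show "(7571/10000) * ?a n * (L - 2) + ?C n \<le> (6897/5000) * m" if "0 < m" "L - 2 \<le> \<rho> * m ^ 3" for m
      by (rule step.IH) (use that step.prems in auto)
    have "?a (Suc n) * L - ?a n * (L - 2) \<le> ((797/250) / 4 + L / (2 * x + 1)) / (x + 1)"
      using average_step[of "Suc n" L "(797/250)"] L x unfolding x_def by auto
    also have "\<dots> \<le> (1807/1000) / (x + 1)"
    proof (rule divide_right_mono)
      have "L / (2 * x + 1) \<le> (101/100)" using L x by (simp add: field_simps)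
      then show "(797/250) / 4 + L / (2 * x + 1) \<le> (1807/1000)" by argo
    qed (use x in simp)
    finally have a: "?a (Suc n) * L - ?a n * (L - 2) \<le> (1807/1000) / (x + 1)" .
    have "(7571/10000) * ?a (Suc n) * L - (7571/10000) * ?a n * (L - 2) = (7571/10000) * (?a (Suc n) * L - ?a n * (L - 2))" by (simp add: algebra_simps)
    also have "\<dots> \<le> (7571/10000) * ((1807/1000) / (x + 1))" by (intro mult_left_mono a) auto
    also have "(7571/10000) * ((1807/1000) / (x + 1)) = ((7571/10000) * (1807/1000)) / (x + 1)" by simp
    also have "\<dots> \<le> (137/100) / (x + 1)" using x by (intro divide_right_mono) auto
    finally have a: "(7571/10000) * ?a (Suc n) * L - (7571/10000) * ?a n * (L - 2) \<le> (137/100) / (x + 1)" .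
    have s: "stat_sum (47/250) (Suc n) - stat_sum (47/250) n \<le> (11/25) / (x + 1)"
      unfolding stat_sum_def using x by (simp add: x_def field_simps)
    obtain k where k: "n = Suc k" using step by (cases n) auto
    have e: "end_sum (Suc n - 1) - end_sum (n - 1) \<le> (37/100) / (x + 1)"
      unfolding end_sum_def k using x by (simp add: x_def k field_simps)
    have "(7571/10000) * ?a (Suc n) * L - (7571/10000) * ?a n * (L - 2) + (?C (Suc n) - ?C n)
      = (7571/10000) * ?a (Suc n) * L - (7571/10000) * ?a n * (L - 2) + ((stat_sum (47/250) (Suc n) - stat_sum (47/250) n) + (end_sum (Suc n - 1) - end_sum (n - 1)))" by simp
    also have "\<dots> \<le> (137/100) / (x + 1) + ((11/25) / (x + 1) + (37/100) / (x + 1))" by (intro add_mono a s e)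
    also have "\<dots> = ((137/100) + ((11/25) + (37/100))) / (x + 1)" by (simp only: add_divide_distrib)
    also have "\<dots> \<le> (23/10) / (x + 1)" using x by (intro divide_right_mono) auto
    finally show "(7571/10000) * ?a (Suc n) * L - (7571/10000) * ?a n * (L - 2) + (?C (Suc n) - ?C n) \<le> (23/10) / (real (Suc n) + 1)"
      by (simp only: x_def)
      have num: "\<rho> * (11/2) ^ 3 \<le> (81/5)" by (simp add: power3_eq_cube)
    show "\<rho> * (11/2) ^ 3 \<le> L" using num L x by linarith
    show "2 < L" using L x by argo
    have "L \<le> 2 * (x + 1)" using L by argo
    then show "L \<le> 2 * (real (Suc n) + 1)" by (simp only: x_def)
    show "9 \<le> Suc n" using step.hyps by simp
    show "L \<le> \<rho> * M ^ 3" "0 < M" using step.prems by blast+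
  qed simp_all
qed

lemma turning_budget_large:
  assumes "8 \<le> n" "2 * real n - 1 \<le> L" "L \<le> 2 * real n + 3" "L \<le> \<rho> * M ^ 3" "0 < M"
  shows "(7571/10000) * (odd_harmonic (Suc (Suc n)) / real (Suc (Suc n))) * L + ((10947/10000) + (3/1000) + (1/4) + (1253/5000) + (1893/5000) + stat_sum 0 n + end_sum n) \<le> (7443/5000) * M"
  using assms
proof (induction n arbitrary: L M rule: dec_induct)
  case base
  have "(5371/1000) \<le> M" by (rule le_of_cube_le[of \<rho> _ L]) (use base in \<open>auto simp: power3_eq_cube\<close>)
  have o: "odd_harmonic 10 \<le> (106663/50000)" by (simp add: odd_harmonic_def eval_nat_numeral)
  have s: "stat_sum 0 8 \<le> (104869/100000)" by (simp add: stat_sum_def eval_nat_numeral)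
  have e: "end_sum 8 \<le> (84589/50000)" by (simp add: end_sum_def eval_nat_numeral)
  have "(7571/10000) * ((106663/50000) / 10) * L + ((10947/10000) + (3/1000) + (1/4) + (1253/5000) + (1893/5000) + (104869/100000) + (84589/50000)) \<le> (7443/5000) * M"
    by (rule cubic_budget[where ml = "(5371/1000)" and mh = "(29059/5000)" and hi = "19"])
       (use base \<open>(5371/1000) \<le> M\<close> in \<open>simp_all add: power3_eq_cube\<close>)
  moreover have "(7571/10000) * (odd_harmonic 10 / 10) * L \<le> (7571/10000) * ((106663/50000) / 10) * L"
    using o base by (intro mult_right_mono mult_left_mono divide_right_mono) auto
  moreover have "Suc (Suc 8) = 10" "real 10 = 10" by simp_all
  ultimately show ?case using s e by (simp only: of_nat_numeral)
next
  case (step n)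
  define x where "x = real (Suc (Suc n))"
  have x: "10 \<le> x" using step by (simp add: x_def)
  have L: "2 * x - 3 \<le> L" "L \<le> 2 * x + 1" using step.prems by (auto simp: x_def)
  let ?a = "\<lambda>k. odd_harmonic (Suc (Suc k)) / real (Suc (Suc k))"
  let ?C = "\<lambda>n. (10947/10000) + (3/1000) + (1/4) + (1253/5000) + (1893/5000) + stat_sum 0 n + end_sum n"
  show ?case
  proof (rule budget_step[where P = "Suc (Suc n)" and L = L and A = "(7571/10000) * ?a n" and C = "?C n" and ml = "(11/2)" and \<kappa> = "(13/5)"])
    show "(7571/10000) * ?a n * (L - 2) + ?C n \<le> (7443/5000) * m" if "0 < m" "L - 2 \<le> \<rho> * m ^ 3" for m
      by (rule step.IH) (use that step.prems in auto)
    have "?a (Suc n) * L - ?a n * (L - 2) \<le> (5 / 4 + L / (2 * x + 1)) / (x + 1)"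
      using average_step[of "Suc (Suc n)" L 5] L x unfolding x_def by auto
    also have "\<dots> \<le> (9/4) / (x + 1)"
    proof (rule divide_right_mono)
      have "L / (2 * x + 1) \<le> 1" using L x by (simp add: field_simps)
      then show "5 / 4 + L / (2 * x + 1) \<le> (9/4)" by argo
    qed (use x in simp)
    finally have a: "?a (Suc n) * L - ?a n * (L - 2) \<le> (9/4) / (x + 1)" .
    have "(7571/10000) * ?a (Suc n) * L - (7571/10000) * ?a n * (L - 2) = (7571/10000) * (?a (Suc n) * L - ?a n * (L - 2))" by (simp add: algebra_simps)
    also have "\<dots> \<le> (7571/10000) * ((9/4) / (x + 1))" by (intro mult_left_mono a) auto
    also have "(7571/10000) * ((9/4) / (x + 1)) = ((7571/10000) * (9/4)) / (x + 1)" by simp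
    also have "\<dots> \<le> (171/100) / (x + 1)" using x by (intro divide_right_mono) auto
    finally have a: "(7571/10000) * ?a (Suc n) * L - (7571/10000) * ?a n * (L - 2) \<le> (171/100) / (x + 1)" .
    have s: "stat_sum 0 (Suc n) - stat_sum 0 n \<le> (12/25) / (x + 1)"
      unfolding stat_sum_def using x by (simp add: x_def field_simps)
    have e: "end_sum (Suc n) - end_sum n \<le> (9/25) / (x + 1)"
      unfolding end_sum_def using x by (simp add: x_def field_simps)
    have "(7571/10000) * ?a (Suc n) * L - (7571/10000) * ?a n * (L - 2) + (?C (Suc n) - ?C n)
      = (7571/10000) * ?a (Suc n) * L - (7571/10000) * ?a n * (L - 2) + ((stat_sum 0 (Suc n) - stat_sum 0 n) + (end_sum (Suc n) - end_sum n))" by simp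
    also have "\<dots> \<le> (171/100) / (x + 1) + ((12/25) / (x + 1) + (9/25) / (x + 1))" by (intro add_mono a s e)
    also have "\<dots> = ((171/100) + ((12/25) + (9/25))) / (x + 1)" by (simp only: add_divide_distrib)
    also have "\<dots> \<le> (13/5) / (x + 1)" using x by (intro divide_right_mono) auto
    finally show "(7571/10000) * ?a (Suc n) * L - (7571/10000) * ?a n * (L - 2) + (?C (Suc n) - ?C n) \<le> (13/5) / (real (Suc (Suc n)) + 1)"
      by (simp only: x_def)
      have num: "\<rho> * (11/2) ^ 3 \<le> (81/5)" by (simp add: power3_eq_cube)
    show "\<rho> * (11/2) ^ 3 \<le> L" using num L x by linarith
    show "2 < L" using L x by argo
    have "L \<le> 2 * (x + 1)" using L by argo
    then show "L \<le> 2 * (real (Suc (Suc n)) + 1)" by (simp only: x_def)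
    show "9 \<le> Suc (Suc n)" using step.hyps by simp
    show "L \<le> \<rho> * M ^ 3" "0 < M" using step.prems by blast+
  qed simp_all
qed

lemma transition_budget_small:
  fixes n nb P :: nat and M L \<tau> G ma \<sigma> ml mh oh ss es :: real
  assumes M: "(12599/5000) \<le> M" "\<tau> * M = 1" and L: "2 * real n - 1 - \<tau> \<le> L" "L \<le> 2 * real n + 1 + \<tau>" "0 \<le> L" "L \<le> \<rho> * M ^ 3"
    and G: "G * M ^ 3 \<le> (171/400)"
    and num: "ma \<le> (12599/5000) \<or> \<rho> * ma ^ 3 \<le> 2 * real n - (1397/1000)" "1 \<le> \<sigma> * ma" "0 < ma" "0 < \<sigma>" "\<sigma> < 2" "0 < ml" "ml \<le> mh"
      "ml \<le> (12599/5000) \<or> \<rho> * ml ^ 3 \<le> 2 * real n - 1 - \<sigma>" "2 * real n + 1 + \<sigma> \<le> \<rho> * mh ^ 3"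
      "odd_harmonic P \<le> oh" "stat_sum \<sigma> n \<le> ss" "end_sum (n - 1) \<le> es"
      "(7571/10000) * (oh / real P) * (\<rho> * ml ^ 3) + ((10947/10000) + (171/400) / ml ^ 3 + real nb * ((1893/2500) / (2 - \<sigma>)) + ss + es) \<le> (6897/5000) * ml"
      "(7571/10000) * (oh / real P) * (\<rho> * mh ^ 3) + ((10947/10000) + (171/400) / ml ^ 3 + real nb * ((1893/2500) / (2 - \<sigma>)) + ss + es) \<le> (6897/5000) * mh"
  shows "(10947/10000) + (7571/10000) * (odd_harmonic P / real P) * L + G + real nb * ((1893/2500) / (2 - \<tau>)) + stat_sum \<tau> n + end_sum (n - 1) \<le> (6897/5000) * M"
proof -
  have M0: "0 < M" using M by linarith
  have tau2: "\<tau> = 1 / M" using M M0 by (simp add: field_simps)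
  have tau: "0 < \<tau>" "\<tau> = 1 / M" using M0 tau2 by auto
  have "\<tau> \<le> (397/1000)" unfolding tau(2) using M by (simp add: field_simps)
  have "ma \<le> M" using num(1)
  proof
    assume "\<rho> * ma ^ 3 \<le> 2 * real n - (1397/1000)"
    then show ?thesis using L \<open>\<tau> \<le> (397/1000)\<close> M0 by (intro le_of_cube_le[of \<rho> ma L]) auto
  qed (use M in linarith)
  have t0: "\<tau> \<le> \<sigma>"
  proof -
    have "1 \<le> \<sigma> * M" using num(2,4) \<open>ma \<le> M\<close> by (meson mult_left_mono less_imp_le order_trans)
    then show ?thesis unfolding tau(2) using M0 by (simp add: field_simps)
  qed
  have ml: "ml \<le> M" using num(8)
  proof
    assume "\<rho> * ml ^ 3 \<le> 2 * real n - 1 - \<sigma>"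
    then show ?thesis using L t0 M0 by (intro le_of_cube_le[of \<rho> ml L]) auto
  qed (use M in linarith)
  let ?C = "(10947/10000) + (171/400) / ml ^ 3 + real nb * ((1893/2500) / (2 - \<sigma>)) + ss + es"
  have oh: "0 \<le> oh" using num(10) odd_harmonic_nonneg[of P] by linarith
  have "(7571/10000) * (odd_harmonic P / real P) * L \<le> (7571/10000) * (oh / real P) * L"
    using num(10) L(3) by (intro mult_right_mono mult_left_mono divide_right_mono) simp_all
  moreover have "(7571/10000) * (oh / real P) * L + ?C \<le> (6897/5000) * M"
  proof (rule cubic_budget[where ml = ml and mh = mh and hi = "2 * real n + 1 + \<sigma>"])
    show "L \<le> 2 * real n + 1 + \<sigma>" using L(2) t0 by linarith
    show "0 \<le> (7571/10000) * (oh / real P)" using oh by simp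
  qed (rule L(3) L(4) num(6) num(7) num(9) num(13) num(14) ml | simp)+
  moreover have "G \<le> (171/400) / ml ^ 3"
  proof -
    have "G \<le> (171/400) / M ^ 3" using G M0 by (simp add: field_simps)
    also have "\<dots> \<le> (171/400) / ml ^ 3" using ml num(6) by (intro divide_left_mono power_mono mult_pos_pos) auto
    finally show ?thesis .
  qed
  moreover have "real nb * ((1893/2500) / (2 - \<tau>)) \<le> real nb * ((1893/2500) / (2 - \<sigma>))"
    using t0 num(5) tau by (intro mult_left_mono divide_left_mono mult_pos_pos) auto
  moreover have "stat_sum \<tau> n \<le> stat_sum \<sigma> n" by (rule stat_sum_mono[OF t0 num(5)])
  ultimately show ?thesis using num(11,12) by argo
qed

lemma transition_budget:
  fixes n nb P :: nat and M L \<tau> G :: real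
  assumes M: "(12599/5000) \<le> M" "\<tau> * M = 1" and L: "2 * real n - 1 - \<tau> \<le> L" "L \<le> 2 * real n + 1 + \<tau>" "0 \<le> L" "L \<le> \<rho> * M ^ 3"
    and G: "G * M ^ 3 \<le> (171/400)" and n: "1 \<le> n" and P: "P = n + nb + 1" and nb: "nb = n mod 2"
  shows "(10947/10000) + (7571/10000) * (odd_harmonic P / real P) * L + G + (2813/5000) * M + real nb * ((1893/2500) / (2 - \<tau>)) + stat_sum \<tau> n + end_sum (n - 1) \<le> (971/500) * M"
proof -
  note small = transition_budget_small[OF M L G]
  have "(10947/10000) + (7571/10000) * (odd_harmonic P / real P) * L + G + real nb * ((1893/2500) / (2 - \<tau>)) + stat_sum \<tau> n + end_sum (n - 1) \<le> (6897/5000) * M"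
  proof (cases "n < 8")
    case True
    with n consider "n = 1" | "n = 2" | "n = 3" | "n = 4" | "n = 5" | "n = 6" | "n = 7" by linarith
    then show ?thesis
    proof cases
      case 1
      then have eqs: "n = 1" "P = 3" "nb = 1" using P nb by simp_all
      have o: "odd_harmonic 3 \<le> (76667/50000)" by (simp add: odd_harmonic_def eval_nat_numeral)
      have s: "stat_sum (3969/10000) 1 \<le> (24069/50000)" by (simp add: stat_sum_def eval_nat_numeral)
      have e: "end_sum 0 \<le> (3/5)" by (simp add: end_sum_def eval_nat_numeral)
      show ?thesis
        by (rule small[where ma = "(12599/5000)" and \<sigma> = "(3969/10000)" and ml = "(12599/5000)" and mh = "(32741/10000)" and oh = "(76667/50000)" and ss = "(24069/50000)" and es = "(3/5)"])
           (use o s e in \<open>simp_all add: eqs power3_eq_cube\<close>)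
    next
      case 2
      then have eqs: "n = 2" "P = 3" "nb = 0" using P nb by simp_all
      have o: "odd_harmonic 3 \<le> (76667/50000)" by (simp add: odd_harmonic_def eval_nat_numeral)
      have s: "stat_sum (3339/10000) 2 \<le> (8421/12500)" by (simp add: stat_sum_def eval_nat_numeral)
      have e: "end_sum 1 \<le> (57/50)" by (simp add: end_sum_def eval_nat_numeral)
      show ?thesis
        by (rule small[where ma = "(14979/5000)" and \<sigma> = "(3339/10000)" and ml = "(15099/5000)" and mh = "(7611/2000)" and oh = "(76667/50000)" and ss = "(8421/12500)" and es = "(57/50)"])
           (use o s e in \<open>simp_all add: eqs power3_eq_cube\<close>)
    next
      case 3
      then have eqs: "n = 3" "P = 5" "nb = 1" using P nb by simp_all
      have o: "odd_harmonic 5 \<le> (178731/100000)" by (simp add: odd_harmonic_def eval_nat_numeral)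
      have s: "stat_sum (2761/10000) 3 \<le> (7897/10000)" by (simp add: stat_sum_def eval_nat_numeral)
      have e: "end_sum 2 \<le> (33/25)" by (simp add: end_sum_def eval_nat_numeral)
      show ?thesis
        by (rule small[where ma = "(36227/10000)" and \<sigma> = "(2761/10000)" and ml = "(18271/5000)" and mh = "(8441/2000)" and oh = "(178731/100000)" and ss = "(7897/10000)" and es = "(33/25)"])
           (use o s e in \<open>simp_all add: eqs power3_eq_cube\<close>)
    next
      case 4
      then have eqs: "n = 4" "P = 5" "nb = 0" using P nb by simp_all
      have o: "odd_harmonic 5 \<le> (178731/100000)" by (simp add: odd_harmonic_def eval_nat_numeral)
      have s: "stat_sum (153/625) 4 \<le> (87877/100000)" by (simp add: stat_sum_def eval_nat_numeral)
      have e: "end_sum 3 \<le> (357/250)" by (simp add: end_sum_def eval_nat_numeral)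
      show ?thesis
        by (rule small[where ma = "(40857/10000)" and \<sigma> = "(153/625)" and ml = "(41169/10000)" and mh = "(2857/625)" and oh = "(178731/100000)" and ss = "(87877/100000)" and es = "(357/250)"])
           (use o s e in \<open>simp_all add: eqs power3_eq_cube\<close>)
    next
      case 5
      then have eqs: "n = 5" "P = 7" "nb = 1" using P nb by simp_all
      have o: "odd_harmonic 7 \<le> (97757/50000)" by (simp add: odd_harmonic_def eval_nat_numeral)
      have s: "stat_sum (2241/10000) 5 \<le> (95071/100000)" by (simp add: stat_sum_def eval_nat_numeral)
      have e: "end_sum 4 \<le> (30103/20000)" by (simp add: end_sum_def eval_nat_numeral)
      show ?thesis
        by (rule small[where ma = "(2789/625)" and \<sigma> = "(2241/10000)" and ml = "(44921/10000)" and mh = "(9753/2000)" and oh = "(97757/50000)" and ss = "(95071/100000)" and es = "(30103/20000)"])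
           (use o s e in \<open>simp_all add: eqs power3_eq_cube\<close>)
    next
      case 6
      then have eqs: "n = 6" "P = 7" "nb = 0" using P nb by simp_all
      have o: "odd_harmonic 7 \<le> (97757/50000)" by (simp add: odd_harmonic_def eval_nat_numeral)
      have s: "stat_sum (2091/10000) 6 \<le> (20221/20000)" by (simp add: stat_sum_def eval_nat_numeral)
      have e: "end_sum 5 \<le> (31303/20000)" by (simp add: end_sum_def eval_nat_numeral)
      show ?thesis
        by (rule small[where ma = "(11961/2500)" and \<sigma> = "(2091/10000)" and ml = "(77/16)" and mh = "(25743/5000)" and oh = "(97757/50000)" and ss = "(20221/20000)" and es = "(31303/20000)"])
           (use o s e in \<open>simp_all add: eqs power3_eq_cube\<close>)
    next
      case 7
      then have eqs: "n = 7" "P = 9" "nb = 1" using P nb by simp_all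
      have o: "odd_harmonic 9 \<le> (208063/100000)" by (simp add: odd_harmonic_def eval_nat_numeral)
      have s: "stat_sum (987/5000) 7 \<le> (13287/12500)" by (simp add: stat_sum_def eval_nat_numeral)
      have e: "end_sum 6 \<le> (10089/6250)" by (simp add: end_sum_def eval_nat_numeral)
      show ?thesis
        by (rule small[where ma = "(50681/10000)" and \<sigma> = "(987/5000)" and ml = "(50947/10000)" and mh = "(53949/10000)" and oh = "(208063/100000)" and ss = "(13287/12500)" and es = "(10089/6250)"])
           (use o s e in \<open>simp_all add: eqs power3_eq_cube\<close>)
    qed
  next
    case False
    have M0: "0 < M" using M by linarith
    have tau2: "\<tau> = 1 / M" using M M0 by (simp add: field_simps)
  have tau: "0 < \<tau>" "\<tau> = 1 / M" using M0 tau2 by auto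
    have "\<tau> \<le> (397/1000)" unfolding tau(2) using M by (simp add: field_simps)
    moreover have n8: "8 \<le> real n" using False by simp
    ultimately have "(73/5) \<le> L" using L(1) by argo
    moreover have "\<rho> * (133/25) ^ 3 \<le> (73/5)" by (simp add: power3_eq_cube)
    ultimately have "\<rho> * (133/25) ^ 3 \<le> L" by (rule order_trans[rotated])
    from le_of_cube_le[OF this L(4) _ less_imp_le[OF M0]] have M532: "(133/25) \<le> M" by simp
    have t0: "\<tau> \<le> (47/250)" unfolding tau(2) using M532 M0 by (simp add: field_simps)
    have "(133/25) ^ 3 \<le> M ^ 3" using M532 by (intro power_mono) auto
    moreover have "150 \<le> ((133/25) :: real) ^ 3" by (simp add: power3_eq_cube)
    ultimately have M3: "150 \<le> M ^ 3" by (rule order_trans[rotated])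
    have "(7571/10000) * (odd_harmonic (Suc n) / real (Suc n)) * L + ((10947/10000) + (3/1000) + (4179/10000) + stat_sum (47/250) n + end_sum (n - 1)) \<le> (6897/5000) * M"
    proof (rule transition_budget_large)
      show "8 \<le> n" using False by simp
      show "2 * real n - (297/250) \<le> L" "L \<le> 2 * real n + (297/250)" using L(1,2) t0 by argo+
    qed (rule L(4) M0)+
    moreover have "G \<le> (3/1000)"
    proof (rule ccontr)
      assume "\<not> G \<le> (3/1000)"
      then have "(3/1000) * 150 \<le> G * M ^ 3" using M3 by (intro mult_mono) auto
      then show False using G by simp
    qed
    moreover have "real nb * ((1893/2500) / (2 - \<tau>)) \<le> 1 * ((1893/2500) / (2 - (47/250)))"
      using t0 nb by (intro mult_mono divide_left_mono mult_pos_pos) auto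
    moreover have "stat_sum \<tau> n \<le> stat_sum (47/250) n" by (rule stat_sum_mono[OF t0]) simp
    moreover have "(7571/10000) * (odd_harmonic P / real P) * L \<le> (7571/10000) * (odd_harmonic (Suc n) / real (Suc n)) * L"
      using odd_harmonic_average_antimono[of "Suc n" P] P L by (intro mult_right_mono mult_left_mono) auto
    moreover have "1 * ((1893/2500) / (2 - (47/250))) \<le> ((4179/10000) :: real)" by simp
    ultimately show ?thesis by argo
  qed
  then show ?thesis by argo
qed

lemma turning_budget_small:
  fixes n nb P :: nat and M L \<tau> G ma \<sigma> \<upsilon> ml mh oh ss es :: real
  assumes M: "(1624/625) \<le> M" "\<tau> * M = 1" and L: "2 * real n - 1 + \<tau> \<le> L" "L \<le> 2 * real n + 3 - \<tau>" "0 \<le> L" "L \<le> \<rho> * M ^ 3" "(9679/100000) * M ^ 3 \<le> L"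
    and G: "G * M ^ 3 \<le> (171/400)"
    and num: "ma \<le> (1624/625) \<or> \<rho> * ma ^ 3 \<le> 2 * real n - 1" "1 \<le> \<sigma> * ma" "0 < ma" "0 < \<sigma>" "\<sigma> < 2" "0 < ml" "ml \<le> mh" "\<upsilon> * mh \<le> 1" "0 \<le> \<upsilon>"
      "ml \<le> (1624/625) \<or> \<rho> * ml ^ 3 \<le> 2 * real n - 1 + \<upsilon>" "2 * real n + 3 \<le> (9679/100000) * mh ^ 3"
      "odd_harmonic P \<le> oh" "stat_sum 0 n \<le> ss" "end_sum n \<le> es"
      "(7571/10000) * (oh / real P) * (\<rho> * ml ^ 3) + ((10947/10000) + (171/400) / ml ^ 3 + (1/4) + (2267/5000) / (2 - \<sigma>) + (real nb - 1) * ((1893/2500) / (2 + \<upsilon>)) + ss + es) \<le> (7443/5000) * ml"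
      "(7571/10000) * (oh / real P) * (\<rho> * mh ^ 3) + ((10947/10000) + (171/400) / ml ^ 3 + (1/4) + (2267/5000) / (2 - \<sigma>) + (real nb - 1) * ((1893/2500) / (2 + \<upsilon>)) + ss + es) \<le> (7443/5000) * mh"
    and nb: "1 \<le> nb"
  shows "(10947/10000) + (7571/10000) * (odd_harmonic P / real P) * L + G + (1/4) + (2267/5000) / (2 - \<tau>) + (real nb - 1) * ((1893/2500) / (2 + \<tau>)) + stat_sum 0 n + end_sum n \<le> (7443/5000) * M"
proof -
  have M0: "0 < M" using M by linarith
  have tau2: "\<tau> = 1 / M" using M M0 by (simp add: field_simps)
  have tau: "0 < \<tau>" "\<tau> = 1 / M" using M0 tau2 by auto
  have Ll: "2 * real n - 1 \<le> L" and Lh: "L \<le> 2 * real n + 3" using L(1,2) tau(1) by linarith+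
  have "ma \<le> M" using num(1)
  proof
    assume "\<rho> * ma ^ 3 \<le> 2 * real n - 1"
    then show ?thesis using Ll L(4) M0 by (intro le_of_cube_le[of \<rho> ma L]) auto
  qed (use M in linarith)
  have t0: "\<tau> \<le> \<sigma>"
  proof -
    have "1 \<le> \<sigma> * M" using num(2,4) \<open>ma \<le> M\<close> by (meson mult_left_mono less_imp_le order_trans)
    then show ?thesis unfolding tau(2) using M0 by (simp add: field_simps)
  qed
  have mh: "M \<le> mh" using Lh L(5) num by (intro le_of_cube_le[of "(9679/100000)" M "2 * real n + 3"]) auto
  have t1: "\<upsilon> \<le> \<tau>"
  proof -
    have "\<upsilon> * M \<le> 1" using num(8,9) mh by (meson mult_left_mono order_trans)
    then show ?thesis unfolding tau(2) using M0 by (simp add: field_simps)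
  qed
  have ml: "ml \<le> M" using num(10)
  proof
    assume "\<rho> * ml ^ 3 \<le> 2 * real n - 1 + \<upsilon>"
    then show ?thesis using L t1 M0 by (intro le_of_cube_le[of \<rho> ml L]) auto
  qed (use M in linarith)
  let ?C = "(10947/10000) + (171/400) / ml ^ 3 + (1/4) + (2267/5000) / (2 - \<sigma>) + (real nb - 1) * ((1893/2500) / (2 + \<upsilon>)) + ss + es"
  have oh: "0 \<le> oh" using num(12) odd_harmonic_nonneg[of P] by linarith
  have "(7571/10000) * (odd_harmonic P / real P) * L \<le> (7571/10000) * (oh / real P) * L"
    using num(12) L(3) by (intro mult_right_mono mult_left_mono divide_right_mono) simp_all
  moreover have "(7571/10000) * (oh / real P) * L + ?C \<le> (7443/5000) * M"
  proof (rule cubic_budget[where ml = ml and mh = mh and hi = "2 * real n + 3"])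
    have "(9679/100000) * mh ^ 3 \<le> \<rho> * mh ^ 3" using num(6,7) by (intro mult_right_mono) auto
    then show "2 * real n + 3 \<le> \<rho> * mh ^ 3" using num(11) by linarith
    show "0 \<le> (7571/10000) * (oh / real P)" using oh by simp
  qed (rule L(3) L(4) Lh num(6) num(7) num(15) num(16) ml | simp)+
  moreover have "G \<le> (171/400) / ml ^ 3"
  proof -
    have "G \<le> (171/400) / M ^ 3" using G M0 by (simp add: field_simps)
    also have "\<dots> \<le> (171/400) / ml ^ 3" using ml num(6) by (intro divide_left_mono power_mono mult_pos_pos) auto
    finally show ?thesis .
  qed
  moreover have "(real nb - 1) * ((1893/2500) / (2 + \<tau>)) \<le> (real nb - 1) * ((1893/2500) / (2 + \<upsilon>))"
    using t1 num(9) tau nb by (intro mult_left_mono divide_left_mono mult_pos_pos) auto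
  moreover have "(2267/5000) / (2 - \<tau>) \<le> (2267/5000) / (2 - \<sigma>)"
    using t0 num(5) tau by (intro divide_left_mono mult_pos_pos) auto
  ultimately show ?thesis using num(13,14) by argo
qed

lemma turning_budget:
  fixes n nb P :: nat and M L \<tau> G :: real
  assumes M: "(1624/625) \<le> M" "\<tau> * M = 1" and L: "2 * real n - 1 + \<tau> \<le> L" "L \<le> 2 * real n + 3 - \<tau>" "0 \<le> L" "L \<le> \<rho> * M ^ 3" "(9679/100000) * M ^ 3 \<le> L"
    and G: "G * M ^ 3 \<le> (171/400)" and n: "1 \<le> n" and P: "P = n + nb + 1" and nb: "nb = 2 - n mod 2"
  shows "(10947/10000) + (7571/10000) * (odd_harmonic P / real P) * L + G + (2267/5000) * M + (1/4) + (2267/5000) / (2 - \<tau>) + (real nb - 1) * ((1893/2500) / (2 + \<tau>)) + stat_sum 0 n + end_sum n \<le> (971/500) * M"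
proof -
  note small = turning_budget_small[OF M L G]
  have nb12: "1 \<le> nb" "nb \<le> 2" using nb by presburger+
  have "(10947/10000) + (7571/10000) * (odd_harmonic P / real P) * L + G + (1/4) + (2267/5000) / (2 - \<tau>) + (real nb - 1) * ((1893/2500) / (2 + \<tau>)) + stat_sum 0 n + end_sum n \<le> (7443/5000) * M"
  proof (cases "n < 8")
    case True
    with n consider "n = 1" | "n = 2" | "n = 3" | "n = 4" | "n = 5" | "n = 6" | "n = 7" by linarith
    then show ?thesis
    proof cases
      case 1
      then have eqs: "n = 1" "P = 3" "nb = 1" using P nb by simp_all
      have o: "odd_harmonic 3 \<le> (76667/50000)" by (simp add: odd_harmonic_def eval_nat_numeral)
      have s: "stat_sum 0 1 \<le> (7717/20000)" by (simp add: stat_sum_def eval_nat_numeral)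
      have e: "end_sum 1 \<le> (57/50)" by (simp add: end_sum_def eval_nat_numeral)
      show ?thesis
        by (rule small[where ma = "(1624/625)" and \<sigma> = "(3849/10000)" and \<upsilon> = "(671/2500)" and ml = "(1624/625)" and mh = "(9311/2500)" and oh = "(76667/50000)" and ss = "(7717/20000)" and es = "(57/50)"])
           (use o s e in \<open>simp_all add: eqs power3_eq_cube\<close>)
    next
      case 2
      then have eqs: "n = 2" "P = 5" "nb = 2" using P nb by simp_all
      have o: "odd_harmonic 5 \<le> (178731/100000)" by (simp add: odd_harmonic_def eval_nat_numeral)
      have s: "stat_sum 0 2 \<le> (28939/50000)" by (simp add: stat_sum_def eval_nat_numeral)
      have e: "end_sum 2 \<le> (33/25)" by (simp add: end_sum_def eval_nat_numeral)
      show ?thesis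
        by (rule small[where ma = "(31409/10000)" and \<sigma> = "(199/625)" and \<upsilon> = "(6/25)" and ml = "(16113/5000)" and mh = "(2604/625)" and oh = "(178731/100000)" and ss = "(28939/50000)" and es = "(33/25)"])
           (use o s e in \<open>simp_all add: eqs power3_eq_cube\<close>)
    next
      case 3
      then have eqs: "n = 3" "P = 5" "nb = 1" using P nb by simp_all
      have o: "odd_harmonic 5 \<le> (178731/100000)" by (simp add: odd_harmonic_def eval_nat_numeral)
      have s: "stat_sum 0 3 \<le> (3537/5000)" by (simp add: stat_sum_def eval_nat_numeral)
      have e: "end_sum 3 \<le> (357/250)" by (simp add: end_sum_def eval_nat_numeral)
      show ?thesis
        by (rule small[where ma = "(931/250)" and \<sigma> = "(1343/5000)" and \<upsilon> = "(2207/10000)" and ml = "(1889/500)" and mh = "(9061/2000)" and oh = "(178731/100000)" and ss = "(3537/5000)" and es = "(357/250)"])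
           (use o s e in \<open>simp_all add: eqs power3_eq_cube\<close>)
    next
      case 4
      then have eqs: "n = 4" "P = 7" "nb = 2" using P nb by simp_all
      have o: "odd_harmonic 7 \<le> (97757/50000)" by (simp add: odd_harmonic_def eval_nat_numeral)
      have s: "stat_sum 0 4 \<le> (40193/50000)" by (simp add: stat_sum_def eval_nat_numeral)
      have e: "end_sum 4 \<le> (30103/20000)" by (simp add: end_sum_def eval_nat_numeral)
      show ?thesis
        by (rule small[where ma = "(2083/500)" and \<sigma> = "(2401/10000)" and \<upsilon> = "(129/625)" and ml = "(21033/5000)" and mh = "(48439/10000)" and oh = "(97757/50000)" and ss = "(40193/50000)" and es = "(30103/20000)"])
           (use o s e in \<open>simp_all add: eqs power3_eq_cube\<close>)
    next
      case 5
      then have eqs: "n = 5" "P = 7" "nb = 1" using P nb by simp_all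
      have o: "odd_harmonic 7 \<le> (97757/50000)" by (simp add: odd_harmonic_def eval_nat_numeral)
      have s: "stat_sum 0 5 \<le> (88103/100000)" by (simp add: stat_sum_def eval_nat_numeral)
      have e: "end_sum 5 \<le> (31303/20000)" by (simp add: end_sum_def eval_nat_numeral)
      show ?thesis
        by (rule small[where ma = "(453/100)" and \<sigma> = "(138/625)" and \<upsilon> = "(122/625)" and ml = "(22813/5000)" and mh = "(12803/2500)" and oh = "(97757/50000)" and ss = "(88103/100000)" and es = "(31303/20000)"])
           (use o s e in \<open>simp_all add: eqs power3_eq_cube\<close>)
    next
      case 6
      then have eqs: "n = 6" "P = 9" "nb = 2" using P nb by simp_all
      have o: "odd_harmonic 9 \<le> (208063/100000)" by (simp add: odd_harmonic_def eval_nat_numeral)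
      have s: "stat_sum 0 6 \<le> (47267/50000)" by (simp add: stat_sum_def eval_nat_numeral)
      have e: "end_sum 6 \<le> (10089/6250)" by (simp add: end_sum_def eval_nat_numeral)
      show ?thesis
        by (rule small[where ma = "(24217/5000)" and \<sigma> = "(413/2000)" and \<upsilon> = "(1861/10000)" and ml = "(24353/5000)" and mh = "(26857/5000)" and oh = "(208063/100000)" and ss = "(47267/50000)" and es = "(10089/6250)"])
           (use o s e in \<open>simp_all add: eqs power3_eq_cube\<close>)
    next
      case 7
      then have eqs: "n = 7" "P = 9" "nb = 1" using P nb by simp_all
      have o: "odd_harmonic 9 \<le> (208063/100000)" by (simp add: odd_harmonic_def eval_nat_numeral)
      have s: "stat_sum 0 7 \<le> (50023/50000)" by (simp add: stat_sum_def eval_nat_numeral)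
      have e: "end_sum 7 \<le> (82789/50000)" by (simp add: end_sum_def eval_nat_numeral)
      show ?thesis
        by (rule small[where ma = "(6401/1250)" and \<sigma> = "(1953/10000)" and \<upsilon> = "(357/2000)" and ml = "(51441/10000)" and mh = "(56003/10000)" and oh = "(208063/100000)" and ss = "(50023/50000)" and es = "(82789/50000)"])
           (use o s e in \<open>simp_all add: eqs power3_eq_cube\<close>)
    qed
  next
    case False
    have M0: "0 < M" using M by linarith
    have tau2: "\<tau> = 1 / M" using M M0 by (simp add: field_simps)
  have tau: "0 < \<tau>" "\<tau> = 1 / M" using M0 tau2 by auto
  have Ll: "2 * real n - 1 \<le> L" and Lh: "L \<le> 2 * real n + 3" using L(1,2) tau(1) by linarith+
    have n8: "8 \<le> real n" using False by simp
    then have "15 \<le> L" using Ll by argo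
    moreover have "\<rho> * (133/25) ^ 3 \<le> 15" by (simp add: power3_eq_cube)
    ultimately have "\<rho> * (133/25) ^ 3 \<le> L" by (rule order_trans[rotated])
    from le_of_cube_le[OF this L(4) _ less_imp_le[OF M0]] have M532: "(133/25) \<le> M" by simp
    have t0: "\<tau> \<le> (19/100)" unfolding tau(2) using M532 M0 by (simp add: field_simps)
    have "(133/25) ^ 3 \<le> M ^ 3" using M532 by (intro power_mono) auto
    moreover have "150 \<le> ((133/25) :: real) ^ 3" by (simp add: power3_eq_cube)
    ultimately have M3: "150 \<le> M ^ 3" by (rule order_trans[rotated])
    have "(7571/10000) * (odd_harmonic (Suc (Suc n)) / real (Suc (Suc n))) * L + ((10947/10000) + (3/1000) + (1/4) + (1253/5000) + (1893/5000) + stat_sum 0 n + end_sum n) \<le> (7443/5000) * M"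
      by (rule turning_budget_large) (use False L(4) Ll Lh M0 in simp_all)
    moreover have "G \<le> (3/1000)"
    proof (rule ccontr)
      assume "\<not> G \<le> (3/1000)"
      then have "(3/1000) * 150 \<le> G * M ^ 3" using M3 by (intro mult_mono) auto
      then show False using G by simp
    qed
    moreover have "(real nb - 1) * ((1893/2500) / (2 + \<tau>)) \<le> 1 * ((1893/2500) / (2 + 0))"
      using tau(1) nb12 by (intro mult_mono divide_left_mono mult_pos_pos) auto
    moreover have "(2267/5000) / (2 - \<tau>) \<le> (2267/5000) / (2 - (19/100))"
      using t0 by (intro divide_left_mono mult_pos_pos) auto
    moreover have "(7571/10000) * (odd_harmonic P / real P) * L \<le> (7571/10000) * (odd_harmonic (Suc (Suc n)) / real (Suc (Suc n))) * L"
      using odd_harmonic_average_antimono[of "Suc (Suc n)" P] P nb12 L by (intro mult_right_mono mult_left_mono) auto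
    moreover have "1 * ((1893/2500) / (2 + 0)) \<le> ((1893/5000) :: real)" "(2267/5000) / (2 - (19/100)) \<le> ((1253/5000) :: real)" by simp_all
    ultimately show ?thesis by argo
  qed
  then show ?thesis by argo
qed

section \<open>Dual expansion and error of a single wave\<close>

lemma shifted_difference_sum:
  fixes f :: "nat \<Rightarrow> real"
  assumes "\<And>i. 0 \<le> f i"
  shows "(\<Sum>i<m. f i - f (i + P)) \<le> (\<Sum>i<P. f i)"
proof -
  have "(\<Sum>i<m + P. f i) = (\<Sum>i<P. f i) + (\<Sum>i<m. f (i + P))"
  proof (induction m)
    case (Suc m)
    then show ?case by simp
  qed simp
  moreover have "(\<Sum>i<m. f i) \<le> (\<Sum>i<m + P. f i)" using assms by (intro sum_mono2) auto
  ultimately show ?thesis by (simp add: sum_subtractf)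
qed

lemma product_reciprocal_sum: "(\<Sum>i<m. 1 / ((real i + 2) * (2 * real i + 1))) \<le> 1"
proof -
  have *: "(\<Sum>i<Suc m. 1 / ((real i + 2) * (2 * real i + 1))) \<le> 1 - 1 / (2 * real m + 2)" for m
  proof (induction m)
    case (Suc m)
    define x where "x = real m + 1"
    have x: "1 \<le> x" by (simp add: x_def)
    have "1 / ((x + 2) * (2 * x + 1)) \<le> 1 / (2 * x * (x + 1))"
      using x by (intro divide_left_mono mult_pos_pos) (auto simp: algebra_simps)
    also have "\<dots> = 1 / (2 * x) - 1 / (2 * x + 2)" using x by (simp add: field_simps)
    finally have "1 / ((real (Suc m) + 2) * (2 * real (Suc m) + 1)) \<le> 1 / (2 * real m + 2) - 1 / (2 * real (Suc m) + 2)"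
      by (simp add: x_def algebra_simps)
    then show ?case using Suc.IH by (simp only: sum.lessThan_Suc[of _ "Suc m"])
  qed simp
  have "0 \<le> 1 / (2 * real m + 2)" by simp
  then have "(\<Sum>i<Suc m. 1 / ((real i + 2) * (2 * real i + 1))) \<le> 1" using *[of m] by linarith
  moreover have "(\<Sum>i<m. 1 / ((real i + 2) * (2 * real i + 1))) \<le> (\<Sum>i<Suc m. 1 / ((real i + 2) * (2 * real i + 1)))"
    by (intro sum_mono2) auto
  ultimately show ?thesis by linarith
qed

lemma residual_pair_convex:
  fixes z P n :: real
  assumes "0 \<le> z" "z \<le> P" "0 < P" "P < 2 * n"
  shows "z / (n * (2 * n - z)) + z / (n * (2 * n + z)) \<le> z / P * (2 / (2 * n - P) - 2 / (2 * n + P))"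
proof -
  have pos: "0 < n" "0 < 2 * n - z" "0 < 2 * n + z" "0 < 2 * n - P" "0 < 2 * n + P" using assms by linarith+
  have "z / (n * (2 * n - z)) + z / (n * (2 * n + z)) = z / n * (1 / (2 * n - z) + 1 / (2 * n + z))" by (simp add: distrib_left)
  also have "1 / (2 * n - z) + 1 / (2 * n + z) = 4 * n / ((2 * n - z) * (2 * n + z))"
    using pos by (subst add_frac_eq) auto
  also have "z / n * (4 * n / ((2 * n - z) * (2 * n + z))) = 4 * z / ((2 * n - z) * (2 * n + z))" using pos by simp
  also have "\<dots> \<le> 4 * z / ((2 * n - P) * (2 * n + P))"
  proof (rule divide_left_mono)
    have "z * z \<le> P * P" using assms by (intro mult_mono) auto
    then show "(2 * n - P) * (2 * n + P) \<le> (2 * n - z) * (2 * n + z)" by (simp add: algebra_simps)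
  qed (use assms pos in auto)
  also have "\<dots> = z / P * (4 * P / ((2 * n - P) * (2 * n + P)))" using assms by simp
  also have "4 * P / ((2 * n - P) * (2 * n + P)) = 2 / (2 * n - P) - 2 / (2 * n + P)"
    using pos by (subst diff_frac_eq) (auto simp: algebra_simps)
  finally show ?thesis .
qed

context hardy
begin

abbreviation "g0 \<equiv> 2 / sqrt X"

lemma g0_pos: "0 < g0" using X_pos by simp

lemma sqrt_sqrt2_le: "sqrt (sqrt 2) \<le> (118921/100000)"
proof -
  have "sqrt 2 \<le> (707107/500000)" by (intro real_le_lsqrt) (auto simp: power2_eq_square)
  then show ?thesis by (intro real_le_lsqrt) (auto simp: power2_eq_square)
qed

lemma residual_sum_bound:
  fixes \<kappa> p q :: real and K M :: nat
  assumes K: "1 \<le> K" and p: "p = 3 * sqrt 2 * X - \<kappa>" "0 \<le> p" "p \<le> 2 * real K + 1"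
    and q: "q = \<kappa> - 4 * X" "q \<le> 2 * real K + 1" "- q < 2 * real K + 2"
  defines "P \<equiv> 2 * K + 1"
  shows "(\<Sum>n\<in>{K<..M}. \<bar>res \<kappa> (int n)\<bar>) + (\<Sum>n\<in>{K<..M}. \<bar>res \<kappa> (- int n)\<bar>)
    \<le> 2 / sqrt Xb / pi * ((p + max q 0) / real P * (2 * odd_harmonic P)) + 1 / (Xb * sqrt Xb) / pi\<^sup>2 * 2"
proof -
  let ?G = "2 / sqrt Xb / pi" and ?H = "1 / (Xb * sqrt Xb) / pi\<^sup>2"
  have GH: "0 \<le> ?G" "0 \<le> ?H" using Xb by auto
  define s where "s = (p + max q 0) / real P"
  have s: "0 \<le> s" using p by (simp add: s_def)
  have both: "\<bar>res \<kappa> (int n)\<bar> + \<bar>res \<kappa> (- int n)\<bar>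
     \<le> ?G * (s * (2 / (2 * real n - real P) - 2 / (2 * real n + real P))) + ?H * (2 / (real n * (2 * real n - real P)))"
    if n: "K < n" for n
  proof -
    have n': "real K + 1 \<le> real n" using n by simp
    have P: "real P = 2 * real K + 1" by (simp add: P_def)
    have n0: "0 < real n" "0 < n" using n by auto
    let ?w = "2 / (2 * real n - real P) - 2 / (2 * real n + real P)"
    have a: "\<bar>res \<kappa> (int n)\<bar> \<le> ?G * (p / (real n * (2 * real n - p)) + max q 0 / (real n * (2 * real n + q))) + ?H / (real n * (2 * real n - p))"
      by (rule residual_above[OF p(1,2) q(1)]) (use p q n' in linarith)+
    have b: "\<bar>res \<kappa> (- int n)\<bar> \<le> ?G * (p / (real n * (2 * real n + p)) + max q 0 / (real n * (2 * real n - q))) + ?H / (real n * (2 * real n - q))"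
      by (rule residual_below[OF p(1,2) q(1)]) (use p q n' n0 in linarith)+
    have P2: "0 < real P" "real P < 2 * real n" using P n' by linarith+
    have pp: "p / (real n * (2 * real n - p)) + p / (real n * (2 * real n + p)) \<le> p / real P * ?w"
      by (rule residual_pair_convex) (use p P P2 in linarith)+
    have qq: "max q 0 / (real n * (2 * real n + q)) + max q 0 / (real n * (2 * real n - q)) \<le> max q 0 / real P * ?w"
    proof (cases "0 \<le> q")
      case True
      have "q / (real n * (2 * real n - q)) + q / (real n * (2 * real n + q)) \<le> q / real P * ?w"
        by (rule residual_pair_convex) (use q True P P2 in linarith)+
      then show ?thesis using True by (simp add: max_def add.commute)
    next
      case False
      then have "max q 0 = 0" by simp
      then show ?thesis by simp
    qed
    have hh: "?H / (real n * (2 * real n - z)) \<le> ?H / (real n * (2 * real n - real P))" if "z \<le> real P" for z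
      using that P2 n0 GH by (intro divide_left_mono mult_left_mono mult_pos_pos) auto
    have "\<bar>res \<kappa> (int n)\<bar> + \<bar>res \<kappa> (- int n)\<bar> \<le>
      ?G * ((p / (real n * (2 * real n - p)) + p / (real n * (2 * real n + p))) + (max q 0 / (real n * (2 * real n + q)) + max q 0 / (real n * (2 * real n - q))))
       + (?H / (real n * (2 * real n - p)) + ?H / (real n * (2 * real n - q)))"
      using add_mono[OF a b] by (simp only: distrib_left add_ac)
    also have "\<dots> \<le> ?G * (p / real P * ?w + max q 0 / real P * ?w) + (?H / (real n * (2 * real n - real P)) + ?H / (real n * (2 * real n - real P)))"
      using pp qq GH p(3) q(2) P by (intro add_mono mult_left_mono hh) auto
    also have "\<dots> = ?G * (s * ?w) + ?H * (2 / (real n * (2 * real n - real P)))"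
      by (simp add: s_def add_divide_distrib distrib_right)
    finally show ?thesis .
  qed
  have reidx: "(\<Sum>n\<in>{K<..M}. h n) = (\<Sum>i<M - K. h (K + 1 + i))" for h :: "nat \<Rightarrow> real"
    by (rule sum.reindex_bij_witness[of _ "\<lambda>i. K + 1 + i" "\<lambda>n. n - (K + 1)"]) auto
  have "(\<Sum>n\<in>{K<..M}. \<bar>res \<kappa> (int n)\<bar>) + (\<Sum>n\<in>{K<..M}. \<bar>res \<kappa> (- int n)\<bar>)
     = (\<Sum>n\<in>{K<..M}. \<bar>res \<kappa> (int n)\<bar> + \<bar>res \<kappa> (- int n)\<bar>)" by (simp add: sum.distrib)
  also have "\<dots> \<le> (\<Sum>n\<in>{K<..M}. ?G * (s * (2 / (2 * real n - real P) - 2 / (2 * real n + real P))) + ?H * (2 / (real n * (2 * real n - real P))))"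
    by (intro sum_mono both) auto
  also have "\<dots> = ?G * (s * (\<Sum>n\<in>{K<..M}. 2 / (2 * real n - real P) - 2 / (2 * real n + real P))) + ?H * (\<Sum>n\<in>{K<..M}. 2 / (real n * (2 * real n - real P)))"
    by (simp only: sum.distrib sum_distrib_left)
  also have "\<dots> \<le> ?G * (s * (2 * odd_harmonic P)) + ?H * 2"
  proof (intro add_mono mult_left_mono)
    have "(\<Sum>n\<in>{K<..M}. 2 / (2 * real n - real P) - 2 / (2 * real n + real P))
       = (\<Sum>i<M - K. 2 / (2 * real i + 1) - 2 / (2 * real (i + P) + 1))"
      unfolding reidx by (intro sum.cong) (auto simp: P_def algebra_simps)
    also have "\<dots> \<le> (\<Sum>i<P. 2 / (2 * real i + 1))" by (rule shifted_difference_sum) auto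
    also have "\<dots> = 2 * odd_harmonic P" by (simp add: odd_harmonic_def sum_distrib_left)
    finally show "(\<Sum>n\<in>{K<..M}. 2 / (2 * real n - real P) - 2 / (2 * real n + real P)) \<le> 2 * odd_harmonic P" .
    have "(\<Sum>n\<in>{K<..M}. 2 / (real n * (2 * real n - real P))) = (\<Sum>i<M - K. 2 / (real (K + 1 + i) * (2 * real i + 1)))"
      unfolding reidx by (intro sum.cong) (auto simp: P_def algebra_simps)
    also have "\<dots> \<le> (\<Sum>i<M - K. 2 * (1 / ((real i + 2) * (2 * real i + 1))))"
    proof (rule sum_mono)
      fix i
      have "2 / (real (K + 1 + i) * (2 * real i + 1)) \<le> 2 / ((real i + 2) * (2 * real i + 1))"
        using K by (intro divide_left_mono mult_right_mono mult_pos_pos) auto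
      then show "2 / (real (K + 1 + i) * (2 * real i + 1)) \<le> 2 * (1 / ((real i + 2) * (2 * real i + 1)))" by simp
    qed
    also have "\<dots> \<le> 2 * 1" unfolding sum_distrib_left[symmetric] by (intro mult_left_mono product_reciprocal_sum) auto
    finally show "(\<Sum>n\<in>{K<..M}. 2 / (real n * (2 * real n - real P))) \<le> 2" by simp
  qed (use GH s in auto)
  finally show ?thesis by (simp add: s_def)
qed

lemma dual_expansion:
  fixes \<kappa> p q :: real and K :: nat
  assumes K: "1 \<le> K" and p: "p = 3 * sqrt 2 * X - \<kappa>" "0 \<le> p" "p \<le> 2 * real K + 1"
    and q: "q = \<kappa> - 4 * X" "q \<le> 2 * real K + 1" "- q < 2 * real K + 2"
  defines "P \<equiv> 2 * K + 1"
  shows "\<bar>(\<Sum>N = \<lceil>Xb\<rceil>..\<lfloor>X\<rfloor>. 2 / sqrt (of_int N) * cos (phase \<kappa> (of_int N))) - (\<Sum>\<nu> = - int K..int K. wave (\<kappa> + 2 * of_int \<nu>))\<bar>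
    \<le> g0 * ((10947/10000) + (7571/10000) * (odd_harmonic P / real P) * (p + max q 0) + (341/2000) / X)"
proof -
  interpret phase_sum "\<lambda>x. 2 / sqrt x" "\<lambda>x. - (1 / (x * sqrt x))" "phase \<kappa>" "\<lambda>x. pi * (\<kappa> - vel x)" Xb X by (rule phase_sum_wave)
  have mode: "mode \<nu> = wave (\<kappa> + 2 * of_int \<nu>)" for \<nu>
    unfolding mode_def wave_def phase_shift ..
  let ?D = "2 / sqrt Xb / pi * ((p + max q 0) / real P * (2 * odd_harmonic P)) + 1 / (Xb * sqrt Xb) / pi\<^sup>2 * 2"
  have "\<bar>(\<Sum>N = \<lceil>Xb\<rceil>..\<lfloor>X\<rfloor>. 2 / sqrt (of_int N) * cos (phase \<kappa> (of_int N))) - (\<Sum>\<nu> = - int K..int K. mode \<nu>)\<bar>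
    \<le> (2 / sqrt Xb + 2 / sqrt X) / 2 + (\<Sum>\<nu>\<in>{K<..K}. (2 / sqrt Xb + 2 / sqrt X) / (2 * pi * real \<nu>)) + ?D"
    by (rule poisson_truncated[OF order.refl]) (unfold P_def, rule residual_sum_bound[OF K p q])
  also have "\<dots> = (2 / sqrt Xb + 2 / sqrt X) / 2 + ?D" by simp
  also have "\<dots> \<le> g0 * ((10947/10000) + (7571/10000) * (odd_harmonic P / real P) * (p + max q 0) + (341/2000) / X)"
  proof -
    have gA: "2 / sqrt Xb = g0 * sqrt (sqrt 2)" using sqrt_Xb by (simp add: field_simps)
    have gA': "2 / sqrt Xb \<le> g0 * (118921/100000)" unfolding gA using sqrt_sqrt2_le g0_pos by (intro mult_left_mono) auto
    have 1: "(2 / sqrt Xb + 2 / sqrt X) / 2 \<le> g0 * (10947/10000)" using gA' g0_pos by argo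
    define A where "A = odd_harmonic P / real P * (p + max q 0)"
    have A: "0 \<le> A" unfolding A_def using p odd_harmonic_nonneg[of P] by auto
    have "2 / sqrt Xb / pi * 2 \<le> g0 * (7571/10000)"
    proof -
      have "2 / sqrt Xb / pi * 2 = 2 * (2 / sqrt Xb) / pi" by simp
      also have "\<dots> \<le> 2 * (g0 * (118921/100000)) / (314159/100000)"
        using gA' pi_bounds g0_pos by (intro frac_le mult_left_mono) auto
      also have "\<dots> = g0 * (2 * (118921/100000) / (314159/100000))" by simp
      also have "\<dots> \<le> g0 * (7571/10000)" using g0_pos by (intro mult_left_mono) auto
      finally show ?thesis .
    qed
    then have "(2 / sqrt Xb / pi * 2) * A \<le> (g0 * (7571/10000)) * A" using A by (rule mult_right_mono)
    then have 2: "2 / sqrt Xb / pi * ((p + max q 0) / real P * (2 * odd_harmonic P)) \<le> g0 * ((7571/10000) * (odd_harmonic P / real P) * (p + max q 0))"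
    proof -
      have "2 / sqrt Xb / pi * ((p + max q 0) / real P * (2 * odd_harmonic P)) = (2 / sqrt Xb / pi * 2) * A" by (simp add: A_def)
      moreover have "g0 * ((7571/10000) * (odd_harmonic P / real P) * (p + max q 0)) = (g0 * (7571/10000)) * A" by (simp add: A_def)
      ultimately show ?thesis using \<open>(2 / sqrt Xb / pi * 2) * A \<le> (g0 * (7571/10000)) * A\<close> by (simp only:)
    qed
    have 3: "1 / (Xb * sqrt Xb) / pi\<^sup>2 * 2 \<le> g0 * ((341/2000) / X)"
    proof -
      have "1 / Xb = sqrt 2 / X" by (simp add: Xb_def)
      moreover have "1 / (Xb * sqrt Xb) = 1 / Xb * (2 / sqrt Xb / 2)" by simp
      ultimately have "1 / (Xb * sqrt Xb) = sqrt 2 / X * (g0 * sqrt (sqrt 2) / 2)" unfolding gA by simp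
      also have "\<dots> = g0 / X * (sqrt 2 * sqrt (sqrt 2) / 2)" by simp
      also have "\<dots> \<le> g0 / X * (841/1000)"
      proof (rule mult_left_mono)
        have "sqrt 2 \<le> (707107/500000)" by (intro real_le_lsqrt) (auto simp: power2_eq_square)
        then have "sqrt 2 * sqrt (sqrt 2) \<le> (707107/500000) * (118921/100000)" using sqrt_sqrt2_le by (intro mult_mono) auto
        then show "sqrt 2 * sqrt (sqrt 2) / 2 \<le> (841/1000)" by simp
      qed (use X_pos in auto)
      finally have h: "1 / (Xb * sqrt Xb) \<le> g0 / X * (841/1000)" .
      have "1 / (Xb * sqrt Xb) / pi\<^sup>2 * 2 \<le> (g0 / X * (841/1000)) / (314159/100000)\<^sup>2 * 2"
        using h pi_bounds X_pos Xb by (intro mult_right_mono frac_le power_mono) auto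
      also have "\<dots> = g0 / X * ((841/1000) / (314159/100000)\<^sup>2 * 2)" by simp
      also have "\<dots> \<le> g0 / X * (341/2000)" using X_pos by (intro mult_left_mono) (auto simp: power2_eq_square)
      finally show ?thesis by simp
    qed
    show ?thesis using 1 2 3 unfolding distrib_left by argo
  qed
  finally show ?thesis unfolding mode .
qed

lemma sin_phase_le:
  assumes "sin (pi * (\<alpha>\<^sup>2 - 1) / 8) = 0"
  shows "\<bar>sin (phase \<alpha> X)\<bar> \<le> pi * (4 * X - \<alpha>)\<^sup>2 / 8"
proof -
  define w where "w = pi * (4 * X - \<alpha>)\<^sup>2 / 8"
  have "phase \<alpha> X = pi * (\<alpha>\<^sup>2 - 1) / 8 - w"
    using folded_0[of \<alpha>] by (simp add: folded_def w_def)
  then have "\<bar>sin (phase \<alpha> X)\<bar> = \<bar>cos (pi * (\<alpha>\<^sup>2 - 1) / 8)\<bar> * \<bar>sin w\<bar>" using assms by (simp add: sin_diff abs_mult)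
  also have "\<dots> \<le> 1 * \<bar>w\<bar>" by (intro mult_mono abs_sin_x_le_abs_x) auto
  finally show ?thesis by (simp add: w_def)
qed

lemma amplitude_le:
  assumes d: "d = \<alpha> - 4 * X" "0 < d" and e: "e = 3 * sqrt 2 * X - \<alpha>" "- d \<le> e"
  shows "amplitude \<alpha> \<le> g0 * ((5991/5000) * (1 + e / (4 * d)))"
proof -
  define w where "w = 1 + e / (4 * d)"
  define B where "B = g0 * ((5991/5000) * w)"
  define Z where "Z = \<alpha>\<^sup>2 - (4 * X)\<^sup>2"
  have Zd: "Z = d * (8 * X + d)" by (simp add: Z_def d(1) power2_eq_square algebra_simps)
  have Z0: "0 < Z" unfolding Zd using d X_pos by simp
  have ed: "- 1 \<le> e / d" using d e by (simp add: field_simps)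
  have w4: "1 + e / d \<le> w ^ 4"
    using Bernoulli_inequality[of "e / (4 * d)" 4] ed unfolding w_def by (simp add: field_simps)
  have w0: "0 < w" using ed unfolding w_def by (simp add: field_simps)
  have "sqrt 2 \<le> (707107/500000)" by (intro real_le_lsqrt) (auto simp: power2_eq_square)
  then have L: "d + e \<ge> 0" "X * (1213/5000) \<le> d + e"
  proof -
    have "(7071/5000) \<le> sqrt 2" by (intro real_le_rsqrt) (auto simp: power2_eq_square)
    then have "X * (3 * (7071/5000) - 4) \<le> X * (3 * sqrt 2 - 4)" using X_pos by (intro mult_left_mono) auto
    also have "X * (3 * sqrt 2 - 4) = d + e" using d e by (simp add: algebra_simps)
    finally show "X * (1213/5000) \<le> d + e" by simp
    then show "d + e \<ge> 0" using X_pos by linarith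
  qed
  have P4: "(Z powr (1/4)) ^ 4 = Z"
    using Z0 by (simp add: powr_realpow[symmetric] powr_powr)
  have "(amplitude \<alpha>) ^ 4 = 64 / Z"
  proof -
    have "(2 * sqrt 2) ^ 4 = (64::real)" by (simp add: power4_eq_xxxx)
    then show ?thesis unfolding amplitude_def Z_def[symmetric] power_divide P4 by simp
  qed
  also have "\<dots> \<le> 8 / (X * d)"
  proof -
    have "8 * X * d \<le> Z" unfolding Zd using d X_pos by (simp add: algebra_simps)
    then have "64 / Z \<le> 64 / (8 * X * d)" using d(2) X_pos Z0 by (intro divide_left_mono) auto
    then show ?thesis by simp
  qed
  also have "\<dots> \<le> 16 / X\<^sup>2 * ((5991/5000) ^ 4 * (1 + e / d))"
  proof -
    have "X \<le> 2 * (41223/20000) * (d + e)" using L by argo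
    also have "\<dots> \<le> 2 * (5991/5000) ^ 4 * (d + e)" using L(1) by (intro mult_right_mono) (auto simp: power4_eq_xxxx)
    finally have "X * (8 / (X\<^sup>2 * d)) \<le> 2 * (5991/5000) ^ 4 * (d + e) * (8 / (X\<^sup>2 * d))" using d by (intro mult_right_mono) auto
    moreover have "X * (8 / (X\<^sup>2 * d)) = 8 / (X * d)" using X_pos by (simp add: power2_eq_square)
    moreover have "2 * (5991/5000) ^ 4 * (d + e) * (8 / (X\<^sup>2 * d)) = 16 / X\<^sup>2 * ((5991/5000) ^ 4 * ((d + e) / d))" by simp
    moreover have "(d + e) / d = 1 + e / d" using d(2) by (simp add: add_divide_distrib)
    ultimately show ?thesis by (simp only:)
  qed
  also have "\<dots> \<le> 16 / X\<^sup>2 * ((5991/5000) ^ 4 * w ^ 4)" using w4 by (intro mult_left_mono) auto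
  also have "\<dots> = B ^ 4"
  proof -
    have "(2 / sqrt X) ^ 4 = 16 / X\<^sup>2" using X_pos by (simp add: power_divide power4_eq_xxxx power2_eq_square)
    then show ?thesis unfolding B_def power_mult_distrib by simp
  qed
  finally have "(amplitude \<alpha>) ^ 4 \<le> B ^ 4" .
  moreover have "0 \<le> B" unfolding B_def using g0_pos w0 by simp
  ultimately have "amplitude \<alpha> \<le> B" using power_strict_mono[of B "amplitude \<alpha>" 4] by (meson not_le zero_less_numeral)
  then show ?thesis by (simp add: B_def w_def)
qed

definition "target \<alpha> = (if \<alpha> \<le> 3 * sqrt 2 * X then amplitude \<alpha> * cos (phase \<alpha> (stat \<alpha>) + pi / 4) else 0)" for \<alpha> :: real

lemma wave_target:
  fixes \<alpha> :: real
  defines "sn \<equiv> \<bar>sin (phase \<alpha> X)\<bar>"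
  assumes d: "d = \<alpha> - 4 * X" "0 < d" and e: "e = 3 * sqrt 2 * X - \<alpha>" and top: "\<alpha> \<le> 4.4 * X"
  shows "- 1 \<le> e \<Longrightarrow> e \<le> 1 \<Longrightarrow> \<bar>wave \<alpha> - target \<alpha>\<bar> \<le> g0 * ((1 + sn) / (pi * d) + (27/200) / d + (3/5))"
    and "0 < e \<Longrightarrow> \<bar>wave \<alpha> - target \<alpha>\<bar> \<le> g0 * ((1 + sn) / (pi * d) + (27/200) / d + (27/50) / e)"
proof -
  have al: "4 * X < \<alpha>" using d by simp
  define main where "main = g0 * ((1 + sn) / (pi * d))"
  note ws = wave_saddle[OF al top]
  have X1: "4 * X < 3 * sqrt 2 * X"
  proof -
    have "(7071/5000) \<le> sqrt 2" by (intro real_le_rsqrt) (auto simp: power2_eq_square)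
    then have "X * 4 < X * (3 * sqrt 2)" using X_pos by (intro mult_strict_left_mono) auto
    then show ?thesis by (simp add: mult_ac)
  qed
  have ed: "- d \<le> e" using X1 d e by linarith
  note amp = amplitude_le[OF d e ed]
  have m: "2 / sqrt X * (1 + \<bar>sin (phase \<alpha> X)\<bar>) / (pi * (\<alpha> - 4 * X)) = main" unfolding main_def sn_def d(1) by simp
  have far: "\<bar>wave \<alpha> - target \<alpha>\<bar> \<le> g0 * ((1 + sn) / (pi * d) + (27/200) / d + (27/50) / e)" if e0: "0 < e"
  proof -
    have lt: "\<alpha> < 3 * sqrt 2 * X" using e0 e(1) by linarith
    have tgt: "target \<alpha> = amplitude \<alpha> * cos (phase \<alpha> (stat \<alpha>) + pi / 4)" using lt by (simp add: target_def)
    have "\<bar>wave \<alpha> - target \<alpha>\<bar> \<le> main + amplitude \<alpha> * (sqrt 2 / (pi * e))"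
      using ws(2)[OF lt] unfolding m tgt e(1) .
    also have "amplitude \<alpha> * (sqrt 2 / (pi * e)) \<le> g0 * ((5991/5000) * (1 + e / (4 * d))) * ((2251/5000) / e)"
    proof -
      have "sqrt 2 \<le> (707107/500000)" by (intro real_le_lsqrt) (auto simp: power2_eq_square)
      also have "(707107/500000) \<le> (2251/5000) * pi" using pi_bounds by simp
      finally have "sqrt 2 \<le> (2251/5000) * pi" .
      then have "sqrt 2 / (pi * e) \<le> (2251/5000) / e"
      proof -
        have "sqrt 2 / (pi * e) \<le> ((2251/5000) * pi) / (pi * e)" using \<open>sqrt 2 \<le> (2251/5000) * pi\<close> e0 by (intro divide_right_mono) auto
        then show ?thesis by simp
      qed
      then have "amplitude \<alpha> * (sqrt 2 / (pi * e)) \<le> g0 * ((5991/5000) * (1 + e / (4 * d))) * ((2251/5000) / e)"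
      proof (intro mult_mono)
        have "0 \<le> e / (4 * d)" using e0 d(2) by simp
        then show "0 \<le> g0 * ((5991/5000) * (1 + e / (4 * d)))" using g0_pos by simp
        show "0 \<le> sqrt 2 / (pi * e)" using e0 by simp
      qed (rule amp)
      then show ?thesis .
    qed
    also have "g0 * ((5991/5000) * (1 + e / (4 * d))) * ((2251/5000) / e) = g0 * ((5991/5000) * (2251/5000) / e + (5991/5000) * (2251/5000) / 4 / d)"
    proof -
      have "(1 + e / (4 * d)) * (c / e) = c / e + c / 4 / d" for c :: real using d(2) e0 by (simp add: field_simps)
      from this[of "(2251/5000)"] have "g0 * ((5991/5000) * (1 + e / (4 * d))) * ((2251/5000) / e) = g0 * ((5991/5000) * ((2251/5000) / e + (2251/5000) / 4 / d))"
        by (simp only: mult.assoc)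
      then show ?thesis by (simp only: distrib_left times_divide_eq_right)
    qed
    also have "\<dots> \<le> g0 * ((27/50) / e + (27/200) / d)"
    proof (intro mult_left_mono add_mono)
      show "(5991/5000) * (2251/5000) / e \<le> (27/50) / e" using e0 by (intro divide_right_mono) auto
      show "(5991/5000) * (2251/5000) / 4 / d \<le> (27/200) / d" using d(2) by (intro divide_right_mono) auto
    qed (use g0_pos in simp)
    finally show ?thesis by (simp add: main_def distrib_left add_ac)
  qed
  then show "0 < e \<Longrightarrow> \<bar>wave \<alpha> - target \<alpha>\<bar> \<le> g0 * ((1 + sn) / (pi * d) + (27/200) / d + (27/50) / e)" .
  assume e1: "- 1 \<le> e" "e \<le> 1"
  show "\<bar>wave \<alpha> - target \<alpha>\<bar> \<le> g0 * ((1 + sn) / (pi * d) + (27/200) / d + (3/5))"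
  proof (cases "(9/10) < e")
    case True
    then have "(27/50) / e \<le> (3/5)" by (simp add: field_simps)
    then have "g0 * ((1 + sn) / (pi * d) + (27/200) / d + (27/50) / e) \<le> g0 * ((1 + sn) / (pi * d) + (27/200) / d + (3/5))"
      using g0_pos by (intro mult_left_mono) auto
    moreover have "0 < e" using True by argo
    ultimately show ?thesis using far by (meson order_trans)
  next
    case False
    have "\<bar>wave \<alpha> - target \<alpha>\<bar> \<le> main + amplitude \<alpha> / 2"
    proof (cases "\<alpha> \<le> 3 * sqrt 2 * X")
      case True
      then show ?thesis using ws(1)[OF True] unfolding m target_def by simp
    next
      case False
      then have "3 * sqrt 2 * X < \<alpha>" by simp
      then show ?thesis using ws(3) False unfolding m target_def by simp
    qed
    also have "amplitude \<alpha> / 2 \<le> g0 * ((27/200) / d + (3/5))"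
    proof -
      have "e / (4 * d) \<le> (9/10) / (4 * d)" using False d by (intro divide_right_mono) auto
      then have "(5991/5000) * (1 + e / (4 * d)) / 2 \<le> (5991/5000) * (1 + (9/10) / (4 * d)) / 2" by simp
      also have "\<dots> \<le> (27/200) / d + (3/5)"
      proof -
        have "(5991/5000) * (1 + (9/10) / (4 * d)) / 2 = (5991/10000) + (53919/400000) / d" by (simp add: field_simps)
        also have "\<dots> \<le> (3/5) + (27/200) / d" using d(2) by (intro add_mono divide_right_mono) auto
        finally show ?thesis by simp
      qed
      finally have "g0 * ((5991/5000) * (1 + e / (4 * d)) / 2) \<le> g0 * ((27/200) / d + (3/5))" using g0_pos by (intro mult_left_mono) auto
      have "amplitude \<alpha> / 2 \<le> g0 * ((5991/5000) * (1 + e / (4 * d))) / 2" using amp by (rule divide_right_mono) simp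
      also have "\<dots> = g0 * ((5991/5000) * (1 + e / (4 * d)) / 2)" by simp
      also have "\<dots> \<le> g0 * ((27/200) / d + (3/5))" by fact
      finally show ?thesis .
    qed
    finally show ?thesis by (simp add: main_def distrib_left add_ac)
  qed
qed

lemma wave_target_simple:
  fixes \<alpha> :: real
  assumes d: "d \<le> \<alpha> - 4 * X" "0 < d" and e: "e = 3 * sqrt 2 * X - \<alpha>" and top: "\<alpha> \<le> 4.4 * X"
  shows "- 1 \<le> e \<Longrightarrow> e \<le> 1 \<Longrightarrow> \<bar>wave \<alpha> - target \<alpha>\<bar> \<le> g0 * ((7717/10000) / d + (3/5))"
    and "0 < e' \<Longrightarrow> e' \<le> e \<Longrightarrow> \<bar>wave \<alpha> - target \<alpha>\<bar> \<le> g0 * ((7717/10000) / d + (27/50) / e')"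
proof -
  define d' where "d' = \<alpha> - 4 * X"
  have d': "0 < d'" "d \<le> d'" using d by (auto simp: d'_def)
  have "(1 + \<bar>sin (phase \<alpha> X)\<bar>) / (pi * d') + (27/200) / d' \<le> (7717/10000) / d"
  proof -
    have "(1 + \<bar>sin (phase \<alpha> X)\<bar>) / (pi * d') \<le> 2 / ((314159/100000) * d')"
      using d' pi_bounds abs_sin_le_one[of "phase \<alpha> X"] by (intro frac_le mult_right_mono mult_pos_pos) auto
    also have "\<dots> \<le> (6367/10000) / d'" using d' by (simp add: field_simps)
    finally have "(1 + \<bar>sin (phase \<alpha> X)\<bar>) / (pi * d') + (27/200) / d' \<le> (6367/10000) / d' + (27/200) / d'" by simp
    also have "\<dots> = (7717/10000) / d'" by (simp add: add_divide_distrib[symmetric])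
    also have "\<dots> \<le> (7717/10000) / d" using d d' by (intro divide_left_mono mult_pos_pos) auto
    finally show ?thesis .
  qed
  note b = this
  note wt = wave_target[OF d'_def d'(1) e top]
  have step: "g0 * ((1 + \<bar>sin (phase \<alpha> X)\<bar>) / (pi * d') + (27/200) / d' + h) \<le> g0 * ((7717/10000) / d + h')" if "h \<le> h'" for h h'
    using b that g0_pos by (intro mult_left_mono add_mono) auto
  show "- 1 \<le> e \<Longrightarrow> e \<le> 1 \<Longrightarrow> \<bar>wave \<alpha> - target \<alpha>\<bar> \<le> g0 * ((7717/10000) / d + (3/5))"
    using wt(1) step[of "(3/5)" "(3/5)"] by (meson order.refl order_trans)
  assume e': "0 < e'" "e' \<le> e"
  then have "(27/50) / e \<le> (27/50) / e'" by (intro divide_left_mono mult_pos_pos) auto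
  from step[OF this] show "\<bar>wave \<alpha> - target \<alpha>\<bar> \<le> g0 * ((7717/10000) / d + (27/50) / e')"
    using wt(2) e' by (meson order_trans less_le_trans)
qed

lemma wave_below_simple:
  fixes \<alpha> :: real
  assumes d: "d \<le> 4 * X - \<alpha>" "0 < d"
  shows "\<bar>wave \<alpha>\<bar> \<le> g0 * ((1893/2500) / d)"
proof -
  have "\<bar>wave \<alpha>\<bar> \<le> g0 * (1.3786 + \<bar>sin (phase \<alpha> X)\<bar>) / (pi * (4 * X - \<alpha>))" by (rule wave_below) (use d in linarith)
  also have "\<dots> \<le> g0 * (11893/5000) / ((314159/100000) * d)"
    using d pi_bounds abs_sin_le_one[of "phase \<alpha> X"] X_pos by (intro frac_le mult_left_mono mult_mono mult_pos_pos) auto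
  also have "\<dots> = g0 * ((11893/5000) / (314159/100000) / d)" by simp
  also have "\<dots> \<le> g0 * ((1893/2500) / d)" using d g0_pos by (intro mult_left_mono divide_right_mono) auto
  finally show ?thesis .
qed

lemma scale:
  assumes M: "t = M ^ 6" "0 < M"
  shows "(19947/50000) * M ^ 3 \<le> X" "X \<le> (7979/20000) * M ^ 3"
    "(9679/100000) * M ^ 3 \<le> (3 * sqrt 2 - 4) * X" "(3 * sqrt 2 - 4) * X \<le> \<rho> * M ^ 3"
    "(341/2000) / X * M ^ 3 \<le> (171/400)"
proof -
  have X2: "X\<^sup>2 * (2 * pi) = (M ^ 3)\<^sup>2"
  proof -
    have "(M ^ 3)\<^sup>2 = M ^ 6" by (simp flip: power_mult)
    then show ?thesis using M(1) unfolding t_def by (simp only: mult_ac)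
  qed
  have M3: "0 < M ^ 3" using M by simp
  have "((19947/50000) * M ^ 3)\<^sup>2 * (2 * pi) \<le> X\<^sup>2 * (2 * pi)"
  proof -
    have "((19947/50000) * M ^ 3)\<^sup>2 * (2 * pi) = ((19947/50000)\<^sup>2 * (2 * pi)) * (M ^ 3)\<^sup>2" by (simp only: power_mult_distrib mult_ac)
    also have "\<dots> \<le> 1 * (M ^ 3)\<^sup>2" using pi_bounds by (intro mult_right_mono) (auto simp: power2_eq_square)
    finally show ?thesis unfolding X2 by simp
  qed
  then have "((19947/50000) * M ^ 3)\<^sup>2 \<le> X\<^sup>2" using pi_gt_zero by (simp add: mult_le_cancel_right)
  then show a: "(19947/50000) * M ^ 3 \<le> X" by (rule power2_le_imp_le) (use X_pos in simp)
  have "X\<^sup>2 * (2 * pi) \<le> ((7979/20000) * M ^ 3)\<^sup>2 * (2 * pi)"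
  proof -
    have "1 * (M ^ 3)\<^sup>2 \<le> ((7979/20000)\<^sup>2 * (2 * pi)) * (M ^ 3)\<^sup>2" using pi_bounds by (intro mult_right_mono) (auto simp: power2_eq_square)
    also have "\<dots> = ((7979/20000) * M ^ 3)\<^sup>2 * (2 * pi)" by (simp only: power_mult_distrib mult_ac)
    finally show ?thesis unfolding X2 by simp
  qed
  then have "X\<^sup>2 \<le> ((7979/20000) * M ^ 3)\<^sup>2" using pi_gt_zero by (simp add: mult_le_cancel_right)
  then show b: "X \<le> (7979/20000) * M ^ 3" by (rule power2_le_imp_le) (use M in simp)
  have s2: "(1414213/1000000) \<le> sqrt 2" "sqrt 2 \<le> (707107/500000)"
    by (intro real_le_rsqrt real_le_lsqrt; simp add: power2_eq_square)+
  have "(242639/1000000) * ((19947/50000) * M ^ 3) \<le> (3 * sqrt 2 - 4) * X" using s2 a M by (intro mult_mono) auto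
  then show "(9679/100000) * M ^ 3 \<le> (3 * sqrt 2 - 4) * X" using M3 by argo
  have "(3 * sqrt 2 - 4) * X \<le> (121321/500000) * ((7979/20000) * M ^ 3)" using s2 b X_pos by (intro mult_mono) auto
  then show "(3 * sqrt 2 - 4) * X \<le> \<rho> * M ^ 3" using M3 by argo
  have "(341/2000) * M ^ 3 \<le> (171/400) * X" using a M3 by argo
  then show "(341/2000) / X * M ^ 3 \<le> (171/400)" using X_pos by (simp add: field_simps)
qed

definition "transition \<alpha> = (1 + 1 / (32 * t\<^sup>2)) * ((pi / 2) powr (1/4) * \<alpha> / (2 * t powr (1/4)))
        * Re (exp (- (\<i> * of_real (pi / 8))) * transition_integral t \<alpha>)" for \<alpha> :: real

lemma transition_bounds:
  fixes \<alpha> M :: real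
  defines "s \<equiv> cos (pi * (\<alpha>\<^sup>2 - 1) / 8)"
  assumes M: "t = M ^ 6" "0 < M" and c: "sin (pi * (\<alpha>\<^sup>2 - 1) / 8) = 0" and e: "\<bar>4 * X - \<alpha>\<bar> \<le> 1 / M"
  shows "(12599/5000) \<le> M \<Longrightarrow> \<bar>transition \<alpha> - wave \<alpha>\<bar> \<le> g0 * ((2813/5000) * M)"
    and "(141/80) \<le> M \<Longrightarrow> \<bar>transition \<alpha>\<bar> \<le> g0 * ((6463/5000) * M)"
    and "(4309/2000) \<le> M \<Longrightarrow> - (g0 * ((4229/5000) * M)) \<le> s * transition \<alpha>"
    and "s * s = 1"
proof -
  define r where "r = M\<^sup>2"
  define v where "v = 1 / M\<^sup>2"
  have r: "t = r ^ 3" "r * v = 1" "0 < v" using M by (auto simp: r_def v_def simp flip: power_mult)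
  have e2: "(4 * X - \<alpha>)\<^sup>2 \<le> v"
  proof -
    have "\<bar>4 * X - \<alpha>\<bar>\<^sup>2 \<le> (1 / M)\<^sup>2" using e by (intro power_mono) auto
    then show ?thesis by (simp add: v_def power_divide)
  qed
  have vle: "v \<le> x" if "m \<le> M" "0 < m" "1 \<le> x * m\<^sup>2" "0 < x" for x m
  proof -
    have "x * m\<^sup>2 \<le> x * M\<^sup>2" using that by (intro mult_left_mono power_mono) auto
    then have "1 \<le> x * M\<^sup>2" using that by linarith
    then show ?thesis using M by (simp add: v_def field_simps)
  qed
  show ss: "s * s = 1" using c sin_cos_squared_add[of "pi * (\<alpha>\<^sup>2 - 1) / 8"] by (simp add: s_def power2_eq_square)
  then have abs_s: "\<bar>s\<bar> = 1" by (metis abs_mult_self_eq abs_1 abs_square_eq_1 power2_eq_square)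
  define k' where "k' = \<alpha> / (4 * X) * (1 + 1 / (32 * t\<^sup>2))"
  define I where "I = integral {0..1} (cusp_integrand t (\<alpha> / (4 * X)))"
  have T: "transition \<alpha> = s * (2 * sqrt X * (k' * I))"
    unfolding transition_def k'_def I_def s_def by (rule transition_term_cusp[OF c])
  have W: "wave \<alpha> = s * (2 * sqrt X * integral {0..fold_end} (\<lambda>w. cos (folded \<alpha> w)))"
    unfolding s_def by (rule wave_folded[OF c])
  have unit: "2 * sqrt X * v \<le> g0 * ((7979/20000) * M)"
  proof -
    have "X * v \<le> (7979/20000) * M ^ 3 * v" using scale(2)[OF M] r by (intro mult_right_mono) auto
    also have "\<dots> = (7979/20000) * M" using M by (simp add: v_def power2_eq_square power3_eq_cube)
    finally have "g0 * (X * v) \<le> g0 * ((7979/20000) * M)" using g0_pos by (intro mult_left_mono) auto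
    moreover have "g0 * (X * v) = 2 * sqrt X * v"
    proof -
      have "X = sqrt X * sqrt X" "sqrt X \<noteq> 0" using X_pos by auto
      then have XX: "X / sqrt X = sqrt X" by (metis nonzero_mult_div_cancel_right)
      have "g0 * (X * v) = 2 * (X / sqrt X) * v" by simp
      then show ?thesis unfolding XX .
    qed
    ultimately show ?thesis by simp
  qed
  have up: "2 * sqrt X * (b * v) \<le> g0 * (c * M)" if "0 \<le> b" "b * (7979/20000) \<le> c" for b c
  proof -
    have "2 * sqrt X * (b * v) = b * (2 * sqrt X * v)" by simp
    also have "\<dots> \<le> b * (g0 * ((7979/20000) * M))" using that unit by (intro mult_left_mono) auto
    also have "\<dots> = (b * (7979/20000)) * (g0 * M)" by simp
    also have "\<dots> \<le> c * (g0 * M)" using that M g0_pos by (intro mult_right_mono) auto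
    finally show ?thesis by (simp only: mult_ac)
  qed
  { assume "(12599/5000) \<le> M"
    then have v: "v \<le> (63/400)" by (rule vle) (auto simp: power2_eq_square)
    have "transition \<alpha> - wave \<alpha> = s * (2 * sqrt X * (k' * I - integral {0..fold_end} (\<lambda>w. cos (folded \<alpha> w))))"
      unfolding T W by (simp add: right_diff_distrib)
    then have "\<bar>transition \<alpha> - wave \<alpha>\<bar> = 2 * sqrt X * \<bar>k' * I - integral {0..fold_end} (\<lambda>w. cos (folded \<alpha> w))\<bar>"
      using abs_s X_pos by (simp add: abs_mult)
    also have "\<dots> \<le> 2 * sqrt X * ((141/100) * v)"
      using transition_wave_core[OF r v e2] X_pos unfolding k'_def I_def by (intro mult_left_mono) auto
    also have "\<dots> \<le> g0 * ((2813/5000) * M)" by (rule up) auto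
    finally show "\<bar>transition \<alpha> - wave \<alpha>\<bar> \<le> g0 * ((2813/5000) * M)" . }
  { assume "(141/80) \<le> M"
    then have v: "v \<le> (161/500)" by (rule vle) (auto simp: power2_eq_square)
    have "\<bar>transition \<alpha>\<bar> = 2 * sqrt X * \<bar>k' * I\<bar>" unfolding T using abs_s X_pos by (simp add: abs_mult)
    also have "\<dots> \<le> 2 * sqrt X * ((81/25) * v)"
      using transition_size_core(1)[OF r v e2] X_pos unfolding k'_def I_def by (intro mult_left_mono) auto
    also have "\<dots> \<le> g0 * ((6463/5000) * M)" by (rule up) auto
    finally show "\<bar>transition \<alpha>\<bar> \<le> g0 * ((6463/5000) * M)" . }
  { assume "(4309/2000) \<le> M"
    then have v: "v \<le> (431/2000)" by (rule vle) (auto simp: power2_eq_square)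
    then have v': "v \<le> (161/500)" by simp
    have "- (2 * sqrt X * ((53/25) * v)) \<le> 2 * sqrt X * (k' * I)"
      using mult_left_mono[OF transition_size_core(2)[OF r v' e2 v], of "2 * sqrt X"] X_pos unfolding k'_def I_def by simp
    moreover have "2 * sqrt X * ((53/25) * v) \<le> g0 * ((4229/5000) * M)" by (rule up) auto
    moreover have "s * transition \<alpha> = 2 * sqrt X * (k' * I)" unfolding T using ss by (simp add: mult.assoc[symmetric])
    ultimately show "- (g0 * ((4229/5000) * M)) \<le> s * transition \<alpha>" by linarith }
qed

lemma odd_square_phase: "odd n \<Longrightarrow> sin (pi * ((real_of_int n)\<^sup>2 - 1) / 8) = 0"
proof -
  assume "odd n"
  then obtain m where m: "n = 2 * m + 1" by (auto elim: oddE)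
  have "even (m * (m + 1))" by simp
  then obtain j where j: "m * (m + 1) = 2 * j" by (rule evenE)
  have "(real_of_int n)\<^sup>2 - 1 = 4 * real_of_int (m * (m + 1))" unfolding m by (simp add: power2_eq_square algebra_simps)
  also have "\<dots> = 8 * of_int j" unfolding j by simp
  finally show ?thesis by (simp add: sin_times_pi_eq_0 mult.commute)
qed

lemma cos_phase_odd:
  assumes "odd n"
  shows "cos (phase (real_of_int n) (real_of_int N)) = cos (t * ln X - t / 2 - pi / 8 - t * ln (real_of_int N))"
proof -
  define w where "w = t * ln X - t / 2 - pi / 8 - t * ln (real_of_int N)"
  have "even (N * (n - N))" using assms by auto
  then obtain j where j: "N * (n - N) = 2 * j" by (rule evenE)
  have "phase (real_of_int n) (real_of_int N) = w + pi * real_of_int (N * (n - N))"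
    by (simp add: phase_def w_def power2_eq_square algebra_simps)
  also have "\<dots> = w + 2 * pi * of_int j" unfolding j by simp
  finally show ?thesis unfolding w_def[symmetric] by (metis cos_add cos_int_2pin sin_int_2pin mult.right_neutral mult_zero_right diff_zero mult.commute)
qed

end

section \<open>The two regimes for large t\<close>

lemma sum_lessThan_add: "(\<Sum>j<m + n. f j) = (\<Sum>j<m. f j) + (\<Sum>j<n. f (m + j))" for f :: "nat \<Rightarrow> real"
  by (induction n) simp_all

lemma transition_budget_one:
  fixes M L \<tau> G q :: real
  assumes M: "(12599/5000) \<le> M" "\<tau> * M = 1" and q: "0 \<le> q" "q \<le> L + \<tau>" "q \<le> 3 + \<tau>" and L: "L \<le> \<rho> * M ^ 3" and G: "G * M ^ 3 \<le> (171/400)"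
  shows "(10947/10000) + (7571/10000) * (odd_harmonic 3 / real 3) * q + G + (2813/5000) * M + (1893/2500) / (2 - \<tau>) + stat_sum \<tau> 1 + end_sum 0 \<le> (971/500) * M"
proof -
  have M0: "0 < M" using M by linarith
  have tau2: "\<tau> = 1 / M" using M M0 by (simp add: field_simps)
  have tau: "0 < \<tau>" "\<tau> \<le> (3969/10000)" unfolding tau2 using M M0 by (simp_all add: field_simps)
  define l where "l = max (q - \<tau>) 0"
  have l: "0 \<le> l" "l \<le> 3" "q \<le> l + \<tau>" using q by (auto simp: l_def)
  have M3: "(1599/100) \<le> M ^ 3"
  proof -
    have "(12599/5000) ^ 3 \<le> M ^ 3" using M by (intro power_mono) auto
    moreover have "(1599/100) \<le> ((12599/5000)::real) ^ 3" by (simp add: power3_eq_cube)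
    ultimately show ?thesis by (rule order_trans[rotated])
  qed
  have "0 \<le> \<rho> * M ^ 3" using M0 by simp
  then have l3: "l \<le> \<rho> * M ^ 3" unfolding l_def using q(2) L by (intro max.boundedI) linarith+
  have "(38701/100000) * l + (5661/2000) \<le> (6897/5000) * M"
    by (rule cubic_budget[where ml = "(12599/5000)" and mh = "(33/10)" and hi = 3]) (use l l3 M in \<open>simp_all add: power3_eq_cube\<close>)
  moreover have "(7571/10000) * (odd_harmonic 3 / real 3) * q \<le> (38701/100000) * (l + (3969/10000))"
  proof (rule mult_mono)
    have "odd_harmonic 3 = 23 / 15" by (simp add: odd_harmonic_def eval_nat_numeral)
    then show "(7571/10000) * (odd_harmonic 3 / real 3) \<le> (38701/100000)" by simp
    show "q \<le> l + (3969/10000)" using l tau by linarith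
  qed (use q in auto)
  moreover have "G \<le> (67/2500)"
  proof (rule ccontr)
    assume "\<not> G \<le> (67/2500)"
    then have "(67/2500) * (1599/100) \<le> G * M ^ 3" using M3 by (intro mult_mono) auto
    then show False using G by simp
  qed
  moreover have "(1893/2500) / (2 - \<tau>) \<le> (1893/2500) / (2 - (3969/10000))" using tau by (intro divide_left_mono mult_pos_pos) auto
  moreover have "(1893/2500) / (2 - (3969/10000)) \<le> ((1181/2500)::real)" by simp
  moreover have "stat_sum \<tau> 1 \<le> (963/2000)"
  proof -
    have "stat_sum \<tau> 1 \<le> stat_sum (3969/10000) 1" by (rule stat_sum_mono) (use tau in auto)
    also have "\<dots> \<le> (963/2000)" by (simp add: stat_sum_def)
    finally show ?thesis .
  qed
  moreover have "end_sum 0 = (3/5)" by (simp add: end_sum_def)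
  ultimately show ?thesis by argo
qed

lemma turning_budget_zero:
  fixes M \<tau> G q :: real
  assumes M: "(1624/625) \<le> M" "\<tau> * M = 1" and q: "0 \<le> q" "q \<le> 3" and G: "G * M ^ 3 \<le> (171/400)"
  shows "(10947/10000) + (7571/10000) * (odd_harmonic 3 / real 3) * q + G + (2267/5000) * M + (1/4) + (2267/5000) / (2 - \<tau>) + (1893/2500) / (2 + \<tau>) + (3/5) \<le> (971/500) * M"
proof -
  have M0: "0 < M" using M by linarith
  have tau2: "\<tau> = 1 / M" using M M0 by (simp add: field_simps)
  have tau: "0 < \<tau>" "\<tau> \<le> (77/200)" unfolding tau2 using M M0 by (simp_all add: field_simps)
  have M3: "(35/2) \<le> M ^ 3"
  proof -
    have "(1624/625) ^ 3 \<le> M ^ 3" using M by (intro power_mono) auto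
    moreover have "(35/2) \<le> ((1624/625)::real) ^ 3" by (simp add: power3_eq_cube)
    ultimately show ?thesis by (rule order_trans[rotated])
  qed
  have "(7571/10000) * (odd_harmonic 3 / real 3) * q \<le> (38701/100000) * 3"
  proof (rule mult_mono)
    have "odd_harmonic 3 = 23 / 15" by (simp add: odd_harmonic_def eval_nat_numeral)
    then show "(7571/10000) * (odd_harmonic 3 / real 3) \<le> (38701/100000)" by simp
  qed (use q in auto)
  moreover have "G \<le> (49/2000)"
  proof (rule ccontr)
    assume "\<not> G \<le> (49/2000)"
    then have "(49/2000) * (35/2) \<le> G * M ^ 3" using M3 by (intro mult_mono) auto
    then show False using G by simp
  qed
  moreover have "(2267/5000) / (2 - \<tau>) \<le> (2267/5000) / (2 - (77/200))" using tau by (intro divide_left_mono mult_pos_pos) auto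
  moreover have "(2267/5000) / (2 - (77/200)) \<le> ((351/1250)::real)" by simp
  moreover have "(1893/2500) / (2 + \<tau>) \<le> (1893/2500) / 2" using tau by (intro divide_left_mono mult_pos_pos) auto
  ultimately show ?thesis using M(1) by argo
qed

context hardy
begin

definition "dirichlet = (\<Sum>N = \<lceil>Xb\<rceil>..\<lfloor>X\<rfloor>. 2 / sqrt (of_int N) * cos (t * ln X - t / 2 - pi / 8 - t * ln (of_int N)))"

lemma dirichlet_modes:
  fixes st :: int and K :: nat and d0 e0 :: real
  assumes st: "odd st" and K: "1 \<le> K" and e0: "e0 = 3 * sqrt 2 * X - (of_int st + 4 * real K)" "\<bar>e0\<bar> \<le> 1"
    and d0: "d0 = of_int st - 4 * X" "- 4 \<le> d0" "d0 \<le> 1"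
  shows "\<bar>dirichlet - (\<Sum>j<2 * K + 1. wave (of_int st + 2 * real j))\<bar>
    \<le> g0 * ((10947/10000) + (7571/10000) * (odd_harmonic (2 * K + 1) / real (2 * K + 1)) * (2 * real K + e0 + max (2 * real K + d0) 0) + (341/2000) / X)"
proof -
  define \<kappa> where "\<kappa> = st + 2 * int K"
  have k: "odd \<kappa>" using st by (simp add: \<kappa>_def)
  have kr: "real_of_int \<kappa> = of_int st + 2 * real K" by (simp add: \<kappa>_def)
  have D: "dirichlet = (\<Sum>N = \<lceil>Xb\<rceil>..\<lfloor>X\<rfloor>. 2 / sqrt (of_int N) * cos (phase (of_int \<kappa>) (of_int N)))"
    unfolding dirichlet_def cos_phase_odd[OF k] ..
  have W: "(\<Sum>\<nu> = - int K..int K. wave (of_int \<kappa> + 2 * of_int \<nu>)) = (\<Sum>j<2 * K + 1. wave (of_int st + 2 * real j))"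
    by (rule sum.reindex_bij_witness[of _ "\<lambda>j. int j - int K" "\<lambda>\<nu>. nat (\<nu> + int K)"]) (auto simp: kr algebra_simps)
  have K1: "1 \<le> real K" using K by simp
  have p: "2 * real K + e0 = 3 * sqrt 2 * X - of_int \<kappa>" and q: "2 * real K + d0 = of_int \<kappa> - 4 * X"
    using e0 d0 kr by simp_all
  show ?thesis unfolding D W[symmetric]
    by (rule dual_expansion[OF K p _ _ q]) (use e0(2) d0(2,3) K1 in linarith)+
qed

lemma above_sum:
  fixes \<alpha> D :: real and n :: nat
  assumes n: "1 \<le> n" and D: "0 < D" "D \<le> \<alpha> - 4 * X" and e: "\<bar>3 * sqrt 2 * X - (\<alpha> + 2 * real n - 2)\<bar> \<le> 1" and X: "(319/50) \<le> X"
  shows "(\<Sum>j<n. \<bar>wave (\<alpha> + 2 * real j) - target (\<alpha> + 2 * real j)\<bar>) \<le> g0 * ((\<Sum>j<n. (7717/10000) / (2 * real j + D)) + end_sum (n - 1))"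
proof -
  obtain m where m: "n = Suc m" using n by (cases n) auto
  have "sqrt 2 \<le> (707107/500000)" by (intro real_le_lsqrt) (auto simp: power2_eq_square)
  then have "3 * sqrt 2 * X \<le> 3 * (707107/500000) * X" using X_pos by (intro mult_right_mono) auto
  then have b: "3 * sqrt 2 * X + 1 \<le> 22/5 * X" using X by argo
  have e1: "\<alpha> + 2 * real m \<le> 3 * sqrt 2 * X + 1" "3 * sqrt 2 * X - 1 \<le> \<alpha> + 2 * real m" using e m by (simp_all add: abs_le_iff)
  have top: "\<alpha> + 2 * real j \<le> 4.4 * X" if "j \<le> m" for j
  proof -
    have "real j \<le> real m" using that by simp
    then have "\<alpha> + 2 * real j \<le> 22/5 * X" using e1 b by linarith
    then show ?thesis by simp
  qed
  have dj: "2 * real j + D \<le> \<alpha> + 2 * real j - 4 * X" "0 < 2 * real j + D" for j using D by simp_all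
  have last: "\<bar>wave (\<alpha> + 2 * real m) - target (\<alpha> + 2 * real m)\<bar> \<le> g0 * ((7717/10000) / (2 * real m + D) + (3/5))"
    by (rule wave_target_simple(1)[OF dj refl top[OF order.refl]]) (use e1 in linarith)+
  have each: "\<bar>wave (\<alpha> + 2 * real j) - target (\<alpha> + 2 * real j)\<bar> \<le> g0 * ((7717/10000) / (2 * real j + D) + (27/50) / (2 * real (m - Suc j) + 1))" if "j < m" for j
  proof (rule wave_target_simple(2)[OF dj refl top])
    show "j \<le> m" using that by simp
    have "real (m - Suc j) = real m - real j - 1" using that by (simp add: of_nat_diff)
    then show "2 * real (m - Suc j) + 1 \<le> 3 * sqrt 2 * X - (\<alpha> + 2 * real j)" using e1 by linarith
  qed simp
  have "(\<Sum>j<n. \<bar>wave (\<alpha> + 2 * real j) - target (\<alpha> + 2 * real j)\<bar>)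
     \<le> (\<Sum>j<m. g0 * ((7717/10000) / (2 * real j + D) + (27/50) / (2 * real (m - Suc j) + 1))) + g0 * ((7717/10000) / (2 * real m + D) + (3/5))"
    unfolding m sum.lessThan_Suc by (intro add_mono sum_mono each last) auto
  also have "\<dots> = g0 * (((\<Sum>j<m. (7717/10000) / (2 * real j + D)) + (\<Sum>j<m. (27/50) / (2 * real (m - Suc j) + 1))) + ((7717/10000) / (2 * real m + D) + (3/5)))"
    by (simp only: sum_distrib_left[symmetric] sum.distrib distrib_left)
  also have "(\<Sum>j<m. (27/50) / (2 * real (m - Suc j) + 1)) = (\<Sum>j<m. (27/50) / (2 * real j + 1))"
    by (rule sum.nat_diff_reindex)
  finally show ?thesis unfolding m end_sum_def by (simp add: add_ac)
qed

lemma X_large: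
  assumes "t = M ^ 6" "(12599/5000) \<le> M"
  shows "(319/50) \<le> X"
proof -
  have "(12599/5000) ^ 3 \<le> M ^ 3" using assms by (intro power_mono) auto
  moreover have "(159991/10000) \<le> ((12599/5000)::real) ^ 3" by (simp add: power3_eq_cube)
  moreover have "(19947/50000) * M ^ 3 \<le> X" using scale(1)[OF assms(1)] assms by simp
  ultimately show ?thesis by argo
qed

text \<open>The wave of \<open>\<alpha>0\<close> is compared with the transition integral, the waves above it with their saddle values,
and the remaining errors are harmonic sums that \<open>transition_budget\<close> bounds.\<close>
lemma transition_regime:
  fixes \<alpha>0 :: int and n :: nat and M :: real
  assumes M: "t = M ^ 6" "(12599/5000) \<le> M" and odd: "odd \<alpha>0" and near: "\<bar>4 * X - of_int \<alpha>0\<bar> \<le> 1 / M"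
    and e: "\<bar>3 * sqrt 2 * X - (of_int \<alpha>0 + 2 * real n)\<bar> \<le> 1" and n: "1 \<le> n"
  shows "\<bar>dirichlet - (transition (of_int \<alpha>0) + (\<Sum>j<n. target (of_int \<alpha>0 + 2 + 2 * real j)))\<bar> \<le> g0 * ((971/500) * M)"
proof -
  have M0: "0 < M" using M by linarith
  define \<tau> where "\<tau> = 1 / M"
  have tau: "0 < \<tau>" "\<tau> * M = 1" "\<tau> \<le> (397/1000)" unfolding \<tau>_def using M M0 by (simp_all add: field_simps)
  define \<epsilon> where "\<epsilon> = of_int \<alpha>0 - 4 * X"
  have eps: "\<bar>\<epsilon>\<bar> \<le> \<tau>" using near by (simp add: \<epsilon>_def \<tau>_def abs_minus_commute)
  define e0 where "e0 = 3 * sqrt 2 * X - (of_int \<alpha>0 + 2 * real n)"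
  have e0: "\<bar>e0\<bar> \<le> 1" using e by (simp add: e0_def)
  define L where "L = (3 * sqrt 2 - 4) * X"
  have L: "L = 2 * real n + e0 + \<epsilon>" by (simp add: L_def e0_def \<epsilon>_def algebra_simps)
  have Lr: "L \<le> \<rho> * M ^ 3" unfolding L_def by (rule scale(4)[OF M(1) M0])
  have G: "(341/2000) / X * M ^ 3 \<le> (171/400)" by (rule scale(5)[OF M(1) M0])
  define nb where "nb = n mod 2"
  define K where "K = (n + nb) div 2"
  have K2: "2 * K = n + nb" unfolding K_def nb_def by presburger
  have K: "1 \<le> K" using K2 n by linarith
  have nb: "nb \<le> 1" by (simp add: nb_def)
  define st where "st = \<alpha>0 - 2 * int nb"
  have Kr: "2 * real K = real n + real nb" using K2 by (metis of_nat_add of_nat_mult of_nat_numeral)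
  have str: "real_of_int st = of_int \<alpha>0 - 2 * real nb" by (simp add: st_def)
  define d0 where "d0 = \<epsilon> - 2 * real nb"
  define pq where "pq = 2 * real K + e0 + max (2 * real K + d0) 0"
  have nbr: "0 \<le> real nb" "real nb \<le> 1" using nb by auto
  have dm: "\<bar>dirichlet - (\<Sum>j<2 * K + 1. wave (of_int st + 2 * real j))\<bar>
    \<le> g0 * ((10947/10000) + (7571/10000) * (odd_harmonic (2 * K + 1) / real (2 * K + 1)) * pq + (341/2000) / X)"
    unfolding pq_def
  proof (rule dirichlet_modes)
    show "odd st" using odd by (simp add: st_def)
    show "e0 = 3 * sqrt 2 * X - (of_int st + 4 * real K)" using Kr str by (simp add: e0_def)
    show "d0 = of_int st - 4 * X" using str by (simp add: d0_def \<epsilon>_def)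
    show "- 4 \<le> d0" "d0 \<le> 1" using eps tau nbr unfolding d0_def by (auto simp: abs_le_iff)
  qed (use K e0 in auto)
  have idx: "2 * K + 1 = nb + (1 + n)" using K2 by simp
  have split: "(\<Sum>j<2 * K + 1. wave (of_int st + 2 * real j))
     = (\<Sum>j<nb. wave (of_int st + 2 * real j)) + (wave (of_int \<alpha>0) + (\<Sum>j<n. wave (of_int \<alpha>0 + 2 + 2 * real j)))"
    unfolding idx sum_lessThan_add by (simp add: str algebra_simps)
  have below: "\<bar>\<Sum>j<nb. wave (of_int st + 2 * real j)\<bar> \<le> g0 * (real nb * ((1893/2500) / (2 - \<tau>)))"
  proof (cases "nb = 0")
    case False
    then have nb1: "nb = 1" using nb by simp
    have "\<bar>wave (of_int st)\<bar> \<le> g0 * ((1893/2500) / (2 - \<tau>))"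
      by (rule wave_below_simple) (use eps tau in \<open>auto simp: str nb1 \<epsilon>_def abs_le_iff\<close>)
    then show ?thesis by (simp add: nb1)
  qed simp
  have trans: "\<bar>transition (of_int \<alpha>0) - wave (of_int \<alpha>0)\<bar> \<le> g0 * ((2813/5000) * M)"
    by (rule transition_bounds(1)[OF M(1) M0 odd_square_phase[OF odd] near M(2)])
  have above: "(\<Sum>j<n. \<bar>wave (of_int \<alpha>0 + 2 + 2 * real j) - target (of_int \<alpha>0 + 2 + 2 * real j)\<bar>) \<le> g0 * (stat_sum \<tau> n + end_sum (n - 1))"
  proof -
    have "(\<Sum>j<n. \<bar>wave (of_int \<alpha>0 + 2 + 2 * real j) - target (of_int \<alpha>0 + 2 + 2 * real j)\<bar>)
       \<le> g0 * ((\<Sum>j<n. (7717/10000) / (2 * real j + (2 - \<tau>))) + end_sum (n - 1))"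
      by (rule above_sum[OF n _ _ _ X_large[OF M]]) (use eps tau e in \<open>auto simp: \<epsilon>_def abs_le_iff\<close>)
    then show ?thesis by (simp add: stat_sum_def add_diff_eq)
  qed
  have budget: "(10947/10000) + (7571/10000) * (odd_harmonic (2 * K + 1) / real (2 * K + 1)) * pq + (341/2000) / X + (2813/5000) * M
      + real nb * ((1893/2500) / (2 - \<tau>)) + stat_sum \<tau> n + end_sum (n - 1) \<le> (971/500) * M"
  proof (cases "n = 1")
    case True
    then have nb1: "nb = 1" "K = 1" using K2 by (auto simp: nb_def)
    have pq: "pq = 2 + e0 + max \<epsilon> 0" by (simp add: pq_def nb1 d0_def)
    have "0 \<le> pq" "pq \<le> L + \<tau>" "pq \<le> 3 + \<tau>" unfolding pq L True using e0 eps tau by (auto simp: abs_le_iff max_def)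
    from transition_budget_one[OF M(2) tau(2) this Lr G] show ?thesis using True nb1 by simp
  next
    case False
    then have n2: "2 \<le> n" using n by simp
    then have "2 \<le> n - nb" unfolding nb_def by presburger
    then have "2 + real nb \<le> real n" by linarith
    then have "0 \<le> 2 * real K + d0" using eps tau unfolding Kr d0_def by (auto simp: abs_le_iff)
    then have pq: "pq = L" unfolding pq_def L using Kr by (simp add: d0_def)
    show ?thesis unfolding pq
    proof (rule transition_budget[OF M(2) tau(2) _ _ _ Lr G n])
      show "2 * real n - 1 - \<tau> \<le> L" "L \<le> 2 * real n + 1 + \<tau>" using e0 eps unfolding L by (auto simp: abs_le_iff)
      have "2 \<le> real n" using n2 by simp
      then show "0 \<le> L" using e0 eps tau unfolding L by (auto simp: abs_le_iff)
      show "2 * K + 1 = n + nb + 1" using K2 by simp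
    qed (rule nb_def)
  qed
  have "\<bar>dirichlet - (transition (of_int \<alpha>0) + (\<Sum>j<n. target (of_int \<alpha>0 + 2 + 2 * real j)))\<bar>
    \<le> \<bar>dirichlet - (\<Sum>j<2 * K + 1. wave (of_int st + 2 * real j))\<bar> + \<bar>\<Sum>j<nb. wave (of_int st + 2 * real j)\<bar>
      + \<bar>transition (of_int \<alpha>0) - wave (of_int \<alpha>0)\<bar> + \<bar>\<Sum>j<n. wave (of_int \<alpha>0 + 2 + 2 * real j) - target (of_int \<alpha>0 + 2 + 2 * real j)\<bar>"
    unfolding split sum_subtractf by linarith
  also have "\<dots> \<le> g0 * ((10947/10000) + (7571/10000) * (odd_harmonic (2 * K + 1) / real (2 * K + 1)) * pq + (341/2000) / X)
     + g0 * (real nb * ((1893/2500) / (2 - \<tau>))) + g0 * ((2813/5000) * M) + g0 * (stat_sum \<tau> n + end_sum (n - 1))"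
    by (intro add_mono dm below trans order_trans[OF sum_abs above])
  also have "\<dots> = g0 * ((10947/10000) + (7571/10000) * (odd_harmonic (2 * K + 1) / real (2 * K + 1)) * pq + (341/2000) / X + (2813/5000) * M
      + real nb * ((1893/2500) / (2 - \<tau>)) + stat_sum \<tau> n + end_sum (n - 1))" by (simp only: distrib_left add_ac)
  also have "\<dots> \<le> g0 * ((971/500) * M)" using budget g0_pos by (intro mult_left_mono) auto
  finally show ?thesis .
qed

text \<open>The two odd numbers next to \<open>4 * X\<close> have distance 2 and neither is closer to it than \<open>1 / M\<close>, so their error terms
cannot both be large; a convexity argument in the distance reduces to the extreme cases.\<close>
lemma turning_pair:
  fixes \<delta> \<tau> u w :: real
  assumes d: "\<tau> \<le> \<delta>" "\<delta> \<le> 2 - \<tau>" "0 < \<tau>" "\<tau> < 2" and u: "u \<le> pi * (2 - \<delta>)\<^sup>2 / 8" and w: "w \<le> pi * \<delta>\<^sup>2 / 8"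
  shows "((6893/5000) + u) / (pi * (2 - \<delta>)) + ((1 + w) / (pi * \<delta>) + (27/200) / \<delta>) \<le> (1/4) + (2267/5000) / \<tau> + (2267/5000) / (2 - \<tau>)"
proof -
  define y where "y = 2 - \<delta>"
  have y: "0 < y" "0 < \<delta>" using d by (auto simp: y_def)
  have "((6893/5000) + u) / (pi * y) \<le> (2267/5000) / y + y / 8"
  proof -
    have "((6893/5000) + u) / (pi * y) = (6893/5000) / (pi * y) + u / (pi * y)" by (simp add: add_divide_distrib)
    also have "(6893/5000) / (pi * y) \<le> (6893/5000) / ((314159/100000) * y)" using y pi_bounds by (intro divide_left_mono mult_right_mono mult_pos_pos) auto
    also have "(6893/5000) / ((314159/100000) * y) = (6893/5000) / (314159/100000) / y" by simp
    also have "\<dots> \<le> (2267/5000) / y" using y by (intro divide_right_mono) auto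
    also have "u / (pi * y) \<le> (pi * y\<^sup>2 / 8) / (pi * y)" using u y by (intro divide_right_mono) (auto simp: y_def)
    also have "(pi * y\<^sup>2 / 8) / (pi * y) = y / 8" using y by (simp add: power2_eq_square)
    finally show ?thesis by simp
  qed
  moreover have "(1 + w) / (pi * \<delta>) + (27/200) / \<delta> \<le> (2267/5000) / \<delta> + \<delta> / 8"
  proof -
    have "(1 + w) / (pi * \<delta>) = 1 / (pi * \<delta>) + w / (pi * \<delta>)" by (simp add: add_divide_distrib)
    also have "1 / (pi * \<delta>) \<le> 1 / ((314159/100000) * \<delta>)" using y pi_bounds by (intro divide_left_mono mult_right_mono mult_pos_pos) auto
    also have "1 / ((314159/100000) * \<delta>) = 1 / (314159/100000) / \<delta>" by simp
    also have "\<dots> \<le> (199/625) / \<delta>" using y by (intro divide_right_mono) auto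
    also have "w / (pi * \<delta>) \<le> (pi * \<delta>\<^sup>2 / 8) / (pi * \<delta>)" using w y by (intro divide_right_mono) auto
    also have "(pi * \<delta>\<^sup>2 / 8) / (pi * \<delta>) = \<delta> / 8" using y by (simp add: power2_eq_square)
    finally have "(1 + w) / (pi * \<delta>) + (27/200) / \<delta> \<le> ((199/625) / \<delta> + \<delta> / 8) + (27/200) / \<delta>" by simp
    also have "\<dots> = (2267/5000) / \<delta> + \<delta> / 8" by (simp add: add_divide_distrib[symmetric])
    finally show ?thesis .
  qed
  moreover have "(2267/5000) / y + (2267/5000) / \<delta> \<le> (2267/5000) / \<tau> + (2267/5000) / (2 - \<tau>)"
  proof -
    have "0 \<le> (\<delta> - \<tau>) * (2 - \<tau> - \<delta>)" using d by (intro mult_nonneg_nonneg) auto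
    then have "\<tau> * (2 - \<tau>) \<le> y * \<delta>" by (simp add: y_def algebra_simps)
    then have "(2267/2500) / (y * \<delta>) \<le> (2267/2500) / (\<tau> * (2 - \<tau>))" using y d by (intro divide_left_mono mult_pos_pos) auto
    moreover have "(2267/5000) / y + (2267/5000) / \<delta> = (2267/2500) / (y * \<delta>)" using y by (simp add: y_def field_simps)
    moreover have "(2267/5000) / \<tau> + (2267/5000) / (2 - \<tau>) = (2267/2500) / (\<tau> * (2 - \<tau>))" using d by (simp add: field_simps)
    ultimately show ?thesis by simp
  qed
  ultimately show ?thesis unfolding y_def by argo
qed

lemma turning_regime:
  fixes \<alpha>1 :: int and n :: nat and M :: real
  assumes M: "t = M ^ 6" "(1624/625) \<le> M" and odd: "odd \<alpha>1" and near: "1 / M \<le> of_int \<alpha>1 - 4 * X" "of_int \<alpha>1 - 4 * X \<le> 2 - 1 / M"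
    and e: "\<bar>3 * sqrt 2 * X - (of_int \<alpha>1 + 2 * real n)\<bar> \<le> 1"
  shows "\<bar>dirichlet - (\<Sum>j<n + 1. target (of_int \<alpha>1 + 2 * real j))\<bar> \<le> g0 * ((971/500) * M)"
proof -
  have M0: "0 < M" using M by linarith
  have M2: "(12599/5000) \<le> M" using M by linarith
  define \<tau> where "\<tau> = 1 / M"
  have tau: "0 < \<tau>" "\<tau> * M = 1" "\<tau> \<le> (77/200)" unfolding \<tau>_def using M M0 by (simp_all add: field_simps)
  define \<delta> where "\<delta> = of_int \<alpha>1 - 4 * X"
  have dl: "\<tau> \<le> \<delta>" "\<delta> \<le> 2 - \<tau>" using near by (simp_all add: \<delta>_def \<tau>_def)
  define e0 where "e0 = 3 * sqrt 2 * X - (of_int \<alpha>1 + 2 * real n)"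
  have e0: "\<bar>e0\<bar> \<le> 1" using e by (simp add: e0_def)
  define L where "L = (3 * sqrt 2 - 4) * X"
  have L: "L = 2 * real n + e0 + \<delta>" by (simp add: L_def e0_def \<delta>_def algebra_simps)
  have Lr: "L \<le> \<rho> * M ^ 3" "(9679/100000) * M ^ 3 \<le> L" unfolding L_def using scale(3,4)[OF M(1) M0] by simp_all
  have L0: "0 \<le> L" using Lr(2) M0 by (meson mult_nonneg_nonneg order_trans zero_le_power less_imp_le zero_le_divide_iff zero_le_numeral)
  have G: "(341/2000) / X * M ^ 3 \<le> (171/400)" by (rule scale(5)[OF M(1) M0])
  define nb where "nb = 2 - n mod 2"
  define K where "K = (n + nb) div 2"
  have K2: "2 * K = n + nb" unfolding K_def nb_def by presburger
  have nb: "1 \<le> nb" "nb \<le> 2" unfolding nb_def by presburger+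
  have K: "1 \<le> K" using K2 nb by presburger
  define st where "st = \<alpha>1 - 2 * int nb"
  have Kr: "2 * real K = real n + real nb" using K2 by (metis of_nat_add of_nat_mult of_nat_numeral)
  have str: "real_of_int st = of_int \<alpha>1 - 2 * real nb" by (simp add: st_def)
  define d0 where "d0 = \<delta> - 2 * real nb"
  define pq where "pq = 2 * real K + e0 + max (2 * real K + d0) 0"
  have nbr: "1 \<le> real nb" "real nb \<le> 2" using nb by auto
  have dm: "\<bar>dirichlet - (\<Sum>j<2 * K + 1. wave (of_int st + 2 * real j))\<bar>
    \<le> g0 * ((10947/10000) + (7571/10000) * (odd_harmonic (2 * K + 1) / real (2 * K + 1)) * pq + (341/2000) / X)"
    unfolding pq_def
  proof (rule dirichlet_modes)
    show "odd st" using odd by (simp add: st_def)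
    show "e0 = 3 * sqrt 2 * X - (of_int st + 4 * real K)" using Kr str by (simp add: e0_def)
    show "d0 = of_int st - 4 * X" using str by (simp add: d0_def \<delta>_def)
    show "- 4 \<le> d0" "d0 \<le> 1" using dl tau nbr unfolding d0_def by linarith+
  qed (use K e0 in auto)
  have idx: "2 * K + 1 = nb + (1 + n)" using K2 by simp
  have split: "(\<Sum>j<2 * K + 1. wave (of_int st + 2 * real j))
     = (\<Sum>j<nb. wave (of_int st + 2 * real j)) + (wave (of_int \<alpha>1) + (\<Sum>j<n. wave (of_int \<alpha>1 + 2 + 2 * real j)))"
    unfolding idx sum_lessThan_add by (simp add: str algebra_simps)
  have tsplit: "(\<Sum>j<n + 1. target (of_int \<alpha>1 + 2 * real j)) = target (of_int \<alpha>1) + (\<Sum>j<n. target (of_int \<alpha>1 + 2 + 2 * real j))"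
    unfolding add.commute[of n 1] sum_lessThan_add by (simp add: algebra_simps)
  define u where "u = \<bar>sin (phase (of_int \<alpha>1 - 2) X)\<bar>"
  define w where "w = \<bar>sin (phase (of_int \<alpha>1) X)\<bar>"
  have odd2: "odd (\<alpha>1 - 2)" using odd by simp
  have u: "u \<le> pi * (2 - \<delta>)\<^sup>2 / 8"
    using sin_phase_le[OF odd_square_phase[OF odd2]] by (simp add: u_def \<delta>_def algebra_simps)
  have w: "w \<le> pi * \<delta>\<^sup>2 / 8"
    using sin_phase_le[OF odd_square_phase[OF odd]] by (simp add: w_def \<delta>_def power2_commute)
  have low: "\<bar>wave (of_int \<alpha>1 - 2)\<bar> \<le> g0 * (((6893/5000) + u) / (pi * (2 - \<delta>)))"
  proof -
    have "\<bar>wave (of_int \<alpha>1 - 2)\<bar> \<le> g0 * (1.3786 + \<bar>sin (phase (of_int \<alpha>1 - 2) X)\<bar>) / (pi * (4 * X - (of_int \<alpha>1 - 2)))"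
      by (rule wave_below) (use dl tau in \<open>simp add: \<delta>_def\<close>)
    also have "4 * X - (of_int \<alpha>1 - 2) = 2 - \<delta>" by (simp add: \<delta>_def)
    finally show ?thesis by (simp add: u_def)
  qed
  have below: "\<bar>\<Sum>j<nb. wave (of_int st + 2 * real j)\<bar> \<le> g0 * (((6893/5000) + u) / (pi * (2 - \<delta>))) + g0 * ((real nb - 1) * ((1893/2500) / (2 + \<tau>)))"
  proof (cases "nb = 1")
    case True
    then show ?thesis using low by (simp add: str)
  next
    case False
    then have nb2: "nb = 2" using nb by simp
    have "\<bar>wave (of_int \<alpha>1 - 4)\<bar> \<le> g0 * ((1893/2500) / (2 + \<tau>))"
      by (rule wave_below_simple) (use dl tau in \<open>auto simp: \<delta>_def\<close>)
    moreover have "(\<Sum>j<nb. wave (of_int st + 2 * real j)) = wave (of_int \<alpha>1 - 4) + wave (of_int \<alpha>1 - 2)"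
      by (simp add: nb2 str eval_nat_numeral algebra_simps)
    ultimately show ?thesis using low by (simp add: nb2)
  qed
  have Xl: "(319/50) \<le> X" by (rule X_large[OF M(1) M2])
  have "sqrt 2 \<le> (707107/500000)" by (intro real_le_lsqrt) (auto simp: power2_eq_square)
  then have "3 * sqrt 2 * X \<le> 3 * (707107/500000) * X" using X_pos by (intro mult_right_mono) auto
  then have b: "3 * sqrt 2 * X + 1 \<le> 22/5 * X" using Xl by argo
  have top: "of_int \<alpha>1 \<le> 4.4 * X"
  proof -
    have "0 \<le> 2 * real n" by simp
    then have "real_of_int \<alpha>1 \<le> 22/5 * X" using e b unfolding abs_le_iff by linarith
    then show ?thesis by simp
  qed
  define F where "F = (1 + w) / (pi * \<delta>) + (27/200) / \<delta>"
  have d0': "0 < \<delta>" using dl tau by linarith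
  have above: "\<bar>wave (of_int \<alpha>1) - target (of_int \<alpha>1)\<bar> + (\<Sum>j<n. \<bar>wave (of_int \<alpha>1 + 2 + 2 * real j) - target (of_int \<alpha>1 + 2 + 2 * real j)\<bar>)
      \<le> g0 * (F + stat_sum 0 n + end_sum n)"
  proof (cases n)
    case 0
    have "\<bar>wave (of_int \<alpha>1) - target (of_int \<alpha>1)\<bar> \<le> g0 * ((1 + w) / (pi * \<delta>) + (27/200) / \<delta> + (3/5))"
      unfolding w_def
      by (rule wave_target(1)[OF \<delta>_def d0' _ top]) (use e0 in \<open>auto simp: e0_def 0 abs_le_iff\<close>)
    then show ?thesis by (simp add: 0 F_def stat_sum_def end_sum_def)
  next
    case (Suc m)
    have "\<bar>wave (of_int \<alpha>1) - target (of_int \<alpha>1)\<bar> \<le> g0 * ((1 + w) / (pi * \<delta>) + (27/200) / \<delta> + (27/50) / (e0 + 2 * real n))"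
      unfolding w_def
      by (rule wave_target(2)[OF \<delta>_def d0' _ top]) (use e0 in \<open>auto simp: e0_def Suc abs_le_iff\<close>)
    also have "\<dots> \<le> g0 * (F + (27/50) / (2 * real m + 1))"
    proof -
      have "(27/50) / (e0 + 2 * real n) \<le> (27/50) / (2 * real m + 1)"
        using e0 by (intro divide_left_mono mult_pos_pos) (auto simp: Suc abs_le_iff)
      then show ?thesis unfolding F_def using g0_pos by (intro mult_left_mono) auto
    qed
    finally have 1: "\<bar>wave (of_int \<alpha>1) - target (of_int \<alpha>1)\<bar> \<le> g0 * (F + (27/50) / (2 * real m + 1))" .
    have 2: "(\<Sum>j<n. \<bar>wave (of_int \<alpha>1 + 2 + 2 * real j) - target (of_int \<alpha>1 + 2 + 2 * real j)\<bar>) \<le> g0 * ((\<Sum>j<n. (7717/10000) / (2 * real j + 2)) + end_sum (n - 1))"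
      by (rule above_sum[OF _ _ _ _ Xl]) (use dl tau e in \<open>auto simp: Suc \<delta>_def abs_le_iff\<close>)
    have "end_sum n = end_sum (n - 1) + (27/50) / (2 * real m + 1)" by (simp add: end_sum_def Suc)
    moreover have "stat_sum 0 n = (\<Sum>j<n. (7717/10000) / (2 * real j + 2))" by (simp add: stat_sum_def)
    ultimately have "g0 * (F + stat_sum 0 n + end_sum n) = g0 * (F + (27/50) / (2 * real m + 1)) + g0 * ((\<Sum>j<n. (7717/10000) / (2 * real j + 2)) + end_sum (n - 1))"
      by (simp only: distrib_left add_ac)
    then show ?thesis using 1 2 by linarith
  qed
  have pair: "((6893/5000) + u) / (pi * (2 - \<delta>)) + F \<le> (1/4) + (2267/5000) * M + (2267/5000) / (2 - \<tau>)"
  proof -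
    have "(2267/5000) / \<tau> = (2267/5000) * M" using M0 by (simp add: \<tau>_def)
    moreover have "\<tau> < 2" using tau by simp
    ultimately show ?thesis using turning_pair[OF dl tau(1) _ u w] unfolding F_def by simp
  qed
  have budget: "(10947/10000) + (7571/10000) * (odd_harmonic (2 * K + 1) / real (2 * K + 1)) * pq + (341/2000) / X + (2267/5000) * M + (1/4) + (2267/5000) / (2 - \<tau>)
      + (real nb - 1) * ((1893/2500) / (2 + \<tau>)) + stat_sum 0 n + end_sum n \<le> (971/500) * M"
  proof (cases "n = 0")
    case True
    then have nb2: "nb = 2" "K = 1" using K2 by (auto simp: nb_def)
    have pq: "pq = 2 + e0" unfolding pq_def d0_def nb2 using dl tau by simp
    have "0 \<le> pq" "pq \<le> 3" unfolding pq using e0 by (auto simp: abs_le_iff)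
    from turning_budget_zero[OF M(2) tau(2) this G] show ?thesis using True nb2 by (simp add: stat_sum_def end_sum_def)
  next
    case False
    then have n1: "1 \<le> n" by simp
    then have "nb \<le> n + 0" unfolding nb_def by presburger
    then have "real nb \<le> real n" by simp
    then have "0 \<le> 2 * real K + d0" using dl tau unfolding Kr d0_def by linarith
    then have pq: "pq = L" unfolding pq_def L using Kr by (simp add: d0_def)
    show ?thesis unfolding pq
    proof (rule turning_budget[OF M(2) tau(2) _ _ L0 Lr G n1])
      show "2 * real n - 1 + \<tau> \<le> L" "L \<le> 2 * real n + 3 - \<tau>" using e0 dl unfolding L by (auto simp: abs_le_iff)
      show "2 * K + 1 = n + nb + 1" using K2 by simp
    qed (rule nb_def)
  qed
  have "\<bar>dirichlet - (\<Sum>j<n + 1. target (of_int \<alpha>1 + 2 * real j))\<bar>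
    \<le> \<bar>dirichlet - (\<Sum>j<2 * K + 1. wave (of_int st + 2 * real j))\<bar> + \<bar>\<Sum>j<nb. wave (of_int st + 2 * real j)\<bar>
      + (\<bar>wave (of_int \<alpha>1) - target (of_int \<alpha>1)\<bar> + \<bar>\<Sum>j<n. wave (of_int \<alpha>1 + 2 + 2 * real j) - target (of_int \<alpha>1 + 2 + 2 * real j)\<bar>)"
    unfolding split tsplit sum_subtractf by linarith
  also have "\<dots> \<le> g0 * ((10947/10000) + (7571/10000) * (odd_harmonic (2 * K + 1) / real (2 * K + 1)) * pq + (341/2000) / X)
     + (g0 * (((6893/5000) + u) / (pi * (2 - \<delta>))) + g0 * ((real nb - 1) * ((1893/2500) / (2 + \<tau>)))) + g0 * (F + stat_sum 0 n + end_sum n)"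
    by (intro add_mono dm below order_trans[OF add_left_mono[OF sum_abs] above])
  also have "\<dots> = g0 * ((10947/10000) + (7571/10000) * (odd_harmonic (2 * K + 1) / real (2 * K + 1)) * pq + (341/2000) / X
      + (((6893/5000) + u) / (pi * (2 - \<delta>)) + F) + (real nb - 1) * ((1893/2500) / (2 + \<tau>)) + stat_sum 0 n + end_sum n)" by (simp only: distrib_left add_ac)
  also have "\<dots> \<le> g0 * ((971/500) * M)" using budget pair g0_pos by (intro mult_left_mono) argo+
  finally show ?thesis .
qed

end

section \<open>Small t, and the theorem\<close>

lemma le_over_sqrt:
  fixes x c M :: real
  assumes "x\<^sup>2 * M \<le> c\<^sup>2" "0 \<le> c" "0 < M"
  shows "x \<le> c * (1 / sqrt M)"
proof -
  have "(x * sqrt M)\<^sup>2 \<le> c\<^sup>2" using assms by (simp add: power_mult_distrib)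
  then have "x * sqrt M \<le> c" using assms by (meson power2_le_imp_le)
  then show ?thesis using assms by (simp add: field_simps)
qed

context hardy
begin

lemma g0_unit:
  assumes M: "t = M ^ 6" "0 < M"
  shows "g0 * M \<le> (6333/2000) * (1 / sqrt M)"
proof (rule le_over_sqrt)
  have "(g0 * M)\<^sup>2 * M = 4 * M ^ 3 / X" using X_pos by (simp add: power_mult_distrib power_divide power2_eq_square power3_eq_cube)
  also have "\<dots> \<le> 4 * M ^ 3 / ((19947/50000) * M ^ 3)" using scale(1)[OF M] M by (intro divide_left_mono mult_pos_pos) (auto simp: X_pos)
  also have "\<dots> \<le> (6333/2000)\<^sup>2" using M by (simp add: power2_eq_square)
  finally show "(g0 * M)\<^sup>2 * M \<le> (6333/2000)\<^sup>2" .
qed (use M in auto)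

lemma a_param_eq: "a_param t = 4 * X"
proof -
  have "8 * t / pi = (4 * X)\<^sup>2" by (simp add: t_def power2_eq_square)
  moreover have "sqrt ((4 * X)\<^sup>2) = 4 * X" using X_pos by (intro real_sqrt_unique) auto
  ultimately show ?thesis by (simp only: a_param_def)
qed

text \<open>With \<open>k = \<alpha> / a\<close>, the stationary point is \<open>X * (k - sqrt (k\<^sup>2 - 1))\<close> and
\<open>pc t \<alpha> = (k + sqrt (k\<^sup>2 - 1))\<^sup>2\<close> is the inverse square of its second factor.\<close>
lemma target_pc:
  assumes "4 * X < \<alpha>" "\<alpha> \<le> 3 * sqrt 2 * X"
  shows "target \<alpha> = 2 * sqrt 2 * cos (t / 2 * (ln (pc t \<alpha>) + 1 / pc t \<alpha>) + t / 2 + pi / 8) / (\<alpha>\<^sup>2 - (a_param t)\<^sup>2) powr (1/4)"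
proof -
  define k where "k = \<alpha> / (4 * X)"
  define w where "w = sqrt (k\<^sup>2 - 1)"
  define r where "r = k - w"
  have k: "1 < k" using assms X_pos by (simp add: k_def)
  then have k2: "1 < k\<^sup>2" by (simp add: one_less_power)
  have w2: "w\<^sup>2 = k\<^sup>2 - 1" using k2 by (simp add: w_def)
  have w0: "0 < w" using k2 by (simp add: w_def)
  have inv: "r * (k + w) = 1" unfolding r_def using w2 by (simp add: algebra_simps power2_eq_square)
  have r0: "0 < r" using inv k w0 by (metis add_pos_pos less_trans zero_less_mult_pos2 zero_less_one)
  have quad: "2 * k * r = r\<^sup>2 + 1" unfolding r_def using w2 by (simp add: algebra_simps power2_eq_square)
  have pc: "pc t \<alpha> = (k + w)\<^sup>2"
  proof -
    have "a_param t / \<alpha> = 1 / k" "\<alpha> / a_param t = k" by (simp_all add: a_param_eq k_def)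
    moreover have "sqrt (1 - (1 / k)\<^sup>2) = w / k"
    proof -
      have "1 - (1 / k)\<^sup>2 = (w / k)\<^sup>2" using w2 k by (simp add: power_divide diff_divide_distrib)
      then show ?thesis using w0 k by simp
    qed
    ultimately have "pc t \<alpha> = 2 * k\<^sup>2 * (1 + w / k) - 1" by (simp add: pc_def)
    also have "\<dots> = 2 * k\<^sup>2 + 2 * k * w - 1" using k by (simp add: algebra_simps power2_eq_square)
    also have "\<dots> = (k + w)\<^sup>2" using w2 by (simp add: power2_sum)
    finally show ?thesis .
  qed
  have kw: "k + w = 1 / r" using inv r0 by (simp add: field_simps)
  have ln_pc: "ln (pc t \<alpha>) = - 2 * ln r" unfolding pc kw using r0 by (simp add: ln_realpow ln_div)
  have inv_pc: "1 / pc t \<alpha> = r\<^sup>2" unfolding pc kw by (simp add: power_divide)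
  have st: "stat \<alpha> = X * r" by (simp add: stat_def r_def w_def k_def)
  have "phase \<alpha> (stat \<alpha>) + pi / 4 = - t / 2 + pi / 8 - t * ln r - pi * X\<^sup>2 * r\<^sup>2 + pi * \<alpha> * X * r"
    unfolding phase_def st using X_pos r0 by (simp add: ln_mult power_mult_distrib algebra_simps)
  also have "pi * \<alpha> * X * r = t * (2 * k * r)" using X_pos by (simp add: k_def t_def power2_eq_square)
  also have "pi * X\<^sup>2 * r\<^sup>2 = t / 2 * r\<^sup>2" by (simp add: t_def)
  also have "- t / 2 + pi / 8 - t * ln r - t / 2 * r\<^sup>2 + t * (2 * k * r) = t / 2 * (ln (pc t \<alpha>) + 1 / pc t \<alpha>) + t / 2 + pi / 8"
    unfolding quad ln_pc inv_pc by (simp add: field_simps)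
  finally have "phase \<alpha> (stat \<alpha>) + pi / 4 = t / 2 * (ln (pc t \<alpha>) + 1 / pc t \<alpha>) + t / 2 + pi / 8" .
  then show ?thesis using assms(2) by (simp add: target_def amplitude_def a_param_eq)
qed

lemma odd_le_INT_O: "odd n \<Longrightarrow> n \<le> INT_O x \<longleftrightarrow> real_of_int n \<le> x"
proof
  assume n: "odd n" "real_of_int n \<le> x"
  then obtain k where k: "n = 2 * k + 1" by (auto elim: oddE)
  with n have "of_int k \<le> (x - 1) / 2" by simp
  then show "n \<le> INT_O x" unfolding INT_O_eq k by (simp add: le_floor_iff)
next
  assume "n \<le> INT_O x"
  then have "real_of_int n \<le> of_int (INT_O x)" by simp
  also have "\<dots> \<le> x" unfolding INT_O_eq using of_int_floor_le[of "(x - 1) / 2"] by simp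
  finally show "real_of_int n \<le> x" .
qed

definition "dual_set m = {\<alpha>::int. odd \<alpha> \<and> m \<le> \<alpha> \<and> \<alpha> \<le> INT_O (3 * sqrt 2 * X)}"

lemma dual_sum_target:
  fixes m :: int and n :: nat
  assumes m: "odd m" "4 * X < of_int m" and n: "3 * sqrt 2 * X < of_int m + 2 * real n"
  shows "(\<Sum>\<alpha>\<in>dual_set m. 2 * sqrt 2 * cos (t / 2 * (ln (pc t (of_int \<alpha>)) + 1 / pc t (of_int \<alpha>)) + t / 2 + pi / 8) / ((of_int \<alpha>)\<^sup>2 - (a_param t)\<^sup>2) powr (1/4))
     = (\<Sum>j<n. target (of_int m + 2 * real j))"
proof -
  have "(\<Sum>\<alpha>\<in>dual_set m. 2 * sqrt 2 * cos (t / 2 * (ln (pc t (of_int \<alpha>)) + 1 / pc t (of_int \<alpha>)) + t / 2 + pi / 8) / ((of_int \<alpha>)\<^sup>2 - (a_param t)\<^sup>2) powr (1/4))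
     = (\<Sum>\<alpha>\<in>dual_set m. target (of_int \<alpha>))"
  proof (rule sum.cong[OF refl])
    fix \<alpha> assume a: "\<alpha> \<in> dual_set m"
    then have "real_of_int \<alpha> \<le> 3 * sqrt 2 * X" using odd_le_INT_O[of \<alpha>] by (simp add: dual_set_def)
    moreover have "real_of_int m \<le> of_int \<alpha>" using a by (simp add: dual_set_def)
    then have "4 * X < of_int \<alpha>" using m(2) by linarith
    ultimately show "2 * sqrt 2 * cos (t / 2 * (ln (pc t (of_int \<alpha>)) + 1 / pc t (of_int \<alpha>)) + t / 2 + pi / 8) / ((of_int \<alpha>)\<^sup>2 - (a_param t)\<^sup>2) powr (1/4) = target (of_int \<alpha>)"
      using target_pc by simp
  qed
  also have "\<dots> = (\<Sum>\<alpha>\<in>(\<lambda>j. m + 2 * int j) ` {..<n}. target (of_int \<alpha>))"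
  proof (rule sum.mono_neutral_left)
    show "dual_set m \<subseteq> (\<lambda>j. m + 2 * int j) ` {..<n}"
    proof
      fix \<alpha> assume a: "\<alpha> \<in> dual_set m"
      then have "real_of_int \<alpha> \<le> 3 * sqrt 2 * X" using odd_le_INT_O[of \<alpha>] by (simp add: dual_set_def)
      then have "real_of_int \<alpha> < of_int (m + 2 * int n)" using n by simp
      then have up: "\<alpha> < m + 2 * int n" by (simp only: of_int_less_iff)
      have ev: "even (\<alpha> - m)" "m \<le> \<alpha>" using a m by (auto simp: dual_set_def)
      from ev(1) obtain d where d: "\<alpha> - m = 2 * d" by (rule evenE)
      have "0 \<le> d" "d < int n" using d ev up by linarith+
      then have "\<alpha> = m + 2 * int (nat d)" "nat d < n" using d by auto
      then show "\<alpha> \<in> (\<lambda>j. m + 2 * int j) ` {..<n}" by blast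
    qed
    show "\<forall>\<alpha>\<in>(\<lambda>j. m + 2 * int j) ` {..<n} - dual_set m. target (of_int \<alpha>) = 0"
    proof
      fix \<alpha> assume a: "\<alpha> \<in> (\<lambda>j. m + 2 * int j) ` {..<n} - dual_set m"
      then have "odd \<alpha>" "m \<le> \<alpha>" using m by auto
      then have "\<not> real_of_int \<alpha> \<le> 3 * sqrt 2 * X" using a odd_le_INT_O[of \<alpha>] by (auto simp: dual_set_def)
      then show "target (of_int \<alpha>) = 0" by (simp add: target_def)
    qed
  qed simp
  also have "\<dots> = (\<Sum>j<n. target (of_int m + 2 * real j))"
    by (subst sum.reindex) (auto simp: inj_on_def)
  finally show ?thesis .
qed

lemma dirichlet_term_le: "\<bar>2 / sqrt (of_int N) * cos y\<bar> \<le> 2 / sqrt (of_int N)" if "0 < N" for N :: int and y :: real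
proof -
  have "\<bar>2 / sqrt (of_int N) * cos y\<bar> = 2 / sqrt (of_int N) * \<bar>cos y\<bar>" using that by (simp add: abs_mult)
  also have "\<dots> \<le> 2 / sqrt (of_int N) * 1" using that by (intro mult_left_mono abs_cos_le_one) auto
  finally show ?thesis by simp
qed

lemma summand_range:
  assumes "N \<in> {\<lceil>Xb\<rceil>..\<lfloor>X\<rfloor>}"
  shows "Xb \<le> of_int N" "of_int N \<le> X" "0 < N" "(7071/10000) * X \<le> of_int N"
proof -
  show b: "Xb \<le> of_int N" "of_int N \<le> X" using assms by (auto simp: ceiling_le_iff le_floor_iff)
  then have "0 < real_of_int N" using Xb by linarith
  then show "0 < N" by simp
  have "(7071/10000) * sqrt 2 \<le> 1"
  proof -
    have "sqrt 2 \<le> (707107/500000)" by (intro real_le_lsqrt) (auto simp: power2_eq_square)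
    then show ?thesis by simp
  qed
  then have "(7071/10000) \<le> 1 / sqrt 2" by (simp add: field_simps)
  then have "(7071/10000) * X \<le> 1 / sqrt 2 * X" using X_pos by (intro mult_right_mono) auto
  also have "1 / sqrt 2 * X = Xb" by (simp add: Xb_def)
  finally show "(7071/10000) * X \<le> of_int N" using b(1) by (rule order_trans)
qed

lemma dirichlet_short:
  assumes M: "t = M ^ 6" "(141/80) \<le> M" and small: "X < 4"
  shows "\<bar>dirichlet\<bar> \<le> 2 * (1 / sqrt M)"
proof -
  have M0: "0 < M" using M by linarith
  have X2: "(109/50) \<le> X"
  proof -
    have "(141/80) ^ 3 \<le> M ^ 3" using M by (intro power_mono) auto
    moreover have "(547/100) \<le> ((141/80)::real) ^ 3" by (simp add: power3_eq_cube)
    ultimately show ?thesis using scale(1)[OF M(1) M0] by argo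
  qed
  define m where "m = (if X < 3 then 2 else 3 :: int)"
  have sub: "{\<lceil>Xb\<rceil>..\<lfloor>X\<rfloor>} \<subseteq> {m}"
  proof
    fix N assume N: "N \<in> {\<lceil>Xb\<rceil>..\<lfloor>X\<rfloor>}"
    note r = summand_range[OF N]
    show "N \<in> {m}"
    proof (cases "X < 3")
      case True
      have "real_of_int N < 3" "1 < real_of_int N" using r(2,4) True X2 by linarith+
      then show ?thesis using True by (simp add: m_def)
    next
      case False
      have "real_of_int N < 4" "2 < real_of_int N" using r(2,4) False small by linarith+
      then show ?thesis using False by (simp add: m_def)
    qed
  qed
  have "\<bar>dirichlet\<bar> \<le> (\<Sum>N = \<lceil>Xb\<rceil>..\<lfloor>X\<rfloor>. 2 / sqrt (of_int N))"
    unfolding dirichlet_def by (rule order_trans[OF sum_abs]) (intro sum_mono dirichlet_term_le summand_range(3))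
  also have "\<dots> \<le> (\<Sum>N\<in>{m}. 2 / sqrt (of_int N))" using sub by (intro sum_mono2) (auto simp: m_def)
  also have "\<dots> = 2 / sqrt (of_int m)" by simp
  also have "\<dots> \<le> 2 * (1 / sqrt M)"
  proof -
    have M3: "(19947/50000) * M ^ 3 \<le> X" by (rule scale(1)[OF M(1) M0])
    have "M \<le> of_int m"
    proof (cases "X < 3")
      case True
      then have "1 * M ^ 3 \<le> 8" using M3 by linarith
      then have "M \<le> 2" by (intro le_of_cube_le[of 1 M 8 2]) auto
      then show ?thesis using True by (simp add: m_def)
    next
      case False
      have "1 * M ^ 3 \<le> 27" using M3 small by linarith
      then have "M \<le> 3" by (intro le_of_cube_le[of 1 M 27 3]) auto
      then show ?thesis using False by (simp add: m_def)
    qed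
    then have "sqrt M \<le> sqrt (of_int m)" by simp
    then have "2 / sqrt (of_int m) \<le> 2 / sqrt M" using M0 by (intro divide_left_mono mult_pos_pos) (auto simp: m_def)
    then show ?thesis by simp
  qed
  finally show ?thesis .
qed

lemma term_le:
  assumes M: "t = M ^ 6" "(43/20) \<le> M" and N: "Xb \<le> of_int N"
  shows "2 / sqrt (of_int N) \<le> (4379/2500) * (1 / sqrt M)"
proof -
  have M0: "0 < M" using M by linarith
  have "2 / sqrt (of_int N) \<le> 2 / sqrt Xb" using Xb N by (intro divide_left_mono mult_pos_pos) auto
  also have "\<dots> = g0 * sqrt (sqrt 2)" using sqrt_Xb by (simp add: field_simps)
  also have "\<dots> \<le> g0 * (118921/100000)" using sqrt_sqrt2_le g0_pos by (intro mult_left_mono) auto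
  also have "\<dots> \<le> (4379/2500) * (1 / sqrt M)"
  proof -
    have "g0 * (43/20) \<le> g0 * M" using M g0_pos by (intro mult_left_mono) auto
    also have "\<dots> \<le> (6333/2000) * (1 / sqrt M)" by (rule g0_unit[OF M(1) M0])
    finally have "g0 * (43/20) \<le> (6333/2000) * (1 / sqrt M)" .
    moreover have "0 < 1 / sqrt M" using M0 by simp
    ultimately show ?thesis by argo
  qed
  finally show ?thesis .
qed

lemma dirichlet_two:
  assumes X: "4 \<le> X" "X < 7"
  shows "{\<lceil>Xb\<rceil>..\<lfloor>X\<rfloor>} \<subseteq> {\<lfloor>X\<rfloor> - 1, \<lfloor>X\<rfloor>}"
proof
  fix N assume N: "N \<in> {\<lceil>Xb\<rceil>..\<lfloor>X\<rfloor>}"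
  note r = summand_range[OF N]
  have "real_of_int \<lfloor>X\<rfloor> \<le> X" by (rule of_int_floor_le)
  then have "real_of_int \<lfloor>X\<rfloor> < 7" using X by linarith
  then have f6: "\<lfloor>X\<rfloor> \<le> 6" by simp
  have "(7071/10000) * real_of_int \<lfloor>X\<rfloor> \<le> of_int N" using r(4) \<open>real_of_int \<lfloor>X\<rfloor> \<le> X\<close> by argo
  moreover have "real_of_int \<lfloor>X\<rfloor> \<le> 6" using f6 by simp
  ultimately have "real_of_int \<lfloor>X\<rfloor> - 2 < of_int N" by argo
  then have "real_of_int (\<lfloor>X\<rfloor> - 2) < of_int N" by simp
  then have "\<lfloor>X\<rfloor> - 2 < N" by (simp only: of_int_less_iff)
  then show "N \<in> {\<lfloor>X\<rfloor> - 1, \<lfloor>X\<rfloor>}" using N by auto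
qed

lemma dirichlet_small:
  assumes M: "t = M ^ 6" "(141/80) \<le> M" and small: "X < 7"
  shows "\<bar>dirichlet\<bar> \<le> (4379/1250) * (1 / sqrt M)"
proof (cases "X < 4")
  case True
  have "0 \<le> 1 / sqrt M" using M by simp
  then show ?thesis using dirichlet_short[OF M True] by argo
next
  case False
  have M0: "0 < M" using M by linarith
  have M2: "(43/20) \<le> M"
  proof (rule le_of_cube_le[of "(7979/20000)" _ X])
    show "(7979/20000) * (43/20) ^ 3 \<le> X" using False by (simp add: power3_eq_cube)
  qed (use scale(2)[OF M(1) M0] M0 in auto)
  have "\<bar>dirichlet\<bar> \<le> (\<Sum>N = \<lceil>Xb\<rceil>..\<lfloor>X\<rfloor>. (4379/2500) * (1 / sqrt M))"
    unfolding dirichlet_def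
  proof (rule order_trans[OF sum_abs], rule sum_mono)
    fix N assume N: "N \<in> {\<lceil>Xb\<rceil>..\<lfloor>X\<rfloor>}"
    show "\<bar>2 / sqrt (of_int N) * cos (t * ln X - t / 2 - pi / 8 - t * ln (of_int N))\<bar> \<le> (4379/2500) * (1 / sqrt M)"
      by (rule order_trans[OF dirichlet_term_le[OF summand_range(3)[OF N]] term_le[OF M(1) M2 summand_range(1)[OF N]]])
  qed
  also have "\<dots> \<le> (\<Sum>N\<in>{\<lfloor>X\<rfloor> - 1, \<lfloor>X\<rfloor>}. (4379/2500) * (1 / sqrt M))"
    using dirichlet_two False small M0 by (intro sum_mono2) auto
  also have "\<dots> = (4379/1250) * (1 / sqrt M)" by simp
  finally show ?thesis .
qed

text \<open>At most two summands and at most one dual term are present, so absolute values suffice.\<close>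
lemma turning_small:
  fixes \<alpha>1 :: int
  assumes M: "t = M ^ 6" "(141/80) \<le> M" "M \<le> (1624/625)" and odd: "odd \<alpha>1" and near: "1 / M \<le> of_int \<alpha>1 - 4 * X"
  shows "\<bar>dirichlet - (\<Sum>j<1. target (of_int \<alpha>1 + 2 * real j))\<bar> \<le> (563/100) * (1 / sqrt M)"
proof -
  have M0: "0 < M" using M by linarith
  have M3: "M ^ 3 \<le> (2193/125)"
  proof -
    have "M ^ 3 \<le> (1624/625) ^ 3" using M M0 by (intro power_mono) auto
    also have "\<dots> \<le> ((2193/125)::real)" by (simp add: power3_eq_cube)
    finally show ?thesis .
  qed
  have "X < 7" using scale(2)[OF M(1) M0] M3 by argo
  note d = dirichlet_small[OF M(1,2) this]
  define \<alpha> where "\<alpha> = real_of_int \<alpha>1"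
  have a: "1 / M \<le> \<alpha> - 4 * X" using near by (simp add: \<alpha>_def)
  have "\<bar>target \<alpha>\<bar> \<le> (21163/10000) * (1 / sqrt M)"
  proof (rule le_over_sqrt)
    define Z where "Z = \<alpha>\<^sup>2 - (4 * X)\<^sup>2"
    have Zd: "Z = (\<alpha> - 4 * X) * (\<alpha> + 4 * X)" by (simp add: Z_def power2_eq_square algebra_simps)
    have pos: "0 \<le> 1 / M" using M0 by simp
    have "8 * X \<le> \<alpha> + 4 * X" "0 \<le> \<alpha> - 4 * X" using a pos by linarith+
    then have "1 / M * (8 * X) \<le> Z" unfolding Zd using a X_pos by (intro mult_mono) auto
    moreover have "8 * (19947/50000) * M\<^sup>2 \<le> 1 / M * (8 * X)"
    proof -
      have "8 * (19947/50000) * M\<^sup>2 = 1 / M * (8 * ((19947/50000) * M ^ 3))" using M0 by (simp add: power2_eq_square power3_eq_cube)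
      also have "\<dots> \<le> 1 / M * (8 * X)" using scale(1)[OF M(1) M0] M0 by (intro mult_left_mono) auto
      finally show ?thesis .
    qed
    ultimately have Z: "8 * (19947/50000) * M\<^sup>2 \<le> Z" by linarith
    then have Z0: "0 < Z" using M0 by (meson less_le_trans mult_pos_pos zero_less_power zero_less_divide_iff zero_less_numeral)
    have sq: "(Z powr (1/4))\<^sup>2 = sqrt Z" using Z0 by (simp add: powr_power powr_half_sqrt)
    have "\<bar>target \<alpha>\<bar> \<le> amplitude \<alpha>"
    proof -
      have A: "0 \<le> amplitude \<alpha>" by (simp add: amplitude_def)
      then have "amplitude \<alpha> * \<bar>cos y\<bar> \<le> amplitude \<alpha> * 1" for y by (intro mult_left_mono abs_cos_le_one)
      then show ?thesis unfolding target_def using A by (simp add: abs_mult)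
    qed
    then have "\<bar>target \<alpha>\<bar>\<^sup>2 \<le> (amplitude \<alpha>)\<^sup>2" by (intro power_mono) auto
    also have "\<dots> = 8 / sqrt Z" unfolding amplitude_def Z_def[symmetric] power_divide sq by (simp add: power_mult_distrib)
    also have "\<dots> \<le> 8 / ((2233/1250) * M)"
    proof -
      have "((2233/1250) * M)\<^sup>2 \<le> Z"
      proof -
        have "((2233/1250) * M)\<^sup>2 = (2233/1250)\<^sup>2 * M\<^sup>2" by (simp only: power_mult_distrib)
        also have "\<dots> \<le> 8 * (19947/50000) * M\<^sup>2" by (intro mult_right_mono) (auto simp: power2_eq_square)
        finally show ?thesis using Z by linarith
      qed
      then have "(2233/1250) * M \<le> sqrt Z" by (rule real_le_rsqrt)
      then show ?thesis using M0 Z0 by (intro divide_left_mono mult_pos_pos) auto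
    qed
    finally have "\<bar>target \<alpha>\<bar>\<^sup>2 * M \<le> 8 / ((2233/1250) * M) * M" using M0 by (intro mult_right_mono) auto
    also have "\<dots> = 8 / (2233/1250)" using M0 by simp
    also have "\<dots> \<le> (21163/10000)\<^sup>2" by (simp add: power2_eq_square)
    finally show "\<bar>target \<alpha>\<bar>\<^sup>2 * M \<le> (21163/10000)\<^sup>2" .
  qed (use M0 in auto)
  moreover have "0 < 1 / sqrt M" using M0 by simp
  ultimately have "\<bar>dirichlet - target \<alpha>\<bar> \<le> (563/100) * (1 / sqrt M)" using d by argo
  then show ?thesis by (simp add: \<alpha>_def)
qed

text \<open>The phase of the wave \<open>\<alpha>0\<close> at \<open>N\<close> differs by less than \<open>pi / 2\<close> from
\<open>pi * (\<alpha>0\<^sup>2 - 1) / 8\<close>, a multiple of \<open>pi\<close>. The summand therefore has the sign \<open>s\<close>,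
which is also the factor in front of the transition integral.\<close>
lemma first_term_sign:
  fixes \<alpha>0 :: int
  defines "s \<equiv> cos (pi * ((real_of_int \<alpha>0)\<^sup>2 - 1) / 8)"
  assumes odd: "odd \<alpha>0" and near: "\<bar>4 * X - of_int \<alpha>0\<bar> \<le> (2321/5000)" and N: "4 \<le> N" "of_int N \<le> X" "X - of_int N \<le> (33/50)"
  shows "0 \<le> s * cos (t * ln X - t / 2 - pi / 8 - t * ln (of_int N))"
proof -
  define \<alpha> where "\<alpha> = real_of_int \<alpha>0"
  define c where "c = pi * (\<alpha>\<^sup>2 - 1) / 8"
  have c: "sin c = 0" unfolding c_def \<alpha>_def by (rule odd_square_phase[OF odd])
  have N4: "4 \<le> real_of_int N" using N by simp
  define \<psi> where "\<psi> = phase \<alpha> (of_int N) - c"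
  have "\<bar>phase \<alpha> X - phase \<alpha> (of_int N)\<bar> \<le> (pi * (683/1000)) * X - (pi * (683/1000)) * of_int N"
  proof (rule abs_le_by_deriv[OF N(2), where f' = "\<lambda>x. pi * (\<alpha> - vel x)" and B' = "\<lambda>_. pi * (683/1000)"])
    fix x assume x: "of_int N \<le> x" "x \<le> X"
    then have x0: "4 \<le> x" using N4 by linarith
    show "(phase \<alpha> has_real_derivative pi * (\<alpha> - vel x)) (at x)" using x0 by (intro phase_deriv) simp
    show "((\<lambda>x. (pi * (683/1000)) * x) has_real_derivative pi * (683/1000)) (at x)" by (auto intro!: derivative_eq_intros)
    have v: "vel x - 4 * X = 2 * (X - x)\<^sup>2 / x" using x0 by (simp add: vel_def field_simps power2_eq_square)
    have "(X - x)\<^sup>2 \<le> (33/50)\<^sup>2" using x N by (intro power_mono) auto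
    then have "2 * (X - x)\<^sup>2 \<le> (1089/1250)" by (simp add: power2_eq_square)
    then have "2 * (X - x)\<^sup>2 / x \<le> (1089/1250) / 4" using x0 by (intro frac_le) auto
    moreover have "0 \<le> 2 * (X - x)\<^sup>2 / x" using x0 by simp
    ultimately have "\<bar>\<alpha> - vel x\<bar> \<le> (683/1000)" using near[folded \<alpha>_def] v unfolding abs_le_iff by argo
    then show "\<bar>pi * (\<alpha> - vel x)\<bar> \<le> pi * (683/1000)" unfolding abs_mult by (intro mult_mono) auto
  qed
  moreover have "(pi * (683/1000)) * X - (pi * (683/1000)) * of_int N \<le> (3927/1250) * (683/1000) * (33/50)"
  proof -
    have "(pi * (683/1000)) * X - (pi * (683/1000)) * of_int N = pi * ((683/1000) * (X - of_int N))" by (simp add: algebra_simps)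
    also have "\<dots> \<le> (3927/1250) * ((683/1000) * (33/50))" using N pi_bounds by (intro mult_mono) auto
    finally show ?thesis by simp
  qed
  moreover have "phase \<alpha> X = c - pi * (4 * X - \<alpha>)\<^sup>2 / 8" using folded_0[of \<alpha>] by (simp add: folded_def c_def)
  moreover have "0 \<le> pi * (4 * X - \<alpha>)\<^sup>2 / 8" by simp
  moreover have "pi * (4 * X - \<alpha>)\<^sup>2 / 8 \<le> (53/625)"
  proof -
    have "\<bar>4 * X - \<alpha>\<bar>\<^sup>2 \<le> (2321/5000)\<^sup>2" using near unfolding \<alpha>_def by (intro power_mono) auto
    then have "(4 * X - \<alpha>)\<^sup>2 \<le> (431/2000)" by (simp add: power2_eq_square)
    then have "pi * (4 * X - \<alpha>)\<^sup>2 \<le> (3927/1250) * (431/2000)" using pi_bounds by (intro mult_mono) auto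
    then show ?thesis by simp
  qed
  ultimately have "\<bar>\<psi>\<bar> \<le> (3927/1250) * (683/1000) * (33/50) + (53/625)" unfolding \<psi>_def by linarith
  also have "\<dots> \<le> pi / 2" using pi_bounds by simp
  finally have "0 \<le> cos \<psi>" by (intro cos_ge_zero) auto
  moreover have "cos (phase \<alpha> (of_int N)) = cos c * cos \<psi>"
  proof -
    have "phase \<alpha> (of_int N) = c + \<psi>" by (simp add: \<psi>_def)
    then show ?thesis using c by (simp add: cos_add)
  qed
  moreover have "cos (phase \<alpha> (of_int N)) = cos (t * ln X - t / 2 - pi / 8 - t * ln (of_int N))"
    unfolding \<alpha>_def by (rule cos_phase_odd[OF odd])
  moreover have "s = cos c" by (simp add: s_def c_def \<alpha>_def)
  moreover have "0 \<le> cos c * cos c" by simp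
  ultimately show ?thesis by (metis mult.assoc mult_nonneg_nonneg)
qed

text \<open>At most two summands and no dual term are present. The sum of the absolute values, \<open>1.5875 + 1.7516 + 4.0931\<close> in
units of \<open>1 / sqrt M\<close>, is too large when there are two summands; the common sign of the last one and of the transition
integral makes them cancel partly.\<close>
lemma transition_small:
  fixes \<alpha>0 :: int
  assumes M: "t = M ^ 6" "(141/80) \<le> M" "M \<le> (12599/5000)" and odd: "odd \<alpha>0" and near: "\<bar>4 * X - of_int \<alpha>0\<bar> \<le> 1 / M"
  shows "\<bar>dirichlet - transition (of_int \<alpha>0)\<bar> \<le> (61/10) * (1 / sqrt M)"
proof -
  have M0: "0 < M" using M by linarith
  let ?U = "1 / sqrt M"
  have U: "0 < ?U" using M0 by simp
  define T where "T = transition (of_int \<alpha>0)"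
  note tb = transition_bounds[OF M(1) M0 odd_square_phase[OF odd] near, folded T_def]
  have T: "\<bar>T\<bar> \<le> (40931/10000) * ?U"
  proof -
    have "\<bar>T\<bar> \<le> g0 * ((6463/5000) * M)" by (rule tb(2)[OF M(2)])
    moreover have "g0 * ((6463/5000) * M) = (6463/5000) * (g0 * M)" by simp
    ultimately show ?thesis using g0_unit[OF M(1) M0] U by argo
  qed
  show ?thesis
  proof (cases "X < 4")
    case True
    show ?thesis using dirichlet_short[OF M(1,2) True] T U unfolding T_def by argo
  next
    case False
    have M2: "(4309/2000) \<le> M"
    proof (rule le_of_cube_le[of "(7979/20000)" _ X])
      show "(7979/20000) * (4309/2000) ^ 3 \<le> X" using False by (simp add: power3_eq_cube)
    qed (use scale(2)[OF M(1) M0] M0 in auto)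
    then have M215: "(43/20) \<le> M" by simp
    have X6: "X < (6383/1000)"
    proof -
      have "M ^ 3 \<le> (12599/5000) ^ 3" using M M0 by (intro power_mono) auto
      also have "\<dots> \<le> ((79997/5000)::real)" by (simp add: power3_eq_cube)
      finally show ?thesis using scale(2)[OF M(1) M0] by argo
    qed
    define N where "N = \<lfloor>X\<rfloor>"
    have N: "of_int N \<le> X" "X < of_int N + 1" unfolding N_def by linarith+
    have N4: "4 \<le> N" using False unfolding N_def by (simp add: le_floor_iff)
    have N4r: "4 \<le> real_of_int N" using N4 by simp
    define f where "f = (\<lambda>N::int. 2 / sqrt (of_int N) * cos (t * ln X - t / 2 - pi / 8 - t * ln (of_int N)))"
    have sub: "{\<lceil>Xb\<rceil>..\<lfloor>X\<rfloor>} \<subseteq> {N - 1, N}" using dirichlet_two False X6 unfolding N_def by simp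
    have XbN: "Xb \<le> of_int N"
    proof -
      have "(7/5) \<le> sqrt 2" by (intro real_le_rsqrt) (auto simp: power2_eq_square)
      then have "X / sqrt 2 \<le> X / (7/5)" using X_pos by (intro divide_left_mono) auto
      also have "X / (7/5) \<le> of_int N" using N N4r by simp
      finally show ?thesis unfolding Xb_def .
    qed
    have fN: "\<bar>f N\<bar> \<le> (127/80) * ?U"
    proof -
      have "\<bar>f N\<bar> \<le> 2 / sqrt (of_int N)" unfolding f_def using N4 by (intro dirichlet_term_le) simp
      also have "\<dots> \<le> 2 / sqrt 4" using real_sqrt_le_mono[OF N4r] N4r by (intro divide_left_mono mult_pos_pos) simp_all
      also have "\<dots> \<le> (127/80) * ?U" by (rule le_over_sqrt) (use M M0 in \<open>auto simp: power2_eq_square\<close>)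
      finally show ?thesis .
    qed
    show ?thesis
    proof (cases "Xb \<le> of_int (N - 1)")
      case False
      then have "\<not> \<lceil>Xb\<rceil> \<le> N - 1" "\<lceil>Xb\<rceil> \<le> N" using XbN unfolding ceiling_le_iff by blast+
      then have "\<lceil>Xb\<rceil> = N" by linarith
      then have "{\<lceil>Xb\<rceil>..\<lfloor>X\<rfloor>} = {N}" unfolding N_def[symmetric] by simp
      then have "dirichlet = f N" unfolding dirichlet_def f_def by simp
      then show ?thesis using fN T U unfolding T_def by argo
    next
      case True
      then have c: "\<lceil>Xb\<rceil> \<le> N - 1" unfolding ceiling_le_iff .
      have eq: "{\<lceil>Xb\<rceil>..\<lfloor>X\<rfloor>} = {N - 1, N}"
      proof
        show "{N - 1, N} \<subseteq> {\<lceil>Xb\<rceil>..\<lfloor>X\<rfloor>}" unfolding N_def[symmetric] using c by simp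
      qed (rule sub)
      then have D: "dirichlet = f (N - 1) + f N" unfolding dirichlet_def f_def by simp
      have f1: "\<bar>f (N - 1)\<bar> \<le> (4379/2500) * ?U"
      proof -
        have "\<bar>f (N - 1)\<bar> \<le> 2 / sqrt (of_int (N - 1))" unfolding f_def using N4 by (intro dirichlet_term_le) simp
        also have "\<dots> \<le> (4379/2500) * ?U" by (rule term_le[OF M(1) M215 True])
        finally show ?thesis .
      qed
      have gap: "X - of_int N \<le> (33/50)"
      proof -
        have "sqrt 2 \<le> (14143/10000)" by (intro real_le_lsqrt) (auto simp: power2_eq_square)
        then have "sqrt 2 * of_int (N - 1) \<le> (14143/10000) * of_int (N - 1)" using N4r by (intro mult_right_mono) auto
        moreover have "X \<le> sqrt 2 * of_int (N - 1)"
        proof -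
          have "X = sqrt 2 * Xb" by (simp add: Xb_def)
          moreover have "sqrt 2 * Xb \<le> sqrt 2 * of_int (N - 1)" by (intro mult_left_mono True) simp
          ultimately show ?thesis by (rule ord_eq_le_trans)
        qed
        ultimately have le: "X \<le> (14143/10000) * (real_of_int N - 1)" by simp
        show ?thesis
        proof (cases "N \<le> 5")
          case True
          then have "real_of_int N \<le> 5" by simp
          then show ?thesis using le by argo
        next
          case False
          then have "6 \<le> N" by simp
          then have "6 \<le> real_of_int N" by simp
          then show ?thesis using X6 by argo
        qed
      qed
      define s where "s = cos (pi * ((real_of_int \<alpha>0)\<^sup>2 - 1) / 8)"
      have ss: "s * s = 1" unfolding s_def by (rule tb(4))
      then have s1: "\<bar>s\<bar> = 1" by (metis abs_mult_self_eq abs_1 abs_square_eq_1 power2_eq_square)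
      have near': "\<bar>4 * X - of_int \<alpha>0\<bar> \<le> (2321/5000)"
      proof -
        have "1 / M \<le> (2321/5000)" using M2 M0 by (simp add: field_simps)
        then show ?thesis using near by linarith
      qed
      have sf0: "0 \<le> s * f N"
      proof -
        have "0 \<le> s * cos (t * ln X - t / 2 - pi / 8 - t * ln (of_int N))"
          unfolding s_def by (rule first_term_sign[OF odd near' N4 N(1) gap])
        moreover have "0 \<le> 2 / sqrt (real_of_int N)" using N4r by simp
        ultimately have "0 \<le> 2 / sqrt (of_int N) * (s * cos (t * ln X - t / 2 - pi / 8 - t * ln (of_int N)))" by (rule mult_nonneg_nonneg[rotated])
        then show ?thesis unfolding f_def by (simp only: mult_ac)
      qed
      have sf: "s * f N \<le> (127/80) * ?U" using fN s1 abs_ge_self[of "s * f N"] by (simp add: abs_mult)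
      have sT: "- ((26783/10000) * ?U) \<le> s * T"
      proof -
        have "- (g0 * ((4229/5000) * M)) \<le> s * T" unfolding s_def by (rule tb(3)[OF M2])
        moreover have "g0 * ((4229/5000) * M) = (4229/5000) * (g0 * M)" by simp
        ultimately show ?thesis using g0_unit[OF M(1) M0] U by argo
      qed
      have sT': "s * T \<le> (40931/10000) * ?U" using T s1 abs_ge_self[of "s * T"] by (simp add: abs_mult)
      have "\<bar>s * f N - s * T\<bar> \<le> (427/100) * ?U" using sf0 sf sT sT' U by argo
      moreover have "\<bar>s * f N - s * T\<bar> = \<bar>f N - T\<bar>" unfolding right_diff_distrib[symmetric] abs_mult s1 by simp
      ultimately have "\<bar>f N - T\<bar> \<le> (427/100) * ?U" by simp
      then show ?thesis unfolding D T_def[symmetric] using f1 U by argo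
    qed
  qed
qed

end

theorem mainTheorem2:
  fixes t :: real
  assumes "t > 30"
  shows "\<bar>(\<Sum>N = \<lceil>sqrt (t / (4 * pi))\<rceil>..\<lfloor>sqrt (t / (2 * pi))\<rfloor>.
             2 * cos (t / 2 * ln (t / (2 * pi)) - t / 2 - pi / 8 - t * ln (of_int N))
             / sqrt (of_int N))
          - (transition_term t
             + (\<Sum>\<alpha> \<in> {\<alpha>::int. odd \<alpha> \<and> alpha_min t \<le> \<alpha> \<and> \<alpha> \<le> INT_O (3 * sqrt (t / pi))}.
                  2 * sqrt 2
                  * cos (t / 2 * (ln (pc t (of_int \<alpha>)) + 1 / pc t (of_int \<alpha>)) + t / 2 + pi / 8)
                  / ((of_int \<alpha>)\<^sup>2 - (a_param t)\<^sup>2) powr (1/4)))\<bar>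
         < 6.15 * t powr (-1/12)"
proof -
  define X where "X = sqrt (t / (2 * pi))"
  have t0: "0 < t" using assms by simp
  interpret h: hardy X by standard (use t0 in \<open>simp add: X_def\<close>)
  have X2: "X\<^sup>2 = t / (2 * pi)" using t0 by (simp add: X_def)
  have ht: "h.t = t" unfolding h.t_def X2 by simp
  define M where "M = t powr (1/6)"
  have M0: "0 < M" using t0 by (simp add: M_def)
  have M6: "t = M ^ 6" unfolding M_def using t0 by (simp add: powr_power)
  have hM: "h.t = M ^ 6" using ht M6 by simp
  have M176: "(141/80) \<le> M"
  proof (rule ccontr)
    assume "\<not> (141/80) \<le> M"
    then have "M ^ 6 \<le> (141/80) ^ 6" using M0 by (intro power_mono) auto
    also have "\<dots> \<le> (30::real)" by (simp add: eval_nat_numeral)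
    finally show False using assms M6 by simp
  qed
  have tau: "t powr (-1/6) = 1 / M" unfolding M_def by (simp add: powr_minus_divide)
  have U: "t powr (-1/12) = 1 / sqrt M"
  proof -
    have "sqrt M = t powr (1/12)" unfolding M_def by (simp add: powr_half_sqrt[symmetric] powr_powr)
    then show ?thesis by (simp add: powr_minus_divide)
  qed
  have U0: "0 < 1 / sqrt M" using M0 by simp
  have Xb: "sqrt (t / (4 * pi)) = h.Xb"
  proof -
    have "t / (4 * pi) = (X / sqrt 2)\<^sup>2" by (simp add: power_divide X2)
    then show ?thesis using h.X_pos by (simp add: h.Xb_def)
  qed
  have b: "3 * sqrt (t / pi) = 3 * sqrt 2 * X"
  proof -
    have "t / pi = (sqrt 2 * X)\<^sup>2" by (simp add: power_mult_distrib X2)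
    then show ?thesis using h.X_pos by simp
  qed
  have S: "(\<Sum>N = \<lceil>sqrt (t / (4 * pi))\<rceil>..\<lfloor>sqrt (t / (2 * pi))\<rfloor>.
             2 * cos (t / 2 * ln (t / (2 * pi)) - t / 2 - pi / 8 - t * ln (of_int N)) / sqrt (of_int N)) = h.dirichlet"
  proof -
    have "ln (t / (2 * pi)) = 2 * ln X" unfolding X2[symmetric] using h.X_pos by (simp add: ln_realpow)
    then have l: "t / 2 * ln (t / (2 * pi)) = t * ln X" by simp
    show ?thesis unfolding h.dirichlet_def Xb X_def[symmetric] ht l by simp
  qed
  have a: "a_param t = 4 * X" using h.a_param_eq unfolding ht .
  define m where "m = NINT_O (4 * X)"
  have m: "odd m" and m_near: "\<And>n. odd n \<Longrightarrow> \<bar>4 * X - of_int m\<bar> \<le> \<bar>4 * X - of_int n\<bar>" unfolding m_def by (rule NINT_O_nearest)+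
  have ep: "eps t = 4 * X - of_int m" by (simp add: eps_def a m_def)
  have dual: "(\<Sum>\<alpha> \<in> {\<alpha>::int. odd \<alpha> \<and> alpha_min t \<le> \<alpha> \<and> \<alpha> \<le> INT_O (3 * sqrt (t / pi))}.
                  2 * sqrt 2 * cos (t / 2 * (ln (pc t (of_int \<alpha>)) + 1 / pc t (of_int \<alpha>)) + t / 2 + pi / 8)
                  / ((of_int \<alpha>)\<^sup>2 - (a_param t)\<^sup>2) powr (1/4)) = (\<Sum>j<n. h.target (of_int (alpha_min t) + 2 * real j))"
    if "odd (alpha_min t)" "4 * X < of_int (alpha_min t)" "3 * sqrt 2 * X < of_int (alpha_min t) + 2 * real n" for n
    using h.dual_sum_target[OF that] unfolding h.dual_set_def ht b .
  have big: "c * (1 / sqrt M) < 6.15 * (1 / sqrt M)" if "c < 6.15" for c using that U0 by (rule mult_strict_right_mono)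
  have large: "2 / sqrt X * ((971/500) * M) < 6.15 * (1 / sqrt M)"
  proof -
    have "2 / sqrt X * ((971/500) * M) = (971/500) * (2 / sqrt X * M)" by simp
    also have "\<dots> \<le> (971/500) * ((6333/2000) * (1 / sqrt M))" using h.g0_unit[OF hM M0] by (intro mult_left_mono) auto
    also have "\<dots> = ((971/500) * (6333/2000)) * (1 / sqrt M)" by simp
    also have "\<dots> < 6.15 * (1 / sqrt M)" by (rule big) simp
    finally show ?thesis .
  qed
  have Lr: "(9679/100000) * M ^ 3 \<le> 3 * sqrt 2 * X - 4 * X" "3 * sqrt 2 * X - 4 * X \<le> \<rho> * M ^ 3"
    using h.scale(3,4)[OF hM M0] by (simp_all add: left_diff_distrib)
  show ?thesis
  proof (cases "\<bar>eps t\<bar> > t powr (-1/6)")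
    case True
    define \<alpha>1 where "\<alpha>1 = INT_O (4 * X) + 2"
    have am: "alpha_min t = \<alpha>1" using True by (simp add: alpha_min_def a \<alpha>1_def)
    have T0: "transition_term t = 0" using True by (simp add: transition_term_def)
    have I: "odd (INT_O (4 * X))" "of_int (INT_O (4 * X)) \<le> 4 * X" "4 * X < of_int (INT_O (4 * X)) + 2"
    proof -
      have fl: "of_int \<lfloor>(4 * X - 1) / 2\<rfloor> \<le> (4 * X - 1) / 2" "(4 * X - 1) / 2 < of_int \<lfloor>(4 * X - 1) / 2\<rfloor> + 1"
        using floor_correct[of "(4 * X - 1) / 2"] by simp_all
      show "odd (INT_O (4 * X))" by (simp add: INT_O_eq)
      show "of_int (INT_O (4 * X)) \<le> 4 * X" "4 * X < of_int (INT_O (4 * X)) + 2"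
        using fl unfolding INT_O_eq of_int_add of_int_mult of_int_1 of_int_numeral by argo+
    qed
    have odd: "odd \<alpha>1" using I by (simp add: \<alpha>1_def)
    have far: "1 / M < \<bar>4 * X - of_int n\<bar>" if "odd n" for n using True m_near[OF that] unfolding ep tau by linarith
    have d1: "1 / M < of_int \<alpha>1 - 4 * X" using far[OF odd] I by (simp add: \<alpha>1_def abs_if split: if_splits)
    have d2: "of_int \<alpha>1 - 4 * X < 2 - 1 / M" using far[OF I(1)] I by (simp add: \<alpha>1_def abs_if split: if_splits)
    have M1: "0 < 1 / M" using M0 by simp
    have above: "4 * X < of_int \<alpha>1" using d1 M1 by linarith
    show ?thesis
    proof (cases "M < (1624/625)")
      case small: True
      have M26: "M \<le> (1624/625)" using small by simp
      have "3 * sqrt 2 * X < of_int \<alpha>1 + 2 * real 1"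
      proof -
        have "M ^ 3 \<le> (1624/625) ^ 3" using small M0 by (intro power_mono) auto
        also have "\<dots> \<le> ((2193/125)::real)" by (simp add: power3_eq_cube)
        finally have "3 * sqrt 2 * X - 4 * X \<le> (17/10)" using Lr(2) by argo
        moreover have "(48/125) \<le> 1 / M" using small M0 by (simp add: field_simps)
        ultimately show ?thesis using d1 unfolding of_nat_1 by argo
      qed
      from dual[OF _ _ this[folded am]] odd above
      have eq: "(\<Sum>\<alpha> \<in> {\<alpha>::int. odd \<alpha> \<and> alpha_min t \<le> \<alpha> \<and> \<alpha> \<le> INT_O (3 * sqrt (t / pi))}.
                  2 * sqrt 2 * cos (t / 2 * (ln (pc t (of_int \<alpha>)) + 1 / pc t (of_int \<alpha>)) + t / 2 + pi / 8)
                  / ((of_int \<alpha>)\<^sup>2 - (a_param t)\<^sup>2) powr (1/4)) = (\<Sum>j<1. h.target (of_int \<alpha>1 + 2 * real j))" unfolding am by blast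
      have "((563/100)::real) < 6.15" by simp
      from le_less_trans[OF h.turning_small[OF hM M176 M26 odd less_imp_le[OF d1]] big[OF this]]
      show ?thesis unfolding S T0 U add_0 eq .
    next
      case False
      define y where "y = (3 * sqrt 2 * X - of_int \<alpha>1 + 1) / 2"
      define n where "n = nat \<lfloor>y\<rfloor>"
      have pos: "0 \<le> y"
      proof -
        have "(1624/625) ^ 3 \<le> M ^ 3" using False by (intro power_mono) auto
        moreover have "(35/2) \<le> ((1624/625)::real) ^ 3" by (simp add: power3_eq_cube)
        ultimately have "(8/5) \<le> 3 * sqrt 2 * X - 4 * X" using Lr(1) by argo
        then show ?thesis unfolding y_def using d2 M1 by argo
      qed
      then have "real n = of_int \<lfloor>y\<rfloor>" unfolding n_def by (intro of_nat_nat) simp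
      then have "real n \<le> y" "y < real n + 1" using floor_correct[of y] by simp_all
      then have n: "real n \<le> (3 * sqrt 2 * X - of_int \<alpha>1 + 1) / 2" "(3 * sqrt 2 * X - of_int \<alpha>1 + 1) / 2 < real n + 1"
        unfolding y_def .
      have e: "\<bar>3 * sqrt 2 * X - (of_int \<alpha>1 + 2 * real n)\<bar> \<le> 1" using n by (simp add: abs_le_iff)
      have "3 * sqrt 2 * X < of_int \<alpha>1 + 2 * real (n + 1)" using n by simp
      from dual[OF _ _ this[folded am]] odd above
      have eq: "(\<Sum>\<alpha> \<in> {\<alpha>::int. odd \<alpha> \<and> alpha_min t \<le> \<alpha> \<and> \<alpha> \<le> INT_O (3 * sqrt (t / pi))}.
                  2 * sqrt 2 * cos (t / 2 * (ln (pc t (of_int \<alpha>)) + 1 / pc t (of_int \<alpha>)) + t / 2 + pi / 8)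
                  / ((of_int \<alpha>)\<^sup>2 - (a_param t)\<^sup>2) powr (1/4)) = (\<Sum>j<n + 1. h.target (of_int \<alpha>1 + 2 * real j))" unfolding am by blast
      have "(1624/625) \<le> M" using False by simp
      from h.turning_regime[OF hM this odd less_imp_le[OF d1] less_imp_le[OF d2] e]
      show ?thesis unfolding S T0 U add_0 eq using large by (rule le_less_trans)
    qed
  next
    case False
    have near: "\<bar>4 * X - of_int m\<bar> \<le> 1 / M" using False unfolding ep tau by simp
    have am: "alpha_min t = m + 2" using False by (simp add: alpha_min_def a m_def)
    have T: "transition_term t = h.transition (of_int m)"
      using False unfolding transition_term_def Let_def a m_def h.transition_def ht by simp
    have odd: "odd (m + 2)" using m by simp
    have M1: "1 / M \<le> (57/100)" using M176 M0 by (simp add: field_simps)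
    have above: "4 * X < of_int (m + 2)" using near M1 by (simp add: abs_le_iff)
    show ?thesis
    proof (cases "M < (12599/5000)")
      case small: True
      have strict: "3 * sqrt 2 * X < of_int (m + 2)"
      proof -
        have "\<rho> * M ^ 3 + 1 / M < 2"
        proof (cases "M \<le> (23/10)")
          case True
          have "M ^ 3 \<le> (23/10) ^ 3" using True M0 by (intro power_mono) auto
          also have "\<dots> = ((12167/1000)::real)" by (simp add: power3_eq_cube)
          finally show ?thesis using M1 by argo
        next
          case False
          have "M ^ 3 \<le> (12599/5000) ^ 3" using small M0 by (intro power_mono) auto
          also have "\<dots> \<le> (16::real)" by (simp add: power3_eq_cube)
          finally have "M ^ 3 \<le> 16" .
          moreover have "1 / M \<le> (11/25)" using False M0 by (simp add: field_simps)
          ultimately show ?thesis by argo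
        qed
        then show ?thesis using Lr(2) near by (simp add: abs_le_iff)
      qed
      have none: "{\<alpha>::int. odd \<alpha> \<and> alpha_min t \<le> \<alpha> \<and> \<alpha> \<le> INT_O (3 * sqrt (t / pi))} = {}"
      proof -
        have "\<not> \<alpha> \<le> INT_O (3 * sqrt 2 * X)" if "odd \<alpha>" "m + 2 \<le> \<alpha>" for \<alpha>
        proof -
          have "real_of_int (m + 2) \<le> of_int \<alpha>" using that by (simp only: of_int_le_iff)
          then show ?thesis using strict h.odd_le_INT_O[OF that(1)] by auto
        qed
        then show ?thesis unfolding am b by blast
      qed
      have "M \<le> (12599/5000)" using small by simp
      from h.transition_small[OF hM M176 this m near]
      have "\<bar>h.dirichlet - h.transition (of_int m)\<bar> < 6.15 * (1 / sqrt M)" using big[of "(61/10)"] by (rule le_less_trans) simp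
      then show ?thesis unfolding S T U none by simp
    next
      case False
      define y where "y = (3 * sqrt 2 * X - of_int m + 1) / 2"
      define n where "n = nat \<lfloor>y\<rfloor>"
      have pos: "1 \<le> y"
      proof -
        have "(12599/5000) ^ 3 \<le> M ^ 3" using False by (intro power_mono) auto
        moreover have "(1599/100) \<le> ((12599/5000)::real) ^ 3" by (simp add: power3_eq_cube)
        ultimately have "(77/50) \<le> 3 * sqrt 2 * X - 4 * X" using Lr(1) by argo
        moreover have "1 / M \<le> (2/5)" using False M0 by (simp add: field_simps)
        ultimately show ?thesis using near unfolding abs_le_iff y_def by argo
      qed
      then have fl: "1 \<le> \<lfloor>y\<rfloor>" by (simp add: le_floor_iff)
      then have "int 1 \<le> \<lfloor>y\<rfloor>" by simp
      then have n1: "1 \<le> n" unfolding n_def by linarith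
      have "real n = of_int \<lfloor>y\<rfloor>" unfolding n_def using fl by (intro of_nat_nat) linarith
      then have "real n \<le> y" "y < real n + 1" using floor_correct[of y] by simp_all
      then have n: "real n \<le> (3 * sqrt 2 * X - of_int m + 1) / 2" "(3 * sqrt 2 * X - of_int m + 1) / 2 < real n + 1"
        unfolding y_def .
      have e: "\<bar>3 * sqrt 2 * X - (of_int m + 2 * real n)\<bar> \<le> 1" using n by (simp add: abs_le_iff)
      have "3 * sqrt 2 * X < of_int (m + 2) + 2 * real n" using n by simp
      from dual[OF _ _ this[folded am]] odd above
      have eq: "(\<Sum>\<alpha> \<in> {\<alpha>::int. odd \<alpha> \<and> alpha_min t \<le> \<alpha> \<and> \<alpha> \<le> INT_O (3 * sqrt (t / pi))}.
                  2 * sqrt 2 * cos (t / 2 * (ln (pc t (of_int \<alpha>)) + 1 / pc t (of_int \<alpha>)) + t / 2 + pi / 8)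
                  / ((of_int \<alpha>)\<^sup>2 - (a_param t)\<^sup>2) powr (1/4)) = (\<Sum>j<n. h.target (of_int m + 2 + 2 * real j))" unfolding am by simp
      have "(12599/5000) \<le> M" using False by simp
      from h.transition_regime[OF hM this m near e n1]
      show ?thesis unfolding S T U eq using large by (rule le_less_trans)
    qed
  qed
qed

end
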